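(* Let $p\ge 1$, $\beta^\star\in\mathbb{R}^p$ and $\tau>0$ be fixed, let the data follow the Gaussian linear model with parameters $(\beta^\star,\tau)$ described in the context, and assume $\|\beta^\star\|_0<p$, where $\|\beta^\star\|_0$ is the number of nonzero entries of $\beta^\star$. Let $(\lambda_n)$ and $(\delta_n)$ be deterministic sequences of positive numbers with $\lambda_n=O(\sqrt n)$, $\lambda_n=\omega(1)$, and $\delta_n=\Theta(1)$. Let $\hat\beta^{\mathrm{lasso}}_{\lambda_n}$ and $\hat\beta^{\mathrm{lasso}}_{\lambda_n+\delta_n}$ be the Lasso estimators with penalty parameters $\lambda_n$ and $\lambda_n+\delta_n$, both computed from the training set $\mathbf Z$ of size $n$, and define $$\tilde h_n^{\mathrm{diff}}(Z_0,\mathbf Z)=(Y_0-X_0^\top\hat\beta^{\mathrm{lasso}}_{\lambda_n})^2-(Y_0-X_0^\top\hat\beta^{\mathrm{lasso}}_{\lambda_n+\delta_n})^2 .$$ Then, as $n\to\infty$, $$\sigma^2(\tilde h_n^{\mathrm{diff}})=O\Big(\frac1{n^2}\Big)\qquad\text{and}\qquad\gamma(\tilde h_n^{\mathrm{diff}})=\Omega\Big(\frac1{n^2\sqrt n}\Big),$$ and consequently $r(\tilde h_n^{\mathrm{diff}})=\Omega(\sqrt n)$; in particular $r(\tilde h_n^{\mathrm{diff}})\neq o(1)$.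
   Context: Linear model: $Z_i=(X_i,Y_i)$, $i\ge 0$, are i.i.d. with $Y_i=X_i^\top\beta^\star+\varepsilon_i$, $X_i\sim\mathcal N(0,\mathbf I)$ in $\mathbb{R}^p$, $\varepsilon_i\sim\mathcal N(0,\tau^2)$, $\varepsilon_i$ independent of $X_i$. The training set is $\mathbf Z=(Z_1,\dots,Z_n)$ with $n\ge p$, $\mathbf X=(X_1,\dots,X_n)^\top\in\mathbb{R}^{n\times p}$, $\mathbf Y=(Y_1,\dots,Y_n)$; $Z_0$ is an independent test point. $\mathbf X^\top\mathbf X$ is almost surely invertible. Lasso: the Lasso estimator with penalty parameter $\lambda$ is $\hat\beta^{\mathrm{lasso}}_{\lambda}\in\arg\min_{\beta\in\mathbb R^p}\frac1{2n}\|\mathbf Y-\mathbf X\beta\|_2^2+\frac{\lambda}{n}\|\beta\|_1$ (almost surely unique since $\mathbf X^\top\mathbf X$ is almost surely invertible). Stability: let $Z_1'$ be an i.i.d. copy of $Z_1$, independent of everything else, and $\mathbf Z'=(Z_1',Z_2,\dots,Z_n)$. For a function $h_n(Z_0,\mathbf Z)$ that is invariant to the order of the $n$ elements of its second argument, - loss stability: $\gamma(h_n)=\mathbb E\big[\big(h_n(Z_0,\mathbf Z)-\mathbb E[h_n(Z_0,\mathbf Z)\mid\mathbf Z]-(h_n(Z_0,\mathbf Z')-\mathbb E[h_n(Z_0,\mathbf Z')\mid\mathbf Z'])\big)^2\big]$; - $\sigma^2(h_n)=\mathrm{Var}(\mathbb E[h_n(Z_0,\mathbf Z)\mid Z_0])$;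 - relative loss stability: $r(h_n)=n\,\gamma(h_n)/\sigma^2(h_n)$. Asymptotic notation ($n\to\infty$): $f_n=O(g_n)$ if $f_n/g_n$ is asymptotically bounded, $f_n=o(g_n)$ if $f_n/g_n\to0$, $f_n=\omega(g_n)$ if $g_n=o(f_n)$, $f_n=\Omega(g_n)$ if $g_n=O(f_n)$, $f_n=\Theta(g_n)$ if both $f_n=O(g_n)$ and $f_n=\Omega(g_n)$. *)

theory Defs
  imports "HOL-Probability.Probability"
begin

text \<open>
  A data point is a pair (x, y) in \<open>(real ^ 'p) \<times> real\<close>, the dimension being the cardinality
  of the index type \<open>'p\<close>.  A training set of size n is a function on the index set \<open>{1..n}\<close>
  (extensional, i.e. an element of the product space \<open>train_space n\<close>).
\<close>

type_synonym 'p datum = "(real ^ 'p) \<times> real"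

abbreviation train_space :: "nat \<Rightarrow> (nat \<Rightarrow> 'p::finite datum) measure" where
  "train_space n \<equiv> Pi\<^sub>M {1..n} (\<lambda>_. borel)"


subsection \<open>The Gaussian linear model\<close>

definition std_gaussian_density :: "real ^ 'p::finite \<Rightarrow> real" where
  "std_gaussian_density x = (\<Prod>j\<in>UNIV. std_normal_density (x $ j))"

text \<open>
  Z i is the i-th data point (index 0 being the test point) and Z1' is the copy of Z 1.  The
  noise is \<open>snd (Z i) - fst (Z i) \<bullet> \<beta>\<close>, so that the model equation holds by construction.
  Joint independence of the sequence and of the copy is stated with the index type
  \<open>nat option\<close>, the copy having index None.  The independence of covariate and noise is stated
  for the generated sigma-algebras, since \<open>indep_var\<close> requires both variables to have the same
  type.
\<close>

locale gaussian_linear_model = prob_space M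
  for M :: "'a measure" +
  fixes Z :: "nat \<Rightarrow> 'a \<Rightarrow> 'p::finite datum"
    and Z1' :: "'a \<Rightarrow> 'p datum"
    and \<beta> :: "real ^ 'p"
    and \<tau> :: real
  assumes \<tau>_pos: "\<tau> > 0"
    and indep: "indep_vars (\<lambda>_. borel) (case_option Z1' Z) UNIV"
    and covariate: "\<And>i. distributed M lborel (\<lambda>\<omega>. fst (Z i \<omega>)) (\<lambda>x. ennreal (std_gaussian_density x))"
    and noise: "\<And>i. distributed M lborel (\<lambda>\<omega>. snd (Z i \<omega>) - fst (Z i \<omega>) \<bullet> \<beta>)
                  (\<lambda>e. ennreal (normal_density 0 \<tau> e))"
    and covariate_noise_indep: "\<And>i. indep_set
          (sets (vimage_algebra (space M) (\<lambda>\<omega>. fst (Z i \<omega>)) borel))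
          (sets (vimage_algebra (space M) (\<lambda>\<omega>. snd (Z i \<omega>) - fst (Z i \<omega>) \<bullet> \<beta>) borel))"
    and copy: "distr M borel Z1' = distr M borel (Z 1)"


subsection \<open>Loss stability\<close>

definition train :: "(nat \<Rightarrow> 'a \<Rightarrow> 'p::finite datum) \<Rightarrow> nat \<Rightarrow> 'a \<Rightarrow> (nat \<Rightarrow> 'p datum)" where
  "train Z n \<omega> = (\<lambda>i\<in>{1..n}. Z i \<omega>)"

definition cond_exp_given ::
  "'a measure \<Rightarrow> 'b measure \<Rightarrow> ('a \<Rightarrow> 'b) \<Rightarrow> ('a \<Rightarrow> real) \<Rightarrow> 'a \<Rightarrow> real" where
  "cond_exp_given M N W f = real_cond_exp M (vimage_algebra (space M) W N) f"

definition centered_loss ::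
  "'a measure \<Rightarrow> (nat \<Rightarrow> 'a \<Rightarrow> 'p::finite datum) \<Rightarrow> nat
    \<Rightarrow> ('p datum \<Rightarrow> (nat \<Rightarrow> 'p datum) \<Rightarrow> real) \<Rightarrow> 'a \<Rightarrow> real" where
  "centered_loss M Z n h \<omega> =
     h (Z 0 \<omega>) (train Z n \<omega>)
     - cond_exp_given M (train_space n) (train Z n) (\<lambda>\<omega>'. h (Z 0 \<omega>') (train Z n \<omega>')) \<omega>"

text \<open>The perturbed training set is the one of the sequence \<open>Z(1 := Z1')\<close>.\<close>

definition loss_stability ::
  "'a measure \<Rightarrow> (nat \<Rightarrow> 'a \<Rightarrow> 'p::finite datum) \<Rightarrow> ('a \<Rightarrow> 'p datum) \<Rightarrow> nat
    \<Rightarrow> ('p datum \<Rightarrow> (nat \<Rightarrow> 'p datum) \<Rightarrow> real) \<Rightarrow> real" where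
  "loss_stability M Z Z1' n h =
     (\<integral>\<omega>. (centered_loss M Z n h \<omega> - centered_loss M (Z(1 := Z1')) n h \<omega>)\<^sup>2 \<partial>M)"

definition sigma_sq ::
  "'a measure \<Rightarrow> (nat \<Rightarrow> 'a \<Rightarrow> 'p::finite datum) \<Rightarrow> nat
    \<Rightarrow> ('p datum \<Rightarrow> (nat \<Rightarrow> 'p datum) \<Rightarrow> real) \<Rightarrow> real" where
  "sigma_sq M Z n h =
     prob_space.variance M (cond_exp_given M borel (Z 0) (\<lambda>\<omega>. h (Z 0 \<omega>) (train Z n \<omega>)))"

definition rel_loss_stability ::
  "'a measure \<Rightarrow> (nat \<Rightarrow> 'a \<Rightarrow> 'p::finite datum) \<Rightarrow> ('a \<Rightarrow> 'p datum) \<Rightarrow> nat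
    \<Rightarrow> ('p datum \<Rightarrow> (nat \<Rightarrow> 'p datum) \<Rightarrow> real) \<Rightarrow> real" where
  "rel_loss_stability M Z Z1' n h = real n * loss_stability M Z Z1' n h / sigma_sq M Z n h"


subsection \<open>The Lasso\<close>

definition lasso_objective ::
  "nat \<Rightarrow> real \<Rightarrow> (nat \<Rightarrow> 'p::finite datum) \<Rightarrow> real ^ 'p \<Rightarrow> real" where
  "lasso_objective n l z b =
     1 / (2 * real n) * (\<Sum>i=1..n. (snd (z i) - fst (z i) \<bullet> b)\<^sup>2)
     + l / real n * (\<Sum>j\<in>UNIV. \<bar>b $ j\<bar>)"

text \<open>
  The minimizer is unique only almost surely, so a Lasso estimator is any measurable selection
  from the set of minimizers.
\<close>

definition is_lasso_estimator ::
  "nat \<Rightarrow> real \<Rightarrow> ((nat \<Rightarrow> 'p::finite datum) \<Rightarrow> real ^ 'p) \<Rightarrow> bool" where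
  "is_lasso_estimator n l bhat \<longleftrightarrow>
     bhat \<in> borel_measurable (train_space n) \<and>
     (\<forall>z\<in>space (train_space n). is_arg_min (lasso_objective n l z) (\<lambda>_. True) (bhat z))"

definition diff_loss ::
  "((nat \<Rightarrow> 'p::finite datum) \<Rightarrow> real ^ 'p) \<Rightarrow> ((nat \<Rightarrow> 'p datum) \<Rightarrow> real ^ 'p)
    \<Rightarrow> 'p datum \<Rightarrow> (nat \<Rightarrow> 'p datum) \<Rightarrow> real" where
  "diff_loss bhat1 bhat2 z0 z =
     (snd z0 - fst z0 \<bullet> bhat1 z)\<^sup>2 - (snd z0 - fst z0 \<bullet> bhat2 z)\<^sup>2"

end

theory Submission
  imports Defs
begin

text \<open>
  Fix a coordinate \<open>j\<close> with \<open>\<beta> $ j = 0\<close>, and let \<open>d\<close> be the difference of the two Lasso solutions.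
  The part of the loss that is linear in the test noise gives \<open>\<gamma> \<ge> 4 \<tau>\<^sup>2 E (d\<^sub>j - d\<^sub>j')\<^sup>2\<close>, where \<open>d'\<close>
  belongs to the perturbed training set, and it suffices to resample the noise of one observation
  only. When the Gram matrix is close to \<open>n\<close> times the identity, \<open>d\<^sub>j\<close> is at least \<open>\<delta> / (2 n)\<close> if the
  coordinate is positive for the larger penalty, and nonpositive if it is not positive for the
  smaller one. A sufficiently large change of one noise variable passes from the first case to the
  second for a range of length of order 1 of the \<open>j\<close>-th correlation with the responses, which
  has fluctuations of order \<open>sqrt n\<close>; so this has probability of order \<open>1 / sqrt n\<close>, and
  \<open>\<gamma>\<close> is at least of order \<open>n\<^sup>-\<^sup>2 / sqrt n\<close>. For the upper bound, \<open>d\<close> is of order \<open>1 / n\<close> wherever the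
  Gram matrix has smallest eigenvalue of order \<open>n\<close>, which fails with exponentially small probability
  only. Finally \<open>\<sigma>\<^sup>2 > 0\<close> (needed because \<open>x / 0 = 0\<close> in the definition of \<open>r\<close>): otherwise the second
  moments of the \<open>j\<close>-th coordinates of the two solutions would agree, whereas they differ by at
  least a constant times \<open>1 / (n sqrt n)\<close>.
\<close>


subsection \<open>Optimality conditions\<close>

text \<open>All lower bounds come from one translation of the noise. An invertible Gram operator
  gives \<open>c\<close> with \<open>gram I X c = sqrt n *\<^sub>R axis j 1\<close>. Adding
  \<open>s * (X i \<bullet> c)\<close> to each noise variable moves the vector of correlations by
  \<open>s * sqrt n\<close> in coordinate \<open>j\<close> and nowhere else, while the vector of the
  \<open>X i \<bullet> c\<close> has bounded length. Hence the density of the noise changes by a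
  bounded factor only, and a window of length 1 in the correlation is a window of length
  \<open>1 / sqrt n\<close> in \<open>s\<close>. The obstacle is that two notions of a good design
  are needed. Sign and size of a single coordinate require a Gram operator near \<open>n\<close>
  times the identity; there a failure probability of order \<open>1 / n\<close>, from second
  moments, suffices. Upper bounds hold with mere curvature of order \<open>n\<close>, but for a
  degenerate design only a bound polynomial in the responses is available, and an exponentially
  small probability is needed to absorb it. Positivity of the variance rests on the full support of
  the Gaussian law: a continuous function that is almost surely constant is constant.\<close>

text \<open>
  First-order conditions for minimizing \<open>b \<bullet> G b / 2 - v \<bullet> b + l * \<parallel>b\<parallel>\<^sub>1\<close> over the vectors
  supported in \<open>J\<close>. In the Lasso, \<open>G\<close> is the Gram operator and \<open>v\<close> the vector of correlations with
  the responses. With \<open>l = 0\<close> the conditions hold at the true coefficients for the noiseless \<open>v\<close>.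
\<close>
definition lasso_kkt ::
  "(real ^ 'p::finite \<Rightarrow> real ^ 'p) \<Rightarrow> real ^ 'p \<Rightarrow> 'p set \<Rightarrow> real \<Rightarrow> real ^ 'p \<Rightarrow> bool" where
  "lasso_kkt G v J l b \<longleftrightarrow>
     (\<forall>k\<in>J. \<bar>(v - G b) $ k\<bar> \<le> l \<and> (v - G b) $ k * b $ k = l * \<bar>b $ k\<bar>) \<and> (\<forall>k. k \<notin> J \<longrightarrow> b $ k = 0)"

text \<open>The limit of vanishing step length: a perturbation inequality, already divided by the
  step \<open>s\<close>, becomes a first-order condition.\<close>

lemma nonpos_if_le_scaled:
  fixes A B :: real
  assumes "\<And>s. 0 < s \<Longrightarrow> s \<le> 1 \<Longrightarrow> A \<le> s * B"
  shows "A \<le> 0"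
proof (rule tendsto_lowerbound)
  show "((\<lambda>s. s * B) \<longlongrightarrow> 0) (at_right 0)"
    by (rule tendsto_eq_intros | simp)+
  show "eventually (\<lambda>s. A \<le> s * B) (at_right 0)"
    using assms eventually_at_right_less[of "0::real"]
    by (auto simp: eventually_at_right_field intro!: exI[of _ 1])
qed simp

lemma mult_le_abs_bound: "\<bar>r\<bar> \<le> l \<Longrightarrow> r * x \<le> l * \<bar>x\<bar>" for r x l :: real
  using mult_right_mono[of "\<bar>r\<bar>" l "\<bar>x\<bar>"] abs_ge_self[of "r * x"] by (simp add: abs_mult)

text \<open>Perturbations \<open>t = s\<close>, \<open>t = - s\<close> and
  \<open>t = - s * x\<close> with small positive \<open>s\<close> yield \<open>g \<le> l\<close>,
  \<open>- g \<le> l\<close> and \<open>l * \<bar>x\<bar> \<le> g * x\<close> in turn; the remaining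
  inequality follows from the first two.\<close>

lemma kkt_scalar:
  fixes g q l x :: real
  assumes H: "\<And>t. t * g \<le> t\<^sup>2 * q / 2 + l * (\<bar>x + t\<bar> - \<bar>x\<bar>)" and "l \<ge> 0"
  shows "\<bar>g\<bar> \<le> l \<and> g * x = l * \<bar>x\<bar>"
proof -
  have tri: "l * (\<bar>x + t\<bar> - \<bar>x\<bar>) \<le> l * \<bar>t\<bar>" for t
    using \<open>l \<ge> 0\<close> by (intro mult_left_mono) auto
  have "g - l \<le> s * (q / 2)" if "0 < s" for s
  proof -
    have "s * (g - l) \<le> s * (s * (q / 2))"
      using H[of s] tri[of s] that by (simp add: algebra_simps power2_eq_square)
    then show ?thesis using that by simp
  qed
  then have 1: "g - l \<le> 0" by (rule nonpos_if_le_scaled)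
  have "- g - l \<le> s * (q / 2)" if "0 < s" for s
  proof -
    have "s * (- g - l) \<le> s * (s * (q / 2))"
      using H[of "- s"] tri[of "- s"] that by (simp add: algebra_simps power2_eq_square)
    then show ?thesis using that by simp
  qed
  then have 2: "- g - l \<le> 0" by (rule nonpos_if_le_scaled)
  \<comment> \<open>Shrinking \<open>x\<close> by the factor \<open>1 - s\<close> makes the change
    of the absolute value exactly linear in \<open>s\<close>, whatever the sign of
    \<open>x\<close>.\<close>
  have "l * \<bar>x\<bar> - g * x \<le> s * (x\<^sup>2 * q / 2)" if "0 < s" "s \<le> 1" for s
  proof -
    have "x + - s * x = (1 - s) * x" by (simp add: algebra_simps)
    then have e: "\<bar>x + - s * x\<bar> = (1 - s) * \<bar>x\<bar>" using that by (simp add: abs_mult)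
    have "s * (l * \<bar>x\<bar> - g * x) \<le> s * (s * (x\<^sup>2 * q / 2))"
      using H[of "- s * x"] unfolding e by (simp add: algebra_simps power2_eq_square)
    then show ?thesis using that by simp
  qed
  then have 3: "l * \<bar>x\<bar> - g * x \<le> 0" by (rule nonpos_if_le_scaled)
  have "g * x \<le> l * \<bar>x\<bar>"
  proof -
    have "g * x \<le> \<bar>g\<bar> * \<bar>x\<bar>" by (simp add: mult_le_abs_bound)
    also have "\<dots> \<le> l * \<bar>x\<bar>" using 1 2 by (intro mult_right_mono) auto
    finally show ?thesis .
  qed
  then show ?thesis using 1 2 3 by auto
qed

text \<open>Moving a single coordinate in \<open>J\<close> stays among the admissible vectors and
  turns the objective into a quadratic plus an absolute value in one variable, with the residual as
  slope and the diagonal entry of \<open>G\<close> as curvature.\<close>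

lemma argmin_imp_lasso_kkt:
  fixes G :: "real ^ 'p::finite \<Rightarrow> real ^ 'p"
  assumes G: "linear G" and sym: "\<And>a b. a \<bullet> G b = G a \<bullet> b" and "l \<ge> 0"
    and supp: "\<And>k. k \<notin> J \<Longrightarrow> b $ k = 0"
    and min: "\<And>a. (\<And>k. k \<notin> J \<Longrightarrow> a $ k = 0) \<Longrightarrow>
        b \<bullet> G b / 2 - v \<bullet> b + l * (\<Sum>k\<in>UNIV. \<bar>b $ k\<bar>)
          \<le> a \<bullet> G a / 2 - v \<bullet> a + l * (\<Sum>k\<in>UNIV. \<bar>a $ k\<bar>)"
  shows "lasso_kkt G v J l b"
proof -
  have "\<bar>(v - G b) $ k\<bar> \<le> l \<and> (v - G b) $ k * b $ k = l * \<bar>b $ k\<bar>" if "k \<in> J" for k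
  proof (rule kkt_scalar[OF _ \<open>l \<ge> 0\<close>])
    fix t :: real
    define e where "e = (axis k 1 :: real ^ 'p)"
    define a where "a = b + t *\<^sub>R e"
    have ek: "e \<bullet> c = c $ k" for c by (simp add: e_def inner_axis')
    have q: "a \<bullet> G a = b \<bullet> G b + 2 * t * (G b $ k) + t\<^sup>2 * (e \<bullet> G e)"
    proof -
      have "a \<bullet> G a = b \<bullet> G b + t * (b \<bullet> G e) + t * (e \<bullet> G b) + t\<^sup>2 * (e \<bullet> G e)"
        by (simp add: a_def linear_add[OF G] linear_scale[OF G] inner_add_left inner_add_right
            algebra_simps power2_eq_square)
      then show ?thesis using sym[of b e] by (simp add: ek inner_commute[of _ e])
    qed
    have va: "v \<bullet> a = v \<bullet> b + t * v $ k"
      by (simp add: a_def inner_add_right inner_commute[of v e] ek)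
    have "(\<Sum>i\<in>UNIV. \<bar>a $ i\<bar>) - (\<Sum>i\<in>UNIV. \<bar>b $ i\<bar>) = (\<Sum>i\<in>UNIV. \<bar>a $ i\<bar> - \<bar>b $ i\<bar>)"
      by (simp add: sum_subtractf)
    also have "\<dots> = (\<Sum>i\<in>UNIV. if i = k then \<bar>b $ k + t\<bar> - \<bar>b $ k\<bar> else 0)"
      by (intro sum.cong) (auto simp: a_def e_def axis_def)
    also have "\<dots> = \<bar>b $ k + t\<bar> - \<bar>b $ k\<bar>" by simp
    finally have l1: "(\<Sum>i\<in>UNIV. \<bar>a $ i\<bar>) = (\<Sum>i\<in>UNIV. \<bar>b $ i\<bar>) + (\<bar>b $ k + t\<bar> - \<bar>b $ k\<bar>)"
      by simp
    have "a $ i = 0" if "i \<notin> J" for i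
      using that \<open>k \<in> J\<close> supp by (auto simp: a_def e_def axis_def)
    from min[OF this] show "t * (v - G b) $ k \<le> t\<^sup>2 * (e \<bullet> G e) / 2 + l * (\<bar>b $ k + t\<bar> - \<bar>b $ k\<bar>)"
      unfolding q va l1 by (simp add: algebra_simps add_divide_distrib)
  qed
  then show ?thesis using supp by (auto simp: lasso_kkt_def)
qed

text \<open>Strong curvature makes the objective coercive: beyond the radius \<open>r\<close> it is
  at least its value 0 at the origin, so a minimizer over the compact intersection of the ball with
  the coordinate subspace is a minimizer over the whole subspace.\<close>

lemma lasso_kkt_exists:
  fixes G :: "real ^ 'p::finite \<Rightarrow> real ^ 'p"
  assumes G: "linear G" and sym: "\<And>a b. a \<bullet> G b = G a \<bullet> b" and "l \<ge> 0"
    and c: "c > 0" "\<And>a. c * (norm a)\<^sup>2 \<le> a \<bullet> G a"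
  shows "\<exists>b. lasso_kkt G v J l b"
proof -
  define F where "F a = a \<bullet> G a / 2 - v \<bullet> a + l * (\<Sum>k\<in>UNIV. \<bar>a $ k\<bar>)" for a
  define S where "S = {a :: real ^ 'p. \<forall>k. k \<notin> J \<longrightarrow> a $ k = 0}"
  define r where "r = 2 * norm v / c"
  have contG: "continuous_on UNIV G" using G by (simp add: linear_continuous_on linear_conv_bounded_linear)
  have contF: "continuous_on UNIV F"
    unfolding F_def by (intro continuous_intros contG) auto
  have "S = (\<Inter>k\<in>-J. {a. a $ k = 0})" by (auto simp: S_def)
  moreover have "closed {a :: real ^ 'p. a $ k = 0}" for k
    by (intro closed_Collect_eq continuous_intros)
  ultimately have "closed S" by auto
  then have cpt: "compact (cball 0 r \<inter> S)" by (simp add: compact_Int_closed)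
  have r0: "r \<ge> 0" using c by (simp add: r_def)
  then have "0 \<in> cball 0 r \<inter> S" by (auto simp: S_def)
  then have ne: "cball 0 r \<inter> S \<noteq> {}" by blast
  from continuous_attains_inf[OF cpt ne continuous_on_subset[OF contF subset_UNIV]]
  obtain b where b: "b \<in> cball 0 r" "b \<in> S" "\<And>a. a \<in> cball 0 r \<inter> S \<Longrightarrow> F b \<le> F a" by blast
  have "F b \<le> F a" if "a \<in> S" for a
  proof (cases "norm a \<le> r")
    case True then show ?thesis using that b by auto
  next
    case False
    have "F b \<le> F 0" using b r0 by (auto simp: S_def)
    also have "F 0 = 0" by (simp add: F_def linear_0[OF G])
    also have "0 \<le> norm a * (c * norm a / 2 - norm v)"
      using False c by (intro mult_nonneg_nonneg) (auto simp: r_def field_simps)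
    also have "\<dots> \<le> a \<bullet> G a / 2 - v \<bullet> a"
      using c(2)[of a] norm_cauchy_schwarz[of v a] by (simp add: algebra_simps power2_eq_square)
    also have "\<dots> \<le> F a" using \<open>l \<ge> 0\<close> by (simp add: F_def sum_nonneg)
    finally show ?thesis .
  qed
  then have "lasso_kkt G v J l b"
    using b(2) by (intro argmin_imp_lasso_kkt[OF G sym \<open>l \<ge> 0\<close>]) (auto simp: F_def S_def)
  then show ?thesis ..
qed

lemma l1_le_norm: "(\<Sum>k\<in>UNIV. \<bar>a $ k\<bar>) \<le> CARD('p) * norm (a :: real ^ 'p::finite)"
  using sum_bounded_above[of UNIV "\<lambda>k. \<bar>a $ k\<bar>" "norm a"] component_le_norm_cart[of a] by simp

lemma norm_le_entries:
  fixes a :: "real ^ 'p::finite" and t :: real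
  assumes "\<And>k. \<bar>a $ k\<bar> \<le> t" shows "norm a \<le> CARD('p) * t"
  using norm_le_l1_cart[of a] sum_bounded_above[of UNIV "\<lambda>k. \<bar>a $ k\<bar>" t] assms by simp

text \<open>The subdifferential of the absolute value is monotone: in each coordinate, multiplying
  both residuals by both solutions and combining gives a product of differences that is nonnegative
  up to the discrepancy of the penalties. Summation over the coordinates yields the claim.\<close>

lemma lasso_kkt_compare:
  fixes G :: "real ^ 'p::finite \<Rightarrow> real ^ 'p"
  assumes G: "linear G" and b: "lasso_kkt G v J l b" and b': "lasso_kkt G v' J l' b'"
  shows "(b - b') \<bullet> G (b - b') \<le> (b - b') \<bullet> (v - v') + \<bar>l - l'\<bar> * (\<Sum>k\<in>UNIV. \<bar>(b - b') $ k\<bar>)"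
proof -
  have tm: "- (\<bar>l - l'\<bar> * \<bar>(b - b') $ k\<bar>) \<le> (b - b') $ k * ((v - G b) $ k - (v' - G b') $ k)" for k
  proof (cases "k \<in> J")
    case True
    define r r' where "r = (v - G b) $ k" and "r' = (v' - G b') $ k"
    have 1: "r * b $ k = l * \<bar>b $ k\<bar>" "r' * b' $ k = l' * \<bar>b' $ k\<bar>" "\<bar>r\<bar> \<le> l" "\<bar>r'\<bar> \<le> l'"
      using b b' True by (auto simp: lasso_kkt_def r_def r'_def)
    have 2: "r * b' $ k \<le> l * \<bar>b' $ k\<bar>"
      using 1(3) by (rule mult_le_abs_bound)
    have 3: "r' * b $ k \<le> l' * \<bar>b $ k\<bar>"
      using 1(4) by (rule mult_le_abs_bound)
    have "- (\<bar>l - l'\<bar> * \<bar>b $ k - b' $ k\<bar>) \<le> - (\<bar>l - l'\<bar> * \<bar>\<bar>b $ k\<bar> - \<bar>b' $ k\<bar>\<bar>)"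
      by (simp add: mult_left_mono abs_triangle_ineq3)
    also have "\<dots> \<le> (l - l') * (\<bar>b $ k\<bar> - \<bar>b' $ k\<bar>)"
      using abs_ge_minus_self[of "(l - l') * (\<bar>b $ k\<bar> - \<bar>b' $ k\<bar>)"] by (simp add: abs_mult)
    also have "\<dots> \<le> (b $ k - b' $ k) * (r - r')"
      using 1 2 3 by (simp add: algebra_simps)
    finally show ?thesis by (simp add: r_def r'_def)
  next
    case False then show ?thesis using b b' by (simp add: lasso_kkt_def)
  qed
  have "- (\<bar>l - l'\<bar> * (\<Sum>k\<in>UNIV. \<bar>(b - b') $ k\<bar>)) = (\<Sum>k\<in>UNIV. - (\<bar>l - l'\<bar> * \<bar>(b - b') $ k\<bar>))"
    by (simp add: sum_distrib_left sum_negf)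
  also have "\<dots> \<le> (\<Sum>k\<in>UNIV. (b - b') $ k * ((v - G b) $ k - (v' - G b') $ k))"
    by (intro sum_mono tm)
  also have "\<dots> = (b - b') \<bullet> (v - v' - G (b - b'))"
    by (simp add: inner_vec_def linear_diff[OF G] algebra_simps)
  finally show ?thesis by (simp add: inner_diff_right)
qed

text \<open>Lipschitz dependence of the solution on \<open>v\<close> and \<open>l\<close>: curvature
  bounds the quadratic form below, the right side is linear in the distance, and one factor cancels.
  With \<open>l' = 0\<close> and the true coefficients as \<open>b'\<close> it becomes a bound on
  the estimation error.\<close>

lemma lasso_kkt_dist:
  fixes G :: "real ^ 'p::finite \<Rightarrow> real ^ 'p"
  assumes G: "linear G" and c: "c > 0" "\<And>a. c * (norm a)\<^sup>2 \<le> a \<bullet> G a"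
    and b: "lasso_kkt G v J l b" and b': "lasso_kkt G v' J l' b'"
  shows "norm (b - b') \<le> (norm (v - v') + \<bar>l - l'\<bar> * CARD('p)) / c"
proof (cases "b = b'")
  case False
  let ?a = "b - b'"
  have "norm ?a * (c * norm ?a) \<le> ?a \<bullet> G ?a" using c(2)[of ?a] by (simp add: power2_eq_square ac_simps)
  also have "\<dots> \<le> ?a \<bullet> (v - v') + \<bar>l - l'\<bar> * (\<Sum>k\<in>UNIV. \<bar>?a $ k\<bar>)"
    by (rule lasso_kkt_compare[OF G b b'])
  also have "\<dots> \<le> norm ?a * norm (v - v') + \<bar>l - l'\<bar> * (CARD('p) * norm ?a)"
    by (intro add_mono mult_left_mono l1_le_norm norm_cauchy_schwarz) auto
  also have "\<dots> = norm ?a * (norm (v - v') + \<bar>l - l'\<bar> * CARD('p))" by (simp add: algebra_simps)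
  finally have "c * norm ?a \<le> norm (v - v') + \<bar>l - l'\<bar> * CARD('p)" using False by simp
  then show ?thesis using c by (simp add: field_simps)
next
  case True then show ?thesis using c by simp
qed

lemma lasso_kkt_zero: "linear G \<Longrightarrow> (\<And>k. k \<notin> J \<Longrightarrow> b $ k = 0) \<Longrightarrow> lasso_kkt G (G b) J 0 b"
  by (auto simp: lasso_kkt_def)

subsection \<open>Gram operators close to a multiple of the identity\<close>

definition near_id :: "real \<Rightarrow> real \<Rightarrow> (real ^ 'p::finite \<Rightarrow> real ^ 'p) \<Rightarrow> bool" where
  "near_id \<eta> N G \<longleftrightarrow> (\<forall>a. norm (G a - N *\<^sub>R a) \<le> \<eta> * N * norm a)"

text \<open>The alternative \<open>N < 0\<close> in the second part takes the place of a sign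
  condition: the triangle inequality produces \<open>\<bar>N\<bar>\<close>, which is
  \<open>N\<close> otherwise.\<close>

lemma near_id_curvature:
  assumes "near_id \<eta> N G"
  shows "(1 - \<eta>) * N * (norm a)\<^sup>2 \<le> a \<bullet> G a" "norm (G a) \<le> (1 + \<eta>) * N * norm a \<or> N < 0"
    "a \<bullet> G a \<le> (1 + \<eta>) * N * (norm a)\<^sup>2"
proof -
  have d: "norm (G a - N *\<^sub>R a) \<le> \<eta> * N * norm a" using assms by (simp add: near_id_def)
  have "\<bar>a \<bullet> (G a - N *\<^sub>R a)\<bar> \<le> norm a * (\<eta> * N * norm a)"
    using Cauchy_Schwarz_ineq2[of a "G a - N *\<^sub>R a"] mult_left_mono[OF d, of "norm a"] by simp
  then show "(1 - \<eta>) * N * (norm a)\<^sup>2 \<le> a \<bullet> G a" "a \<bullet> G a \<le> (1 + \<eta>) * N * (norm a)\<^sup>2"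
    by (auto simp: inner_diff_right power2_norm_eq_inner[symmetric] algebra_simps power2_eq_square)
  show "norm (G a) \<le> (1 + \<eta>) * N * norm a \<or> N < 0"
    using norm_triangle_ineq[of "G a - N *\<^sub>R a" "N *\<^sub>R a"] d by (auto simp: algebra_simps)
qed

lemma near_id_offdiag:
  assumes "near_id \<eta> N G"
  shows "\<bar>G a $ k - N * a $ k\<bar> \<le> \<eta> * N * norm a"
  using assms component_le_norm_cart[of "G a - N *\<^sub>R a" k]
  by (auto simp: near_id_def intro: order_trans)

text \<open>The full solution \<open>b\<close> is compared with the solution \<open>b0\<close> that
  omits coordinate \<open>j\<close>. Monotonicity in the other coordinates leaves
  \<open>c * (norm (b - b0))\<^sup>2 \<le> b $ j * (r0 - r)\<close>, where \<open>r0\<close> and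
  \<open>r\<close> are the residuals at \<open>j\<close>. As \<open>r = l\<close> once
  \<open>b $ j > 0\<close>, and \<open>\<bar>r\<bar> \<le> l\<close> always, the comparison of
  \<open>r0\<close> with \<open>l\<close> alone decides whether coordinate \<open>j\<close> becomes
  positive.\<close>

lemma lasso_kkt_sign:
  fixes G :: "real ^ 'p::finite \<Rightarrow> real ^ 'p"
  assumes G: "linear G" and c: "c > 0" "\<And>a. c * (norm a)\<^sup>2 \<le> a \<bullet> G a" and "l \<ge> 0"
    and b: "lasso_kkt G v UNIV l b" and b0: "lasso_kkt G v (- {j}) l b0"
  shows "(v - G b0) $ j > l \<Longrightarrow> b $ j > 0"
    and "(v - G b0) $ j > l \<Longrightarrow> c * (norm (b - b0))\<^sup>2 \<le> b $ j * ((v - G b0) $ j - l)"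
    and "(v - G b0) $ j \<le> l \<Longrightarrow> b $ j \<le> 0"
proof -
  define r0 r where "r0 = (v - G b0) $ j" and "r = (v - G b) $ j"
  have r: "\<bar>r\<bar> \<le> l" "r * b $ j = l * \<bar>b $ j\<bar>" and b0j: "b0 $ j = 0"
    using b b0 by (auto simp: lasso_kkt_def r_def)
  have tm: "0 \<le> (b - b0) $ k * ((v - G b) $ k - (v - G b0) $ k)" if "k \<noteq> j" for k
  proof -
    define q q' where "q = (v - G b) $ k" and "q' = (v - G b0) $ k"
    have 1: "q * b $ k = l * \<bar>b $ k\<bar>" "q' * b0 $ k = l * \<bar>b0 $ k\<bar>" "\<bar>q\<bar> \<le> l" "\<bar>q'\<bar> \<le> l"
      using b b0 that by (auto simp: lasso_kkt_def q_def q'_def)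
    have 2: "q * b0 $ k \<le> l * \<bar>b0 $ k\<bar>"
      using 1(3) by (rule mult_le_abs_bound)
    have 3: "q' * b $ k \<le> l * \<bar>b $ k\<bar>"
      using 1(4) by (rule mult_le_abs_bound)
    have "0 \<le> (b $ k - b0 $ k) * (q - q')" using 1 2 3 by (simp add: algebra_simps)
    then show ?thesis by (simp add: q_def q'_def)
  qed
  have "b $ j * (r - r0) = (b - b0) $ j * ((v - G b) $ j - (v - G b0) $ j)"
    by (simp add: r_def r0_def b0j)
  also have "\<dots> \<le> (\<Sum>k\<in>UNIV. (b - b0) $ k * ((v - G b) $ k - (v - G b0) $ k))"
    using tm by (subst sum.remove[of _ j]) (auto intro!: sum_nonneg)
  also have "\<dots> = - ((b - b0) \<bullet> G (b - b0))"
    by (simp add: inner_vec_def linear_diff[OF G] algebra_simps sum_negf[symmetric])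
  finally have "b $ j * (r - r0) \<le> - ((b - b0) \<bullet> G (b - b0))" .
  then have main: "c * (norm (b - b0))\<^sup>2 \<le> b $ j * (r0 - r)"
    using c(2)[of "b - b0"] by (simp add: algebra_simps)
  show pos: "b $ j > 0" if "(v - G b0) $ j > l"
  proof (rule ccontr)
    assume n: "\<not> b $ j > 0"
    have "r0 - r > 0" using that r by (auto simp: r0_def)
    then have "b $ j * (r0 - r) \<le> 0" using n by (simp add: mult_nonpos_nonneg)
    then have "c * (norm (b - b0))\<^sup>2 \<le> 0" using main by simp
    then have "b = b0" using c(1) by (simp add: mult_le_0_iff)
    then have "r0 = r" by (simp add: r0_def r_def)
    then show False using \<open>r0 - r > 0\<close> by simp
  qed
  show "c * (norm (b - b0))\<^sup>2 \<le> b $ j * ((v - G b0) $ j - l)" if "(v - G b0) $ j > l"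
    using main pos[OF that] r(2) by (simp add: r0_def)
  show "b $ j \<le> 0" if "(v - G b0) $ j \<le> l"
  proof (rule ccontr)
    assume p: "\<not> b $ j \<le> 0"
    then have "r = l" using r(2) by simp
    then have "b $ j * (r0 - r) \<le> 0" using p that by (simp add: r0_def mult_nonneg_nonpos)
    then have "c * (norm (b - b0))\<^sup>2 \<le> 0" using main by simp
    then have "b = b0" using c(1) by (simp add: mult_le_0_iff)
    then show False using p b0j by simp
  qed
qed

text \<open>
  At a coordinate active for the larger penalty the optimality conditions give
  \<open>(G (b1 - b2)) $ j \<ge> \<delta>\<close> up to sign, and \<open>G\<close> is close to \<open>N\<close> times the identity.
\<close>
lemma lasso_kkt_diff_coord:
  fixes G :: "real ^ 'p::finite \<Rightarrow> real ^ 'p"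
  assumes G: "linear G" and ni: "near_id \<eta> N G" "N > 0" "\<eta> * (4 * CARD('p)) \<le> 1"
    and l: "0 < l" "0 < \<delta>"
    and b1: "lasso_kkt G v UNIV l b1" and b2: "lasso_kkt G v UNIV (l + \<delta>) b2"
  shows "b2 $ j > 0 \<Longrightarrow> b1 $ j - b2 $ j \<ge> \<delta> / (2 * N)"
    and "b2 $ j < 0 \<Longrightarrow> b1 $ j - b2 $ j \<le> - (\<delta> / (2 * N))"
    and "b1 $ j \<le> 0 \<Longrightarrow> b1 $ j - b2 $ j \<le> 0"
    and "(b1 $ j)\<^sup>2 - (b2 $ j)\<^sup>2 \<ge> \<delta> / N * \<bar>b2 $ j\<bar>"
proof -
  let ?d = "b1 - b2"
  have card: "(1::real) \<le> CARD('p)" using zero_less_card_finite[where 'a='p] by linarith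
  have eta: "\<eta> \<le> 1 / 2"
  proof (cases "\<eta> \<ge> 0")
    case True
    then have "\<eta> * 4 \<le> \<eta> * (4 * CARD('p))" using card by (intro mult_left_mono) auto
    then show ?thesis using ni by simp
  qed simp
  \<comment> \<open>\<open>near_id\<close> contains no sign condition on \<eta>; applying it to a
    unit vector supplies one.\<close>
  have eta0: "0 \<le> \<eta>"
  proof -
    have "norm (G (axis j 1) - N *\<^sub>R axis j 1) \<le> \<eta> * N * norm (axis j 1 :: real ^ 'p)"
      using ni(1) unfolding near_id_def by blast
    moreover have "norm (axis j 1 :: real ^ 'p) = 1" by (simp add: norm_axis_1)
    ultimately have "norm (G (axis j 1) - N *\<^sub>R axis j 1) \<le> \<eta> * N" by simp
    then have "0 \<le> \<eta> * N" by (rule order_trans[OF norm_ge_zero])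
    then show ?thesis using ni by (simp add: zero_le_mult_iff)
  qed
  have curv: "(N / 2) * (norm a)\<^sup>2 \<le> a \<bullet> G a" for a
  proof -
    have "(N / 2) * (norm a)\<^sup>2 \<le> (1 - \<eta>) * N * (norm a)\<^sup>2"
      using eta ni by (intro mult_right_mono) auto
    then show ?thesis using near_id_curvature(1)[OF ni(1), of a] by simp
  qed
  have "norm ?d \<le> (norm (v - v) + \<bar>l - (l + \<delta>)\<bar> * CARD('p)) / (N / 2)"
    using ni curv by (intro lasso_kkt_dist[OF G _ _ b1 b2]) auto
  then have nd: "norm ?d \<le> 2 * \<delta> * CARD('p) / N" using l by (simp add: ac_simps)
  have "\<bar>G ?d $ j - N * ?d $ j\<bar> \<le> \<eta> * N * norm ?d" by (rule near_id_offdiag[OF ni(1)])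
  \<comment> \<open>The factor \<open>4 * CARD('p)\<close> in the bound on \<eta> is fixed here: the
    off-diagonal part of \<open>G\<close> uses up at most half of the gap \<delta> between the
    residuals.\<close>
  also have "\<dots> \<le> \<eta> * N * (2 * \<delta> * CARD('p) / N)"
    using nd eta0 ni by (intro mult_left_mono) auto
  also have "\<dots> = \<delta> / 2 * (\<eta> * (4 * CARD('p)))" using ni by (simp add: field_simps)
  also have "\<dots> \<le> \<delta> / 2 * 1" using ni l by (intro mult_left_mono) auto
  finally have off: "\<bar>G ?d $ j - N * ?d $ j\<bar> \<le> \<delta> / 2" by simp
  define r1 r2 where "r1 = (v - G b1) $ j" and "r2 = (v - G b2) $ j"
  have r: "\<bar>r1\<bar> \<le> l" "r1 * b1 $ j = l * \<bar>b1 $ j\<bar>" "\<bar>r2\<bar> \<le> l + \<delta>" "r2 * b2 $ j = (l + \<delta>) * \<bar>b2 $ j\<bar>"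
    using b1 b2 by (auto simp: lasso_kkt_def r1_def r2_def)
  have Gd: "G ?d $ j = r2 - r1" by (simp add: r1_def r2_def linear_diff[OF G])
  show p: "b1 $ j - b2 $ j \<ge> \<delta> / (2 * N)" if "b2 $ j > 0"
  proof -
    have "r2 = l + \<delta>" using that r(4) by simp
    then have "N * ?d $ j \<ge> \<delta> / 2" using off Gd r(1) by linarith
    then show ?thesis using ni by (simp add: field_simps)
  qed
  show m: "b1 $ j - b2 $ j \<le> - (\<delta> / (2 * N))" if "b2 $ j < 0"
  proof -
    have "r2 * b2 $ j = (- (l + \<delta>)) * b2 $ j" using that r(4) by (simp add: algebra_simps)
    then have "r2 = - (l + \<delta>)" using that by (subst (asm) mult_cancel_right) auto
    then have "N * ?d $ j \<le> - \<delta> / 2" using off Gd r(1) by linarith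
    then show ?thesis using ni by (simp add: field_simps)
  qed
  show "b1 $ j - b2 $ j \<le> 0" if "b1 $ j \<le> 0"
  proof (cases "b2 $ j < 0")
    case True
    then show ?thesis using m l ni by (smt (verit) divide_nonneg_pos)
  qed (use that in auto)
  \<comment> \<open>An active coordinate has the same sign for both penalties and is larger in
    modulus by \<open>\<delta> / (2 * N)\<close> for the smaller one; the cross term of the square
    gives the bound.\<close>
  show "(b1 $ j)\<^sup>2 - (b2 $ j)\<^sup>2 \<ge> \<delta> / N * \<bar>b2 $ j\<bar>"
  proof -
    have D: "\<delta> / (2 * N) \<ge> 0" using l ni by simp
    consider "b2 $ j > 0" | "b2 $ j < 0" | "b2 $ j = 0" by linarith
    then show ?thesis
    proof cases
      case 1
      have "(b2 $ j + \<delta> / (2 * N))\<^sup>2 \<le> (b1 $ j)\<^sup>2" using p[OF 1] 1 D by (intro power_mono) auto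
      moreover have "(b2 $ j + \<delta> / (2 * N))\<^sup>2 \<ge> (b2 $ j)\<^sup>2 + \<delta> / N * b2 $ j"
        using zero_le_power2[of "\<delta> / (2 * N)"] by (simp add: power2_sum ac_simps)
      ultimately show ?thesis using 1 by simp
    next
      case 2
      have "(- b2 $ j + \<delta> / (2 * N))\<^sup>2 \<le> (- b1 $ j)\<^sup>2" using m[OF 2] 2 D by (intro power_mono) auto
      moreover have "(- b2 $ j + \<delta> / (2 * N))\<^sup>2 \<ge> (b2 $ j)\<^sup>2 - \<delta> / N * b2 $ j"
        using zero_le_power2[of "\<delta> / (2 * N)"] by (simp add: power2_sum power2_diff ac_simps)
      ultimately show ?thesis using 2 by simp
    qed simp
  qed
qed


text \<open>Curvature makes \<open>G\<close> injective, hence onto. For a Gram operator the energy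
  \<open>a \<bullet> G a\<close> is the squared length of the translation that \<open>a\<close>
  induces on the noise, which is why it is bounded along with the solution.\<close>

lemma near_id_solve:
  fixes m :: real and G :: "real ^ 'p::finite \<Rightarrow> real ^ 'p"
  assumes G: "linear G" and ni: "near_id \<eta> N G" "\<eta> \<le> 1 / 2" "N > 0"
  shows "\<exists>a. G a = m *\<^sub>R axis j 1 \<and> a \<bullet> G a \<le> 2 * m\<^sup>2 / N"
proof -
  have curv: "(N / 2) * (norm a)\<^sup>2 \<le> a \<bullet> G a" for a
  proof -
    have "(N / 2) * (norm a)\<^sup>2 \<le> (1 - \<eta>) * N * (norm a)\<^sup>2"
      using ni by (intro mult_right_mono) auto
    then show ?thesis using near_id_curvature(1)[OF ni(1), of a] by simp
  qed
  have "a = 0" if "G a = 0" for a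
    using curv[of a] ni that by (simp add: mult_le_0_iff)
  then have "inj G" using G by (simp add: linear_injective_0)
  then have "surj G" using G by (simp add: linear_injective_imp_surjective)
  then obtain a where a: "G a = m *\<^sub>R axis j 1" by (metis surjD)
  have "a \<bullet> G a = m * a $ j" by (simp add: a inner_axis)
  also have "\<dots> \<le> \<bar>m\<bar> * \<bar>a $ j\<bar>" by (metis abs_ge_self abs_mult)
  also have "\<dots> \<le> \<bar>m\<bar> * norm a" by (intro mult_left_mono component_le_norm_cart) auto
  finally have 1: "a \<bullet> G a \<le> \<bar>m\<bar> * norm a" .
  have "(N / 2 * norm a) * norm a \<le> \<bar>m\<bar> * norm a"
    using curv[of a] 1 by (simp add: power2_eq_square ac_simps)
  then have "N / 2 * norm a \<le> \<bar>m\<bar>"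
    by (cases "a = 0") (auto simp: mult_le_cancel_right)
  then have "norm a \<le> 2 * \<bar>m\<bar> / N" using ni by (simp add: field_simps)
  then have "\<bar>m\<bar> * norm a \<le> \<bar>m\<bar> * (2 * \<bar>m\<bar> / N)" by (intro mult_left_mono) auto
  also have "\<dots> = 2 * m\<^sup>2 / N" by (simp add: power2_eq_square field_simps abs_mult_self_eq)
  finally show ?thesis using a 1 by (intro exI[of _ a]) auto
qed

lemma lasso_kkt_shift:
  assumes "lasso_kkt G v (- {j}) l b"
  shows "lasso_kkt G (v + t *\<^sub>R axis j 1) (- {j}) l b"
  using assms by (auto simp: lasso_kkt_def axis_def)

locale near_id_gram =
  fixes G :: "real ^ 'p::finite \<Rightarrow> real ^ 'p" and \<eta> N :: real
  assumes lin: "linear G" and sym: "a \<bullet> G b = G a \<bullet> b" and ni: "near_id \<eta> N G"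
    and N: "N > 0" and eta: "0 \<le> \<eta>" "\<eta> \<le> 1 / 4"
begin

lemma curv: "(N / 2) * (norm a)\<^sup>2 \<le> a \<bullet> G a"
proof -
  have "(N / 2) * (norm a)\<^sup>2 \<le> (1 - \<eta>) * N * (norm a)\<^sup>2"
    using eta N by (intro mult_right_mono) auto
  then show ?thesis using near_id_curvature(1)[OF ni, of a] by simp
qed

lemma dist:
  fixes l l' :: real
  assumes "lasso_kkt G v J l b" "lasso_kkt G v' J l' b'"
  shows "norm (b - b') \<le> 2 * (norm (v - v') + \<bar>l - l'\<bar> * CARD('p)) / N"
  using lasso_kkt_dist[OF lin _ curv assms] N by (simp add: algebra_simps)

lemma solution_exists: "l \<ge> 0 \<Longrightarrow> \<exists>b. lasso_kkt G v J l b"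
  by (rule lasso_kkt_exists[where G = G and c = "N / 2"]) (use lin sym N curv in auto)

lemma offdiag_le:
  assumes "a $ j = 0" shows "\<bar>G a $ j\<bar> \<le> \<eta> * N * norm a"
  using near_id_offdiag[OF ni, of a j] assms by simp

text \<open>Since \<open>\<beta> $ j = 0\<close>, the vector \<beta> solves the restricted problem
  without noise and penalty, so \<open>b\<close> is close to it. Both vanish at \<open>j\<close>, so
  \<open>G (b - \<beta>)\<close> has only an off-diagonal contribution there.\<close>

lemma restricted_residual:
  fixes l :: real
  assumes b: "lasso_kkt G (G \<beta> + w) (- {j}) l b" and "\<beta> $ j = 0" and "l \<ge> 0"
  shows "\<bar>(G \<beta> + w - G b) $ j\<bar> \<le> 2 * (norm w + l * CARD('p))"
proof -
  have "lasso_kkt G (G \<beta>) (- {j}) 0 \<beta>" using assms by (intro lasso_kkt_zero lin) auto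
  from dist[OF b this] have d: "norm (b - \<beta>) \<le> 2 * (norm w + l * CARD('p)) / N" using \<open>l \<ge> 0\<close> by simp
  have "b $ j = 0" using b by (simp add: lasso_kkt_def)
  then have "\<bar>G (b - \<beta>) $ j\<bar> \<le> \<eta> * N * norm (b - \<beta>)" using assms by (intro offdiag_le) auto
  also have "\<dots> \<le> \<eta> * N * (2 * (norm w + l * CARD('p)) / N)"
    using d eta N by (intro mult_left_mono) auto
  also have "\<dots> = 2 * \<eta> * (norm w + l * CARD('p))" using N by simp
  also have "\<dots> \<le> 1 * (norm w + l * CARD('p))"
    using eta \<open>l \<ge> 0\<close> by (intro mult_right_mono) auto
  finally have 1: "\<bar>G (b - \<beta>) $ j\<bar> \<le> norm w + l * CARD('p)" by simp
  have "(G \<beta> + w - G b) $ j = w $ j - G (b - \<beta>) $ j" by (simp add: linear_diff[OF lin])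
  moreover have "\<bar>w $ j\<bar> \<le> norm w" by (rule component_le_norm_cart)
  ultimately have "\<bar>(G \<beta> + w - G b) $ j\<bar> \<le> norm w + (norm w + l * CARD('p))" using 1 by linarith
  also have "\<dots> \<le> 2 * (norm w + l * CARD('p))" using \<open>l \<ge> 0\<close> by simp
  finally show ?thesis .
qed

text \<open>
  The solution restricted to \<open>- {j}\<close> does not see the \<open>j\<close>-th correlation, so its residual there is
  affine in \<open>s\<close> and the signs of both solutions switch at explicit thresholds.
\<close>
lemma crossing_interval:
  fixes l \<delta> m :: real
  assumes "\<beta> $ j = 0" and m: "m > 0" and l: "l \<ge> 0" "\<delta> \<ge> 0"
    and gap: "q $ j - q' $ j \<ge> 1 + \<delta> + 2 * \<eta> * (norm (q - q') + \<delta> * CARD('p))"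
    and b2: "\<And>s. lasso_kkt G (G \<beta> + w + q + (s * m) *\<^sub>R axis j 1) UNIV (l + \<delta>) (b2 s)"
    and b1: "\<And>s. lasso_kkt G (G \<beta> + w + q' + (s * m) *\<^sub>R axis j 1) UNIV l (b1 s)"
  shows "\<exists>s0. \<bar>s0\<bar> * m \<le> 3 * (norm w + norm q + (l + \<delta>) * CARD('p))
     \<and> (\<forall>s. s0 < s \<longrightarrow> s \<le> s0 + 1 / m \<longrightarrow> b2 s $ j > 0 \<and> b1 s $ j \<le> 0)"
proof -
  let ?v2 = "G \<beta> + w + q" and ?v1 = "G \<beta> + w + q'"
  have ld: "l + \<delta> \<ge> 0" using l by simp
  have card: "(1::real) \<le> CARD('p)" using zero_less_card_finite[where 'a='p] by linarith
  have N2: "N / 2 > 0" using N by simp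
  obtain c2 where c2: "lasso_kkt G ?v2 (- {j}) (l + \<delta>) c2"
    using solution_exists[OF ld] by blast
  obtain c1 where c1: "lasso_kkt G ?v1 (- {j}) l c1"
    using solution_exists[OF l(1)] by blast
  define r2 r1 where "r2 = (?v2 - G c2) $ j" and "r1 = (?v1 - G c1) $ j"
  have rs2: "(?v2 + (s * m) *\<^sub>R axis j 1 - G c2) $ j = r2 + s * m" for s
    by (simp add: r2_def axis_def)
  have rs1: "(?v1 + (s * m) *\<^sub>R axis j 1 - G c1) $ j = r1 + s * m" for s
    by (simp add: r1_def axis_def)
  \<comment> \<open>The value of \<open>s\<close> at which the restricted residual of the problem
    with the larger penalty reaches its threshold \<open>l + \<delta>\<close>.\<close>
  define s0 where "s0 = (l + \<delta> - r2) / m"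
  have "c2 $ j = 0" "c1 $ j = 0" using c2 c1 by (auto simp: lasso_kkt_def)
  then have "\<bar>G (c2 - c1) $ j\<bar> \<le> \<eta> * N * norm (c2 - c1)" by (intro offdiag_le) auto
  also have "\<dots> \<le> \<eta> * N * (2 * (norm (?v2 - ?v1) + \<bar>l + \<delta> - l\<bar> * CARD('p)) / N)"
    using eta N by (intro mult_left_mono dist[OF c2 c1]) auto
  also have "\<dots> = 2 * \<eta> * (norm (q - q') + \<delta> * CARD('p))" using l N by simp
  finally have off: "\<bar>G (c2 - c1) $ j\<bar> \<le> 2 * \<eta> * (norm (q - q') + \<delta> * CARD('p))" .
  have "r2 - r1 = q $ j - q' $ j - G (c2 - c1) $ j"
    by (simp add: r2_def r1_def linear_diff[OF lin])
  \<comment> \<open>The other problem reaches its threshold \<open>l\<close> only when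
    \<open>s * m\<close> is at least \<open>l - r1\<close>, which exceeds
    \<open>l + \<delta> - r2\<close> by 1 or more. In between lies the window of length 1.\<close>
  then have rr: "r2 - r1 \<ge> 1 + \<delta>" using gap off by (auto simp: abs_le_iff)
  have "\<bar>r2\<bar> \<le> 2 * (norm (w + q) + (l + \<delta>) * CARD('p))"
    using restricted_residual[of \<beta> "w + q" j "l + \<delta>" c2] c2 assms(1) ld
    by (simp add: r2_def add.assoc)
  also have "\<dots> \<le> 2 * (norm w + norm q + (l + \<delta>) * CARD('p))"
    using norm_triangle_ineq[of w q] by simp
  finally have r2b: "\<bar>r2\<bar> \<le> 2 * (norm w + norm q + (l + \<delta>) * CARD('p))" .
  have "\<bar>s0\<bar> * m = \<bar>l + \<delta> - r2\<bar>" using m by (simp add: s0_def abs_div)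
  also have "\<dots> \<le> (l + \<delta>) + \<bar>r2\<bar>" using ld by linarith
  also have "l + \<delta> \<le> norm w + norm q + (l + \<delta>) * CARD('p)"
  proof -
    have "l + \<delta> \<le> (l + \<delta>) * CARD('p)" using mult_left_mono[OF card ld] by simp
    then show ?thesis using norm_ge_zero[of w] norm_ge_zero[of q] by linarith
  qed
  finally have s0: "\<bar>s0\<bar> * m \<le> 3 * (norm w + norm q + (l + \<delta>) * CARD('p))" using r2b by simp
  have "b2 s $ j > 0 \<and> b1 s $ j \<le> 0" if "s0 < s" "s \<le> s0 + 1 / m" for s
  proof
    have "s * m > l + \<delta> - r2" using that m by (simp add: s0_def field_simps)
    then show "b2 s $ j > 0"
      using lasso_kkt_sign(1)[OF lin N2 curv ld b2[of s] lasso_kkt_shift[OF c2]] rs2[of s] by simp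
    have "s * m \<le> l + \<delta> - r2 + 1" using that m by (simp add: s0_def field_simps)
    then show "b1 s $ j \<le> 0"
      using lasso_kkt_sign(3)[OF lin N2 curv l(1) b1[of s] lasso_kkt_shift[OF c1]] rs1[of s] rr by simp
  qed
  then show ?thesis using s0 by blast
qed

text \<open>If coordinate \<open>j\<close> is active, \<open>G (b - c)\<close> equals
  \<open>r - l\<close> there, so \<open>norm (b - c)\<close> is at least of order
  \<open>(r - l) / N\<close>; on the other hand \<open>lasso_kkt_sign\<close> bounds its square by
  \<open>b $ j * (r - l)\<close> over the curvature. Eliminating the norm bounds
  \<open>b $ j\<close> below.\<close>

lemma large_coord:
  fixes l t a :: real
  assumes "\<beta> $ j = 0" and l: "l \<ge> 0" and t: "t > 0"
    and large: "a \<ge> l + 2 * (norm w + l * CARD('p)) + t"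
    and b: "lasso_kkt G (G \<beta> + w + a *\<^sub>R axis j 1) UNIV l b"
  shows "b $ j \<ge> t / (4 * N)"
proof -
  have N2: "(1 - \<eta>) * N > 0" using N eta by simp
  note curv' = near_id_curvature(1)[OF ni]
  obtain c where c: "lasso_kkt G (G \<beta> + w) (- {j}) l c"
    using solution_exists[OF l] by blast
  define r where "r = (G \<beta> + w + a *\<^sub>R axis j 1 - G c) $ j"
  have "r = (G \<beta> + w - G c) $ j + a" by (simp add: r_def axis_def)
  then have r: "r - l \<ge> t" using restricted_residual[OF c assms(1) l] large by (auto simp: abs_le_iff)
  note sg = lasso_kkt_sign[OF lin N2 curv' l b lasso_kkt_shift[OF c]]
  have pos: "b $ j > 0" using sg(1) r t by (simp add: r_def)
  then have "(G \<beta> + w + a *\<^sub>R axis j 1 - G b) $ j = l" using b by (auto simp: lasso_kkt_def dest!: spec[of _ j])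
  then have "G (b - c) $ j = r - l" by (simp add: r_def linear_diff[OF lin])
  then have "r - l \<le> norm (G (b - c))" using component_le_norm_cart[of "G (b - c)" j] by simp
  also have "\<dots> \<le> (1 + \<eta>) * N * norm (b - c)" using near_id_curvature(2)[OF ni, of "b - c"] N by simp
  also have "\<dots> \<le> 5 / 4 * N * norm (b - c)" using eta N by (intro mult_right_mono) auto
  finally have 1: "(r - l) \<le> 5 / 4 * N * norm (b - c)" .
  have "(r - l)\<^sup>2 \<le> (5 / 4 * N * norm (b - c))\<^sup>2" using 1 r t by (intro power_mono) auto
  \<comment> \<open>\<open>25 / 12\<close> is \<open>(1 + \<eta>)\<^sup>2 / (1 - \<eta>)\<close> at
    the extreme value \<open>\<eta> = 1 / 4\<close>; the statement rounds it up to 4.\<close>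
  also have "\<dots> = 25 / 12 * N * (3 / 4 * N * (norm (b - c))\<^sup>2)" by (simp add: power2_eq_square)
  also have "\<dots> \<le> 25 / 12 * N * ((1 - \<eta>) * N * (norm (b - c))\<^sup>2)"
    using eta N by (intro mult_left_mono mult_right_mono) auto
  also have "\<dots> \<le> 25 / 12 * N * (b $ j * (r - l))"
    using sg(2) r t N by (intro mult_left_mono) (auto simp: r_def)
  finally have "(r - l) * (r - l) \<le> (25 / 12 * N * b $ j) * (r - l)" by (simp add: power2_eq_square ac_simps)
  then have "r - l \<le> 25 / 12 * N * b $ j" using r t by (simp add: mult_le_cancel_right)
  moreover have "0 < N * b $ j" using pos N by simp
  ultimately have "t \<le> 4 * N * b $ j" using r by simp
  then show ?thesis using N by (simp add: field_simps)
qed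

end


subsection \<open>The Gaussian laws\<close>

definition gauss_x :: "(real ^ 'p::finite) measure" where
  "gauss_x = density lborel (\<lambda>x. ennreal (std_gaussian_density x))"

definition gauss_e :: "real \<Rightarrow> real measure" where
  "gauss_e \<tau> = density lborel (\<lambda>e. ennreal (normal_density 0 \<tau> e))"

definition gauss_z :: "real ^ 'p::finite \<Rightarrow> real \<Rightarrow> 'p datum measure" where
  "gauss_z \<beta> \<tau> = distr (gauss_x \<Otimes>\<^sub>M gauss_e \<tau>) borel (\<lambda>(x, e). (x, x \<bullet> \<beta> + e))"

lemma sets_gauss [simp, measurable_cong]:
  "sets gauss_x = sets borel" "sets (gauss_e \<tau>) = sets borel" "sets (gauss_z \<beta> \<tau>) = sets borel"
  by (simp_all add: gauss_x_def gauss_e_def gauss_z_def)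

lemma space_gauss [simp]:
  "space gauss_x = UNIV" "space (gauss_e \<tau>) = UNIV" "space (gauss_z \<beta> \<tau>) = UNIV"
  by (simp_all add: gauss_x_def gauss_e_def gauss_z_def)

lemma measurable_vec_nth [measurable]: "(\<lambda>x :: real ^ 'p::finite. x $ k) \<in> borel_measurable borel"
  by (intro borel_measurable_continuous_onI continuous_intros)

lemma measurable_std_gaussian_density [measurable]: "std_gaussian_density \<in> borel_measurable borel"
  unfolding std_gaussian_density_def by measurable

lemma nn_integral_gauss_x:
  "f \<in> borel_measurable borel \<Longrightarrow>
    (\<integral>\<^sup>+x. f x \<partial>gauss_x) = (\<integral>\<^sup>+x. ennreal (std_gaussian_density x) * f x \<partial>lborel)"
  by (simp add: gauss_x_def nn_integral_density)

lemma nn_integral_gauss_e: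
  "f \<in> borel_measurable borel \<Longrightarrow>
    (\<integral>\<^sup>+e. f e \<partial>gauss_e \<tau>) = (\<integral>\<^sup>+e. ennreal (normal_density 0 \<tau> e) * f e \<partial>lborel)"
  by (simp add: gauss_e_def nn_integral_density)

lemma std_gaussian_density_pos: "std_gaussian_density x > 0"
  unfolding std_gaussian_density_def by (intro prod_pos) (simp add: normal_density_pos)

lemma Basis_vec_real: "(Basis :: (real ^ 'p::finite) set) = range (\<lambda>k. axis k 1)"
  by (auto simp: Basis_vec_def)

lemma inj_axis: "inj (\<lambda>k. axis k (1::real) :: real ^ 'p::finite)"
  by (auto simp: inj_def axis_eq_axis)

text \<open>Lebesgue measure factors over \<open>Basis\<close>, whose elements are the axis vectors;
  \<open>ix\<close> translates a basis vector back into its coordinate index, so that the factors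
  may differ from coordinate to coordinate.\<close>

lemma nn_integral_gauss_x_prod:
  fixes f :: "'p::finite \<Rightarrow> real \<Rightarrow> real"
  assumes f [measurable]: "\<And>k. f k \<in> borel_measurable borel" and nn: "\<And>k t. 0 \<le> f k t"
  shows "(\<integral>\<^sup>+x. ennreal (\<Prod>k\<in>UNIV. f k (x $ k)) \<partial>gauss_x) =
    (\<Prod>k\<in>UNIV. \<integral>\<^sup>+t. ennreal (f k t * std_normal_density t) \<partial>lborel)"
proof -
  define ix where "ix = inv_into UNIV (\<lambda>k. axis k (1::real) :: real ^ 'p)"
  have ix: "ix (axis k 1) = k" for k unfolding ix_def by (rule inv_into_f_f[OF inj_axis]) simp
  define F where "F b t = f (ix b) t * std_normal_density t" for b t
  have [measurable]: "F b \<in> borel_measurable borel" for b unfolding F_def by measurable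
  have eq: "(\<Prod>b\<in>Basis. F b (x \<bullet> b)) = (\<Prod>k\<in>UNIV. f k (x $ k)) * std_gaussian_density x" for x :: "real ^ 'p"
    by (simp add: Basis_vec_real prod.reindex[OF inj_axis] F_def ix inner_axis
        std_gaussian_density_def prod.distrib)
  have "(\<integral>\<^sup>+x. ennreal (\<Prod>k\<in>UNIV. f k (x $ k)) \<partial>gauss_x) = (\<integral>\<^sup>+x. (\<Prod>b\<in>Basis. ennreal (F b (x \<bullet> b))) \<partial>lborel)"
  proof (subst nn_integral_gauss_x)
    show "(\<integral>\<^sup>+x. ennreal (std_gaussian_density x) * ennreal (\<Prod>k\<in>UNIV. f k (x $ k)) \<partial>lborel) = 
      (\<integral>\<^sup>+x. (\<Prod>b\<in>Basis. ennreal (F b (x \<bullet> b))) \<partial>lborel)"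
    proof (rule nn_integral_cong)
      fix x :: "real ^ 'p"
      have "(\<Prod>b\<in>Basis. ennreal (F b (x \<bullet> b))) = ennreal (\<Prod>b\<in>Basis. F b (x \<bullet> b))"
        by (rule prod_ennreal) (simp add: F_def nn)
      then show "ennreal (std_gaussian_density x) * ennreal (\<Prod>k\<in>UNIV. f k (x $ k)) = (\<Prod>b\<in>Basis. ennreal (F b (x \<bullet> b)))"
        using std_gaussian_density_pos[of x]
        by (simp add: eq ennreal_mult'[symmetric] prod_nonneg nn mult.commute)
    qed
  qed measurable
  also have "\<dots> = (\<Prod>b\<in>(Basis :: (real ^ 'p) set). \<integral>\<^sup>+t. ennreal (F b t) \<partial>lborel)"
    by (rule nn_integral_lborel_prod) auto
  also have "\<dots> = (\<Prod>k\<in>UNIV. \<integral>\<^sup>+t. ennreal (f k t * std_normal_density t) \<partial>lborel)"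
    by (simp add: Basis_vec_real prod.reindex[OF inj_axis] F_def ix)
  finally show ?thesis .
qed

lemma nn_integral_std_normal: "(\<integral>\<^sup>+t. ennreal (std_normal_density t) \<partial>lborel) = 1"
  by (subst nn_integral_eq_integral) auto

lemma prob_space_gauss_x: "prob_space (gauss_x :: (real ^ 'p::finite) measure)"
proof
  show "emeasure (gauss_x :: (real ^ 'p) measure) (space gauss_x) = 1"
    using nn_integral_gauss_x_prod[of "\<lambda>(_ :: 'p) _. 1 :: real"]
    by (simp add: nn_integral_std_normal)
qed

lemma nn_integral_gauss_x_coord:
  fixes f :: "real \<Rightarrow> real" and k :: "'p::finite"
  assumes [measurable]: "f \<in> borel_measurable borel" and nn: "\<And>t. 0 \<le> f t"
  shows "(\<integral>\<^sup>+x. ennreal (f (x $ k)) \<partial>gauss_x) = (\<integral>\<^sup>+t. ennreal (f t * std_normal_density t) \<partial>lborel)"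
proof -
  define F where "F i t = (if i = k then f t else 1)" for i t
  have "(\<Prod>i\<in>UNIV. F i (x $ i)) = f (x $ k)" for x :: "real ^ 'p" by (simp add: F_def)
  then have "(\<integral>\<^sup>+x. ennreal (f (x $ k)) \<partial>gauss_x) = (\<Prod>i\<in>UNIV. \<integral>\<^sup>+t. ennreal (F i t * std_normal_density t) \<partial>lborel)"
    using nn_integral_gauss_x_prod[of F] nn unfolding F_def by simp
  also have "\<dots> = (\<Prod>i\<in>UNIV. if i = k then \<integral>\<^sup>+t. ennreal (f t * std_normal_density t) \<partial>lborel else 1)"
    by (intro prod.cong) (auto simp: F_def nn_integral_std_normal)
  finally show ?thesis by simp
qed

lemma integrable_gauss_x_moment: "integrable gauss_x (\<lambda>x. \<bar>x $ k\<bar> ^ m)"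
proof (rule integrableI_bounded)
  have "(\<integral>\<^sup>+x. ennreal (\<bar>x $ k\<bar> ^ m) \<partial>gauss_x) = (\<integral>\<^sup>+t. ennreal (\<bar>t\<bar> ^ m * std_normal_density t) \<partial>lborel)"
    by (rule nn_integral_gauss_x_coord) auto
  also have "\<dots> < \<infinity>"
    using integrable_normal_moment_abs[of 1 0 m] by (subst nn_integral_eq_integral) (auto simp: ac_simps)
  finally show "(\<integral>\<^sup>+x. ennreal (norm (\<bar>x $ k\<bar> ^ m)) \<partial>gauss_x) < \<infinity>" by simp
qed measurable

lemma nn_integral_gauss_x_sq: "(\<integral>\<^sup>+x. ennreal ((x $ k)\<^sup>2) \<partial>gauss_x) = 1"
proof -
  have "(\<integral>\<^sup>+x. ennreal ((x $ k)\<^sup>2) \<partial>gauss_x) = (\<integral>\<^sup>+t. ennreal (t\<^sup>2 * std_normal_density t) \<partial>lborel)"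
    by (rule nn_integral_gauss_x_coord) auto
  also have "\<dots> = ennreal 1"
    using normal_moment_even[of 1 0 1]
    by (subst nn_integral_eq_integral) (auto simp: has_bochner_integral_iff mult.commute[of _ "std_normal_density _"])
  finally show ?thesis by simp
qed

text \<open>Reflection in one coordinate leaves the Gaussian law invariant. This symmetry replaces
  the computation of mixed moments and removes cross terms in second moments.\<close>

definition flip_coord :: "'p \<Rightarrow> real ^ 'p::finite \<Rightarrow> real ^ 'p" where
  "flip_coord k x = (\<chi> i. if i = k then - x $ i else x $ i)"

lemma nn_integral_gauss_x_flip:
  fixes f :: "real ^ 'p::finite \<Rightarrow> ennreal"
  assumes f [measurable]: "f \<in> borel_measurable borel"
  shows "(\<integral>\<^sup>+x. f (flip_coord k x) \<partial>gauss_x) = (\<integral>\<^sup>+x. f x \<partial>gauss_x)"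
proof -
  define c where "c b = (if b = axis k (1::real) then - 1 else 1 :: real)" for b :: "real ^ 'p"
  have T: "0 + (\<Sum>j\<in>Basis. (c j * (x \<bullet> j)) *\<^sub>R j) = flip_coord k x" for x :: "real ^ 'p"
  proof -
    have "(\<Sum>j\<in>Basis. (c j * (x \<bullet> j)) *\<^sub>R j) = (\<Sum>i\<in>UNIV. (if i = k then - x $ i else x $ i) *\<^sub>R axis i 1)"
      by (auto simp: Basis_vec_real sum.reindex[OF inj_axis] c_def inner_axis axis_eq_axis intro!: sum.cong)
    also have "\<dots> = flip_coord k x"
    proof -
      have "(\<Sum>j\<in>UNIV. g j * (if i = j then 1 else 0)) = g i" for g :: "'p \<Rightarrow> real" and i
        by (simp add: if_distrib cong: if_cong)
      then show ?thesis by (simp add: flip_coord_def vec_eq_iff axis_def)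
    qed
    finally show ?thesis by simp
  qed
  have cont: "continuous_on UNIV (flip_coord k :: real ^ 'p \<Rightarrow> _)"
  proof -
    have "(flip_coord k :: real ^ 'p \<Rightarrow> _) = (\<lambda>x. (\<Sum>j\<in>Basis. (c j * (x \<bullet> j)) *\<^sub>R j))"
      using T by (simp add: fun_eq_iff)
    then show ?thesis by (simp only:) (intro continuous_intros)
  qed
  then have [measurable]: "flip_coord k \<in> borel \<rightarrow>\<^sub>M (borel :: (real ^ 'p) measure)"
    by (rule borel_measurable_continuous_onI)
  \<comment> \<open>All scaling factors are \<open>1\<close> or \<open>- 1\<close>, so the affine
    change of variables has a determinant of modulus 1.\<close>
  have "(lborel :: (real ^ 'p) measure) = density (distr lborel borel (\<lambda>x. 0 + (\<Sum>j\<in>Basis. (c j * (x \<bullet> j)) *\<^sub>R j))) (\<lambda>_. ennreal (\<Prod>j\<in>Basis. \<bar>c j\<bar>))"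
    by (rule lborel_affine_euclidean) (simp add: c_def)
  also have "\<dots> = distr lborel borel (flip_coord k)"
    unfolding T by (simp add: c_def if_distrib density_1 cong: if_cong)
  finally have L: "(lborel :: (real ^ 'p) measure) = distr lborel borel (flip_coord k)" .
  have dens: "std_gaussian_density (flip_coord k x) = std_gaussian_density x" for x :: "real ^ 'p"
    unfolding std_gaussian_density_def
    by (intro prod.cong) (auto simp: flip_coord_def std_normal_density_def)
  have "(\<integral>\<^sup>+x. f x \<partial>gauss_x) = (\<integral>\<^sup>+x. ennreal (std_gaussian_density x) * f x \<partial>distr lborel borel (flip_coord k))"
    using L by (simp add: nn_integral_gauss_x)
  also have "\<dots> = (\<integral>\<^sup>+x. ennreal (std_gaussian_density x) * f (flip_coord k x) \<partial>lborel)"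
    by (subst nn_integral_distr) (auto simp: dens)
  finally show ?thesis by (simp add: nn_integral_gauss_x)
qed

lemma measurable_flip_coord [measurable]: "flip_coord k \<in> borel \<rightarrow>\<^sub>M (borel :: (real ^ 'p::finite) measure)"
proof (rule borel_measurable_continuous_onI)
  have "flip_coord k = (\<lambda>x :: real ^ 'p. (\<chi> i. if i = k then - x $ i else x $ i))"
    by (simp add: fun_eq_iff flip_coord_def)
  moreover have "continuous_on UNIV (\<lambda>x :: real ^ 'p. if i = k then - x $ i else x $ i)" for i
    by (cases "i = k") (auto intro!: continuous_intros)
  ultimately show "continuous_on UNIV (flip_coord k :: real ^ 'p \<Rightarrow> _)"
    by (auto intro: continuous_on_vec_lambda)
qed

lemma distr_flip_gauss_x: "distr gauss_x borel (flip_coord k) = (gauss_x :: (real ^ 'p::finite) measure)"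
proof (rule measure_eqI)
  fix A assume "A \<in> sets (distr gauss_x borel (flip_coord k) :: (real ^ 'p) measure)"
  then have [measurable]: "A \<in> sets borel" by simp
  have "emeasure (distr gauss_x borel (flip_coord k)) A =
      (\<integral>\<^sup>+x. indicator A x \<partial>distr gauss_x borel (flip_coord k))" by simp
  also have "\<dots> = (\<integral>\<^sup>+x. indicator A (flip_coord k x) \<partial>gauss_x)" by (subst nn_integral_distr) auto
  also have "\<dots> = (\<integral>\<^sup>+x. indicator A x \<partial>gauss_x)" by (rule nn_integral_gauss_x_flip) measurable
  finally show "emeasure (distr gauss_x borel (flip_coord k)) A = emeasure gauss_x A" by simp
qed simp

lemma integral_gauss_x_odd:
  fixes f :: "real ^ 'p::finite \<Rightarrow> real"
  assumes [measurable]: "f \<in> borel_measurable borel" and odd: "\<And>x. f (flip_coord k x) = - f x"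
  shows "(\<integral>x. f x \<partial>gauss_x) = 0"
proof -
  have "(\<integral>x. f x \<partial>gauss_x) = (\<integral>x. f x \<partial>distr gauss_x borel (flip_coord k))"
    by (simp add: distr_flip_gauss_x)
  also have "\<dots> = (\<integral>x. f (flip_coord k x) \<partial>gauss_x)" by (rule integral_distr) auto
  also have "\<dots> = - (\<integral>x. f x \<partial>gauss_x)" by (simp add: odd)
  finally show ?thesis by simp
qed

lemma integral_gauss_x_prod2: "(\<integral>x. x $ k * x $ l \<partial>gauss_x) = (if k = l then 1 else 0)"
proof (cases "k = l")
  case True
  have "(\<integral>x. (x $ l)\<^sup>2 \<partial>gauss_x) = enn2real (\<integral>\<^sup>+x. ennreal ((x $ l)\<^sup>2) \<partial>gauss_x)"
    by (rule integral_eq_nn_integral) auto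
  then have "(\<integral>x. (x $ l)\<^sup>2 \<partial>gauss_x) = 1" by (simp add: nn_integral_gauss_x_sq)
  then show ?thesis using True by (simp add: power2_eq_square)
next
  case False
  then show ?thesis using integral_gauss_x_odd[of "\<lambda>x. x $ k * x $ l" k] by (simp add: flip_coord_def)
qed

lemma prob_space_gauss_e: "\<tau> > 0 \<Longrightarrow> prob_space (gauss_e \<tau>)"
  by (simp add: gauss_e_def prob_space_normal_density)

lemma integrable_gauss_e_moment: "\<tau> > 0 \<Longrightarrow> integrable (gauss_e \<tau>) (\<lambda>e. \<bar>e\<bar> ^ m)"
  using integrable_normal_moment_abs[of \<tau> 0 m] by (simp add: gauss_e_def integrable_density)

lemma nn_integral_gauss_e_sq:
  assumes "\<tau> > 0" shows "(\<integral>\<^sup>+e. ennreal (e\<^sup>2) \<partial>gauss_e \<tau>) = ennreal (\<tau>\<^sup>2)"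
proof -
  have "(\<integral>\<^sup>+e. ennreal (e\<^sup>2) \<partial>gauss_e \<tau>) = (\<integral>\<^sup>+e. ennreal (normal_density 0 \<tau> e * e\<^sup>2) \<partial>lborel)"
    by (subst nn_integral_gauss_e) (auto simp: ennreal_mult')
  also have "\<dots> = ennreal (\<tau>\<^sup>2)"
    using normal_moment_even[OF assms, of 0 1]
    by (subst nn_integral_eq_integral) (auto simp: has_bochner_integral_iff)
  finally show ?thesis .
qed

lemma nn_integral_gauss_e_uminus:
  assumes [measurable]: "f \<in> borel_measurable borel"
  shows "(\<integral>\<^sup>+e. f (- e) \<partial>gauss_e \<tau>) = (\<integral>\<^sup>+e. f e \<partial>gauss_e \<tau>)"
proof -
  have "(\<integral>\<^sup>+e. f e \<partial>gauss_e \<tau>) = (\<integral>\<^sup>+e. ennreal (normal_density 0 \<tau> e) * f e \<partial>lborel)"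
    by (rule nn_integral_gauss_e) fact
  also have "\<dots> = (\<integral>\<^sup>+e. ennreal (normal_density 0 \<tau> (- e)) * f (- e) \<partial>lborel)"
    by (subst nn_integral_real_affine[where c = "-1" and t = 0]) auto
  also have "\<dots> = (\<integral>\<^sup>+e. f (- e) \<partial>gauss_e \<tau>)"
    by (subst nn_integral_gauss_e) (auto simp: normal_density_def)
  finally show ?thesis ..
qed

lemma integral_gauss_e_id: "\<tau> > 0 \<Longrightarrow> (\<integral>e. e \<partial>gauss_e \<tau>) = 0"
  using integral_normal_moment_nz_1[of \<tau> 0] by (simp add: gauss_e_def integral_density)

text \<open>The exponential is the ratio of the normal densities at \<open>h + e\<close> and
  \<open>e\<close>: the one-dimensional Cameron-Martin formula.\<close>

lemma nn_integral_gauss_e_shift: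
  assumes [measurable]: "f \<in> borel_measurable borel" and "\<tau> > 0"
  shows "(\<integral>\<^sup>+e. f e \<partial>gauss_e \<tau>) =
    (\<integral>\<^sup>+e. ennreal (exp (- (2 * h * e + h\<^sup>2) / (2 * \<tau>\<^sup>2))) * f (e + h) \<partial>gauss_e \<tau>)"
proof -
  have d: "normal_density 0 \<tau> (h + e) = normal_density 0 \<tau> e * exp (- (2 * h * e + h\<^sup>2) / (2 * \<tau>\<^sup>2))" for e
    using \<open>\<tau> > 0\<close> unfolding normal_density_def
    by (simp add: mult_exp_exp field_simps power2_eq_square)
  have "(\<integral>\<^sup>+e. f e \<partial>gauss_e \<tau>) = (\<integral>\<^sup>+e. ennreal (normal_density 0 \<tau> (h + e)) * f (h + e) \<partial>lborel)"
    by (subst nn_integral_gauss_e, measurable, subst nn_integral_real_affine[where c = 1 and t = h]) auto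
  also have "\<dots> = (\<integral>\<^sup>+e. ennreal (exp (- (2 * h * e + h\<^sup>2) / (2 * \<tau>\<^sup>2))) * f (e + h) \<partial>gauss_e \<tau>)"
    by (subst nn_integral_gauss_e, measurable)
       (simp add: d ennreal_mult' add.commute[of _ h] mult.assoc)
  finally show ?thesis .
qed


section \<open>Power inequalities and integrals of products\<close>

lemma power_sum_le:
  fixes a :: "'i \<Rightarrow> real"
  assumes "finite A" "A \<noteq> {}" and nn: "\<And>i. i \<in> A \<Longrightarrow> 0 \<le> a i"
  shows "(\<Sum>i\<in>A. a i) ^ m \<le> real (card A) ^ m * (\<Sum>i\<in>A. a i ^ m)"
proof -
  define t where "t = Max (a ` A)"
  have t: "a i \<le> t" if "i \<in> A" for i using that \<open>finite A\<close> by (simp add: t_def)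
  have "t \<in> a ` A" unfolding t_def using \<open>A \<noteq> {}\<close> \<open>finite A\<close> by (intro Max_in) auto
  then obtain k where k: "k \<in> A" "t = a k" by blast
  have "(\<Sum>i\<in>A. a i) ^ m \<le> (real (card A) * t) ^ m"
    using sum_bounded_above[of A a t] t nn by (intro power_mono sum_nonneg) auto
  also have "\<dots> = real (card A) ^ m * a k ^ m" by (simp add: power_mult_distrib k)
  also have "\<dots> \<le> real (card A) ^ m * (\<Sum>i\<in>A. a i ^ m)"
    using k nn \<open>finite A\<close> by (intro mult_left_mono member_le_sum) auto
  finally show ?thesis .
qed

lemma power_add_le:
  fixes a b :: real
  assumes "0 \<le> a" "0 \<le> b" shows "(a + b) ^ m \<le> 2 ^ m * (a ^ m + b ^ m)"
  using power_sum_le[of "UNIV :: bool set" "\<lambda>i. if i then a else b" m] assms by (simp add: UNIV_bool ac_simps)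

lemma (in pair_sigma_finite) integrable_pair_mult:
  fixes f :: "'a \<Rightarrow> real" and g :: "'b \<Rightarrow> real"
  assumes f: "integrable M1 f" and g: "integrable M2 g"
  shows "integrable (M1 \<Otimes>\<^sub>M M2) (\<lambda>w. f (fst w) * g (snd w))"
    and "(\<integral>w. f (fst w) * g (snd w) \<partial>(M1 \<Otimes>\<^sub>M M2)) = (\<integral>x. f x \<partial>M1) * (\<integral>y. g y \<partial>M2)"
proof -
  note [measurable] = borel_measurable_integrable[OF f] borel_measurable_integrable[OF g]
  show 1: "integrable (M1 \<Otimes>\<^sub>M M2) (\<lambda>w. f (fst w) * g (snd w))"
  proof (rule Fubini_integrable)
    show "integrable M1 (\<lambda>x. \<integral>y. norm (f (fst (x, y)) * g (snd (x, y))) \<partial>M2)"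
      using f by (simp add: abs_mult)
    show "AE x in M1. integrable M2 (\<lambda>y. f (fst (x, y)) * g (snd (x, y)))"
      using g by simp
  qed measurable
  show "(\<integral>w. f (fst w) * g (snd w) \<partial>(M1 \<Otimes>\<^sub>M M2)) = (\<integral>x. f x \<partial>M1) * (\<integral>y. g y \<partial>M2)"
    using integral_fst'[OF 1] by simp
qed

section \<open>The law of one data point and of a whole training set\<close>

context
  fixes \<beta> :: "real ^ 'p::finite" and \<tau> :: real
  assumes \<tau>: "\<tau> > 0"
begin

interpretation gx: prob_space "gauss_x :: (real ^ 'p) measure" by (rule prob_space_gauss_x)
interpretation ge: prob_space "gauss_e \<tau>" by (rule prob_space_gauss_e[OF \<tau>])
interpretation gp: pair_prob_space "gauss_x :: (real ^ 'p) measure" "gauss_e \<tau>" ..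

lemma measurable_mk_datum [measurable]:
  "(\<lambda>(x, e). (x, x \<bullet> \<beta> + e)) \<in> (gauss_x \<Otimes>\<^sub>M gauss_e \<tau>) \<rightarrow>\<^sub>M (borel :: 'p datum measure)"
  unfolding borel_prod[symmetric] by measurable

lemma prob_space_gauss_z: "prob_space (gauss_z \<beta> \<tau>)"
  unfolding gauss_z_def by (intro gp.prob_space_distr measurable_mk_datum)

lemma nn_integral_gauss_z:
  assumes [measurable]: "f \<in> borel_measurable borel"
  shows "(\<integral>\<^sup>+z. f z \<partial>gauss_z \<beta> \<tau>) = (\<integral>\<^sup>+x. \<integral>\<^sup>+e. f (x, x \<bullet> \<beta> + e) \<partial>gauss_e \<tau> \<partial>gauss_x)"
proof -
  have "(\<integral>\<^sup>+z. f z \<partial>gauss_z \<beta> \<tau>) = (\<integral>\<^sup>+w. f (case w of (x, e) \<Rightarrow> (x, x \<bullet> \<beta> + e)) \<partial>(gauss_x \<Otimes>\<^sub>M gauss_e \<tau>))"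
    unfolding gauss_z_def by (rule nn_integral_distr) measurable
  also have "\<dots> = (\<integral>\<^sup>+x. \<integral>\<^sup>+e. f (x, x \<bullet> \<beta> + e) \<partial>gauss_e \<tau> \<partial>gauss_x)"
    by (subst ge.nn_integral_fst[symmetric]) auto
  finally show ?thesis .
qed

lemma integrable_gauss_z_norm: "integrable (gauss_z \<beta> \<tau>) (\<lambda>z. norm z ^ m)"
proof -
  have bound: "norm (case w of (x, e) \<Rightarrow> (x, x \<bullet> \<beta> + e)) ^ m \<le>
     2 ^ m * ((1 + norm \<beta>) ^ m * (CARD('p) ^ m * (\<Sum>k\<in>UNIV. \<bar>fst w $ k\<bar> ^ m)) + \<bar>snd w\<bar> ^ m)" for w
  proof -
    obtain x e where w: "w = (x, e)" by (cases w)
    have "norm (x, x \<bullet> \<beta> + e) \<le> norm x + norm (x \<bullet> \<beta> + e)" by (rule norm_Pair_le)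
    also have "\<dots> \<le> norm x + norm x * norm \<beta> + \<bar>e\<bar>"
      using Cauchy_Schwarz_ineq2[of x \<beta>] by simp
    also have "\<dots> = (1 + norm \<beta>) * norm x + \<bar>e\<bar>" by (simp add: algebra_simps)
    also have "\<dots> \<le> (1 + norm \<beta>) * (\<Sum>k\<in>UNIV. \<bar>x $ k\<bar>) + \<bar>e\<bar>"
      by (intro add_mono mult_left_mono norm_le_l1_cart) auto
    finally have "norm (x, x \<bullet> \<beta> + e) ^ m \<le> ((1 + norm \<beta>) * (\<Sum>k\<in>UNIV. \<bar>x $ k\<bar>) + \<bar>e\<bar>) ^ m"
      by (intro power_mono) auto
    also have "\<dots> \<le> 2 ^ m * (((1 + norm \<beta>) * (\<Sum>k\<in>UNIV. \<bar>x $ k\<bar>)) ^ m + \<bar>e\<bar> ^ m)"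
      by (intro power_add_le) (auto simp: sum_nonneg)
    also have "\<dots> \<le> 2 ^ m * ((1 + norm \<beta>) ^ m * (CARD('p) ^ m * (\<Sum>k\<in>UNIV. \<bar>x $ k\<bar> ^ m)) + \<bar>e\<bar> ^ m)"
      unfolding power_mult_distrib
      using power_sum_le[of "UNIV :: 'p set" "\<lambda>k. \<bar>x $ k\<bar>" m] by (intro mult_left_mono add_mono) auto
    finally show ?thesis by (simp add: w)
  qed
  have ix: "integrable (gauss_x \<Otimes>\<^sub>M gauss_e \<tau>) (\<lambda>w. \<bar>fst w $ k\<bar> ^ m)" for k :: 'p
    using gp.integrable_pair_mult(1)[OF integrable_gauss_x_moment[of k m], of "\<lambda>_. 1"] by simp
  have ie: "integrable (gauss_x \<Otimes>\<^sub>M gauss_e \<tau>) (\<lambda>w :: (real ^ 'p) \<times> real. \<bar>snd w\<bar> ^ m)"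
    using gp.integrable_pair_mult(1)[of "\<lambda>_. 1", OF _ integrable_gauss_e_moment[OF \<tau>, of m]] by simp
  have "integrable (gauss_x \<Otimes>\<^sub>M gauss_e \<tau>) (\<lambda>w :: (real ^ 'p) \<times> real.
     2 ^ m * ((1 + norm \<beta>) ^ m * (CARD('p) ^ m * (\<Sum>k\<in>UNIV. \<bar>fst w $ k\<bar> ^ m)) + \<bar>snd w\<bar> ^ m))"
    by (intro Bochner_Integration.integrable_add integrable_mult_right Bochner_Integration.integrable_sum ix ie)
  then have "integrable (gauss_x \<Otimes>\<^sub>M gauss_e \<tau>) (\<lambda>w. norm (case w of (x, e) \<Rightarrow> (x, x \<bullet> \<beta> + e)) ^ m)"
  proof (rule Bochner_Integration.integrable_bound[OF _ _ AE_I2])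
    fix w :: "(real ^ 'p) \<times> real"
    show "norm (norm (case w of (x, e) \<Rightarrow> (x, x \<bullet> \<beta> + e)) ^ m) \<le> 
      norm (2 ^ m * ((1 + norm \<beta>) ^ m * (CARD('p) ^ m * (\<Sum>k\<in>UNIV. \<bar>fst w $ k\<bar> ^ m)) + \<bar>snd w\<bar> ^ m))"
      using order_trans[OF bound[of w] abs_ge_self] by simp
  qed measurable
  then show ?thesis unfolding gauss_z_def by (subst integrable_distr_eq) auto
qed

end


text \<open>Generates the data from design and noise, so that the design can be fixed and only the
  noise integrated. The restriction to \<open>I\<close> makes the result a point of the product
  space.\<close>

definition mk_data :: "real ^ 'p::finite \<Rightarrow> 'i set \<Rightarrow> ('i \<Rightarrow> real ^ 'p) \<Rightarrow> ('i \<Rightarrow> real) \<Rightarrow> 'i \<Rightarrow> 'p datum" where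
  "mk_data \<beta> I X E = (\<lambda>i\<in>I. (X i, X i \<bullet> \<beta> + E i))"

lemma mk_data_insert: "a \<notin> I \<Longrightarrow>
  mk_data \<beta> (insert a I) (X(a := x)) (E(a := e)) = (mk_data \<beta> I X E)(a := (x, x \<bullet> \<beta> + e))"
  by (auto simp: mk_data_def fun_eq_iff)

lemma measurable_mk_data [measurable (raw)]:
  fixes \<beta> :: "real ^ 'p::finite"
  assumes [measurable]: "X \<in> N \<rightarrow>\<^sub>M Pi\<^sub>M I (\<lambda>_. borel)" "E \<in> N \<rightarrow>\<^sub>M Pi\<^sub>M I (\<lambda>_. borel)"
  shows "(\<lambda>w. mk_data \<beta> I (X w) (E w)) \<in> N \<rightarrow>\<^sub>M Pi\<^sub>M I (\<lambda>_. borel)"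
  unfolding mk_data_def borel_prod[symmetric] by (rule measurable_restrict) measurable

context
  fixes \<beta> :: "real ^ 'p::finite" and \<tau> :: real
  assumes \<tau>: "\<tau> > 0"
begin

interpretation gx: prob_space "gauss_x :: (real ^ 'p) measure" by (rule prob_space_gauss_x)
interpretation ge: prob_space "gauss_e \<tau>" by (rule prob_space_gauss_e[OF \<tau>])
interpretation gz: prob_space "gauss_z \<beta> \<tau>" by (rule prob_space_gauss_z[OF \<tau>])
interpretation pgx: product_sigma_finite "\<lambda>_. gauss_x :: (real ^ 'p) measure" ..
interpretation pge: product_sigma_finite "\<lambda>_. gauss_e \<tau>" ..
interpretation pgz: product_sigma_finite "\<lambda>_. gauss_z \<beta> \<tau>" ..

text \<open>The i.i.d. law of the data disintegrates into the law of the design and, for a fixed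
  design, the law of the noise. In the induction step the new covariate has to be moved outside the
  integral over the earlier noise, by Fubini.\<close>

lemma nn_integral_PiM_gauss_z:
  fixes I :: "'i set"
  assumes "finite I" "F \<in> borel_measurable (Pi\<^sub>M I (\<lambda>_. borel))"
  shows "(\<integral>\<^sup>+z. F z \<partial>Pi\<^sub>M I (\<lambda>_. gauss_z \<beta> \<tau>)) =
    (\<integral>\<^sup>+X. \<integral>\<^sup>+E. F (mk_data \<beta> I X E) \<partial>Pi\<^sub>M I (\<lambda>_. gauss_e \<tau>) \<partial>Pi\<^sub>M I (\<lambda>_. gauss_x))"
  using assms
proof (induction I arbitrary: F rule: finite_induct)
  case empty
  have "mk_data \<beta> {} (\<lambda>_::'i. undefined) (\<lambda>_. undefined) = (\<lambda>_. undefined)" by (simp add: mk_data_def restrict_def)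
  then show ?case by (simp add: PiM_empty nn_integral_count_space_finite)
next
  case (insert a I)
  note [measurable] = insert.prems
  interpret PX: finite_product_sigma_finite "\<lambda>_. gauss_x :: (real ^ 'p) measure" I by standard fact
  interpret PE: finite_product_sigma_finite "\<lambda>_. gauss_e \<tau>" I by standard fact
  interpret PE': finite_product_sigma_finite "\<lambda>_. gauss_e \<tau>" "insert a I" by standard (use insert in auto)
  have upd [measurable]: "(\<lambda>w. (f w)(a := h w)) \<in> N \<rightarrow>\<^sub>M Pi\<^sub>M (insert a I) (\<lambda>_. borel)"
    if "f \<in> N \<rightarrow>\<^sub>M Pi\<^sub>M I (\<lambda>_. borel)" "h \<in> N \<rightarrow>\<^sub>M borel"
    for f :: "'n \<Rightarrow> 'i \<Rightarrow> 'b::topological_space" and h and N :: "'n measure"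
    using that by (intro measurable_fun_upd[where J = I]) auto
  have mk [measurable]: "(\<lambda>w. (f w, f w \<bullet> \<beta> + h w)) \<in> N \<rightarrow>\<^sub>M borel"
    if "f \<in> N \<rightarrow>\<^sub>M borel" "h \<in> N \<rightarrow>\<^sub>M borel" for f h and N :: "'n measure"
    using that unfolding borel_prod[symmetric] by measurable
  define H where "H z = (\<integral>\<^sup>+x. \<integral>\<^sup>+e. F (z(a := (x, x \<bullet> \<beta> + e))) \<partial>gauss_e \<tau> \<partial>gauss_x)" for z
  have [measurable]: "H \<in> borel_measurable (Pi\<^sub>M I (\<lambda>_. borel))" unfolding H_def by measurable
  have "(\<integral>\<^sup>+z. F z \<partial>Pi\<^sub>M (insert a I) (\<lambda>_. gauss_z \<beta> \<tau>)) =
      (\<integral>\<^sup>+z. \<integral>\<^sup>+q. F (z(a := q)) \<partial>gauss_z \<beta> \<tau> \<partial>Pi\<^sub>M I (\<lambda>_. gauss_z \<beta> \<tau>))"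
    using insert by (intro pgz.product_nn_integral_insert) auto
  also have "\<dots> = (\<integral>\<^sup>+z. H z \<partial>Pi\<^sub>M I (\<lambda>_. gauss_z \<beta> \<tau>))"
  proof (rule nn_integral_cong)
    fix z assume "z \<in> space (Pi\<^sub>M I (\<lambda>_. gauss_z \<beta> \<tau>))"
    then have z: "z \<in> space (Pi\<^sub>M I (\<lambda>_. borel))" by (simp add: space_PiM)
    have "(\<lambda>q. F (z(a := q))) \<in> borel_measurable borel"
      using z by measurable
    then show "(\<integral>\<^sup>+q. F (z(a := q)) \<partial>gauss_z \<beta> \<tau>) = H z"
      unfolding H_def by (rule nn_integral_gauss_z[OF \<tau>])
  qed
  also have "\<dots> = (\<integral>\<^sup>+X. \<integral>\<^sup>+E. H (mk_data \<beta> I X E) \<partial>Pi\<^sub>M I (\<lambda>_. gauss_e \<tau>) \<partial>Pi\<^sub>M I (\<lambda>_. gauss_x))"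
    by (rule insert.IH) measurable
  also have "\<dots> = (\<integral>\<^sup>+X. \<integral>\<^sup>+x. \<integral>\<^sup>+E. \<integral>\<^sup>+e. F (mk_data \<beta> (insert a I) (X(a := x)) (E(a := e)))
      \<partial>gauss_e \<tau> \<partial>Pi\<^sub>M I (\<lambda>_. gauss_e \<tau>) \<partial>gauss_x \<partial>Pi\<^sub>M I (\<lambda>_. gauss_x))"
  proof (rule nn_integral_cong)
    fix X :: "'i \<Rightarrow> real ^ 'p" assume "X \<in> space (Pi\<^sub>M I (\<lambda>_. gauss_x))"
    then have [measurable]: "X \<in> space (Pi\<^sub>M I (\<lambda>_. borel))" by (simp add: space_PiM)
    interpret pair_sigma_finite "Pi\<^sub>M I (\<lambda>_. gauss_e \<tau>)" "gauss_x :: (real ^ 'p) measure" ..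
    show "(\<integral>\<^sup>+E. H (mk_data \<beta> I X E) \<partial>Pi\<^sub>M I (\<lambda>_. gauss_e \<tau>)) =
      (\<integral>\<^sup>+x. \<integral>\<^sup>+E. \<integral>\<^sup>+e. F (mk_data \<beta> (insert a I) (X(a := x)) (E(a := e)))
      \<partial>gauss_e \<tau> \<partial>Pi\<^sub>M I (\<lambda>_. gauss_e \<tau>) \<partial>gauss_x)"
      unfolding H_def mk_data_insert[OF insert.hyps(2)] by (rule Fubini'[symmetric]) measurable
  qed
  also have "\<dots> = (\<integral>\<^sup>+X. \<integral>\<^sup>+x. \<integral>\<^sup>+E. F (mk_data \<beta> (insert a I) (X(a := x)) E)
      \<partial>Pi\<^sub>M (insert a I) (\<lambda>_. gauss_e \<tau>) \<partial>gauss_x \<partial>Pi\<^sub>M I (\<lambda>_. gauss_x))"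
  proof (intro nn_integral_cong)
    fix X :: "'i \<Rightarrow> real ^ 'p" and x assume "X \<in> space (Pi\<^sub>M I (\<lambda>_. gauss_x))"
    then have [measurable]: "X \<in> space (Pi\<^sub>M I (\<lambda>_. borel))" by (simp add: space_PiM)
    show "(\<integral>\<^sup>+E. \<integral>\<^sup>+e. F (mk_data \<beta> (insert a I) (X(a := x)) (E(a := e)))
      \<partial>gauss_e \<tau> \<partial>Pi\<^sub>M I (\<lambda>_. gauss_e \<tau>)) = (\<integral>\<^sup>+E. F (mk_data \<beta> (insert a I) (X(a := x)) E)
      \<partial>Pi\<^sub>M (insert a I) (\<lambda>_. gauss_e \<tau>))"
      using insert.hyps by (intro pge.product_nn_integral_insert[symmetric]) measurable
  qed
  also have "\<dots> = (\<integral>\<^sup>+X. \<integral>\<^sup>+E. F (mk_data \<beta> (insert a I) X E)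
      \<partial>Pi\<^sub>M (insert a I) (\<lambda>_. gauss_e \<tau>) \<partial>Pi\<^sub>M (insert a I) (\<lambda>_. gauss_x))"
    using insert.hyps by (intro pgx.product_nn_integral_insert[symmetric]) measurable
  finally show ?case .
qed

text \<open>Cameron-Martin formula for the noise vector: the one-dimensional weights multiply, so
  their exponents add up to a linear form and a squared length.\<close>

lemma nn_integral_PiM_gauss_e_shift:
  fixes I :: "'i set" and u :: "'i \<Rightarrow> real"
  assumes "finite I" "F \<in> borel_measurable (Pi\<^sub>M I (\<lambda>_. borel))"
  shows "(\<integral>\<^sup>+E. F E \<partial>Pi\<^sub>M I (\<lambda>_. gauss_e \<tau>)) =
    (\<integral>\<^sup>+E. ennreal (exp (- (2 * (\<Sum>i\<in>I. u i * E i) + (\<Sum>i\<in>I. (u i)\<^sup>2)) / (2 * \<tau>\<^sup>2))) * F (\<lambda>i\<in>I. E i + u i)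
      \<partial>Pi\<^sub>M I (\<lambda>_. gauss_e \<tau>))"
  using assms
proof (induction I arbitrary: F rule: finite_induct)
  case empty
  then show ?case by (simp add: PiM_empty nn_integral_count_space_finite restrict_def)
next
  case (insert a I)
  note [measurable] = insert.prems
  interpret PE: finite_product_sigma_finite "\<lambda>_. gauss_e \<tau>" I by standard fact
  have upd [measurable]: "(\<lambda>w. (f w)(a := h w)) \<in> N \<rightarrow>\<^sub>M Pi\<^sub>M (insert a I) (\<lambda>_. borel)"
    if "f \<in> N \<rightarrow>\<^sub>M Pi\<^sub>M I (\<lambda>_. borel)" "h \<in> N \<rightarrow>\<^sub>M borel"
    for f :: "'n \<Rightarrow> 'i \<Rightarrow> real" and h and N :: "'n measure"
    using that by (intro measurable_fun_upd[where J = I]) auto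
  have rs [measurable]: "(\<lambda>E. \<lambda>i\<in>J. E i + u i) \<in> Pi\<^sub>M J (\<lambda>_. borel) \<rightarrow>\<^sub>M Pi\<^sub>M J (\<lambda>_. borel)" for J
    by (rule measurable_restrict) measurable
  define w where "w e = ennreal (exp (- (2 * u a * e + (u a)\<^sup>2) / (2 * \<tau>\<^sup>2)))" for e
  define W where "W J E = ennreal (exp (- (2 * (\<Sum>i\<in>J. u i * E i) + (\<Sum>i\<in>J. (u i)\<^sup>2)) / (2 * \<tau>\<^sup>2)))" for J E
  have [measurable]: "w \<in> borel_measurable borel" "W J \<in> borel_measurable (Pi\<^sub>M J (\<lambda>_. borel))" for J
    unfolding w_def W_def by measurable
  define H where "H E = (\<integral>\<^sup>+e. w e * F (E(a := e + u a)) \<partial>gauss_e \<tau>)" for E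
  have [measurable]: "H \<in> borel_measurable (Pi\<^sub>M I (\<lambda>_. borel))" unfolding H_def by measurable
  have WW: "W (insert a I) (E(a := e)) = W I E * w e" for E e
  proof -
    have "(\<Sum>i\<in>I. u i * (if i = a then e else E i)) = (\<Sum>i\<in>I. u i * E i)"
      using insert.hyps by (intro sum.cong) auto
    then have s: "2 * (\<Sum>i\<in>insert a I. u i * (E(a := e)) i) + (\<Sum>i\<in>insert a I. (u i)\<^sup>2)
        = (2 * (\<Sum>i\<in>I. u i * E i) + (\<Sum>i\<in>I. (u i)\<^sup>2)) + (2 * u a * e + (u a)\<^sup>2)"
      using insert.hyps by simp
    have ex: "exp (- (A + B) / D) = exp (- A / D) * exp (- B / D)" for A B D :: real
      by (simp add: mult_exp_exp diff_divide_distrib)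
    show ?thesis unfolding W_def w_def s by (subst ex) (rule ennreal_mult', simp)
  qed
  have sh: "(\<lambda>i\<in>insert a I. (E(a := e)) i + u i) = (\<lambda>i\<in>I. E i + u i)(a := e + u a)" for E e
    using insert.hyps by (auto simp: fun_eq_iff)
  have "(\<integral>\<^sup>+E. F E \<partial>Pi\<^sub>M (insert a I) (\<lambda>_. gauss_e \<tau>)) =
      (\<integral>\<^sup>+E. \<integral>\<^sup>+e. F (E(a := e)) \<partial>gauss_e \<tau> \<partial>Pi\<^sub>M I (\<lambda>_. gauss_e \<tau>))"
    using insert by (intro pge.product_nn_integral_insert) auto
  also have "\<dots> = (\<integral>\<^sup>+E. H E \<partial>Pi\<^sub>M I (\<lambda>_. gauss_e \<tau>))"
  proof (rule nn_integral_cong)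
    fix E assume "E \<in> space (Pi\<^sub>M I (\<lambda>_. gauss_e \<tau>))"
    then have z: "E \<in> space (Pi\<^sub>M I (\<lambda>_. borel))" by (simp add: space_PiM)
    have "(\<lambda>q. F (E(a := q))) \<in> borel_measurable borel"
      using z by measurable
    then show "(\<integral>\<^sup>+q. F (E(a := q)) \<partial>gauss_e \<tau>) = H E"
      unfolding H_def w_def by (rule nn_integral_gauss_e_shift[OF _ \<tau>])
  qed
  also have "\<dots> = (\<integral>\<^sup>+E. W I E * H (\<lambda>i\<in>I. E i + u i) \<partial>Pi\<^sub>M I (\<lambda>_. gauss_e \<tau>))"
    unfolding W_def by (rule insert.IH) measurable
  also have "\<dots> = (\<integral>\<^sup>+E. \<integral>\<^sup>+e. W (insert a I) (E(a := e)) * F (\<lambda>i\<in>insert a I. (E(a := e)) i + u i)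
      \<partial>gauss_e \<tau> \<partial>Pi\<^sub>M I (\<lambda>_. gauss_e \<tau>))"
  proof (rule nn_integral_cong)
    fix E assume "E \<in> space (Pi\<^sub>M I (\<lambda>_. gauss_e \<tau>))"
    then have [measurable]: "E \<in> space (Pi\<^sub>M I (\<lambda>_. borel))" by (simp add: space_PiM)
    have [measurable]: "(\<lambda>i\<in>I. E i + u i) \<in> space (Pi\<^sub>M I (\<lambda>_. borel))" by (simp add: space_PiM)
    show "W I E * H (\<lambda>i\<in>I. E i + u i) = (\<integral>\<^sup>+e. W (insert a I) (E(a := e)) * F (\<lambda>i\<in>insert a I. (E(a := e)) i + u i) \<partial>gauss_e \<tau>)"
      unfolding H_def WW sh mult.assoc by (rule nn_integral_cmult[symmetric]) measurable
  qed
  also have "\<dots> = (\<integral>\<^sup>+E. W (insert a I) E * F (\<lambda>i\<in>insert a I. E i + u i) \<partial>Pi\<^sub>M (insert a I) (\<lambda>_. gauss_e \<tau>))"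
    using insert.hyps by (intro pge.product_nn_integral_insert[symmetric]) measurable
  finally show ?case unfolding W_def .
qed

end


text \<open>
  The event \<open>A\<close> is charged proportionally to the length of its sections along the direction \<open>u\<close>:
  average the translation formula over \<open>s \<in> {-S..S}\<close>.
\<close>
lemma gauss_section_lower_bound:
  fixes I :: "'i set" and u :: "'i \<Rightarrow> real"
  assumes \<tau>: "\<tau> > 0" and I: "finite I" and S: "S > 0" and L: "L \<ge> 0"
    and A: "A \<in> sets (Pi\<^sub>M I (\<lambda>_. borel))" and E0 [measurable]: "E0 \<in> sets (Pi\<^sub>M I (\<lambda>_. borel))"
    and U: "(\<Sum>i\<in>I. (u i)\<^sup>2) \<le> U"
    and C: "\<And>E. E \<in> E0 \<Longrightarrow> \<bar>\<Sum>i\<in>I. u i * E i\<bar> \<le> C"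
    and sect: "\<And>E. E \<in> E0 \<Longrightarrow> \<exists>s0. - S \<le> s0 \<and> s0 + L \<le> S \<and>
        (\<forall>s. s0 < s \<longrightarrow> s < s0 + L \<longrightarrow> (\<lambda>i\<in>I. E i + s * u i) \<in> A)"
  shows "ennreal (L / (2 * S) * exp (- (2 * S * C + S\<^sup>2 * U) / (2 * \<tau>\<^sup>2))) * emeasure (Pi\<^sub>M I (\<lambda>_. gauss_e \<tau>)) E0
     \<le> emeasure (Pi\<^sub>M I (\<lambda>_. gauss_e \<tau>)) A"
proof -
  interpret ge: prob_space "gauss_e \<tau>" by (rule prob_space_gauss_e[OF \<tau>])
  interpret pge: product_sigma_finite "\<lambda>_. gauss_e \<tau>" ..
  interpret PE: finite_product_sigma_finite "\<lambda>_. gauss_e \<tau>" I by standard fact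
  let ?P = "Pi\<^sub>M I (\<lambda>_. gauss_e \<tau>)"
  interpret pair_sigma_finite ?P "lborel :: real measure" ..
  have sets: "sets ?P = sets (Pi\<^sub>M I (\<lambda>_. borel))" by (intro sets_PiM_cong) auto
  note [measurable] = A
  have AP [measurable]: "A \<in> sets ?P" "E0 \<in> sets ?P" using A E0 sets by auto
  define w where "w s E = ennreal (exp (- (2 * (\<Sum>i\<in>I. (s * u i) * E i) + (\<Sum>i\<in>I. (s * u i)\<^sup>2)) / (2 * \<tau>\<^sup>2)))" for s E
  define k where "k = exp (- (2 * S * C + S\<^sup>2 * U) / (2 * \<tau>\<^sup>2))"
  define T where "T s E = (\<lambda>i\<in>I. E i + s * u i)" for s E
  have [measurable]: "(\<lambda>(E, s). T s E) \<in> Pi\<^sub>M I (\<lambda>_. borel) \<Otimes>\<^sub>M borel \<rightarrow>\<^sub>M Pi\<^sub>M I (\<lambda>_. borel)"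
    unfolding T_def case_prod_unfold by (rule measurable_restrict) measurable
  have [measurable]: "(\<lambda>(E, s). w s E) \<in> borel_measurable (Pi\<^sub>M I (\<lambda>_. borel) \<Otimes>\<^sub>M borel)"
    unfolding w_def by measurable
  have m [measurable]: "(\<lambda>(E, s). indicator {- S..S} s * (w s E * indicator A (T s E)))
      \<in> borel_measurable (?P \<Otimes>\<^sub>M lborel)" by measurable
  \<comment> \<open>A constant is integrated over \<open>{- S..S}\<close>. After translating and
    exchanging the integrals, the inner integral weighs, for a fixed noise vector, the set of those
    \<open>s\<close> that move it into \<open>A\<close>.\<close>
  have "ennreal (2 * S) * emeasure ?P A = (\<integral>\<^sup>+s. indicator {- S..S} s * emeasure ?P A \<partial>lborel)"
    using S by (subst nn_integral_multc) auto
  also have "\<dots> = (\<integral>\<^sup>+s. \<integral>\<^sup>+E. indicator {- S..S} s * (w s E * indicator A (T s E)) \<partial>?P \<partial>lborel)"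
  proof (rule nn_integral_cong)
    fix s :: real
    have "emeasure ?P A = (\<integral>\<^sup>+E. indicator A E \<partial>?P)" by simp
    also have "\<dots> = (\<integral>\<^sup>+E. w s E * indicator A (T s E) \<partial>?P)"
      unfolding w_def T_def by (rule nn_integral_PiM_gauss_e_shift[OF \<tau> I]) measurable
    finally show "indicator {- S..S} s * emeasure ?P A =
        (\<integral>\<^sup>+E. indicator {- S..S} s * (w s E * indicator A (T s E)) \<partial>?P)"
      by (simp add: nn_integral_cmult)
  qed
  also have "\<dots> = (\<integral>\<^sup>+E. \<integral>\<^sup>+s. indicator {- S..S} s * (w s E * indicator A (T s E)) \<partial>lborel \<partial>?P)"
    by (rule Fubini'[OF m])
  also have "\<dots> \<ge> (\<integral>\<^sup>+E. indicator E0 E * ennreal (k * L) \<partial>?P)"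
  proof (rule nn_integral_mono)
    fix E
    show "indicator E0 E * ennreal (k * L) \<le> (\<integral>\<^sup>+s. indicator {- S..S} s * (w s E * indicator A (T s E)) \<partial>lborel)"
    proof (cases "E \<in> E0")
      case True
      obtain s0 where s0: "- S \<le> s0" "s0 + L \<le> S"
        "\<And>s. s0 < s \<Longrightarrow> s < s0 + L \<Longrightarrow> T s E \<in> A" using sect[OF True] by (auto simp: T_def)
      \<comment> \<open>The bounds \<open>C\<close> on the linear form and \<open>U\<close> on the
        squared length make the translation weight at least \<open>k\<close>, uniformly over
        \<open>\<bar>s\<bar> \<le> S\<close>.\<close>
      have wk: "ennreal k \<le> w s E" if "\<bar>s\<bar> \<le> S" for s
      proof -
        have "(\<Sum>i\<in>I. s * u i * E i) = s * (\<Sum>i\<in>I. u i * E i)" by (simp add: sum_distrib_left mult.assoc)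
        also have "\<dots> \<le> \<bar>s\<bar> * \<bar>\<Sum>i\<in>I. u i * E i\<bar>" by (metis abs_ge_self abs_mult)
        also have "\<dots> \<le> S * C" using that C[OF True] S by (intro mult_mono) auto
        finally have 1: "(\<Sum>i\<in>I. s * u i * E i) \<le> S * C" .
        have "(\<Sum>i\<in>I. (s * u i)\<^sup>2) = s\<^sup>2 * (\<Sum>i\<in>I. (u i)\<^sup>2)" by (simp add: sum_distrib_left power_mult_distrib)
        also have "\<dots> \<le> S\<^sup>2 * U"
          using that U by (intro mult_mono sum_nonneg) (auto simp: abs_le_square_iff[symmetric])
        finally have 2: "(\<Sum>i\<in>I. (s * u i)\<^sup>2) \<le> S\<^sup>2 * U" .
        show ?thesis unfolding w_def k_def using 1 2 \<tau>
          by (intro ennreal_leI) (simp add: divide_right_mono)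
      qed
      have "ennreal (k * L) = (\<integral>\<^sup>+s. ennreal k * indicator {s0<..<s0 + L} s \<partial>lborel)"
        using L by (subst nn_integral_cmult) (auto simp: ennreal_mult'[symmetric] k_def)
      also have "\<dots> \<le> (\<integral>\<^sup>+s. indicator {- S..S} s * (w s E * indicator A (T s E)) \<partial>lborel)"
        using s0 wk by (intro nn_integral_mono) (auto simp: indicator_def)
      finally show ?thesis using True by simp
    qed simp
  qed
  also have "(\<integral>\<^sup>+E. indicator E0 E * ennreal (k * L) \<partial>?P) = ennreal (k * L) * emeasure ?P E0"
    by (subst nn_integral_multc) (auto simp: mult.commute)
  finally have main: "ennreal (k * L) * emeasure ?P E0 \<le> ennreal (2 * S) * emeasure ?P A" .
  have "ennreal (L / (2 * S) * k) = ennreal (1 / (2 * S)) * ennreal (k * L)"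
    using S by (subst ennreal_mult'[symmetric]) (auto simp: mult.commute)
  then have "ennreal (L / (2 * S) * k) * emeasure ?P E0 = ennreal (1 / (2 * S)) * (ennreal (k * L) * emeasure ?P E0)"
    by (simp only: mult.assoc)
  also have "\<dots> \<le> ennreal (1 / (2 * S)) * (ennreal (2 * S) * emeasure ?P A)"
    by (intro mult_left_mono main) auto
  also have "\<dots> = ennreal (1 / (2 * S)  * (2 * S)) * emeasure ?P A"
    using S by (subst ennreal_mult') (auto simp: mult.assoc)
  also have "\<dots> = emeasure ?P A" using S by simp
  finally show ?thesis by (simp add: k_def)
qed

section \<open>Second moments, independence and conditional expectation\<close>

text \<open>Integrating out the last variable kills the cross term because \<open>f\<close> has mean
  0. With nonnegative integrals, integrability of the sum need not be carried through the
  induction.\<close>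

lemma nn_integral_PiM_sum_sq:
  fixes f :: "'a \<Rightarrow> real" and c :: "'i \<Rightarrow> real"
  assumes Q: "prob_space Q" and I: "finite I" and f: "integrable Q f" and f2: "integrable Q (\<lambda>z. (f z)\<^sup>2)"
    and mean: "(\<integral>z. f z \<partial>Q) = 0"
  shows "(\<integral>\<^sup>+z. ennreal ((\<Sum>i\<in>I. c i * f (z i))\<^sup>2) \<partial>Pi\<^sub>M I (\<lambda>_. Q)) =
    ennreal ((\<Sum>i\<in>I. (c i)\<^sup>2) * (\<integral>z. (f z)\<^sup>2 \<partial>Q))"
  using I
proof (induction I rule: finite_induct)
  case empty
  then show ?case by (simp add: PiM_empty nn_integral_count_space_finite)
next
  case (insert a I)
  interpret Q: prob_space Q by fact
  interpret p: product_sigma_finite "\<lambda>_. Q" ..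
  interpret P: prob_space "Pi\<^sub>M I (\<lambda>_. Q)" by (intro prob_space_PiM Q)
  note [measurable] = borel_measurable_integrable[OF f]
  let ?V = "\<integral>z. (f z)\<^sup>2 \<partial>Q"
  have V: "?V \<ge> 0" by simp
  have inner: "(\<integral>\<^sup>+y. ennreal ((c a * f y + t)\<^sup>2) \<partial>Q) = ennreal ((c a)\<^sup>2 * ?V + t\<^sup>2)" for t
  proof -
    have e: "(c a * f y + t)\<^sup>2 = (c a)\<^sup>2 * (f y)\<^sup>2 + 2 * c a * t * f y + t\<^sup>2" for y
      by (simp add: power2_eq_square algebra_simps)
    have int: "integrable Q (\<lambda>y. (c a * f y + t)\<^sup>2)" unfolding e using f f2 by simp
    have "(\<integral>y. (c a * f y + t)\<^sup>2 \<partial>Q) = (c a)\<^sup>2 * ?V + t\<^sup>2"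
      unfolding e using f f2 mean by (simp add: Q.prob_space)
    then show ?thesis using nn_integral_eq_integral[OF int] by simp
  qed
  have "(\<integral>\<^sup>+z. ennreal ((\<Sum>i\<in>insert a I. c i * f (z i))\<^sup>2) \<partial>Pi\<^sub>M (insert a I) (\<lambda>_. Q)) =
    (\<integral>\<^sup>+z. \<integral>\<^sup>+y. ennreal ((\<Sum>i\<in>insert a I. c i * f ((z(a := y)) i))\<^sup>2) \<partial>Q \<partial>Pi\<^sub>M I (\<lambda>_. Q))"
    using insert.hyps by (intro p.product_nn_integral_insert) auto
  also have "\<dots> = (\<integral>\<^sup>+z. \<integral>\<^sup>+y. ennreal ((c a * f y + (\<Sum>i\<in>I. c i * f (z i)))\<^sup>2) \<partial>Q \<partial>Pi\<^sub>M I (\<lambda>_. Q))"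
  proof (intro nn_integral_cong)
    fix z y
    have "(\<Sum>i\<in>I. c i * f ((z(a := y)) i)) = (\<Sum>i\<in>I. c i * f (z i))"
      using insert.hyps by (intro sum.cong) auto
    then show "ennreal ((\<Sum>i\<in>insert a I. c i * f ((z(a := y)) i))\<^sup>2) = ennreal ((c a * f y + (\<Sum>i\<in>I. c i * f (z i)))\<^sup>2)"
      using insert.hyps by simp
  qed
  also have "\<dots> = (\<integral>\<^sup>+z. ennreal ((c a)\<^sup>2 * ?V) + ennreal ((\<Sum>i\<in>I. c i * f (z i))\<^sup>2) \<partial>Pi\<^sub>M I (\<lambda>_. Q))"
    unfolding inner using V by (simp add: ennreal_plus)
  also have "\<dots> = ennreal ((c a)\<^sup>2 * ?V) + (\<integral>\<^sup>+z. ennreal ((\<Sum>i\<in>I. c i * f (z i))\<^sup>2) \<partial>Pi\<^sub>M I (\<lambda>_. Q))"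
    by (subst nn_integral_add) (auto simp: P.emeasure_space_1)
  also have "\<dots> = ennreal ((\<Sum>i\<in>insert a I. (c i)\<^sup>2) * ?V)"
    unfolding insert.IH using insert.hyps V by (simp add: ennreal_plus[symmetric] sum_nonneg algebra_simps del: ennreal_plus)
  finally show ?case .
qed

text \<open>Independence on the product space, as Hoeffding's inequality demands it: the joint law
  of the coordinate maps is the product measure itself, hence the product of their laws.\<close>

lemma indep_vars_PiM_same:
  assumes Q: "prob_space Q" and I: "finite I" "I \<noteq> {}" and [measurable]: "g \<in> borel_measurable Q"
  shows "prob_space.indep_vars (Pi\<^sub>M I (\<lambda>_. Q)) (\<lambda>_. borel) (\<lambda>i z. g (z i)) I"
proof -
  interpret P: prob_space "Pi\<^sub>M I (\<lambda>_. Q)" by (intro prob_space_PiM Q)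
  have rv: "(\<lambda>z. z i) \<in> Pi\<^sub>M I (\<lambda>_. Q) \<rightarrow>\<^sub>M Q" if "i \<in> I" for i using that by simp
  have "distr (Pi\<^sub>M I (\<lambda>_. Q)) (Pi\<^sub>M I (\<lambda>_. Q)) (\<lambda>z. \<lambda>i\<in>I. z i) = distr (Pi\<^sub>M I (\<lambda>_. Q)) (Pi\<^sub>M I (\<lambda>_. Q)) (\<lambda>z. z)"
    by (intro distr_cong) (auto simp: space_PiM PiE_def extensional_restrict)
  also have "\<dots> = Pi\<^sub>M I (\<lambda>_. Q)" by simp
  also have "\<dots> = Pi\<^sub>M I (\<lambda>i. distr (Pi\<^sub>M I (\<lambda>_. Q)) Q (\<lambda>z. z i))"
    using Q I distr_PiM_component[of I "\<lambda>_. Q"] by (intro PiM_cong) auto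
  finally have "P.indep_vars (\<lambda>_. Q) (\<lambda>i z. z i) I"
    using P.indep_vars_iff_distr_eq_PiM'[OF I(2), of "\<lambda>i z. z i" "\<lambda>_. Q"] rv by simp
  then show ?thesis by (rule P.indep_vars_compose2) simp
qed


text \<open>The freezing lemma: for independent \<open>X\<close> and \<open>Y\<close>, conditioning
  on \<open>X\<close> means integrating over \<open>Y\<close> with \<open>X\<close> held fixed. The
  defining identity is checked on preimages of measurable sets under \<open>X\<close>, where Fubini
  applies. It is used once with the training set and once with the test point as
  \<open>X\<close>.\<close>

lemma (in prob_space) cond_exp_given_indep:
  fixes f :: "'b \<times> 'c \<Rightarrow> real"
  assumes X [measurable]: "X \<in> M \<rightarrow>\<^sub>M N1" and Y [measurable]: "Y \<in> M \<rightarrow>\<^sub>M N2"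
    and joint: "distr M (N1 \<Otimes>\<^sub>M N2) (\<lambda>\<omega>. (X \<omega>, Y \<omega>)) = D1 \<Otimes>\<^sub>M D2"
    and D: "prob_space D1" "prob_space D2" "sets D1 = sets N1" "sets D2 = sets N2"
    and f: "integrable (D1 \<Otimes>\<^sub>M D2) f"
  shows "AE \<omega> in M. cond_exp_given M N1 X (\<lambda>\<omega>. f (X \<omega>, Y \<omega>)) \<omega> = (\<integral>y. f (X \<omega>, y) \<partial>D2)"
proof -
  interpret D1: prob_space D1 by fact
  interpret D2: prob_space D2 by fact
  interpret D: pair_prob_space D1 D2 ..
  define F where "F = vimage_algebra (space M) X N1"
  have sp: "X \<in> space M \<rightarrow> space N1" using X by (rule measurable_space[THEN funcsetI])
  have sF: "sets F = {X -` B \<inter> space M | B. B \<in> sets N1}"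
    unfolding F_def by (rule sets_vimage_algebra2[OF sp])
  have "subalgebra M F" unfolding subalgebra_def
    using X sF by (auto simp: measurable_sets) (simp_all add: F_def)
  then interpret F: finite_measure_subalgebra M F by unfold_locales
  have [measurable_cong]: "sets D1 = sets N1" "sets D2 = sets N2" by fact+
  have [measurable]: "f \<in> borel_measurable (N1 \<Otimes>\<^sub>M N2)"
    using borel_measurable_integrable[OF f] by (simp cong: measurable_cong_sets sets_pair_measure_cong)
  define g where "g x = (\<integral>y. f (x, y) \<partial>D2)" for x
  have [measurable]: "g \<in> borel_measurable N1" unfolding g_def by measurable
  have int_joint: "integrable M (\<lambda>\<omega>. h (X \<omega>, Y \<omega>))" "(\<integral>\<omega>. h (X \<omega>, Y \<omega>) \<partial>M) = (\<integral>w. h w \<partial>(D1 \<Otimes>\<^sub>M D2))"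
    if h: "integrable (D1 \<Otimes>\<^sub>M D2) h" for h :: "'b \<times> 'c \<Rightarrow> real"
  proof -
    have [measurable]: "h \<in> borel_measurable (N1 \<Otimes>\<^sub>M N2)"
      using borel_measurable_integrable[OF h] by (simp cong: measurable_cong_sets sets_pair_measure_cong)
    show "integrable M (\<lambda>\<omega>. h (X \<omega>, Y \<omega>))"
      using h unfolding joint[symmetric] by (subst (asm) integrable_distr_eq) auto
    show "(\<integral>\<omega>. h (X \<omega>, Y \<omega>) \<partial>M) = (\<integral>w. h w \<partial>(D1 \<Otimes>\<^sub>M D2))"
      unfolding joint[symmetric] by (subst integral_distr) auto
  qed
  have g1: "integrable (D1 \<Otimes>\<^sub>M D2) (\<lambda>w. g (fst w))"
    using D.integrable_pair_mult(1)[OF D.integrable_fst'[OF f], of "\<lambda>_. 1"] by (simp add: g_def)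
  have "AE \<omega> in M. real_cond_exp M F (\<lambda>\<omega>. f (X \<omega>, Y \<omega>)) \<omega> = g (X \<omega>)"
  proof (rule F.real_cond_exp_charact)
    show "integrable M (\<lambda>\<omega>. f (X \<omega>, Y \<omega>))" by (rule int_joint(1)[OF f])
    show "integrable M (\<lambda>\<omega>. g (X \<omega>))" using int_joint(1)[OF g1] by simp
    show "(\<lambda>\<omega>. g (X \<omega>)) \<in> borel_measurable F"
      unfolding F_def by (rule measurable_compose[OF measurable_vimage_algebra1[OF sp]]) measurable
    fix A assume "A \<in> sets F"
    then obtain B where A: "A = X -` B \<inter> space M" and B [measurable]: "B \<in> sets N1" by (auto simp: sF)
    have ind: "indicator A \<omega> = (indicator B (X \<omega>) :: real)" if "\<omega> \<in> space M" for \<omega>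
      using that by (auto simp: A indicator_def)
    have if1: "integrable (D1 \<Otimes>\<^sub>M D2) (\<lambda>w. indicator B (fst w) * f w)"
      by (rule Bochner_Integration.integrable_bound[OF f]) (auto simp: indicator_def)
    have if2: "integrable (D1 \<Otimes>\<^sub>M D2) (\<lambda>w. indicator B (fst w) * g (fst w))"
      by (rule Bochner_Integration.integrable_bound[OF g1]) (auto simp: indicator_def)
    have "(\<integral>\<omega>\<in>A. f (X \<omega>, Y \<omega>) \<partial>M) = (\<integral>\<omega>. indicator B (X \<omega>) * f (X \<omega>, Y \<omega>) \<partial>M)"
      unfolding set_lebesgue_integral_def by (intro Bochner_Integration.integral_cong) (auto simp: ind)
    also have "\<dots> = (\<integral>w. indicator B (fst w) * f w \<partial>(D1 \<Otimes>\<^sub>M D2))"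
      using int_joint(2)[OF if1] by simp
    also have "\<dots> = (\<integral>x. \<integral>y. indicator B x * f (x, y) \<partial>D2 \<partial>D1)"
      using D.integral_fst'[OF if1] by simp
    also have "\<dots> = (\<integral>x. \<integral>y. indicator B x * g x \<partial>D2 \<partial>D1)" by (simp add: g_def D2.prob_space)
    also have "\<dots> = (\<integral>w. indicator B (fst w) * g (fst w) \<partial>(D1 \<Otimes>\<^sub>M D2))"
      using D.integral_fst'[OF if2] by simp
    also have "\<dots> = (\<integral>\<omega>. indicator B (X \<omega>) * g (X \<omega>) \<partial>M)"
      using int_joint(2)[OF if2] by simp
    also have "\<dots> = (\<integral>\<omega>\<in>A. g (X \<omega>) \<partial>M)"
      unfolding set_lebesgue_integral_def by (intro Bochner_Integration.integral_cong) (auto simp: ind)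
    finally show "(\<integral>\<omega>\<in>A. f (X \<omega>, Y \<omega>) \<partial>M) = (\<integral>\<omega>\<in>A. g (X \<omega>) \<partial>M)" .
  qed
  then show ?thesis by (simp add: cond_exp_given_def F_def g_def)
qed

section \<open>Joint laws in the Gaussian linear model\<close>

context gaussian_linear_model
begin

lemma measurable_Z [measurable]: "Z i \<in> M \<rightarrow>\<^sub>M borel" "Z1' \<in> M \<rightarrow>\<^sub>M borel"
proof -
  have "random_variable borel (case_option Z1' Z k)" for k
    using indep unfolding indep_vars_def by blast
  from this[of "Some i"] this[of None] show "Z i \<in> M \<rightarrow>\<^sub>M borel" "Z1' \<in> M \<rightarrow>\<^sub>M borel" by simp_all
qed

text \<open>Independence of covariate and noise is given for generated sigma-algebras, so their
  joint law is identified as a product measure through its values on rectangles; the data point is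
  the image of that product under the model equation.\<close>

lemma law_Z: "distr M borel (Z i) = gauss_z \<beta> \<tau>"
proof -
  define \<xi> \<eta> where "\<xi> = (\<lambda>\<omega>. fst (Z i \<omega>))" and "\<eta> = (\<lambda>\<omega>. snd (Z i \<omega>) - fst (Z i \<omega>) \<bullet> \<beta>)"
  have Zm: "Z i \<in> M \<rightarrow>\<^sub>M borel \<Otimes>\<^sub>M borel" unfolding borel_prod by measurable
  have m [measurable]: "\<xi> \<in> M \<rightarrow>\<^sub>M borel" "\<eta> \<in> M \<rightarrow>\<^sub>M borel"
    unfolding \<xi>_def \<eta>_def using Zm by measurable
  have lx: "distr M borel \<xi> = gauss_x"
    using distributed_distr_eq_density[OF covariate[of i]]
    by (simp add: gauss_x_def \<xi>_def cong: distr_cong)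
  have le: "distr M borel \<eta> = gauss_e \<tau>"
    using distributed_distr_eq_density[OF noise[of i]]
    by (simp add: gauss_e_def \<eta>_def cong: distr_cong)
  interpret gx: prob_space "gauss_x :: (real ^ 'p) measure" by (rule prob_space_gauss_x)
  interpret ge: prob_space "gauss_e \<tau>" by (rule prob_space_gauss_e[OF \<tau>_pos])
  have joint: "gauss_x \<Otimes>\<^sub>M gauss_e \<tau> = distr M (borel \<Otimes>\<^sub>M borel) (\<lambda>\<omega>. (\<xi> \<omega>, \<eta> \<omega>))"
  proof (rule pair_measure_eqI)
    show "sets (gauss_x \<Otimes>\<^sub>M gauss_e \<tau>) = sets (distr M (borel \<Otimes>\<^sub>M borel) (\<lambda>\<omega>. (\<xi> \<omega>, \<eta> \<omega>)))"
      by (simp cong: sets_pair_measure_cong)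
    fix A :: "(real ^ 'p) set" and B assume "A \<in> sets gauss_x" "B \<in> sets (gauss_e \<tau>)"
    then have [measurable]: "A \<in> sets borel" "B \<in> sets borel" by simp_all
    have "prob ((\<xi> -` A \<inter> space M) \<inter> (\<eta> -` B \<inter> space M)) = prob (\<xi> -` A \<inter> space M) * prob (\<eta> -` B \<inter> space M)"
      unfolding \<xi>_def \<eta>_def
      by (rule indep_setD[OF covariate_noise_indep[of i]]) (auto intro!: in_vimage_algebra)
    moreover have "(\<xi> -` A \<inter> space M) \<inter> (\<eta> -` B \<inter> space M) = (\<lambda>\<omega>. (\<xi> \<omega>, \<eta> \<omega>)) -` (A \<times> B) \<inter> space M" by auto
    moreover have "emeasure gauss_x A = ennreal (prob (\<xi> -` A \<inter> space M))"
      unfolding lx[symmetric] by (subst emeasure_distr) (auto simp: emeasure_eq_measure)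
    moreover have "emeasure (gauss_e \<tau>) B = ennreal (prob (\<eta> -` B \<inter> space M))"
      unfolding le[symmetric] by (subst emeasure_distr) (auto simp: emeasure_eq_measure)
    moreover have "emeasure (distr M (borel \<Otimes>\<^sub>M borel) (\<lambda>\<omega>. (\<xi> \<omega>, \<eta> \<omega>))) (A \<times> B) =
        ennreal (prob ((\<lambda>\<omega>. (\<xi> \<omega>, \<eta> \<omega>)) -` (A \<times> B) \<inter> space M))"
      by (subst emeasure_distr) (auto simp: emeasure_eq_measure)
    ultimately show "emeasure gauss_x A * emeasure (gauss_e \<tau>) B =
        emeasure (distr M (borel \<Otimes>\<^sub>M borel) (\<lambda>\<omega>. (\<xi> \<omega>, \<eta> \<omega>))) (A \<times> B)"
      by (simp only: ennreal_mult'[OF measure_nonneg])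
  qed unfold_locales
  have "gauss_z \<beta> \<tau> = distr M borel ((\<lambda>(x, e). (x, x \<bullet> \<beta> + e)) \<circ> (\<lambda>\<omega>. (\<xi> \<omega>, \<eta> \<omega>)))"
    unfolding gauss_z_def joint
  proof (rule distr_distr)
    show "(\<lambda>(x, e). (x, x \<bullet> \<beta> + e)) \<in> borel \<Otimes>\<^sub>M borel \<rightarrow>\<^sub>M (borel :: 'p datum measure)"
      unfolding borel_prod[symmetric] by measurable
  qed measurable
  also have "\<dots> = distr M borel (Z i)" by (intro distr_cong) (auto simp: \<xi>_def \<eta>_def)
  finally show ?thesis ..
qed

lemma law_Z1': "distr M borel Z1' = gauss_z \<beta> \<tau>"
  using copy law_Z[of 1] by simp

text \<open>The index \<open>None\<close> stands for the copy, so an injective \<open>f\<close>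
  picks any finite family of distinct members of the sequence together with the copy. Training sets,
  perturbed training sets and the test point are all covered.\<close>

lemma law_family:
  fixes f :: "'i \<Rightarrow> nat option"
  assumes f: "inj_on f I" and I: "finite I" "I \<noteq> {}"
  shows "distr M (Pi\<^sub>M I (\<lambda>_. borel)) (\<lambda>\<omega>. \<lambda>i\<in>I. case_option Z1' Z (f i) \<omega>) = Pi\<^sub>M I (\<lambda>_. gauss_z \<beta> \<tau>)"
proof -
  let ?V = "case_option Z1' Z" and ?K = "f ` I"
  have V [measurable]: "?V k \<in> M \<rightarrow>\<^sub>M borel" for k by (cases k) auto
  have "indep_vars (\<lambda>_. borel) ?V ?K" using indep by (rule indep_vars_subset) simp
  then have "distr M (Pi\<^sub>M ?K (\<lambda>_. borel)) (\<lambda>\<omega>. \<lambda>k\<in>?K. ?V k \<omega>) = Pi\<^sub>M ?K (\<lambda>k. distr M borel (?V k))"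
    using I by (subst indep_vars_iff_distr_eq_PiM[symmetric]) auto
  also have "\<dots> = Pi\<^sub>M ?K (\<lambda>_. gauss_z \<beta> \<tau>)"
    by (intro PiM_cong) (auto simp: law_Z law_Z1' split: option.split)
  finally have K: "distr M (Pi\<^sub>M ?K (\<lambda>_. borel)) (\<lambda>\<omega>. \<lambda>k\<in>?K. ?V k \<omega>) = Pi\<^sub>M ?K (\<lambda>_. gauss_z \<beta> \<tau>)" .
  have "Pi\<^sub>M I (\<lambda>_. gauss_z \<beta> \<tau>) = distr (Pi\<^sub>M ?K (\<lambda>_. gauss_z \<beta> \<tau>)) (Pi\<^sub>M I (\<lambda>_. gauss_z \<beta> \<tau>)) (\<lambda>\<omega>. \<lambda>n\<in>I. \<omega> (f n))"
    using distr_PiM_reindex[of ?K "\<lambda>_. gauss_z \<beta> \<tau>" f I, OF prob_space_gauss_z[OF \<tau>_pos] f] by simp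
  also have "\<dots> = distr (Pi\<^sub>M ?K (\<lambda>_. gauss_z \<beta> \<tau>)) (Pi\<^sub>M I (\<lambda>_. borel)) (\<lambda>\<omega>. \<lambda>n\<in>I. \<omega> (f n))"
    by (intro distr_cong sets_PiM_cong) auto
  also have "\<dots> = distr M (Pi\<^sub>M I (\<lambda>_. borel)) ((\<lambda>\<omega>. \<lambda>n\<in>I. \<omega> (f n)) \<circ> (\<lambda>\<omega>. \<lambda>k\<in>?K. ?V k \<omega>))"
    unfolding K[symmetric]
    by (rule distr_distr) (intro measurable_restrict V measurable_component_singleton imageI; assumption)+
  also have "\<dots> = distr M (Pi\<^sub>M I (\<lambda>_. borel)) (\<lambda>\<omega>. \<lambda>i\<in>I. ?V (f i) \<omega>)"
    by (intro distr_cong) (auto simp: fun_eq_iff)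
  finally show ?thesis ..
qed

lemma nn_integral_family:
  fixes f :: "'i \<Rightarrow> nat option"
  assumes "inj_on f I" "finite I" "I \<noteq> {}" and F: "F \<in> borel_measurable (Pi\<^sub>M I (\<lambda>_. borel))"
  shows "(\<integral>\<^sup>+\<omega>. F (\<lambda>i\<in>I. case_option Z1' Z (f i) \<omega>) \<partial>M) = (\<integral>\<^sup>+z. F z \<partial>Pi\<^sub>M I (\<lambda>_. gauss_z \<beta> \<tau>))"
proof -
  have V: "case_option Z1' Z k \<in> M \<rightarrow>\<^sub>M borel" for k by (cases k) auto
  have "(\<lambda>\<omega>. \<lambda>i\<in>I. case_option Z1' Z (f i) \<omega>) \<in> M \<rightarrow>\<^sub>M Pi\<^sub>M I (\<lambda>_. borel)"
    by (intro measurable_restrict V)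
  from nn_integral_distr[OF this, unfolded measurable_distr_eq1, OF F] show ?thesis
    by (simp only: law_family[OF assms(1-3)])
qed

end


subsection \<open>The Lasso as a function of the data\<close>

text \<open>The transposed design matrix times the design matrix, without normalization, as a sum of
  rank-one operators; \<open>corr\<close> is the transposed design matrix applied to the
  responses.\<close>

definition gram :: "'i set \<Rightarrow> ('i \<Rightarrow> real ^ 'p::finite) \<Rightarrow> real ^ 'p \<Rightarrow> real ^ 'p" where
  "gram I x a = (\<Sum>i\<in>I. (x i \<bullet> a) *\<^sub>R x i)"

definition corr :: "'i set \<Rightarrow> ('i \<Rightarrow> 'p::finite datum) \<Rightarrow> real ^ 'p" where
  "corr I z = (\<Sum>i\<in>I. snd (z i) *\<^sub>R fst (z i))"

lemma linear_gram: "linear (gram I x)"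
  unfolding gram_def by (intro linear_compose_sum ballI linearI) (auto simp: inner_add_right scaleR_add_left)

lemma gram_sym: "a \<bullet> gram I x b = gram I x a \<bullet> b"
  by (simp add: gram_def inner_sum_right inner_sum_left inner_commute mult.commute)

lemma inner_gram: "a \<bullet> gram I x a = (\<Sum>i\<in>I. (x i \<bullet> a)\<^sup>2)"
  by (simp add: gram_def inner_sum_right power2_eq_square inner_commute)

lemma gram_insert: "finite I \<Longrightarrow> k \<notin> I \<Longrightarrow> gram (insert k I) x a = (x k \<bullet> a) *\<^sub>R x k + gram I x a"
  by (simp add: gram_def)

lemma gram_cong: "(\<And>i. i \<in> I \<Longrightarrow> x i = y i) \<Longrightarrow> gram I x = gram I y"
  by (simp add: gram_def fun_eq_iff)

lemma gram_mk_data: "gram I (\<lambda>i. fst (mk_data \<beta> I X E i)) = gram I X"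
  by (rule gram_cong) (simp add: mk_data_def)

lemma corr_mk_data: "corr I (mk_data \<beta> I X E) = gram I X \<beta> + (\<Sum>i\<in>I. E i *\<^sub>R X i)"
  by (simp add: corr_def mk_data_def gram_def scaleR_add_left sum.distrib)

text \<open>Multiplying by \<open>n\<close> brings the objective into the form that belongs to
  \<open>lasso_kkt\<close> with penalty \<open>l\<close> itself, up to a term that does not depend
  on \<open>b\<close>.\<close>

lemma lasso_objective_eq:
  assumes "n > 0"
  shows "real n * lasso_objective n l z b = (\<Sum>i=1..n. (snd (z i))\<^sup>2) / 2 +
    (b \<bullet> gram {1..n} (\<lambda>i. fst (z i)) b / 2 - corr {1..n} z \<bullet> b + l * (\<Sum>k\<in>UNIV. \<bar>b $ k\<bar>))"
proof -
  have "(\<Sum>i=1..n. (snd (z i) - fst (z i) \<bullet> b)\<^sup>2) =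
      (\<Sum>i=1..n. (snd (z i))\<^sup>2) + b \<bullet> gram {1..n} (\<lambda>i. fst (z i)) b - 2 * (corr {1..n} z \<bullet> b)"
    by (simp add: inner_gram corr_def inner_sum_left power2_diff sum.distrib sum_subtractf sum_distrib_left mult.assoc)
  then show ?thesis using assms unfolding lasso_objective_def by (simp add: distrib_left)
qed

lemma lasso_estimator_kkt:
  assumes b: "is_lasso_estimator n l bhat" and "n > 0" "l > 0" and z: "z \<in> space (train_space n)"
  shows "lasso_kkt (gram {1..n} (\<lambda>i. fst (z i))) (corr {1..n} z) UNIV l (bhat z)"
proof (rule argmin_imp_lasso_kkt)
  fix a
  have "is_arg_min (lasso_objective n l z) (\<lambda>_. True) (bhat z)"
    using b z by (auto simp: is_lasso_estimator_def)
  then have "lasso_objective n l z (bhat z) \<le> lasso_objective n l z a" by (simp add: is_arg_min_def not_less)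
  then have "real n * lasso_objective n l z (bhat z) \<le> real n * lasso_objective n l z a"
    by (intro mult_left_mono) auto
  then show "bhat z \<bullet> gram {1..n} (\<lambda>i. fst (z i)) (bhat z) / 2 - corr {1..n} z \<bullet> bhat z + l * (\<Sum>k\<in>UNIV. \<bar>bhat z $ k\<bar>)
      \<le> a \<bullet> gram {1..n} (\<lambda>i. fst (z i)) a / 2 - corr {1..n} z \<bullet> a + l * (\<Sum>k\<in>UNIV. \<bar>a $ k\<bar>)"
    unfolding lasso_objective_eq[OF \<open>n > 0\<close>] by simp
qed (use assms in \<open>auto simp: linear_gram gram_sym\<close>)

text \<open>Comparison with \<open>b = 0\<close> bounds the penalty term, and
  \<open>l \<ge> 1\<close> removes the penalty factor. The bound holds for every data set, however
  degenerate its design, and is the only control outside the curvature event.\<close>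

lemma lasso_estimator_bound:
  assumes b: "is_lasso_estimator n l bhat" and "n > 0" "l \<ge> 1" and z: "z \<in> space (train_space n)"
  shows "norm (bhat z) \<le> (\<Sum>i=1..n. (snd (z i))\<^sup>2)"
proof -
  have "is_arg_min (lasso_objective n l z) (\<lambda>_. True) (bhat z)"
    using b z by (auto simp: is_lasso_estimator_def)
  then have "lasso_objective n l z (bhat z) \<le> lasso_objective n l z 0" by (simp add: is_arg_min_def not_less)
  then have "real n * lasso_objective n l z (bhat z) \<le> real n * lasso_objective n l z 0"
    by (intro mult_left_mono) auto
  then have 1: "real n * lasso_objective n l z (bhat z) \<le> (\<Sum>i=1..n. (snd (z i))\<^sup>2) / 2"
    unfolding lasso_objective_eq[OF \<open>n > 0\<close>, of l z 0] by simp
  have "norm (bhat z) \<le> (\<Sum>k\<in>UNIV. \<bar>bhat z $ k\<bar>)" by (rule norm_le_l1_cart)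
  also have "\<dots> \<le> l * (\<Sum>k\<in>UNIV. \<bar>bhat z $ k\<bar>)"
    using mult_right_mono[OF \<open>l \<ge> 1\<close>, of "\<Sum>k\<in>UNIV. \<bar>bhat z $ k\<bar>"] by (simp add: sum_nonneg)
  also have "\<dots> \<le> real n * lasso_objective n l z (bhat z)"
  proof -
    have "real n * lasso_objective n l z (bhat z) =
        1 / 2 * (\<Sum>i=1..n. (snd (z i) - fst (z i) \<bullet> bhat z)\<^sup>2) + l * (\<Sum>k\<in>UNIV. \<bar>bhat z $ k\<bar>)"
      using \<open>n > 0\<close> by (simp add: lasso_objective_def field_simps)
    then show ?thesis by (simp add: sum_nonneg)
  qed
  also note 1
  also have "(\<Sum>i=1..n. (snd (z i))\<^sup>2) / 2 \<le> (\<Sum>i=1..n. (snd (z i))\<^sup>2)" by (simp add: sum_nonneg)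
  finally show ?thesis .
qed

lemma mk_data_in_space [simp]: "mk_data \<beta> {1..n} X E \<in> space (train_space n)"
  by (simp add: mk_data_def space_PiM)

text \<open>An entrywise, hence measurable, sufficient condition for \<open>near_id\<close>.\<close>
definition near_id_entries :: "real \<Rightarrow> real \<Rightarrow> 'i set \<Rightarrow> ('i \<Rightarrow> real ^ 'p::finite) \<Rightarrow> bool" where
  "near_id_entries \<eta> N I x \<longleftrightarrow>
     (\<forall>k l. \<bar>\<Sum>i\<in>I. (x i $ k * x i $ l - (if k = l then 1 else 0))\<bar> \<le> \<eta> * N / (CARD('p) * CARD('p)))"

lemma gram_nth: "gram I x a $ k = (\<Sum>l\<in>UNIV. (\<Sum>i\<in>I. x i $ k * x i $ l) * a $ l)"
proof -
  have "gram I x a $ k = (\<Sum>i\<in>I. \<Sum>l\<in>UNIV. x i $ k * x i $ l * a $ l)"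
    by (simp add: gram_def inner_vec_def sum_distrib_left sum_distrib_right mult_ac)
  also have "\<dots> = (\<Sum>l\<in>UNIV. \<Sum>i\<in>I. x i $ k * x i $ l * a $ l)" by (rule sum.swap)
  finally show ?thesis by (simp add: sum_distrib_right)
qed

text \<open>The factor \<open>CARD('p) * CARD('p)\<close> lost in passing from entries to the
  operator norm is the one divided out in \<open>near_id_entries\<close>.\<close>

lemma norm_matrix_entries_le:
  fixes a b :: "real ^ 'p::finite" and t :: real
  assumes b: "\<And>k. b $ k = (\<Sum>l\<in>UNIV. T k l * a $ l)" and T: "\<And>k l. \<bar>T k l\<bar> \<le> t"
  shows "norm b \<le> real (CARD('p) * CARD('p)) * t * norm a"
proof -
  have t: "t \<ge> 0" using T[of undefined undefined] by linarith
  have "\<bar>b $ k\<bar> \<le> CARD('p) * (t * norm a)" for k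
  proof -
    have "\<bar>b $ k\<bar> \<le> (\<Sum>l\<in>UNIV. \<bar>T k l * a $ l\<bar>)" unfolding b by (rule sum_abs)
    also have "\<dots> \<le> (\<Sum>l\<in>(UNIV :: 'p set). t * norm a)"
      unfolding abs_mult by (intro sum_mono mult_mono T component_le_norm_cart t) auto
    finally show ?thesis by simp
  qed
  from norm_le_entries[OF this] show ?thesis by (simp add: mult.assoc)
qed

lemma near_id_entries_imp:
  fixes x :: "'i \<Rightarrow> real ^ 'p::finite"
  assumes "near_id_entries \<eta> (card I) I x" "finite I"
  shows "near_id \<eta> (card I) (gram I x)"
  unfolding near_id_def
proof
  fix a :: "real ^ 'p"
  let ?T = "\<lambda>k l. \<Sum>i\<in>I. (x i $ k * x i $ l - (if k = l then 1 else 0))"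
  have "(gram I x a - real (card I) *\<^sub>R a) $ k = (\<Sum>l\<in>UNIV. ?T k l * a $ l)" for k
  proof -
    have "(\<Sum>l\<in>UNIV. ?T k l * a $ l) = (\<Sum>l\<in>UNIV. (\<Sum>i\<in>I. x i $ k * x i $ l) * a $ l - (if k = l then card I * a $ l else 0))"
      by (intro sum.cong) (auto simp: sum_subtractf algebra_simps)
    then show ?thesis by (simp add: gram_nth sum_subtractf)
  qed
  moreover have "\<bar>?T k l\<bar> \<le> \<eta> * card I / real (CARD('p) * CARD('p))" for k l
    using assms(1) unfolding near_id_entries_def by blast
  ultimately have "norm (gram I x a - real (card I) *\<^sub>R a)
      \<le> real (CARD('p) * CARD('p)) * (\<eta> * card I / real (CARD('p) * CARD('p))) * norm a"
    by (rule norm_matrix_entries_le)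
  then show "norm (gram I x a - real (card I) *\<^sub>R a) \<le> \<eta> * card I * norm a" by simp
qed

text \<open>A further row of norm at most \<open>R\<close> changes the Gram operator by at most
  \<open>R\<^sup>2\<close> and the centring by 1, which is small against
  \<open>\<eta> * (card I + 1)\<close>. So closeness to the identity can be required of the other
  rows only, and the resampled row need only be bounded.\<close>

lemma near_id_gram_insert:
  fixes x :: "'i \<Rightarrow> real ^ 'p::finite"
  assumes ni: "near_id (\<eta> / 2) (card I) (gram I x)" and I: "finite I" "k \<notin> I"
    and R: "norm (x k) \<le> R" "2 * (1 + R\<^sup>2) \<le> \<eta> * (real (card I) + 1)" and "\<eta> \<ge> 0"
  shows "near_id \<eta> (real (card I) + 1) (gram (insert k I) x)"
  unfolding near_id_def
proof
  fix a
  let ?N = "real (card I)"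
  have "gram (insert k I) x a - (?N + 1) *\<^sub>R a = (gram I x a - ?N *\<^sub>R a) + (x k \<bullet> a) *\<^sub>R x k - a"
    by (simp add: gram_insert[OF I] algebra_simps)
  also have "norm \<dots> \<le> norm (gram I x a - ?N *\<^sub>R a) + norm ((x k \<bullet> a) *\<^sub>R x k) + norm a"
    by (intro order_trans[OF norm_triangle_ineq4] add_right_mono norm_triangle_ineq)
  also have "norm (gram I x a - ?N *\<^sub>R a) \<le> \<eta> / 2 * ?N * norm a" using ni by (simp add: near_id_def)
  also have "norm ((x k \<bullet> a) *\<^sub>R x k) \<le> R\<^sup>2 * norm a"
  proof -
    have "norm ((x k \<bullet> a) *\<^sub>R x k) \<le> (norm (x k) * norm a) * norm (x k)"
      using Cauchy_Schwarz_ineq2[of "x k" a] by (simp add: mult_right_mono)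
    also have "\<dots> = (norm (x k))\<^sup>2 * norm a" by (simp add: power2_eq_square)
    also have "\<dots> \<le> R\<^sup>2 * norm a" using R by (intro mult_right_mono power_mono) auto
    finally show ?thesis .
  qed
  also have "\<eta> / 2 * ?N * norm a + R\<^sup>2 * norm a + norm a = (\<eta> / 2 * ?N + (1 + R\<^sup>2)) * norm a"
    by (simp add: algebra_simps)
  also have "\<dots> \<le> (\<eta> / 2 * ?N + \<eta> * (?N + 1) / 2) * norm a"
    using R(2) by (intro mult_right_mono add_left_mono) (auto simp: add.commute)
  also have "\<dots> \<le> \<eta> * (?N + 1) * norm a"
  proof (rule mult_right_mono)
    have "\<eta> * ?N \<le> \<eta> * (?N + 1)" using \<open>\<eta> \<ge> 0\<close> by (intro mult_left_mono) auto
    then show "\<eta> / 2 * ?N + \<eta> * (?N + 1) / 2 \<le> \<eta> * (?N + 1)" by simp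
  qed simp
  finally show "norm (gram (insert k I) x a - (?N + 1) *\<^sub>R a) \<le> \<eta> * (?N + 1) * norm a" by simp
qed


section \<open>Probabilities of good designs and good noise\<close>

lemma (in prob_space) prob_abs_gt_le_second_moment:
  fixes f :: "'a \<Rightarrow> real"
  assumes "f \<in> borel_measurable M" and V: "(\<integral>\<^sup>+\<omega>. ennreal ((f \<omega>)\<^sup>2) \<partial>M) \<le> ennreal V" and "t > 0" "V \<ge> 0"
  shows "prob {\<omega> \<in> space M. \<bar>f \<omega>\<bar> > t} \<le> V / t\<^sup>2"
proof -
  note [measurable] = assms(1)
  have "emeasure M {\<omega> \<in> space M. \<bar>f \<omega>\<bar> > t} \<le> emeasure M {\<omega> \<in> space M. 1 \<le> ennreal (1 / t\<^sup>2) * ennreal ((f \<omega>)\<^sup>2)}"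
  proof (intro emeasure_mono subsetI)
    fix \<omega> assume w: "\<omega> \<in> {\<omega> \<in> space M. \<bar>f \<omega>\<bar> > t}"
    then have "t\<^sup>2 \<le> (f \<omega>)\<^sup>2" using \<open>t > 0\<close> by (simp add: abs_le_square_iff[symmetric])
    then have "1 \<le> 1 / t\<^sup>2 * (f \<omega>)\<^sup>2" using \<open>t > 0\<close> by (simp add: field_simps)
    then have "ennreal 1 \<le> ennreal (1 / t\<^sup>2 * (f \<omega>)\<^sup>2)" by (rule ennreal_leI)
    then show "\<omega> \<in> {\<omega> \<in> space M. 1 \<le> ennreal (1 / t\<^sup>2) * ennreal ((f \<omega>)\<^sup>2)}"
      using w by (subst (asm) ennreal_mult') auto
  qed measurable
  also have "\<dots> \<le> ennreal (1 / t\<^sup>2) * (\<integral>\<^sup>+\<omega>. ennreal ((f \<omega>)\<^sup>2) * indicator (space M) \<omega> \<partial>M)"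
    using nn_integral_Markov_inequality[of "\<lambda>\<omega>. ennreal ((f \<omega>)\<^sup>2)" "space M" M "ennreal (1 / t\<^sup>2)"] by simp
  also have "(\<integral>\<^sup>+\<omega>. ennreal ((f \<omega>)\<^sup>2) * indicator (space M) \<omega> \<partial>M) = (\<integral>\<^sup>+\<omega>. ennreal ((f \<omega>)\<^sup>2) \<partial>M)"
    by (intro nn_integral_cong) auto
  also have "ennreal (1 / t\<^sup>2) * \<dots> \<le> ennreal (1 / t\<^sup>2) * ennreal V" by (intro mult_left_mono V) auto
  also have "\<dots> = ennreal (V / t\<^sup>2)" by (simp add: ennreal_mult'[symmetric])
  finally show ?thesis using \<open>V \<ge> 0\<close> by (simp add: emeasure_eq_measure)
qed

lemma integrable_gauss_x_prod2:
  fixes k l :: "'p::finite"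
  shows "integrable gauss_x (\<lambda>x. x $ k * x $ l)" "integrable gauss_x (\<lambda>x. (x $ k * x $ l)\<^sup>2)"
proof -
  have ab: "\<bar>a * b\<bar> \<le> a\<^sup>2 + b\<^sup>2" for a b :: real
    using sum_squares_bound[of "\<bar>a\<bar>" "\<bar>b\<bar>"] zero_le_power2[of a] zero_le_power2[of b] unfolding abs_mult power2_abs by linarith
  have i: "integrable gauss_x (\<lambda>x :: real ^ 'p. \<bar>x $ k\<bar> ^ m + \<bar>x $ l\<bar> ^ m)" for m
    by (intro Bochner_Integration.integrable_add integrable_gauss_x_moment)
  show "integrable gauss_x (\<lambda>x. x $ k * x $ l)"
    using ab by (intro Bochner_Integration.integrable_bound[OF i[of 2]]) auto
  show "integrable gauss_x (\<lambda>x. (x $ k * x $ l)\<^sup>2)"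
  proof (intro Bochner_Integration.integrable_bound[OF i[of 4]] AE_I2)
    fix x :: "real ^ 'p"
    show "norm ((x $ k * x $ l)\<^sup>2) \<le> norm (\<bar>x $ k\<bar> ^ 4 + \<bar>x $ l\<bar> ^ 4)"
      using ab[of "(x $ k)\<^sup>2" "(x $ l)\<^sup>2"] by (simp add: power_mult_distrib)
  qed measurable
qed

text \<open>Every centred entry is a sum of i.i.d. centred variables with finite variance, so
  Chebyshev's inequality at a level proportional to \<open>card I\<close> leaves a failure
  probability of order \<open>1 / card I\<close>; a union bound over the entries keeps the order.
  The index set is arbitrary because the resampled row is sometimes left out.\<close>

lemma near_id_entries_prob:
  assumes "\<eta> > 0"
  shows "\<exists>C. \<forall>I :: nat set. finite I \<and> I \<noteq> {} \<longrightarrow>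
     measure (Pi\<^sub>M I (\<lambda>_. gauss_x)) {x \<in> space (Pi\<^sub>M I (\<lambda>_. borel :: (real ^ 'p::finite) measure)). \<not> near_id_entries \<eta> (card I) I x}
       \<le> C / real (card I)"
proof -
  define f where "f k l x = x $ k * x $ l - (if k = l then 1 else 0)" for k l :: 'p and x :: "real ^ 'p"
  define V where "V k l = (\<integral>x. (f k l x)\<^sup>2 \<partial>gauss_x)" for k l
  define q where "q = real (CARD('p) * CARD('p))"
  define C where "C = (\<Sum>k\<in>UNIV. \<Sum>l\<in>UNIV. V k l * q\<^sup>2 / \<eta>\<^sup>2)"
  have q: "q > 0" unfolding q_def by simp
  interpret gx: prob_space "gauss_x :: (real ^ 'p) measure" by (rule prob_space_gauss_x)
  have V0: "V k l \<ge> 0" for k l by (simp add: V_def)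
  have [measurable]: "f k l \<in> borel_measurable borel" for k l unfolding f_def by measurable
  have if1: "integrable gauss_x (f k l)" for k l
    unfolding f_def by (intro Bochner_Integration.integrable_diff integrable_gauss_x_prod2) auto
  have if2: "integrable gauss_x (\<lambda>x. (f k l x)\<^sup>2)" for k l
    unfolding f_def power2_diff
    by (intro Bochner_Integration.integrable_diff Bochner_Integration.integrable_add integrable_mult_left integrable_mult_right integrable_gauss_x_prod2) auto
  have mean: "(\<integral>x. f k l x \<partial>gauss_x) = 0" for k l
    unfolding f_def
    by (subst Bochner_Integration.integral_diff[OF integrable_gauss_x_prod2(1)])
       (auto simp: integral_gauss_x_prod2 gx.prob_space[simplified])
  have "measure (Pi\<^sub>M I (\<lambda>_. gauss_x)) {x \<in> space (Pi\<^sub>M I (\<lambda>_. borel :: (real ^ 'p) measure)). \<not> near_id_entries \<eta> (card I) I x}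
       \<le> C / real (card I)" if I: "finite I" "I \<noteq> {}" for I :: "nat set"
  proof -
    let ?P = "Pi\<^sub>M I (\<lambda>_. gauss_x :: (real ^ 'p) measure)"
    interpret P: prob_space ?P by (intro prob_space_PiM prob_space_gauss_x)
    define N where "N = real (card I)"
    have N: "N > 0" using I by (simp add: N_def card_gt_0_iff)
    define S where "S kl x = (\<Sum>i\<in>I. 1 * f (fst kl) (snd kl) (x i))" for kl and x :: "nat \<Rightarrow> real ^ 'p"
    have [measurable]: "S kl \<in> borel_measurable ?P" for kl unfolding S_def by measurable
    define t where "t = \<eta> * N / q"
    have t: "t > 0" using \<open>\<eta> > 0\<close> N q by (simp add: t_def)
    have bad: "P.prob {x \<in> space ?P. \<bar>S (k, l) x\<bar> > t} \<le> V k l * q\<^sup>2 / \<eta>\<^sup>2 / N" for k l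
    proof -
      have "(\<integral>\<^sup>+x. ennreal ((S (k, l) x)\<^sup>2) \<partial>?P) = ennreal ((\<Sum>i\<in>I. 1\<^sup>2) * V k l)"
        unfolding S_def V_def fst_conv snd_conv by (rule nn_integral_PiM_sum_sq[OF prob_space_gauss_x I(1) if1 if2 mean])
      then have "P.prob {x \<in> space ?P. \<bar>S (k, l) x\<bar> > t} \<le> N * V k l / t\<^sup>2"
        using t V0 N by (intro P.prob_abs_gt_le_second_moment) (auto simp: N_def)
      also have "\<dots> = V k l * q\<^sup>2 / \<eta>\<^sup>2 / N"
        using N q \<open>\<eta> > 0\<close> by (simp add: t_def power2_eq_square field_simps)
      finally show ?thesis .
    qed
    have sp: "space (Pi\<^sub>M I (\<lambda>_. borel :: (real ^ 'p) measure)) = space ?P" by (simp add: space_PiM)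
    have "{x \<in> space ?P. \<not> near_id_entries \<eta> (card I) I x} = (\<Union>kl\<in>UNIV. {x \<in> space ?P. \<bar>S kl x\<bar> > t})"
    proof -
      have "near_id_entries \<eta> (card I) I x \<longleftrightarrow> (\<forall>k l. \<bar>S (k, l) x\<bar> \<le> t)" for x
        unfolding near_id_entries_def S_def f_def t_def q_def N_def by simp
      then show ?thesis by (auto simp: not_le)
    qed
    then have "P.prob {x \<in> space ?P. \<not> near_id_entries \<eta> (card I) I x} \<le> (\<Sum>kl\<in>UNIV. P.prob {x \<in> space ?P. \<bar>S kl x\<bar> > t})"
      by (simp only:) (rule P.finite_measure_subadditive_finite, auto)
    also have "\<dots> \<le> (\<Sum>kl\<in>UNIV. V (fst kl) (snd kl) * q\<^sup>2 / \<eta>\<^sup>2 / N)"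
    proof (rule sum_mono)
      show "P.prob {x \<in> space ?P. \<bar>S kl x\<bar> > t} \<le> V (fst kl) (snd kl) * q\<^sup>2 / \<eta>\<^sup>2 / N" for kl
        using bad[of "fst kl" "snd kl"] by simp
    qed
    also have "\<dots> = C / N"
    proof -
      have "C = (\<Sum>kl\<in>UNIV \<times> UNIV. V (fst kl) (snd kl) * q\<^sup>2 / \<eta>\<^sup>2)"
        unfolding C_def sum.cartesian_product by (simp add: case_prod_unfold)
      then show ?thesis by (simp add: sum_divide_distrib)
    qed
    finally show ?thesis by (simp add: sp N_def)
  qed
  then show ?thesis by blast
qed

lemma measurable_near_id_entries [measurable]:
  "Measurable.pred (Pi\<^sub>M I (\<lambda>_. borel)) (near_id_entries \<eta> N I)"
  unfolding near_id_entries_def by measurable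

text \<open>Chebyshev's inequality for one linear form and for the \<open>CARD('p)\<close>
  coordinates of the noise correlation. The thresholds give failure probabilities at most
  \<open>1 / 4\<close> and \<open>1 / (8 * CARD('p))\<close>, together less than one half.\<close>

lemma noise_event_prob:
  fixes X :: "'i \<Rightarrow> real ^ 'p::finite" and n :: real
  assumes \<tau>: "\<tau> > 0" and I: "finite I" and n: "n > 0"
    and X: "\<And>k. (\<Sum>i\<in>I. (X i $ k)\<^sup>2) \<le> 2 * n" and u: "(\<Sum>i\<in>I. (u i)\<^sup>2) \<le> 4"
  shows "emeasure (Pi\<^sub>M I (\<lambda>_. gauss_e \<tau>)) {E \<in> space (Pi\<^sub>M I (\<lambda>_. borel)).
      \<bar>\<Sum>i\<in>I. u i * E i\<bar> \<le> 4 * \<tau> \<and> norm (\<Sum>i\<in>I. E i *\<^sub>R X i) \<le> 4 * (real CARD('p))\<^sup>2 * \<tau> * sqrt n} \<ge> ennreal (1 / 2)"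
proof -
  let ?P = "Pi\<^sub>M I (\<lambda>_. gauss_e \<tau>)"
  interpret P: prob_space ?P by (intro prob_space_PiM prob_space_gauss_e[OF \<tau>])
  have sp: "space (Pi\<^sub>M I (\<lambda>_. borel :: real measure)) = space ?P" by (simp add: space_PiM)
  let ?p = "real CARD('p)"
  have p: "?p \<ge> 1" using zero_less_card_finite[where 'a='p] by linarith
  have ie: "integrable (gauss_e \<tau>) (\<lambda>e. e)"
    using integrable_gauss_e_moment[OF \<tau>, of 1]
    by (intro Bochner_Integration.integrable_bound[OF integrable_gauss_e_moment[OF \<tau>, of 1]]) auto
  have ie2: "integrable (gauss_e \<tau>) (\<lambda>e. e\<^sup>2)" using integrable_gauss_e_moment[OF \<tau>, of 2] by simp
  have var: "(\<integral>e. e\<^sup>2 \<partial>gauss_e \<tau>) = \<tau>\<^sup>2"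
    using nn_integral_gauss_e_sq[OF \<tau>] by (subst integral_eq_nn_integral) auto
  have cheb: "P.prob {E \<in> space ?P. \<bar>\<Sum>i\<in>I. c i * E i\<bar> > t} \<le> (\<Sum>i\<in>I. (c i)\<^sup>2) * \<tau>\<^sup>2 / t\<^sup>2" if "t > 0" for c t
  proof (rule P.prob_abs_gt_le_second_moment[of "\<lambda>E. \<Sum>i\<in>I. c i * E i"])
    show "(\<integral>\<^sup>+E. ennreal ((\<Sum>i\<in>I. c i * E i)\<^sup>2) \<partial>?P) \<le> ennreal ((\<Sum>i\<in>I. (c i)\<^sup>2) * \<tau>\<^sup>2)"
      using nn_integral_PiM_sum_sq[OF prob_space_gauss_e[OF \<tau>] I ie ie2 integral_gauss_e_id[OF \<tau>], of c] var by simp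
  qed (use that in \<open>auto intro!: mult_nonneg_nonneg sum_nonneg\<close>)
  define t where "t = 4 * ?p * \<tau> * sqrt n"
  have t: "t > 0" using p \<tau> n by (simp add: t_def)
  define B where "B = {E \<in> space ?P. \<bar>\<Sum>i\<in>I. u i * E i\<bar> > 4 * \<tau>}"
  define W where "W k = {E \<in> space ?P. \<bar>\<Sum>i\<in>I. X i $ k * E i\<bar> > t}" for k
  have B: "P.prob B \<le> 1 / 4"
  proof -
    have "P.prob B \<le> (\<Sum>i\<in>I. (u i)\<^sup>2) * \<tau>\<^sup>2 / (4 * \<tau>)\<^sup>2" unfolding B_def by (rule cheb) (use \<tau> in simp)
    also have "\<dots> \<le> 4 * \<tau>\<^sup>2 / (4 * \<tau>)\<^sup>2" using u by (intro divide_right_mono mult_right_mono) auto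
    also have "\<dots> = 1 / 4" using \<tau> by (simp add: power2_eq_square)
    finally show ?thesis .
  qed
  have W: "P.prob (W k) \<le> 1 / (8 * ?p)" for k
  proof -
    have "P.prob (W k) \<le> (\<Sum>i\<in>I. (X i $ k)\<^sup>2) * \<tau>\<^sup>2 / t\<^sup>2" unfolding W_def by (rule cheb) (rule t)
    also have "\<dots> \<le> (2 * n) * \<tau>\<^sup>2 / t\<^sup>2" using X by (intro divide_right_mono mult_right_mono) auto
    also have "t\<^sup>2 = 16 * ?p\<^sup>2 * \<tau>\<^sup>2 * n" using n by (simp add: t_def power_mult_distrib)
    also have "2 * n * \<tau>\<^sup>2 / (16 * ?p\<^sup>2 * \<tau>\<^sup>2 * n) = 1 / (8 * ?p * ?p)"
      using \<tau> n p by (simp add: power2_eq_square)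
    also have "\<dots> \<le> 1 / (8 * ?p)" using p by (intro divide_left_mono) auto
    finally show ?thesis .
  qed
  have [measurable]: "B \<in> sets ?P" "W k \<in> sets ?P" for k unfolding B_def W_def by measurable
  have "P.prob (B \<union> (\<Union>k\<in>UNIV. W k)) \<le> P.prob B + P.prob (\<Union>k\<in>UNIV. W k)" by (rule measure_Un_le) auto
  also have "P.prob (\<Union>k\<in>UNIV. W k) \<le> (\<Sum>k\<in>UNIV. P.prob (W k))"
    by (rule P.finite_measure_subadditive_finite) auto
  also have "\<dots> \<le> (\<Sum>k\<in>(UNIV :: 'p set). 1 / (8 * ?p))" by (intro sum_mono W)
  also have "\<dots> = 1 / 8" using p by simp
  finally have "P.prob (B \<union> (\<Union>k\<in>UNIV. W k)) \<le> 1 / 2" using B by simp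
  then have half: "P.prob (space ?P - (B \<union> (\<Union>k\<in>UNIV. W k))) \<ge> 1 / 2" by (subst P.prob_compl) auto
  have sub: "space ?P - (B \<union> (\<Union>k\<in>UNIV. W k)) \<subseteq> {E \<in> space ?P. \<bar>\<Sum>i\<in>I. u i * E i\<bar> \<le> 4 * \<tau> \<and>
      norm (\<Sum>i\<in>I. E i *\<^sub>R X i) \<le> 4 * ?p\<^sup>2 * \<tau> * sqrt n}" (is "_ \<subseteq> ?G")
  proof
    fix E assume E: "E \<in> space ?P - (B \<union> (\<Union>k\<in>UNIV. W k))"
    have "\<bar>(\<Sum>i\<in>I. E i *\<^sub>R X i) $ k\<bar> \<le> t" for k
      using E by (auto simp: W_def not_less mult.commute)
    from norm_le_entries[OF this] have "norm (\<Sum>i\<in>I. E i *\<^sub>R X i) \<le> 4 * ?p\<^sup>2 * \<tau> * sqrt n"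
      by (simp add: t_def power2_eq_square mult_ac)
    then show "E \<in> ?G" using E by (auto simp: B_def not_less)
  qed
  have "ennreal (1 / 2) \<le> ennreal (P.prob (space ?P - (B \<union> (\<Union>k\<in>UNIV. W k))))" by (intro ennreal_leI half)
  also have "\<dots> = emeasure ?P (space ?P - (B \<union> (\<Union>k\<in>UNIV. W k)))" by (simp add: P.emeasure_eq_measure)
  also have "\<dots> \<le> emeasure ?P ?G" by (intro emeasure_mono sub) measurable
  finally show ?thesis by (simp add: sp)
qed


section \<open>Crossing events under translation of the noise\<close>

lemma near_id_gram_col:
  assumes "near_id \<eta> N (gram I X)" "\<eta> \<le> 1" "N \<ge> 0"
  shows "(\<Sum>i\<in>I. (X i $ k)\<^sup>2) \<le> 2 * N"
proof -
  have "(\<Sum>i\<in>I. (X i $ k)\<^sup>2) = axis k 1 \<bullet> gram I X (axis k 1)"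
    by (simp add: inner_gram inner_axis)
  also have "\<dots> \<le> (1 + \<eta>) * N * (norm (axis k (1::real)))\<^sup>2" by (rule near_id_curvature(3)[OF assms(1)])
  also have "\<dots> \<le> 2 * N" using mult_right_mono[of "1 + \<eta>" 2 N] assms by (simp add: norm_axis_1)
  finally show ?thesis .
qed

text \<open>Shifting the noise by multiples of the fitted values of \<open>a\<close> adds
  \<open>s *\<^sub>R gram I X a\<close> to the noise correlation, so only coordinate
  \<open>j\<close> moves.\<close>

lemma sum_scaleR_shift:
  fixes X :: "'i \<Rightarrow> real ^ 'p::finite"
  assumes "gram I X a = m *\<^sub>R axis j 1"
  shows "(\<Sum>i\<in>I. (E i + s * (X i \<bullet> a)) *\<^sub>R X i) = (\<Sum>i\<in>I. E i *\<^sub>R X i) + (s * m) *\<^sub>R axis j 1"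
proof -
  have "(\<Sum>i\<in>I. (E i + s * (X i \<bullet> a)) *\<^sub>R X i) = (\<Sum>i\<in>I. E i *\<^sub>R X i) + s *\<^sub>R gram I X a"
    by (simp add: gram_def scaleR_add_left sum.distrib scaleR_sum_right)
  then show ?thesis by (simp add: assms)
qed

text \<open>The design and two noise values \<open>e\<close>, \<open>e'\<close> of observation
  \<open>a\<close> are fixed. For a typical vector of the remaining noise, translation along
  \<open>u\<close> meets a window of length \<open>1 / sqrt n\<close> in which coordinate
  \<open>j\<close> is positive for \<open>e\<close> with the larger penalty and not positive for
  \<open>e'\<close> with the smaller one; \<open>gauss_section_lower_bound\<close> converts this
  length into a probability.\<close>

lemma crossing_prob:
  fixes X :: "'i \<Rightarrow> real ^ 'p::finite" and \<beta> x :: "real ^ 'p" and e e' l \<delta> L D K R :: real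
  assumes \<tau>: "\<tau> > 0" and I: "finite I" "a \<notin> I" "card I \<ge> 1" and n: "n = real (card I) + 1"
    and niX: "near_id (\<eta> / 2) (card I) (gram I X)"
    and et: "0 \<le> \<eta>" "\<eta> * (4 * R) \<le> 1" "\<eta> * (2 * CARD('p)) \<le> 1" "\<eta> \<le> 1 / 4" "2 * (1 + R\<^sup>2) \<le> \<eta> * n"
    and x: "x $ j \<ge> 1" "norm x \<le> R" and e: "e \<ge> K" "e \<le> K + 1" "e' \<le> - K" and K: "K \<ge> 1 + 2 * D"
    and \<beta>: "\<beta> $ j = 0" and l: "0 \<le> l" "0 \<le> \<delta>" "\<delta> \<le> D" "l + \<delta> \<le> L * sqrt n"
    and S: "S = 3 * (4 * (real CARD('p))\<^sup>2 * \<tau> + (K + 1) * R + L * CARD('p)) + 1"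
    and b2: "\<And>E. E \<in> space (Pi\<^sub>M I (\<lambda>_. borel)) \<Longrightarrow>
      lasso_kkt (gram (insert a I) (X(a := x))) (gram (insert a I) (X(a := x)) \<beta> + (\<Sum>i\<in>I. E i *\<^sub>R X i) + e *\<^sub>R x) UNIV (l + \<delta>) (b2 E)"
    and b1: "\<And>E. E \<in> space (Pi\<^sub>M I (\<lambda>_. borel)) \<Longrightarrow>
      lasso_kkt (gram (insert a I) (X(a := x))) (gram (insert a I) (X(a := x)) \<beta> + (\<Sum>i\<in>I. E i *\<^sub>R X i) + e' *\<^sub>R x) UNIV l (b1 E)"
    and [measurable]: "b1 \<in> borel_measurable (Pi\<^sub>M I (\<lambda>_. borel))" "b2 \<in> borel_measurable (Pi\<^sub>M I (\<lambda>_. borel))"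
  shows "emeasure (Pi\<^sub>M I (\<lambda>_. gauss_e \<tau>)) {E \<in> space (Pi\<^sub>M I (\<lambda>_. borel)). b2 E $ j > 0 \<and> b1 E $ j \<le> 0}
    \<ge> ennreal (1 / (4 * S) * exp (- (8 * S * \<tau> + 4 * S\<^sup>2) / (2 * \<tau>\<^sup>2)) / sqrt n)"
proof -
  let ?P = "Pi\<^sub>M I (\<lambda>_. gauss_e \<tau>)" and ?B = "Pi\<^sub>M I (\<lambda>_. borel :: real measure)"
  define G where "G = gram (insert a I) (X(a := x))"
  let ?N = "real (card I)"
  have hN: "?N \<ge> 1" using I by simp
  have n1: "n \<ge> 2" using n hN by simp
  have D0: "D \<ge> 0" using l by simp
  have R0: "R \<ge> 1" using x component_le_norm_cart[of x j] by simp
  have K0: "K \<ge> 1" using K D0 by simp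
  have gramX: "gram I (X(a := x)) = gram I X" using I by (intro gram_cong) auto
  have "near_id \<eta> (?N + 1) (gram (insert a I) (X(a := x)))"
  proof (rule near_id_gram_insert[where R = R, OF _ I(1,2) _ _ et(1)])
    show "2 * (1 + R\<^sup>2) \<le> \<eta> * (real (card I) + 1)" using et n by simp
  qed (use niX x in \<open>simp_all add: gramX\<close>)
  then have "near_id \<eta> n G" by (simp add: G_def n)
  then interpret near_id_gram G \<eta> n
    using et n1 by (intro near_id_gram.intro) (simp_all add: G_def linear_gram gram_sym)
  \<comment> \<open>With this scaling the direction \<open>u\<close> has squared length at most 4,
    independently of \<open>n\<close>; this keeps the translation weight bounded below.\<close>
  define m where "m = sqrt n"
  have m: "m \<ge> 1" "m > 0" "m\<^sup>2 = n" using n1 by (auto simp: m_def)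
  have "0 \<le> L * m" using l by (simp add: m_def)
  then have L0: "L \<ge> 0" using m by (simp add: zero_le_mult_iff)
  have S1: "S \<ge> 1" using S \<tau> K0 R0 L0 by simp
  obtain c where c: "gram I X c = m *\<^sub>R axis j 1" "c \<bullet> gram I X c \<le> 2 * m\<^sup>2 / ?N"
    using near_id_solve[OF linear_gram niX, of m j] et hN by auto
  define u where "u i = X i \<bullet> c" for i
  have "(\<Sum>i\<in>I. (u i)\<^sup>2) = c \<bullet> gram I X c" by (simp add: inner_gram u_def)
  also note c(2)
  also have "2 * m\<^sup>2 / ?N \<le> 4" using hN by (simp add: m n field_simps)
  finally have u: "(\<Sum>i\<in>I. (u i)\<^sup>2) \<le> 4" .
  have X: "(\<Sum>i\<in>I. (X i $ k)\<^sup>2) \<le> 2 * n" for k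
    using near_id_gram_col[OF niX, of k] et n by simp
  let ?W = "4 * (real CARD('p))\<^sup>2 * \<tau>"
  define E0 where "E0 = {E \<in> space ?B. \<bar>\<Sum>i\<in>I. u i * E i\<bar> \<le> 4 * \<tau> \<and> norm (\<Sum>i\<in>I. E i *\<^sub>R X i) \<le> ?W * sqrt n}"
  let ?A = "{E \<in> space ?B. b2 E $ j > 0 \<and> b1 E $ j \<le> 0}"
  have half: "emeasure ?P E0 \<ge> ennreal (1 / 2)"
    unfolding E0_def using n1 by (intro noise_event_prob[OF \<tau> I(1) _ X u]) simp
  have [measurable]: "E0 \<in> sets ?B" unfolding E0_def by measurable
  have "\<exists>s0. - S \<le> s0 \<and> s0 + 1 / m \<le> S \<and> (\<forall>s. s0 < s \<longrightarrow> s < s0 + 1 / m \<longrightarrow> (\<lambda>i\<in>I. E i + s * u i) \<in> ?A)"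
    if E: "E \<in> E0" for E
  proof -
    define w where "w = (\<Sum>i\<in>I. E i *\<^sub>R X i)"
    have w: "norm w \<le> ?W * m" using E by (simp add: E0_def w_def m_def)
    define T where "T s = (\<lambda>i\<in>I. E i + s * u i)" for s
    have T: "T s \<in> space ?B" for s by (simp add: T_def space_PiM)
    have wT: "(\<Sum>i\<in>I. T s i *\<^sub>R X i) = w + (s * m) *\<^sub>R axis j 1" for s
      using sum_scaleR_shift[OF c(1), of E s] by (simp add: T_def u_def w_def)
    have "\<exists>s0. \<bar>s0\<bar> * m \<le> 3 * (norm w + norm (e *\<^sub>R x) + (l + \<delta>) * CARD('p))
      \<and> (\<forall>s. s0 < s \<longrightarrow> s \<le> s0 + 1 / m \<longrightarrow> b2 (T s) $ j > 0 \<and> b1 (T s) $ j \<le> 0)"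
    proof (rule crossing_interval[OF \<beta> m(2) l(1,2), where q' = "e' *\<^sub>R x"])
      have ee: "e - e' \<ge> 2 * K" using e by simp
      have "norm (e *\<^sub>R x - e' *\<^sub>R x) = (e - e') * norm x"
        using ee K0 by (simp flip: scaleR_left_diff_distrib)
      also have "\<dots> \<le> (e - e') * R" using x ee K0 by (intro mult_left_mono) auto
      finally have nx: "norm (e *\<^sub>R x - e' *\<^sub>R x) \<le> (e - e') * R" .
      have "2 * \<eta> * (norm (e *\<^sub>R x - e' *\<^sub>R x) + \<delta> * CARD('p)) \<le> 2 * \<eta> * ((e - e') * R + \<delta> * CARD('p))"
        using nx et by (intro mult_left_mono) auto
      also have "\<dots> = (e - e') / 2 * (\<eta> * (4 * R)) + \<delta> * (\<eta> * (2 * CARD('p)))" by (simp add: field_simps)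
      also have "\<dots> \<le> (e - e') / 2 * 1 + \<delta> * 1"
        using et l ee K0 by (intro add_mono mult_left_mono) auto
      finally have 1: "2 * \<eta> * (norm (e *\<^sub>R x - e' *\<^sub>R x) + \<delta> * CARD('p)) \<le> (e - e') / 2 + \<delta>" by simp
      have "(e *\<^sub>R x) $ j - (e' *\<^sub>R x) $ j = (e - e') * x $ j" by (simp add: algebra_simps)
      also have "\<dots> \<ge> (e - e') * 1" using x ee K0 by (intro mult_left_mono) auto
      finally have 2: "(e *\<^sub>R x) $ j - (e' *\<^sub>R x) $ j \<ge> e - e'" by simp
      \<comment> \<open>Half of \<open>e - e'\<close> pays for the off-diagonal error; the other
        half is at least \<open>K\<close> and pays for \<open>1 + 2 * \<delta>\<close>. Hence the
        requirement \<open>K \<ge> 1 + 2 * D\<close>.\<close>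
      have 3: "e - e' \<ge> 1 + \<delta> + ((e - e') / 2 + \<delta>)" using ee K l by (simp add: field_simps)
      have "1 + \<delta> + 2 * \<eta> * (norm (e *\<^sub>R x - e' *\<^sub>R x) + \<delta> * CARD('p)) \<le> 1 + \<delta> + ((e - e') / 2 + \<delta>)"
        by (intro add_left_mono 1)
      also note 3
      also note 2
      finally show "(e *\<^sub>R x) $ j - (e' *\<^sub>R x) $ j \<ge> 1 + \<delta> + 2 * \<eta> * (norm (e *\<^sub>R x - e' *\<^sub>R x) + \<delta> * CARD('p))" .
      show "lasso_kkt G (G \<beta> + w + e *\<^sub>R x + (s * m) *\<^sub>R axis j 1) UNIV (l + \<delta>) (b2 (T s))" for s
        using b2[OF T[of s]] unfolding wT G_def[symmetric] by (simp add: add_ac)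
      show "lasso_kkt G (G \<beta> + w + e' *\<^sub>R x + (s * m) *\<^sub>R axis j 1) UNIV l (b1 (T s))" for s
        using b1[OF T[of s]] unfolding wT G_def[symmetric] by (simp add: add_ac)
    qed
    then obtain s0 where s0: "\<bar>s0\<bar> * m \<le> 3 * (norm w + norm (e *\<^sub>R x) + (l + \<delta>) * CARD('p))"
      "\<And>s. s0 < s \<Longrightarrow> s \<le> s0 + 1 / m \<Longrightarrow> b2 (T s) $ j > 0 \<and> b1 (T s) $ j \<le> 0" by blast
    have "norm (e *\<^sub>R x) \<le> (K + 1) * R" using e K0 x by (simp add: mult_mono)
    also have "\<dots> \<le> (K + 1) * R * m" using m K0 R0 by simp
    finally have ex: "norm (e *\<^sub>R x) \<le> (K + 1) * R * m" .
    have lp: "(l + \<delta>) * CARD('p) \<le> L * m * CARD('p)" using l by (intro mult_right_mono) (auto simp: m_def)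
    note s0(1)
    also have "3 * (norm w + norm (e *\<^sub>R x) + (l + \<delta>) * CARD('p)) \<le> 3 * (?W * m + (K + 1) * R * m + L * m * CARD('p))"
      by (intro mult_left_mono add_mono w ex lp) simp
    \<comment> \<open>All three contributions are of order \<open>m\<close>, so the start of the
      window is bounded; the extra 1 in \<open>S\<close> makes room for its length
      \<open>1 / m \<le> 1\<close>.\<close>
    also have "\<dots> = (S - 1) * m" by (simp add: S algebra_simps)
    finally have "\<bar>s0\<bar> \<le> S - 1" using m by simp
    moreover have "1 / m \<le> 1" using m by simp
    ultimately have "- S \<le> s0" "s0 + 1 / m \<le> S" by (auto simp: abs_le_iff)
    then show ?thesis using s0(2) T by (intro exI[of _ s0]) (auto simp: T_def)
  qed
  then have fin: "ennreal (1 / m / (2 * S) * exp (- (2 * S * (4 * \<tau>) + S\<^sup>2 * 4) / (2 * \<tau>\<^sup>2))) * emeasure ?P E0 \<le> emeasure ?P ?A"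
    using u m S1 by (intro gauss_section_lower_bound[OF \<tau> I(1)]) (auto simp: E0_def)
  have "ennreal (1 / (4 * S) * exp (- (8 * S * \<tau> + 4 * S\<^sup>2) / (2 * \<tau>\<^sup>2)) / sqrt n)
    = ennreal (1 / m / (2 * S) * exp (- (2 * S * (4 * \<tau>) + S\<^sup>2 * 4) / (2 * \<tau>\<^sup>2))) * ennreal (1 / 2)"
    using S1 m by (subst ennreal_mult'[symmetric]) (auto simp: m_def mult_ac)
  also note mult_left_mono[OF half zero_le]
  also note fin
  finally show ?thesis .
qed

text \<open>No narrow window is involved: every \<open>s\<close> between \<open>S - 1\<close> and
  \<open>S\<close> pushes the \<open>j\<close>-th correlation past the threshold by at least
  \<open>sqrt n\<close>, so the event has a probability bounded below independently of
  \<open>n\<close>.\<close>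

lemma large_coord_prob:
  fixes X :: "'i \<Rightarrow> real ^ 'p::finite" and \<beta> :: "real ^ 'p" and l L :: real
  assumes \<tau>: "\<tau> > 0" and I: "finite I" "card I \<ge> 1" and n: "n = real (card I)"
    and ni: "near_id \<eta> n (gram I X)" and eta: "0 \<le> \<eta>" "\<eta> \<le> 1 / 4"
    and \<beta>: "\<beta> $ j = 0" and l: "0 \<le> l" "l \<le> L * sqrt n"
    and S: "S = L + 2 * (4 * (real CARD('p))\<^sup>2 * \<tau> + L * CARD('p)) + 2"
    and b: "\<And>E. E \<in> space (Pi\<^sub>M I (\<lambda>_. borel)) \<Longrightarrow>
      lasso_kkt (gram I X) (gram I X \<beta> + (\<Sum>i\<in>I. E i *\<^sub>R X i)) UNIV l (b E)"
    and [measurable]: "b \<in> borel_measurable (Pi\<^sub>M I (\<lambda>_. borel))"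
  shows "emeasure (Pi\<^sub>M I (\<lambda>_. gauss_e \<tau>)) {E \<in> space (Pi\<^sub>M I (\<lambda>_. borel)). b E $ j \<ge> 1 / (4 * sqrt n)}
    \<ge> ennreal (1 / (4 * S) * exp (- (8 * S * \<tau> + 4 * S\<^sup>2) / (2 * \<tau>\<^sup>2)))"
proof -
  let ?P = "Pi\<^sub>M I (\<lambda>_. gauss_e \<tau>)" and ?B = "Pi\<^sub>M I (\<lambda>_. borel :: real measure)"
  have n1: "n \<ge> 1" using n I by simp
  interpret near_id_gram "gram I X" \<eta> n
    using eta n1 ni by (intro near_id_gram.intro) (simp_all add: linear_gram gram_sym)
  define m where "m = sqrt n"
  have m: "m \<ge> 1" "m > 0" "m\<^sup>2 = n" using n1 by (auto simp: m_def)
  have "0 \<le> L * m" using l by (simp add: m_def)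
  then have L0: "L \<ge> 0" using m by (simp add: zero_le_mult_iff)
  have S1: "S \<ge> 1" using S \<tau> L0 by simp
  have eta2: "\<eta> \<le> 1 / 2" using eta by simp
  obtain c where c: "gram I X c = m *\<^sub>R axis j 1" "c \<bullet> gram I X c \<le> 2 * m\<^sup>2 / n"
    using near_id_solve[OF lin ni eta2 N, of m j] by auto
  define u where "u i = X i \<bullet> c" for i
  have "(\<Sum>i\<in>I. (u i)\<^sup>2) = c \<bullet> gram I X c" by (simp add: inner_gram u_def)
  also note c(2)
  also have "2 * m\<^sup>2 / n \<le> 4" using n1 by (simp add: m)
  finally have u: "(\<Sum>i\<in>I. (u i)\<^sup>2) \<le> 4" .
  have X: "(\<Sum>i\<in>I. (X i $ k)\<^sup>2) \<le> 2 * n" for k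
    using near_id_gram_col[OF ni, of k] eta n1 by simp
  let ?W = "4 * (real CARD('p))\<^sup>2 * \<tau>"
  define E0 where "E0 = {E \<in> space ?B. \<bar>\<Sum>i\<in>I. u i * E i\<bar> \<le> 4 * \<tau> \<and> norm (\<Sum>i\<in>I. E i *\<^sub>R X i) \<le> ?W * sqrt n}"
  let ?A = "{E \<in> space ?B. b E $ j \<ge> 1 / (4 * sqrt n)}"
  have half: "emeasure ?P E0 \<ge> ennreal (1 / 2)"
    unfolding E0_def using n1 by (intro noise_event_prob[OF \<tau> I(1) _ X u]) simp
  have [measurable]: "E0 \<in> sets ?B" unfolding E0_def by measurable
  have "\<exists>s0. - S \<le> s0 \<and> s0 + 1 \<le> S \<and> (\<forall>s. s0 < s \<longrightarrow> s < s0 + 1 \<longrightarrow> (\<lambda>i\<in>I. E i + s * u i) \<in> ?A)"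
    if E: "E \<in> E0" for E
  proof (intro exI[of _ "S - 1"] conjI allI impI)
    show "- S \<le> S - 1" "S - 1 + 1 \<le> S" using S1 by auto
    fix s assume s: "S - 1 < s" "s < S - 1 + 1"
    define w where "w = (\<Sum>i\<in>I. E i *\<^sub>R X i)"
    have w: "norm w \<le> ?W * m" using E by (simp add: E0_def w_def m_def)
    define T where "T = (\<lambda>i\<in>I. E i + s * u i)"
    have T: "T \<in> space ?B" by (simp add: T_def space_PiM)
    have wT: "(\<Sum>i\<in>I. T i *\<^sub>R X i) = w + (s * m) *\<^sub>R axis j 1"
      using sum_scaleR_shift[OF c(1), of E s] by (simp add: T_def u_def w_def)
    have lL: "l \<le> L * m" using l by (simp add: m_def)
    have lp: "l * CARD('p) \<le> L * m * CARD('p)" using lL by (intro mult_right_mono) auto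
    have "l + 2 * (norm w + l * CARD('p)) + m \<le> L * m + 2 * (?W * m + L * m * CARD('p)) + m"
      by (intro add_mono mult_left_mono lL w lp) auto
    also have "\<dots> = (S - 1) * m" by (simp add: S algebra_simps)
    also have "\<dots> \<le> s * m" using s m by simp
    finally have big: "s * m \<ge> l + 2 * (norm w + l * CARD('p)) + m" .
    have "lasso_kkt (gram I X) (gram I X \<beta> + w + (s * m) *\<^sub>R axis j 1) UNIV l (b T)"
      using b[OF T] unfolding wT by (simp add: add_ac)
    from large_coord[OF \<beta> l(1) m(2) big this] have "b T $ j \<ge> m / (4 * n)" .
    moreover have "m / (4 * n) = 1 / (4 * m)" using m by (simp add: m(3)[symmetric] power2_eq_square)
    ultimately show "(\<lambda>i\<in>I. E i + s * u i) \<in> ?A" using T by (simp add: T_def m_def)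
  qed
  then have fin: "ennreal (1 / (2 * S) * exp (- (2 * S * (4 * \<tau>) + S\<^sup>2 * 4) / (2 * \<tau>\<^sup>2))) * emeasure ?P E0 \<le> emeasure ?P ?A"
    using u m S1 by (intro gauss_section_lower_bound[OF \<tau> I(1)]) (auto simp: E0_def)
  have "ennreal (1 / (4 * S) * exp (- (8 * S * \<tau> + 4 * S\<^sup>2) / (2 * \<tau>\<^sup>2)))
    = ennreal (1 / (2 * S) * exp (- (2 * S * (4 * \<tau>) + S\<^sup>2 * 4) / (2 * \<tau>\<^sup>2))) * ennreal (1 / 2)"
    using S1 by (subst ennreal_mult'[symmetric]) (auto simp: mult_ac)
  also note mult_left_mono[OF half zero_le]
  also note fin
  finally show ?thesis .
qed


section \<open>Full support, and resampling of the noise alone\<close>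

text \<open>The density is strictly positive and a nonempty open set is not Lebesgue null.\<close>

lemma emeasure_gauss_x_pos:
  assumes "open U" "U \<noteq> {}" shows "emeasure gauss_x U > 0"
proof (rule ccontr)
  assume "\<not> emeasure gauss_x U > 0"
  moreover have [measurable]: "U \<in> sets borel" using assms by simp
  ultimately have "(\<integral>\<^sup>+x. ennreal (std_gaussian_density x) * indicator U x \<partial>lborel) = 0"
    by (simp add: gauss_x_def emeasure_density)
  then have "AE x in lborel. ennreal (std_gaussian_density x) * indicator U x = 0"
    by (subst (asm) nn_integral_0_iff_AE) auto
  then have "AE x in lborel. x \<notin> U"
  proof (rule AE_mp, intro AE_I2 impI)
    fix x assume "ennreal (std_gaussian_density x) * indicator U x = 0"
    then show "x \<notin> U" using std_gaussian_density_pos[of x] by (auto simp: indicator_def split: if_splits)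
  qed
  then have "U \<in> null_sets lborel" by (subst AE_iff_null_sets) auto
  then show False using open_not_negligible[OF assms] by (simp add: negligible_iff_null_sets null_sets_completionI)
qed

lemma emeasure_gauss_e_pos:
  assumes "open U" "U \<noteq> {}" "\<tau> > 0" shows "emeasure (gauss_e \<tau>) U > 0"
proof (rule ccontr)
  assume "\<not> emeasure (gauss_e \<tau>) U > 0"
  moreover have [measurable]: "U \<in> sets borel" using assms by simp
  ultimately have "(\<integral>\<^sup>+x. ennreal (normal_density 0 \<tau> x) * indicator U x \<partial>lborel) = 0"
    by (simp add: gauss_e_def emeasure_density)
  then have "AE x in lborel. ennreal (normal_density 0 \<tau> x) * indicator U x = 0"
    by (subst (asm) nn_integral_0_iff_AE) auto
  then have "AE x in lborel. x \<notin> U"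
  proof (rule AE_mp, intro AE_I2 impI)
    fix x assume "ennreal (normal_density 0 \<tau> x) * indicator U x = 0"
    then show "x \<notin> U" using normal_density_pos[OF assms(3), of 0 x] by (auto simp: indicator_def split: if_splits)
  qed
  then have "U \<in> null_sets lborel" by (subst AE_iff_null_sets) auto
  then show False using open_not_negligible[OF assms(1,2)] by (simp add: negligible_iff_null_sets null_sets_completionI)
qed

text \<open>Insert a third independent copy between the two points that share their covariate.\<close>
lemma resample_noise_le:
  fixes \<phi> :: "'p::finite datum \<Rightarrow> real"
  assumes \<tau>: "\<tau> > 0" and \<phi> [measurable]: "\<phi> \<in> borel_measurable borel"
  shows "(\<integral>\<^sup>+x. \<integral>\<^sup>+e. \<integral>\<^sup>+e'. ennreal ((\<phi> (x, x \<bullet> \<beta> + e) - \<phi> (x, x \<bullet> \<beta> + e'))\<^sup>2) \<partial>gauss_e \<tau> \<partial>gauss_e \<tau> \<partial>gauss_x)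
    \<le> 4 * (\<integral>\<^sup>+z. \<integral>\<^sup>+q. ennreal ((\<phi> z - \<phi> q)\<^sup>2) \<partial>gauss_z \<beta> \<tau> \<partial>gauss_z \<beta> \<tau>)"
proof -
  interpret gx: prob_space "gauss_x :: (real ^ 'p) measure" by (rule prob_space_gauss_x)
  interpret ge: prob_space "gauss_e \<tau>" by (rule prob_space_gauss_e[OF \<tau>])
  interpret gz: prob_space "gauss_z \<beta> \<tau>" by (rule prob_space_gauss_z[OF \<tau>])
  have [measurable]: "(\<lambda>w. (f w, f w \<bullet> \<beta> + h w)) \<in> N \<rightarrow>\<^sub>M borel"
    if "f \<in> N \<rightarrow>\<^sub>M borel" "h \<in> N \<rightarrow>\<^sub>M borel" for f :: "'n \<Rightarrow> real ^ 'p" and h and N :: "'n measure"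
    using that unfolding borel_prod[symmetric] by measurable
  define Q where "Q z = (\<integral>\<^sup>+q. ennreal ((\<phi> z - \<phi> q)\<^sup>2) \<partial>gauss_z \<beta> \<tau>)" for z
  have Qm [measurable]: "Q \<in> borel_measurable borel" unfolding Q_def by measurable
  have pt: "ennreal ((\<phi> z - \<phi> z')\<^sup>2) \<le> 2 * Q z + 2 * Q z'" for z z'
  proof -
    have "ennreal ((\<phi> z - \<phi> z')\<^sup>2) = (\<integral>\<^sup>+q. ennreal ((\<phi> z - \<phi> z')\<^sup>2) \<partial>gauss_z \<beta> \<tau>)"
      by (simp add: gz.emeasure_space_1[simplified])
    also have "\<dots> \<le> (\<integral>\<^sup>+q. 2 * ennreal ((\<phi> z - \<phi> q)\<^sup>2) + 2 * ennreal ((\<phi> z' - \<phi> q)\<^sup>2) \<partial>gauss_z \<beta> \<tau>)"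
    proof (rule nn_integral_mono)
      fix q
      have "(\<phi> z - \<phi> z')\<^sup>2 \<le> 2 * (\<phi> z - \<phi> q)\<^sup>2 + 2 * (\<phi> z' - \<phi> q)\<^sup>2"
        using zero_le_power2[of "(\<phi> z - \<phi> q) + (\<phi> z' - \<phi> q)"] by (simp add: power2_eq_square algebra_simps)
      then have "ennreal ((\<phi> z - \<phi> z')\<^sup>2) \<le> ennreal (2 * (\<phi> z - \<phi> q)\<^sup>2 + 2 * (\<phi> z' - \<phi> q)\<^sup>2)" by (rule ennreal_leI)
      also have "\<dots> = 2 * ennreal ((\<phi> z - \<phi> q)\<^sup>2) + 2 * ennreal ((\<phi> z' - \<phi> q)\<^sup>2)"
        by (simp add: ennreal_plus ennreal_mult')
      finally show "ennreal ((\<phi> z - \<phi> z')\<^sup>2) \<le> 2 * ennreal ((\<phi> z - \<phi> q)\<^sup>2) + 2 * ennreal ((\<phi> z' - \<phi> q)\<^sup>2)" .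
    qed
    also have "\<dots> = 2 * Q z + 2 * Q z'"
      by (subst nn_integral_add) (auto simp: nn_integral_cmult Q_def)
    finally show ?thesis .
  qed
  have "(\<integral>\<^sup>+x. \<integral>\<^sup>+e. \<integral>\<^sup>+e'. ennreal ((\<phi> (x, x \<bullet> \<beta> + e) - \<phi> (x, x \<bullet> \<beta> + e'))\<^sup>2) \<partial>gauss_e \<tau> \<partial>gauss_e \<tau> \<partial>gauss_x)
    \<le> (\<integral>\<^sup>+x. \<integral>\<^sup>+e. \<integral>\<^sup>+e'. 2 * Q (x, x \<bullet> \<beta> + e) + 2 * Q (x, x \<bullet> \<beta> + e') \<partial>gauss_e \<tau> \<partial>gauss_e \<tau> \<partial>gauss_x)"
    by (intro nn_integral_mono pt)
  also have "\<dots> = (\<integral>\<^sup>+x. \<integral>\<^sup>+e. 2 * Q (x, x \<bullet> \<beta> + e) + 2 * (\<integral>\<^sup>+e'. Q (x, x \<bullet> \<beta> + e') \<partial>gauss_e \<tau>) \<partial>gauss_e \<tau> \<partial>gauss_x)"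
    by (intro nn_integral_cong, subst nn_integral_add)
       (auto simp: nn_integral_cmult ge.emeasure_space_1[simplified])
  also have "\<dots> = (\<integral>\<^sup>+x. 2 * (\<integral>\<^sup>+e. Q (x, x \<bullet> \<beta> + e) \<partial>gauss_e \<tau>) + 2 * (\<integral>\<^sup>+e'. Q (x, x \<bullet> \<beta> + e') \<partial>gauss_e \<tau>) \<partial>gauss_x)"
    by (intro nn_integral_cong, subst nn_integral_add)
       (auto simp: nn_integral_cmult ge.emeasure_space_1[simplified])
  also have "\<dots> = (\<integral>\<^sup>+x. 4 * (\<integral>\<^sup>+e. Q (x, x \<bullet> \<beta> + e) \<partial>gauss_e \<tau>) \<partial>gauss_x)"
    by (intro nn_integral_cong) (simp add: distrib_right[symmetric])
  also have "\<dots> = 4 * (\<integral>\<^sup>+x. \<integral>\<^sup>+e. Q (x, x \<bullet> \<beta> + e) \<partial>gauss_e \<tau> \<partial>gauss_x)"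
    by (rule nn_integral_cmult) measurable
  also have "(\<integral>\<^sup>+x. \<integral>\<^sup>+e. Q (x, x \<bullet> \<beta> + e) \<partial>gauss_e \<tau> \<partial>gauss_x) = (\<integral>\<^sup>+z. Q z \<partial>gauss_z \<beta> \<tau>)"
    by (rule nn_integral_gauss_z[OF \<tau> Qm, symmetric])
  finally show ?thesis by (simp add: Q_def)
qed

lemma data_kkt:
  assumes "is_lasso_estimator n l bhat" "n > 0" "l > 0"
  shows "lasso_kkt (gram {1..n} X) (gram {1..n} X \<beta> + (\<Sum>i=1..n. E i *\<^sub>R X i)) UNIV l (bhat (mk_data \<beta> {1..n} X E))"
  using lasso_estimator_kkt[OF assms mk_data_in_space] unfolding gram_mk_data corr_mk_data .


section \<open>Two Lasso estimators with explicit constants\<close>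

lemma measurable_fst_borel [measurable]: "fst \<in> borel \<rightarrow>\<^sub>M (borel :: 'b::second_countable_topology measure)"
  by (intro borel_measurable_continuous_onI continuous_intros)

lemma measurable_snd_borel [measurable]: "snd \<in> borel \<rightarrow>\<^sub>M (borel :: 'b::second_countable_topology measure)"
  by (intro borel_measurable_continuous_onI continuous_intros)

lemma measurable_near_id_entries_fst [measurable]:
  "Measurable.pred (Pi\<^sub>M I (\<lambda>_. borel :: 'p::finite datum measure)) (\<lambda>z. near_id_entries \<eta> N I (\<lambda>i. fst (z i)))"
  unfolding near_id_entries_def by measurable

text \<open>The asymptotic hypotheses are replaced by bounds valid from \<open>N0\<close> on:
  \<open>L\<close> bounds the larger penalty relative to \<open>sqrt n\<close>, and
  \<open>d1\<close>, \<open>d2\<close> enclose the gap \<delta>. The probability space of the model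
  does not enter, only the laws of the data.\<close>

locale lasso_pair =
  fixes \<beta> :: "real ^ 'p::finite" and \<tau> L d1 d2 :: real and j :: 'p and lam \<delta> :: "nat \<Rightarrow> real"
    and bhat1 bhat2 :: "nat \<Rightarrow> (nat \<Rightarrow> 'p datum) \<Rightarrow> real ^ 'p" and N0 :: nat
  assumes \<tau>: "\<tau> > 0" and null: "\<beta> $ j = 0" and d1: "d1 > 0" and N0: "N0 \<ge> 2"
    and lam: "\<And>n. n \<ge> N0 \<Longrightarrow> lam n \<ge> 1" "\<And>n. n \<ge> N0 \<Longrightarrow> lam n + \<delta> n \<le> L * sqrt (real n)"
    and \<delta>: "\<And>n. n \<ge> N0 \<Longrightarrow> d1 \<le> \<delta> n" "\<And>n. n \<ge> N0 \<Longrightarrow> \<delta> n \<le> d2"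
    and est1: "\<And>n. n \<ge> N0 \<Longrightarrow> is_lasso_estimator n (lam n) (bhat1 n)"
    and est2: "\<And>n. n \<ge> N0 \<Longrightarrow> is_lasso_estimator n (lam n + \<delta> n) (bhat2 n)"
begin

abbreviation P :: "nat \<Rightarrow> (nat \<Rightarrow> 'p datum) measure" where
  "P n \<equiv> Pi\<^sub>M {1..n} (\<lambda>_. gauss_z \<beta> \<tau>)"

text \<open>Meets all requirements on closeness to the identity at once. The 12 is
  \<open>4 * R\<close> for covariates of norm less than \<open>R = 3\<close>.\<close>

definition \<eta>0 :: real where "\<eta>0 = 1 / (12 * CARD('p))"

lemma card_p: "real CARD('p) \<ge> 1"
  using zero_less_card_finite[where 'a='p] by linarith

lemma \<eta>0: "\<eta>0 > 0" "\<eta>0 * (4 * 3) \<le> 1" "\<eta>0 * (2 * CARD('p)) \<le> 1" "\<eta>0 \<le> 1 / 4" "\<eta>0 * (4 * CARD('p)) \<le> 1"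
  using card_p by (simp_all add: \<eta>0_def field_simps) (use card_p in linarith)+

lemma measurable_bhat:
  assumes "n \<ge> N0"
  shows "bhat1 n \<in> borel_measurable (Pi\<^sub>M {1..n} (\<lambda>_. borel))" "bhat2 n \<in> borel_measurable (Pi\<^sub>M {1..n} (\<lambda>_. borel))"
  using est1[OF assms] est2[OF assms] by (auto simp: is_lasso_estimator_def)

lemma measurable_datum [measurable (raw)]:
  fixes f :: "'n \<Rightarrow> real ^ 'p"
  assumes [measurable]: "f \<in> N \<rightarrow>\<^sub>M borel" "h \<in> N \<rightarrow>\<^sub>M borel"
  shows "(\<lambda>w. (f w, f w \<bullet> \<beta> + h w)) \<in> N \<rightarrow>\<^sub>M (borel :: 'p datum measure)"
  unfolding borel_prod[symmetric] by measurable

lemma kkt1: "n \<ge> N0 \<Longrightarrow> lasso_kkt (gram {1..n} X) (gram {1..n} X \<beta> + (\<Sum>i=1..n. E i *\<^sub>R X i)) UNIV (lam n) (bhat1 n (mk_data \<beta> {1..n} X E))"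
  and kkt2: "n \<ge> N0 \<Longrightarrow> lasso_kkt (gram {1..n} X) (gram {1..n} X \<beta> + (\<Sum>i=1..n. E i *\<^sub>R X i)) UNIV (lam n + \<delta> n) (bhat2 n (mk_data \<beta> {1..n} X E))"
  using N0 lam(1)[of n] \<delta>(1)[of n] d1 by (intro data_kkt est1 est2; simp)+

lemma L_pos: "L > 0"
proof -
  have "lam N0 + \<delta> N0 > 0" using lam(1)[of N0] \<delta>(1)[of N0] d1 by simp
  then have "0 < L * sqrt (real N0)" using lam(2)[of N0] by simp
  then show ?thesis by (simp add: zero_less_mult_iff)
qed

lemma near_id_entries_half:
  assumes "\<eta> > 0"
  shows "\<exists>m. \<forall>I :: nat set. finite I \<and> card I \<ge> m \<longrightarrow>
    emeasure (Pi\<^sub>M I (\<lambda>_. gauss_x)) {X \<in> space (Pi\<^sub>M I (\<lambda>_. borel :: (real ^ 'p) measure)). near_id_entries \<eta> (card I) I X} \<ge> ennreal (1 / 2)"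
proof -
  obtain C where C: "\<And>I :: nat set. finite I \<Longrightarrow> I \<noteq> {} \<Longrightarrow>
     measure (Pi\<^sub>M I (\<lambda>_. gauss_x)) {x \<in> space (Pi\<^sub>M I (\<lambda>_. borel :: (real ^ 'p) measure)). \<not> near_id_entries \<eta> (card I) I x}
       \<le> C / real (card I)"
    using near_id_entries_prob[OF assms] by blast
  define m where "m = nat \<lceil>2 * \<bar>C\<bar>\<rceil> + 1"
  have "emeasure (Pi\<^sub>M I (\<lambda>_. gauss_x)) {X \<in> space (Pi\<^sub>M I (\<lambda>_. borel :: (real ^ 'p) measure)). near_id_entries \<eta> (card I) I X} \<ge> ennreal (1 / 2)"
    if I: "finite I" "card I \<ge> m" for I :: "nat set"
  proof -
    interpret PX: prob_space "Pi\<^sub>M I (\<lambda>_. gauss_x :: (real ^ 'p) measure)"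
      by (intro prob_space_PiM prob_space_gauss_x)
    let ?S = "space (Pi\<^sub>M I (\<lambda>_. borel :: (real ^ 'p) measure))"
    have sp: "?S = space (Pi\<^sub>M I (\<lambda>_. gauss_x :: (real ^ 'p) measure))" by (simp add: space_PiM)
    have cI: "real (card I) \<ge> 2 * \<bar>C\<bar> + 1" using I(2) unfolding m_def by linarith
    then have "I \<noteq> {}" by auto
    let ?B = "{X \<in> ?S. \<not> near_id_entries \<eta> (card I) I X}"
    have [measurable]: "?B \<in> sets (Pi\<^sub>M I (\<lambda>_. gauss_x))" by measurable
    have "PX.prob ?B \<le> C / real (card I)" using C[OF I(1) \<open>I \<noteq> {}\<close>] .
    also have "\<dots> \<le> 1 / 2" using cI by (simp add: field_simps)
    finally have "1 / 2 \<le> PX.prob (?S - ?B)" unfolding sp by (subst PX.prob_compl) (auto simp: sp[symmetric])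
    moreover have "?S - ?B = {X \<in> ?S. near_id_entries \<eta> (card I) I X}" by auto
    ultimately show ?thesis unfolding PX.emeasure_eq_measure by (intro ennreal_leI) simp
  qed
  then show ?thesis by blast
qed

text \<open>The event of \<open>large_coord_prob\<close> is intersected with designs near the
  identity, since only there are the two solutions compared coordinatewise afterwards. The constants
  lost are \<open>1 / 4\<close> for the size of the coordinate and \<open>1 / 2\<close> for the
  design.\<close>

lemma large_coord_expectation:
  "\<exists>c>0. \<forall>\<^sub>F n in sequentially. 
    (\<integral>\<^sup>+z. ennreal \<bar>bhat2 n z $ j\<bar> * indicator {z. near_id_entries \<eta>0 (real n) {1..n} (\<lambda>i. fst (z i))} z \<partial>P n)
      \<ge> ennreal (c / sqrt (real n))"
proof -
  define S where "S = L + 2 * (4 * (real CARD('p))\<^sup>2 * \<tau> + L * CARD('p)) + 2"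
  define c where "c = 1 / (4 * S) * exp (- (8 * S * \<tau> + 4 * S\<^sup>2) / (2 * \<tau>\<^sup>2))"
  have S: "S > 0" using L_pos \<tau> by (simp add: S_def add_pos_nonneg)
  have c: "c > 0" unfolding c_def using S by simp
  obtain m where m: "\<And>I :: nat set. finite I \<Longrightarrow> card I \<ge> m \<Longrightarrow>
    emeasure (Pi\<^sub>M I (\<lambda>_. gauss_x)) {X \<in> space (Pi\<^sub>M I (\<lambda>_. borel :: (real ^ 'p) measure)). near_id_entries \<eta>0 (card I) I X} \<ge> ennreal (1 / 2)"
    using near_id_entries_half[OF \<eta>0(1)] by blast
  have "(\<integral>\<^sup>+z. ennreal \<bar>bhat2 n z $ j\<bar> * indicator {z. near_id_entries \<eta>0 (real n) {1..n} (\<lambda>i. fst (z i))} z \<partial>P n)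
      \<ge> ennreal (c / 8 / sqrt (real n))" if n: "n \<ge> max N0 m" for n
  proof -
    have nN: "n \<ge> N0" "n \<ge> 2" "n \<ge> m" using n N0 by auto
    note [measurable] = measurable_bhat[OF nN(1)]
    let ?I = "{1..n}" and ?PX = "Pi\<^sub>M {1..n} (\<lambda>_. gauss_x :: (real ^ 'p) measure)" and ?PE = "Pi\<^sub>M {1..n} (\<lambda>_. gauss_e \<tau>)"
    let ?F = "\<lambda>z. ennreal \<bar>bhat2 n z $ j\<bar> * indicator {z. near_id_entries \<eta>0 (real n) {1..n} (\<lambda>i. fst (z i))} z"
    let ?V = "{X \<in> space (Pi\<^sub>M ?I (\<lambda>_. borel)). near_id_entries \<eta>0 (real n) ?I X}"
    have Fm: "?F \<in> borel_measurable (Pi\<^sub>M {1..n} (\<lambda>_. borel))" by measurable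
    have "ennreal (c / 8 / sqrt (real n)) = ennreal (c / (4 * sqrt (real n))) * ennreal (1 / 2)"
      using c by (subst ennreal_mult'[symmetric]) auto
    also have "\<dots> \<le> ennreal (c / (4 * sqrt (real n))) * emeasure ?PX ?V"
      using m[of ?I] nN by (intro mult_left_mono) auto
    also have "\<dots> = (\<integral>\<^sup>+X. ennreal (c / (4 * sqrt (real n))) * indicator ?V X \<partial>?PX)"
      by (rule nn_integral_cmult_indicator[symmetric]) measurable
    also have "\<dots> \<le> (\<integral>\<^sup>+X. \<integral>\<^sup>+E. ?F (mk_data \<beta> ?I X E) \<partial>?PE \<partial>?PX)"
    proof (rule nn_integral_mono)
      fix X assume "X \<in> space ?PX"
      then have Xs [measurable]: "X \<in> space (Pi\<^sub>M ?I (\<lambda>_. borel))" by (simp add: space_PiM)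
      show "ennreal (c / (4 * sqrt (real n))) * indicator ?V X \<le> (\<integral>\<^sup>+E. ?F (mk_data \<beta> ?I X E) \<partial>?PE)"
      proof (cases "X \<in> ?V")
        case True
        let ?b = "\<lambda>E. bhat2 n (mk_data \<beta> ?I X E)"
        let ?A = "{E \<in> space (Pi\<^sub>M ?I (\<lambda>_. borel)). ?b E $ j \<ge> 1 / (4 * sqrt (real n))}"
        have bm [measurable]: "?b \<in> borel_measurable (Pi\<^sub>M ?I (\<lambda>_. borel))" by measurable
        have "emeasure ?PE ?A \<ge> ennreal c" unfolding c_def
        proof (rule large_coord_prob[OF \<tau>, where \<eta> = \<eta>0 and L = L and l = "lam n + \<delta> n"])
          show "near_id \<eta>0 (real n) (gram ?I X)" using near_id_entries_imp[of \<eta>0 ?I X] True by simp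
          show "lasso_kkt (gram ?I X) (gram ?I X \<beta> + (\<Sum>i\<in>?I. E i *\<^sub>R X i)) UNIV (lam n + \<delta> n) (?b E)" for E
            by (rule kkt2[OF nN(1)])
        qed (use nN \<eta>0 null lam[OF nN(1)] \<delta>[OF nN(1)] d1 S_def bm in auto)
        then have "ennreal (1 / (4 * sqrt (real n))) * ennreal c \<le> ennreal (1 / (4 * sqrt (real n))) * emeasure ?PE ?A"
          by (intro mult_left_mono) auto
        also have "\<dots> = (\<integral>\<^sup>+E. ennreal (1 / (4 * sqrt (real n))) * indicator ?A E \<partial>?PE)"
          by (rule nn_integral_cmult_indicator[symmetric]) measurable
        also have "\<dots> \<le> (\<integral>\<^sup>+E. ?F (mk_data \<beta> ?I X E) \<partial>?PE)"
        proof (rule nn_integral_mono)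
          fix E
          have "near_id_entries \<eta>0 (real n) ?I (\<lambda>i. fst (mk_data \<beta> ?I X E i))"
            using True unfolding near_id_entries_def by (simp add: mk_data_def)
          then show "ennreal (1 / (4 * sqrt (real n))) * indicator ?A E \<le> ?F (mk_data \<beta> ?I X E)"
            by (auto simp: indicator_def intro!: ennreal_leI)
        qed
        finally show ?thesis using True c by (simp add: ennreal_mult'[symmetric] mult.commute)
      qed simp
    qed
    also have "\<dots> = (\<integral>\<^sup>+z. ?F z \<partial>P n)" by (rule nn_integral_PiM_gauss_z[OF \<tau> _ Fm, symmetric]) simp
    finally show ?thesis .
  qed
  then have "\<forall>\<^sub>F n in sequentially. 
    (\<integral>\<^sup>+z. ennreal \<bar>bhat2 n z $ j\<bar> * indicator {z. near_id_entries \<eta>0 (real n) {1..n} (\<lambda>i. fst (z i))} z \<partial>P n)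
      \<ge> ennreal (c / 8 / sqrt (real n))" by (rule eventually_sequentiallyI)
  then show ?thesis using c by (intro exI[of _ "c / 8"]) auto
qed

end


section \<open>Lower bound for the effect of resampling one observation\<close>

context lasso_pair
begin

definition coord_diff :: "nat \<Rightarrow> (nat \<Rightarrow> 'p datum) \<Rightarrow> real" where
  "coord_diff n z = bhat1 n z $ j - bhat2 n z $ j"

lemma measurable_coord_diff:
  assumes "n \<ge> N0" shows "coord_diff n \<in> borel_measurable (Pi\<^sub>M {1..n} (\<lambda>_. borel))"
proof -
  note [measurable] = measurable_bhat[OF assms]
  show ?thesis unfolding coord_diff_def by measurable
qed

text \<open>Three ingredients multiply: the other rows are near the identity with probability at
  least one half, the resampled row with its two noise values lies in a fixed box of probability
  \<kappa>, and given these the remaining noise produces the crossing with probability of order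
  \<open>1 / sqrt n\<close>. On the crossing the two values of \<open>coord_diff\<close> differ by
  at least \<open>d1 / (2 * n)\<close>.\<close>

lemma resample_lower_bound:
  "\<exists>c>0. \<forall>\<^sub>F n in sequentially.
    (\<integral>\<^sup>+z. \<integral>\<^sup>+q. ennreal ((coord_diff n z - coord_diff n (z(1 := q)))\<^sup>2) \<partial>gauss_z \<beta> \<tau> \<partial>P n)
      \<ge> ennreal (c / (real n ^ 2 * sqrt (real n)))"
proof -
  interpret gx: prob_space "gauss_x :: (real ^ 'p) measure" by (rule prob_space_gauss_x)
  interpret ge: prob_space "gauss_e \<tau>" by (rule prob_space_gauss_e[OF \<tau>])
  interpret gz: prob_space "gauss_z \<beta> \<tau>" by (rule prob_space_gauss_z[OF \<tau>])
  interpret pgx: product_sigma_finite "\<lambda>_. gauss_x :: (real ^ 'p) measure" ..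
  interpret pge: product_sigma_finite "\<lambda>_. gauss_e \<tau>" ..
  interpret pgz: product_sigma_finite "\<lambda>_. gauss_z \<beta> \<tau>" ..
  interpret pe2: pair_prob_space "gauss_e \<tau>" "gauss_e \<tau>" ..
  let ?E2 = "gauss_e \<tau> \<Otimes>\<^sub>M gauss_e \<tau>"
  interpret pxe: pair_prob_space "gauss_x :: (real ^ 'p) measure" ?E2 ..
  let ?K = "(gauss_x :: (real ^ 'p) measure) \<Otimes>\<^sub>M ?E2"
  note E2_Times = sigma_finite_measure.emeasure_pair_measure_Times[OF prob_space_imp_sigma_finite[OF pe2.prob_space_axioms]]
    and E2_fst = sigma_finite_measure.nn_integral_fst[OF prob_space_imp_sigma_finite[OF pe2.prob_space_axioms]]
  define D where "D = d2"
  have D0: "D \<ge> 0" using \<delta>[of N0] d1 by (simp add: D_def)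
  define K where "K = 1 + 2 * D"
  define S where "S = 3 * (4 * (real CARD('p))\<^sup>2 * \<tau> + (K + 1) * 3 + L * CARD('p)) + 1"
  define c where "c = 1 / (4 * S) * exp (- (8 * S * \<tau> + 4 * S\<^sup>2) / (2 * \<tau>\<^sup>2))"
  have S: "S > 0" using L_pos \<tau> D0 by (simp add: S_def K_def add_pos_nonneg)
  have c: "c > 0" unfolding c_def using S by simp
  \<comment> \<open>A coordinate above 1 lets the noise of this row act on the \<open>j\<close>-th
    correlation, and the norm bound controls its effect on the Gram operator. The set contains
    \<open>2 *\<^sub>R axis j 1\<close>, and being open it has positive probability.\<close>
  define Ux where "Ux = {x :: real ^ 'p. x $ j > 1 \<and> norm x < 3}"
  define Box where "Box = Ux \<times> ({K<..<K+1} \<times> {-(K+1)<..<-K})"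
  have "open Ux" unfolding Ux_def
    by (intro open_Collect_conj open_Collect_less continuous_intros)
  moreover have "2 *\<^sub>R axis j 1 \<in> Ux" by (simp add: Ux_def norm_axis_1)
  ultimately have Ux: "open Ux" "Ux \<noteq> {}" by auto
  have [measurable]: "Ux \<in> sets borel" using Ux by simp
  have [measurable]: "Box \<in> sets ?K" unfolding Box_def by measurable
  define \<kappa> where "\<kappa> = pxe.prob Box"
  have "emeasure ?K Box = emeasure gauss_x Ux * (emeasure (gauss_e \<tau>) {K<..<K+1} * emeasure (gauss_e \<tau>) {-(K+1)<..<-K})"
    unfolding Box_def by (simp add: ge.emeasure_pair_measure_Times E2_Times)
  also have "\<dots> > 0"
    using emeasure_gauss_x_pos[OF Ux] emeasure_gauss_e_pos[of "{K<..<K+1}" \<tau>] emeasure_gauss_e_pos[of "{-(K+1)<..<-K}" \<tau>] \<tau>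
    by (simp add: ennreal_zero_less_mult_iff)
  finally have \<kappa>: "\<kappa> > 0" "emeasure ?K Box = ennreal \<kappa>"
    unfolding \<kappa>_def pxe.emeasure_eq_measure by simp_all
  obtain m where m: "\<And>I :: nat set. finite I \<Longrightarrow> card I \<ge> m \<Longrightarrow>
    emeasure (Pi\<^sub>M I (\<lambda>_. gauss_x)) {X \<in> space (Pi\<^sub>M I (\<lambda>_. borel :: (real ^ 'p) measure)). near_id_entries (\<eta>0 / 2) (card I) I X} \<ge> ennreal (1 / 2)"
    using near_id_entries_half[of "\<eta>0 / 2"] \<eta>0(1) by auto
  \<comment> \<open>\<open>20\<close> is \<open>2 * (1 + R\<^sup>2)\<close> with
    \<open>R = 3\<close>, as \<open>near_id_gram_insert\<close> requires.\<close>
  define N1 where "N1 = max (max N0 (m + 1)) (nat \<lceil>20 / \<eta>0\<rceil>)"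
  \<comment> \<open>The 8 combines the probability \<open>1 / 2\<close> of the design with the
    factor 4 lost when a full resampling is reduced to one of the noise.\<close>
  define C where "C = (d1 / 2)\<^sup>2 * c * \<kappa> / 8"
  have C: "C > 0" unfolding C_def using d1 c \<kappa> by simp
  have "(\<integral>\<^sup>+z. \<integral>\<^sup>+q. ennreal ((coord_diff n z - coord_diff n (z(1 := q)))\<^sup>2) \<partial>gauss_z \<beta> \<tau> \<partial>P n)
      \<ge> ennreal (C / (real n ^ 2 * sqrt (real n)))" if n: "n \<ge> N1" for n
  proof -
    have nN: "n \<ge> N0" "n \<ge> 2" "n - 1 \<ge> m" using n N0 by (auto simp: N1_def)
    have "real n \<ge> 20 / \<eta>0" using n unfolding N1_def by linarith
    then have n20: "2 * (1 + 3\<^sup>2) \<le> \<eta>0 * real n" using \<eta>0(1) by (simp add: field_simps)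
    note bm [measurable] = measurable_bhat[OF nN(1)] measurable_coord_diff[OF nN(1)]
    define I where "I = {2..n}"
    have I: "finite I" "1 \<notin> I" "insert 1 I = {1..n}" "real (card I) + 1 = real n" "card I \<ge> 1" "card I \<ge> m"
      using nN by (auto simp: I_def)
    let ?PX = "Pi\<^sub>M I (\<lambda>_. gauss_x :: (real ^ 'p) measure)" and ?PE = "Pi\<^sub>M I (\<lambda>_. gauss_e \<tau>)"
    interpret PE: finite_product_sigma_finite "\<lambda>_. gauss_e \<tau>" I by standard (rule I)
    let ?V = "{X \<in> space (Pi\<^sub>M I (\<lambda>_. borel)). near_id_entries (\<eta>0 / 2) (card I) I X}"
    have upd [measurable (raw)]: "(\<lambda>w. (f w)(1 := h w)) \<in> N \<rightarrow>\<^sub>M Pi\<^sub>M {1..n} (\<lambda>_. borel)"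
      if "f \<in> N \<rightarrow>\<^sub>M Pi\<^sub>M I (\<lambda>_. borel)" "h \<in> N \<rightarrow>\<^sub>M borel"
      for f :: "'n \<Rightarrow> nat \<Rightarrow> 'top::topological_space" and h and N :: "'n measure"
      using that I by (intro measurable_fun_upd[where J = I]) auto
    have upd' [measurable (raw)]: "(\<lambda>w. (f w)(1 := h w)) \<in> N \<rightarrow>\<^sub>M Pi\<^sub>M {1..n} (\<lambda>_. borel)"
      if "f \<in> N \<rightarrow>\<^sub>M Pi\<^sub>M {1..n} (\<lambda>_. borel)" "h \<in> N \<rightarrow>\<^sub>M borel"
      for f :: "'n \<Rightarrow> nat \<Rightarrow> 'top::topological_space" and h and N :: "'n measure"
      using that nN by (intro measurable_fun_upd[where J = "{1..n}"]) auto
    define \<Psi> where "\<Psi> y w = (case w of (x, e, e') \<Rightarrow> 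
      ennreal ((coord_diff n (y(1 := (x, x \<bullet> \<beta> + e))) - coord_diff n (y(1 := (x, x \<bullet> \<beta> + e'))))\<^sup>2))" for y w
    have \<Psi>m [measurable]: "(\<lambda>(y, w). \<Psi> y w) \<in> borel_measurable (Pi\<^sub>M I (\<lambda>_. borel) \<Otimes>\<^sub>M ?K)"
      unfolding \<Psi>_def case_prod_unfold by measurable
    define H where "H y = (\<integral>\<^sup>+w. \<Psi> y w \<partial>?K)" for y
    have Hm: "H \<in> borel_measurable (Pi\<^sub>M I (\<lambda>_. borel))" unfolding H_def by measurable
    have Hle: "H y \<le> 4 * (\<integral>\<^sup>+z. \<integral>\<^sup>+q. ennreal ((coord_diff n (y(1 := z)) - coord_diff n (y(1 := q)))\<^sup>2) \<partial>gauss_z \<beta> \<tau> \<partial>gauss_z \<beta> \<tau>)"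
      if [measurable]: "y \<in> space (Pi\<^sub>M I (\<lambda>_. borel))" for y
    proof -
      have "H y = (\<integral>\<^sup>+x. \<integral>\<^sup>+e. \<integral>\<^sup>+e'. \<Psi> y (x, e, e') \<partial>gauss_e \<tau> \<partial>gauss_e \<tau> \<partial>gauss_x)"
        unfolding H_def
        by (subst E2_fst[symmetric], measurable, subst ge.nn_integral_fst[symmetric]) measurable
      also have "\<dots> \<le> 4 * (\<integral>\<^sup>+z. \<integral>\<^sup>+q. ennreal ((coord_diff n (y(1 := z)) - coord_diff n (y(1 := q)))\<^sup>2) \<partial>gauss_z \<beta> \<tau> \<partial>gauss_z \<beta> \<tau>)"
        unfolding \<Psi>_def prod.case by (rule resample_noise_le[OF \<tau>]) measurable
      finally show ?thesis .
    qed
    have point: "ennreal ((d1 / (2 * real n))\<^sup>2 * (c / sqrt (real n))) \<le> (\<integral>\<^sup>+E. \<Psi> (mk_data \<beta> I X E) w \<partial>?PE)"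
      if X: "X \<in> ?V" and w: "w \<in> Box" for X w
    proof -
      obtain x e e' where wx: "w = (x, e, e')" by (cases w)
      have box: "x $ j > 1" "norm x < 3" "K < e" "e < K + 1" "e' < - K" using w by (auto simp: wx Box_def Ux_def)
      have [measurable]: "X \<in> space (Pi\<^sub>M I (\<lambda>_. borel))" using X by simp
      let ?X = "X(1 := x)"
      have niI: "near_id (\<eta>0 / 2) (card I) (gram I X)" using near_id_entries_imp[of "\<eta>0 / 2" I X] X I by simp
      have gI: "gram I ?X = gram I X" using I by (intro gram_cong) auto
      have "near_id \<eta>0 (real (card I) + 1) (gram (insert 1 I) ?X)"
      proof (rule near_id_gram_insert[where R = 3, OF _ I(1,2) _ _ less_imp_le[OF \<eta>0(1)]])
        show "near_id (\<eta>0 / 2) (real (card I)) (gram I ?X)" unfolding gI by (rule niI)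
        show "2 * (1 + 3\<^sup>2) \<le> \<eta>0 * (real (card I) + 1)" unfolding I(4) by (rule n20)
      qed (use box in simp)
      then have ni: "near_id \<eta>0 (real n) (gram {1..n} ?X)" by (simp only: I)
      have mk: "(mk_data \<beta> I X E)(1 := (x, x \<bullet> \<beta> + f)) = mk_data \<beta> {1..n} ?X (E(1 := f))" for E f
        using mk_data_insert[OF I(2), of \<beta> X x E f] by (simp only: I)
      have sm: "(\<Sum>i=1..n. (E(1 := f)) i *\<^sub>R ?X i) = (\<Sum>i\<in>I. E i *\<^sub>R X i) + f *\<^sub>R x" for E :: "nat \<Rightarrow> real" and f
      proof -
        have "(\<Sum>i\<in>I. (E(1 := f)) i *\<^sub>R ?X i) = (\<Sum>i\<in>I. E i *\<^sub>R X i)" using I by (intro sum.cong) auto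
        then show ?thesis unfolding I(3)[symmetric] using I(1,2) by (simp add: add.commute)
      qed
      let ?b1 = "\<lambda>E. bhat1 n ((mk_data \<beta> I X E)(1 := (x, x \<bullet> \<beta> + e')))"
      let ?b2 = "\<lambda>E. bhat2 n ((mk_data \<beta> I X E)(1 := (x, x \<bullet> \<beta> + e)))"
      let ?A = "{E \<in> space (Pi\<^sub>M I (\<lambda>_. borel)). ?b2 E $ j > 0 \<and> ?b1 E $ j \<le> 0}"
      have b12 [measurable]: "?b1 \<in> borel_measurable (Pi\<^sub>M I (\<lambda>_. borel))" "?b2 \<in> borel_measurable (Pi\<^sub>M I (\<lambda>_. borel))"
        by measurable
      have "emeasure ?PE ?A \<ge> ennreal (c / sqrt (real n))" unfolding c_def
      proof (rule crossing_prob[OF \<tau> I(1,2,5) I(4)[symmetric] niI, where R = 3 and x = x and D = D and L = L and l = "lam n" and \<delta> = "\<delta> n" and K = K])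
        show "lasso_kkt (gram (insert 1 I) ?X) (gram (insert 1 I) ?X \<beta> + (\<Sum>i\<in>I. E i *\<^sub>R X i) + e *\<^sub>R x) UNIV (lam n + \<delta> n) (?b2 E)" for E
          using kkt2[OF nN(1), of ?X "E(1 := e)"] unfolding mk sm I(3) by (simp only: add.assoc)
        show "lasso_kkt (gram (insert 1 I) ?X) (gram (insert 1 I) ?X \<beta> + (\<Sum>i\<in>I. E i *\<^sub>R X i) + e' *\<^sub>R x) UNIV (lam n) (?b1 E)" for E
          using kkt1[OF nN(1), of ?X "E(1 := e')"] unfolding mk sm I(3) by (simp only: add.assoc)
      qed (use nN \<eta>0 null lam[OF nN(1)] \<delta>[OF nN(1)] d1 box n20 b12 in \<open>auto simp: S_def K_def D_def\<close>)
      then have "ennreal ((d1 / (2 * real n))\<^sup>2) * ennreal (c / sqrt (real n)) \<le> ennreal ((d1 / (2 * real n))\<^sup>2) * emeasure ?PE ?A"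
        by (intro mult_left_mono) auto
      also have "\<dots> = (\<integral>\<^sup>+E. ennreal ((d1 / (2 * real n))\<^sup>2) * indicator ?A E \<partial>?PE)"
        by (rule nn_integral_cmult_indicator[symmetric]) measurable
      also have "\<dots> \<le> (\<integral>\<^sup>+E. \<Psi> (mk_data \<beta> I X E) w \<partial>?PE)"
      proof (rule nn_integral_mono)
        fix E
        show "ennreal ((d1 / (2 * real n))\<^sup>2) * indicator ?A E \<le> \<Psi> (mk_data \<beta> I X E) w"
        proof (cases "E \<in> ?A")
          case True
          \<comment> \<open>For \<open>e\<close> the coordinate is positive at the larger penalty,
            so the difference is at least \<open>d1 / (2 * n)\<close>; for \<open>e'\<close> it is
            not positive at the smaller penalty, so the difference is at most 0.\<close>
          note dc = lasso_kkt_diff_coord[OF linear_gram ni _ \<eta>0(5) _ _ kkt1[OF nN(1)] kkt2[OF nN(1)], where j = j]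
          have pos: "lam n > 0" "\<delta> n > 0" "real n > 0" using nN lam[OF nN(1)] \<delta>[OF nN(1)] d1 by auto
          have 1: "bhat2 n (mk_data \<beta> {1..n} ?X (E(1 := e))) $ j > 0" using True unfolding mk by simp
          have 2: "bhat1 n (mk_data \<beta> {1..n} ?X (E(1 := e'))) $ j \<le> 0" using True unfolding mk by simp
          have "d1 / (2 * real n) \<le> \<delta> n / (2 * real n)"
            using \<delta>[OF nN(1)] pos by (intro divide_right_mono) auto
          also have "\<dots> \<le> coord_diff n (mk_data \<beta> {1..n} ?X (E(1 := e)))"
            unfolding coord_diff_def by (rule dc(1)[OF pos(3,1,2) 1])
          finally have A: "d1 / (2 * real n) \<le> coord_diff n (mk_data \<beta> {1..n} ?X (E(1 := e)))" .
          have B: "coord_diff n (mk_data \<beta> {1..n} ?X (E(1 := e'))) \<le> 0"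
            unfolding coord_diff_def by (rule dc(3)[OF pos(3,1,2) 2])
          have "(d1 / (2 * real n))\<^sup>2 \<le> (coord_diff n (mk_data \<beta> {1..n} ?X (E(1 := e))) - coord_diff n (mk_data \<beta> {1..n} ?X (E(1 := e'))))\<^sup>2"
            using A B d1 by (intro power_mono) auto
          then show ?thesis using True unfolding \<Psi>_def wx prod.case mk by (simp add: ennreal_leI)
        qed simp
      qed
      finally show ?thesis by (simp add: ennreal_mult'[symmetric])
    qed
    define t where "t = (d1 / (2 * real n))\<^sup>2 * (c / sqrt (real n))"
    have a0: "t \<ge> 0" using c by (simp add: t_def)
    have "ennreal (t * \<kappa> / 2) = ennreal (t * \<kappa>) * ennreal (1 / 2)"
      using a0 \<kappa> by (subst ennreal_mult'[symmetric]) auto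
    also have "\<dots> \<le> ennreal (t * \<kappa>) * emeasure ?PX ?V" by (intro mult_left_mono m I) auto
    also have "\<dots> = (\<integral>\<^sup>+X. ennreal (t * \<kappa>) * indicator ?V X \<partial>?PX)"
      by (rule nn_integral_cmult_indicator[symmetric]) measurable
    also have "\<dots> \<le> (\<integral>\<^sup>+X. \<integral>\<^sup>+E. H (mk_data \<beta> I X E) \<partial>?PE \<partial>?PX)"
    proof (rule nn_integral_mono)
      fix X assume "X \<in> space ?PX"
      then have [measurable]: "X \<in> space (Pi\<^sub>M I (\<lambda>_. borel))" by (simp add: space_PiM)
      show "ennreal (t * \<kappa>) * indicator ?V X \<le> (\<integral>\<^sup>+E. H (mk_data \<beta> I X E) \<partial>?PE)"
      proof (cases "X \<in> ?V")
        case True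
        \<comment> \<open>The crossing estimate integrates the remaining noise for a fixed point of
          the box; exchanging the two integrals recovers \<open>H\<close>.\<close>
        interpret pair_sigma_finite ?PE ?K ..
        have "ennreal (t * \<kappa>) = ennreal t * emeasure ?K Box" using a0 by (simp add: \<kappa> ennreal_mult')
        also have "\<dots> = (\<integral>\<^sup>+w. ennreal t * indicator Box w \<partial>?K)"
          by (rule nn_integral_cmult_indicator[symmetric]) measurable
        also have "\<dots> \<le> (\<integral>\<^sup>+w. \<integral>\<^sup>+E. \<Psi> (mk_data \<beta> I X E) w \<partial>?PE \<partial>?K)"
          using point[OF True] unfolding t_def by (intro nn_integral_mono) (auto simp: indicator_def)
        also have "\<dots> = (\<integral>\<^sup>+E. H (mk_data \<beta> I X E) \<partial>?PE)"
          unfolding H_def by (rule Fubini') measurable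
        finally show ?thesis using True by simp
      qed simp
    qed
    also have "\<dots> = (\<integral>\<^sup>+y. H y \<partial>Pi\<^sub>M I (\<lambda>_. gauss_z \<beta> \<tau>))"
      by (rule nn_integral_PiM_gauss_z[OF \<tau> I(1) Hm, symmetric])
    also have "\<dots> \<le> (\<integral>\<^sup>+y. 4 * (\<integral>\<^sup>+z. \<integral>\<^sup>+q. ennreal ((coord_diff n (y(1 := z)) - coord_diff n (y(1 := q)))\<^sup>2) \<partial>gauss_z \<beta> \<tau> \<partial>gauss_z \<beta> \<tau>) \<partial>Pi\<^sub>M I (\<lambda>_. gauss_z \<beta> \<tau>))"
      by (intro nn_integral_mono Hle) (simp add: space_PiM)
    also have "\<dots> = 4 * (\<integral>\<^sup>+y. \<integral>\<^sup>+z. \<integral>\<^sup>+q. ennreal ((coord_diff n (y(1 := z)) - coord_diff n (y(1 := q)))\<^sup>2) \<partial>gauss_z \<beta> \<tau> \<partial>gauss_z \<beta> \<tau> \<partial>Pi\<^sub>M I (\<lambda>_. gauss_z \<beta> \<tau>))"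
      by (rule nn_integral_cmult) measurable
    also have "(\<integral>\<^sup>+y. \<integral>\<^sup>+z. \<integral>\<^sup>+q. ennreal ((coord_diff n (y(1 := z)) - coord_diff n (y(1 := q)))\<^sup>2) \<partial>gauss_z \<beta> \<tau> \<partial>gauss_z \<beta> \<tau> \<partial>Pi\<^sub>M I (\<lambda>_. gauss_z \<beta> \<tau>))
      = (\<integral>\<^sup>+z. \<integral>\<^sup>+q. ennreal ((coord_diff n z - coord_diff n (z(1 := q)))\<^sup>2) \<partial>gauss_z \<beta> \<tau> \<partial>P n)"
    proof -
      have fm: "(\<lambda>z. \<integral>\<^sup>+q. ennreal ((coord_diff n z - coord_diff n (z(1 := q)))\<^sup>2) \<partial>gauss_z \<beta> \<tau>) \<in> borel_measurable (Pi\<^sub>M (insert 1 I) (\<lambda>_. gauss_z \<beta> \<tau>))"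
        unfolding I(3) by measurable
      show ?thesis unfolding I(3)[symmetric] by (subst pgz.product_nn_integral_insert[OF I(1,2) fm]) simp
    qed
    finally have fin: "ennreal (t * \<kappa> / 2) \<le> 4 * (\<integral>\<^sup>+z. \<integral>\<^sup>+q. ennreal ((coord_diff n z - coord_diff n (z(1 := q)))\<^sup>2) \<partial>gauss_z \<beta> \<tau> \<partial>P n)" .
    have "C / (real n ^ 2 * sqrt (real n)) = 1 / 4 * (t * \<kappa> / 2)"
      by (simp add: C_def t_def power2_eq_square)
    then have "ennreal (C / (real n ^ 2 * sqrt (real n))) = ennreal (1 / 4) * ennreal (t * \<kappa> / 2)"
      by (simp only: ennreal_mult'[of "1 / 4"])
    also have "\<dots> \<le> ennreal (1 / 4) * (4 * (\<integral>\<^sup>+z. \<integral>\<^sup>+q. ennreal ((coord_diff n z - coord_diff n (z(1 := q)))\<^sup>2) \<partial>gauss_z \<beta> \<tau> \<partial>P n))"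
      by (intro mult_left_mono fin) auto
    also have "\<dots> = ennreal (1 / 4) * ennreal 4 * (\<integral>\<^sup>+z. \<integral>\<^sup>+q. ennreal ((coord_diff n z - coord_diff n (z(1 := q)))\<^sup>2) \<partial>gauss_z \<beta> \<tau> \<partial>P n)"
      by (simp add: mult.assoc)
    also have "ennreal (1 / 4) * ennreal 4 = 1" by (subst ennreal_mult'[symmetric]) auto
    finally show ?thesis by (simp only: mult_1_left)
  qed
  then have "\<forall>\<^sub>F n in sequentially.
    (\<integral>\<^sup>+z. \<integral>\<^sup>+q. ennreal ((coord_diff n z - coord_diff n (z(1 := q)))\<^sup>2) \<partial>gauss_z \<beta> \<tau> \<partial>P n)
      \<ge> ennreal (C / (real n ^ 2 * sqrt (real n)))" by (rule eventually_sequentiallyI)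
  then show ?thesis using C by blast
qed

end


section \<open>Curvature of the Gram matrix outside a rare event\<close>

lemma integrable_PiM_component:
  fixes g :: "'a \<Rightarrow> real"
  assumes Q: "prob_space Q" and "i \<in> I" and g: "integrable Q g"
  shows "integrable (Pi\<^sub>M I (\<lambda>_. Q)) (\<lambda>z. g (z i))" "(\<integral>z. g (z i) \<partial>Pi\<^sub>M I (\<lambda>_. Q)) = (\<integral>x. g x \<partial>Q)"
proof -
  have D: "distr (Pi\<^sub>M I (\<lambda>_. Q)) Q (\<lambda>z. z i) = Q" using distr_PiM_component[of I "\<lambda>_. Q" i] assms by simp
  have m: "(\<lambda>z. z i) \<in> Pi\<^sub>M I (\<lambda>_. Q) \<rightarrow>\<^sub>M Q" using \<open>i \<in> I\<close> by simp
  have gm: "g \<in> borel_measurable Q" using g by simp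
  show "integrable (Pi\<^sub>M I (\<lambda>_. Q)) (\<lambda>z. g (z i))"
    using integrable_distr_eq[OF m gm] g unfolding D by simp
  show "(\<integral>z. g (z i) \<partial>Pi\<^sub>M I (\<lambda>_. Q)) = (\<integral>x. g x \<partial>Q)"
    using integral_distr[OF m gm] unfolding D by simp
qed

lemma distr_gauss_z_fst:
  fixes \<beta> :: "real ^ 'p::finite"
  assumes \<tau>: "\<tau> > 0" shows "distr (gauss_z \<beta> \<tau>) borel fst = gauss_x"
proof (rule measure_eqI)
  interpret ge: prob_space "gauss_e \<tau>" by (rule prob_space_gauss_e[OF \<tau>])
  fix A assume "A \<in> sets (distr (gauss_z \<beta> \<tau>) borel fst)"
  then have A [measurable]: "A \<in> sets borel" by simp
  have "emeasure (distr (gauss_z \<beta> \<tau>) borel fst) A = (\<integral>\<^sup>+z. indicator A z \<partial>distr (gauss_z \<beta> \<tau>) borel fst)" by simp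
  also have "\<dots> = (\<integral>\<^sup>+z. indicator A (fst z) \<partial>gauss_z \<beta> \<tau>)" by (rule nn_integral_distr) measurable
  also have "\<dots> = (\<integral>\<^sup>+x. \<integral>\<^sup>+e. indicator A (fst (x, x \<bullet> \<beta> + e)) \<partial>gauss_e \<tau> \<partial>gauss_x)"
    by (rule nn_integral_gauss_z[OF \<tau>]) measurable
  also have "\<dots> = emeasure gauss_x A" by (simp add: ge.emeasure_space_1[simplified])
  finally show "emeasure (distr (gauss_z \<beta> \<tau>) borel fst) A = emeasure gauss_x A" .
qed simp

text \<open>The weighted second-moment matrix is so close, entry by entry, to a diagonal matrix with
  entries at least \<open>\<kappa> * N\<close> that half of the curvature survives. The weights lie
  in the unit interval, so dropping them only increases the quadratic form.\<close>

lemma curvature_of_truncated_entries: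
  fixes x :: "'i \<Rightarrow> real ^ 'p::finite" and \<kappa> N :: real and \<mu> :: "'p \<Rightarrow> 'p \<Rightarrow> real" and \<psi> :: "real ^ 'p \<Rightarrow> real"
  assumes \<psi>: "\<And>x. 0 \<le> \<psi> x" "\<And>x. \<psi> x \<le> 1" and N: "N \<ge> 0"
    and diag: "\<And>k. \<kappa> \<le> \<mu> k k" and off: "\<And>k l. k \<noteq> l \<Longrightarrow> \<mu> k l = 0"
    and close: "\<And>k l. \<bar>(\<Sum>i\<in>I. \<psi> (x i) * (x i $ k * x i $ l)) - N * \<mu> k l\<bar> \<le> \<kappa> / (2 * (CARD('p) * CARD('p))) * N"
  shows "\<kappa> / 2 * N * (norm a)\<^sup>2 \<le> a \<bullet> gram I x a"
proof -
  let ?T = "\<lambda>k l. \<Sum>i\<in>I. \<psi> (x i) * (x i $ k * x i $ l)"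
  let ?q = "real (CARD('p) * CARD('p))"
  have q: "?q > 0" by simp
  define T where "T k l = ?T k l - N * \<mu> k l" for k l
  define b where "b = (\<chi> k. \<Sum>l\<in>UNIV. T k l * a $ l)"
  have "norm b \<le> ?q * (\<kappa> / (2 * ?q) * N) * norm a"
    using close by (intro norm_matrix_entries_le[where T = T]) (auto simp: b_def T_def)
  also have "?q * (\<kappa> / (2 * ?q) * N) = \<kappa> / 2 * N" using q by (simp add: field_simps)
  finally have nb: "norm b \<le> \<kappa> / 2 * N * norm a" .
  have "(norm a)\<^sup>2 = (\<Sum>k\<in>UNIV. (a $ k)\<^sup>2)"
    unfolding power2_norm_eq_inner inner_vec_def by (simp add: power2_eq_square)
  then have "\<kappa> * N * (norm a)\<^sup>2 = (\<Sum>k\<in>UNIV. N * \<kappa> * (a $ k)\<^sup>2)"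
    by (simp add: sum_distrib_left mult_ac)
  also have "\<dots> \<le> (\<Sum>k\<in>UNIV. N * \<mu> k k * (a $ k)\<^sup>2)"
    using N diag by (intro sum_mono mult_right_mono mult_left_mono) auto
  also have "\<dots> = (\<Sum>k\<in>UNIV. a $ k * (\<Sum>l\<in>UNIV. N * \<mu> k l * a $ l))"
  proof (rule sum.cong[OF refl])
    fix k
    have "(\<Sum>l\<in>UNIV. N * \<mu> k l * a $ l) = (\<Sum>l\<in>UNIV. if l = k then N * \<mu> k k * a $ k else 0)"
      using off by (intro sum.cong) auto
    then show "N * \<mu> k k * (a $ k)\<^sup>2 = a $ k * (\<Sum>l\<in>UNIV. N * \<mu> k l * a $ l)" by (simp add: power2_eq_square)
  qed
  also have "\<dots> = (\<Sum>k\<in>UNIV. a $ k * (\<Sum>l\<in>UNIV. ?T k l * a $ l)) - a \<bullet> b"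
    by (simp add: b_def T_def inner_vec_def sum_subtractf algebra_simps)
  also have "(\<Sum>k\<in>UNIV. a $ k * (\<Sum>l\<in>UNIV. ?T k l * a $ l)) = (\<Sum>i\<in>I. \<psi> (x i) * (x i \<bullet> a)\<^sup>2)"
  proof -
    have "(\<Sum>k\<in>UNIV. a $ k * (\<Sum>l\<in>UNIV. ?T k l * a $ l)) =
        (\<Sum>k\<in>UNIV. \<Sum>l\<in>UNIV. \<Sum>i\<in>I. \<psi> (x i) * ((x i $ k * a $ k) * (x i $ l * a $ l)))"
      by (simp add: sum_distrib_left sum_distrib_right mult_ac)
    also have "\<dots> = (\<Sum>k\<in>UNIV. \<Sum>i\<in>I. \<Sum>l\<in>UNIV. \<psi> (x i) * ((x i $ k * a $ k) * (x i $ l * a $ l)))"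
      by (intro sum.cong refl sum.swap)
    also have "\<dots> = (\<Sum>i\<in>I. \<Sum>k\<in>UNIV. \<Sum>l\<in>UNIV. \<psi> (x i) * ((x i $ k * a $ k) * (x i $ l * a $ l)))"
      by (rule sum.swap)
    also have "\<dots> = (\<Sum>i\<in>I. \<psi> (x i) * (x i \<bullet> a)\<^sup>2)"
    proof (rule sum.cong[OF refl])
      fix i
      have "(\<Sum>k\<in>UNIV. \<Sum>l\<in>UNIV. \<psi> (x i) * ((x i $ k * a $ k) * (x i $ l * a $ l))) =
          \<psi> (x i) * (\<Sum>k\<in>UNIV. \<Sum>l\<in>UNIV. (x i $ k * a $ k) * (x i $ l * a $ l))"
        by (simp add: sum_distrib_left)
      then show "(\<Sum>k\<in>UNIV. \<Sum>l\<in>UNIV. \<psi> (x i) * ((x i $ k * a $ k) * (x i $ l * a $ l))) = \<psi> (x i) * (x i \<bullet> a)\<^sup>2"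
        by (simp only: inner_vec_def power2_eq_square sum_product inner_real_def)
    qed
    finally show ?thesis .
  qed
  also have "\<dots> \<le> (\<Sum>i\<in>I. (x i \<bullet> a)\<^sup>2)"
    using \<psi> by (intro sum_mono) (simp add: mult_left_le_one_le)
  also have "\<dots> = a \<bullet> gram I x a" by (simp add: inner_gram)
  finally have "\<kappa> * N * (norm a)\<^sup>2 \<le> a \<bullet> gram I x a - a \<bullet> b" by simp
  moreover have "\<bar>a \<bullet> b\<bar> \<le> \<kappa> / 2 * N * (norm a)\<^sup>2"
  proof -
    have "\<bar>a \<bullet> b\<bar> \<le> norm a * norm b" by (rule Cauchy_Schwarz_ineq2)
    also have "\<dots> \<le> norm a * (\<kappa> / 2 * N * norm a)" by (intro mult_left_mono nb) auto
    finally show ?thesis by (simp add: power2_eq_square mult_ac)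
  qed
  ultimately show ?thesis by (simp add: abs_le_iff)
qed

context lasso_pair
begin

sublocale gz: prob_space "gauss_z \<beta> \<tau>" by (rule prob_space_gauss_z[OF \<tau>])

lemma prob_P: "prob_space (P n)"
  by (intro prob_space_PiM prob_space_gauss_z[OF \<tau>])

text \<open>
  The smallest eigenvalue of the Gram matrix is of order \<open>n\<close> outside an exponentially unlikely
  event: truncating the covariates to the unit cube only decreases the Gram matrix, and makes
  Hoeffding's inequality applicable to its entries.
\<close>
lemma curvature_event:
  "\<exists>c0>0. \<exists>c1>0. \<exists>C1. \<exists>Bad. \<forall>n\<ge>1. Bad n \<in> sets (Pi\<^sub>M {1..n} (\<lambda>_. borel :: 'p datum measure)) \<and>
     measure (P n) (Bad n) \<le> C1 * exp (- c1 * real n) \<and>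
     (\<forall>z \<in> space (train_space n) - Bad n. \<forall>a. c0 * real n * (norm a)\<^sup>2 \<le> a \<bullet> gram {1..n} (\<lambda>i. fst (z i)) a)"
proof -
  define cube where "cube = {x :: real ^ 'p. \<forall>i. \<bar>x $ i\<bar> \<le> 1}"
  have [measurable]: "cube \<in> sets borel" unfolding cube_def by measurable
  define f where "f k l x = indicator cube x * (x $ k * x $ l)" for k l :: 'p and x :: "real ^ 'p"
  have [measurable]: "f k l \<in> borel_measurable borel" for k l unfolding f_def by measurable
  have fb: "\<bar>f k l x\<bar> \<le> 1" for k l x
    by (auto simp: f_def indicator_def cube_def abs_mult intro: mult_le_one)
  interpret gx: prob_space "gauss_x :: (real ^ 'p) measure" by (rule prob_space_gauss_x)
  have fi: "integrable gauss_x (f k l)" for k l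
    using fb by (intro gx.integrable_const_bound[where B = 1]) auto
  define \<mu> where "\<mu> k l = (\<integral>x. f k l x \<partial>gauss_x)" for k l
  \<comment> \<open>The cube is symmetric, so reflection of coordinate \<open>k\<close> reverses the
    sign of the truncated product.\<close>
  have off: "\<mu> k l = 0" if "k \<noteq> l" for k l
    unfolding \<mu>_def
  proof (rule integral_gauss_x_odd[where k = k])
    fix x :: "real ^ 'p"
    have "\<bar>flip_coord k x $ i\<bar> = \<bar>x $ i\<bar>" for i by (simp add: flip_coord_def)
    then have "flip_coord k x \<in> cube \<longleftrightarrow> x \<in> cube" by (simp add: cube_def)
    then show "f k l (flip_coord k x) = - f k l x" using that by (simp add: f_def indicator_def flip_coord_def)
  qed measurable
  \<comment> \<open>A vanishing integral of a nonnegative function would make it vanish almost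
    everywhere, but it is positive on a nonempty open set.\<close>
  have diag: "\<mu> k k > 0" for k
  proof (rule ccontr)
    assume "\<not> \<mu> k k > 0"
    have nn: "0 \<le> f k k x" for x by (simp add: f_def)
    then have "0 \<le> \<mu> k k" unfolding \<mu>_def by (rule Bochner_Integration.integral_nonneg)
    then have "\<mu> k k = 0" using \<open>\<not> \<mu> k k > 0\<close> by simp
    then have "AE x in gauss_x. f k k x = 0"
      using integral_nonneg_eq_0_iff_AE[OF fi, of k k] nn by (simp add: \<mu>_def)
    then have "AE x in gauss_x. x \<notin> {x. f k k x \<noteq> 0}" by simp
    then have z: "emeasure gauss_x {x. f k k x \<noteq> 0} = 0"
      by (subst (asm) AE_iff_measurable[OF _ refl]) (auto simp: f_def)
    let ?U = "{x :: real ^ 'p. (\<forall>i. \<bar>x $ i\<bar> < 1) \<and> x $ k > 0}"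
    have "?U = (\<Inter>i. {x. \<bar>x $ i\<bar> < 1}) \<inter> {x. 0 < x $ k}" by auto
    moreover have "open {x :: real ^ 'p. \<bar>x $ i\<bar> < 1}" for i by (intro open_Collect_less continuous_intros)
    moreover have "open {x :: real ^ 'p. 0 < x $ k}" by (intro open_Collect_less continuous_intros)
    ultimately have "open ?U" by (auto intro!: open_Int open_INT)
    moreover have "(\<chi> i. 1 / 2) \<in> ?U" by simp
    ultimately have "emeasure gauss_x ?U > 0" using emeasure_gauss_x_pos[of ?U] by blast
    also have "emeasure gauss_x ?U \<le> emeasure gauss_x {x. f k k x \<noteq> 0}"
      by (rule emeasure_mono) (auto simp: f_def cube_def less_imp_le)
    finally show False using z by simp
  qed
  define \<kappa> where "\<kappa> = Min (range (\<lambda>k. \<mu> k k))"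
  have \<kappa>: "\<kappa> > 0" "\<kappa> \<le> \<mu> k k" for k using diag by (simp_all add: \<kappa>_def)
  define q where "q = real (CARD('p) * CARD('p))"
  have q: "q > 0" unfolding q_def by simp
  define \<epsilon> where "\<epsilon> = \<kappa> / (2 * q)"
  have \<epsilon>: "\<epsilon> > 0" using \<kappa> q by (simp add: \<epsilon>_def)
  define dev where "dev n kl z = \<bar>(\<Sum>i=1..n. f (fst kl) (snd kl) (fst (z i))) - real n * \<mu> (fst kl) (snd kl)\<bar>" 
    for n kl and z :: "nat \<Rightarrow> 'p datum"
  have devm [measurable]: "dev n kl \<in> borel_measurable (Pi\<^sub>M {1..n} (\<lambda>_. borel))" for n kl
    unfolding dev_def by measurable
  define Bad where "Bad n = (\<Union>kl\<in>UNIV. {z \<in> space (train_space n). dev n kl z \<ge> \<epsilon> * real n})" for n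
  have "Bad n \<in> sets (Pi\<^sub>M {1..n} (\<lambda>_. borel :: 'p datum measure)) \<and>
     measure (P n) (Bad n) \<le> 2 * q * exp (- (\<epsilon>\<^sup>2 / 2) * real n) \<and>
     (\<forall>z \<in> space (train_space n) - Bad n. \<forall>a. \<kappa> / 2 * real n * (norm a)\<^sup>2 \<le> a \<bullet> gram {1..n} (\<lambda>i. fst (z i)) a)"
    if n: "n \<ge> 1" for n
  proof (intro conjI ballI allI)
    show B: "Bad n \<in> sets (Pi\<^sub>M {1..n} (\<lambda>_. borel :: 'p datum measure))" unfolding Bad_def by measurable
    interpret Pn: prob_space "P n" by (rule prob_P)
    have sp: "space (train_space n) = space (P n)" by (simp add: space_PiM)
    have hoeff: "Pn.prob {z \<in> space (P n). dev n kl z \<ge> \<epsilon> * real n} \<le> 2 * exp (- (\<epsilon>\<^sup>2 / 2) * real n)" for kl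
    proof -
      let ?g = "\<lambda>z :: 'p datum. f (fst kl) (snd kl) (fst z)"
      have gm [measurable]: "?g \<in> borel_measurable (gauss_z \<beta> \<tau>)" by measurable
      have ind: "Pn.indep_vars (\<lambda>_. borel) (\<lambda>i z. ?g (z i)) {1..n}"
        using n by (intro indep_vars_PiM_same prob_space_gauss_z[OF \<tau>] gm) auto
      have gi: "integrable (gauss_z \<beta> \<tau>) ?g" using fb by (intro gz.integrable_const_bound[where B = 1]) auto
      have "(\<integral>z. ?g z \<partial>gauss_z \<beta> \<tau>) = \<mu> (fst kl) (snd kl)"
        unfolding \<mu>_def distr_gauss_z_fst[OF \<tau>, of \<beta>, symmetric] by (subst integral_distr) auto
      then have Eg: "(\<integral>z. ?g (z i) \<partial>P n) = \<mu> (fst kl) (snd kl)" if "i \<in> {1..n}" for i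
        using integrable_PiM_component(2)[OF prob_space_gauss_z[OF \<tau>] that gi] by simp
      have E: "(\<Sum>i=1..n. \<integral>z. ?g (z i) \<partial>P n) = real n * \<mu> (fst kl) (snd kl)"
        using Eg by simp
      \<comment> \<open>The truncated products lie in \<open>{- 1..1}\<close>; this range of length
        2 determines the rate \<open>\<epsilon>\<^sup>2 / 2\<close>.\<close>
      have loc: "Hoeffding_ineq (P n) {1..n} (\<lambda>i z. ?g (z i)) (\<lambda>_. - 1) (\<lambda>_. 1)"
        using ind fb by unfold_locales (auto simp: abs_le_iff minus_le_iff)
      have "Pn.prob {z \<in> space (P n). \<bar>(\<Sum>i=1..n. ?g (z i)) - (\<Sum>i=1..n. \<integral>z. ?g (z i) \<partial>P n)\<bar> \<ge> \<epsilon> * real n}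
        \<le> 2 * exp (-2 * (\<epsilon> * real n)\<^sup>2 / (\<Sum>i=1..n. (1 - (- 1))\<^sup>2))"
        using \<epsilon> n by (intro Hoeffding_ineq.Hoeffding_ineq_abs_ge[OF loc]) auto
      also have "-2 * (\<epsilon> * real n)\<^sup>2 / (\<Sum>i=1..n. (1 - (- 1))\<^sup>2) = - (\<epsilon>\<^sup>2 / 2) * real n"
        using n by (simp add: power2_eq_square field_simps)
      finally show ?thesis unfolding E dev_def .
    qed
    have "Pn.prob (Bad n) \<le> (\<Sum>kl\<in>UNIV. Pn.prob {z \<in> space (P n). dev n kl z \<ge> \<epsilon> * real n})"
    proof -
      have "{z \<in> space (P n). dev n kl z \<ge> \<epsilon> * real n} \<in> sets (P n)" for kl by measurable
      then show ?thesis unfolding Bad_def sp by (intro Pn.finite_measure_subadditive_finite finite image_subsetI)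
    qed
    also have "\<dots> \<le> (\<Sum>kl\<in>(UNIV :: ('p \<times> 'p) set). 2 * exp (- (\<epsilon>\<^sup>2 / 2) * real n))" by (intro sum_mono hoeff)
    also have "\<dots> = 2 * q * exp (- (\<epsilon>\<^sup>2 / 2) * real n)" by (simp add: q_def)
    finally show "Pn.prob (Bad n) \<le> 2 * q * exp (- (\<epsilon>\<^sup>2 / 2) * real n)" .
    fix z a assume z: "z \<in> space (train_space n) - Bad n"
    show "\<kappa> / 2 * real n * (norm a)\<^sup>2 \<le> a \<bullet> gram {1..n} (\<lambda>i. fst (z i)) a"
    proof (rule curvature_of_truncated_entries[where \<psi> = "indicator cube" and \<mu> = \<mu>])
      fix k l
      have "z \<notin> {z \<in> space (train_space n). dev n (k, l) z \<ge> \<epsilon> * real n}" using z unfolding Bad_def by blast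
      then have "dev n (k, l) z < \<epsilon> * real n" using z by (simp add: not_le)
      then show "\<bar>(\<Sum>i\<in>{1..n}. indicator cube (fst (z i)) * (fst (z i) $ k * fst (z i) $ l)) - real n * \<mu> k l\<bar>
          \<le> \<kappa> / (2 * (CARD('p) * CARD('p))) * real n"
        unfolding dev_def f_def \<epsilon>_def q_def by simp
    qed (use \<kappa> off in \<open>auto simp: indicator_def\<close>)
  qed
  then show ?thesis using \<kappa>(1) \<epsilon>
    by (intro exI[of _ "\<kappa> / 2"] conjI exI[of _ "\<epsilon>\<^sup>2 / 2"] exI[of _ "2 * q"] exI[of _ Bad]) auto
qed

end


declare One_nat_def [simp del]

section \<open>Envelopes and moment bounds\<close>

context lasso_pair
begin

definition response_sq :: "nat \<Rightarrow> (nat \<Rightarrow> 'p datum) \<Rightarrow> real" where "response_sq n z = (\<Sum>i=1..n. (snd (z i))\<^sup>2)"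
text \<open>An envelope valid for every data set: \<open>response_sq\<close> bounds the norm of
  either solution, and products of two such norms are at most a multiple of this square.\<close>

definition crude_bound :: "nat \<Rightarrow> (nat \<Rightarrow> 'p datum) \<Rightarrow> real" where "crude_bound n z = (1 + response_sq n z)\<^sup>2"
text \<open>The transposed design matrix applied to the noise, recovered from the data.\<close>

definition noise_corr :: "nat \<Rightarrow> (nat \<Rightarrow> 'p datum) \<Rightarrow> real ^ 'p" where
  "noise_corr n z = (\<Sum>i=1..n. (snd (z i) - fst (z i) \<bullet> \<beta>) *\<^sub>R fst (z i))"

lemma response_sq_nonneg: "0 \<le> response_sq n z" by (simp add: response_sq_def sum_nonneg)

lemma crude_bound_ge: "1 \<le> crude_bound n z" "1 + 2 * response_sq n z \<le> crude_bound n z" "(response_sq n z)\<^sup>2 \<le> crude_bound n z"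
  using response_sq_nonneg[of n z] by (simp_all add: crude_bound_def power2_sum)

lemma measurable_response_sq [measurable]: "response_sq n \<in> borel_measurable (Pi\<^sub>M {1..n} (\<lambda>_. borel))"
  unfolding response_sq_def by measurable

lemma measurable_crude_bound [measurable]: "crude_bound n \<in> borel_measurable (Pi\<^sub>M {1..n} (\<lambda>_. borel))"
  unfolding crude_bound_def by measurable

lemma measurable_noise_corr [measurable]: "noise_corr n \<in> borel_measurable (Pi\<^sub>M {1..n} (\<lambda>_. borel))"
  unfolding noise_corr_def by measurable

lemma norm_datum: "\<bar>snd z\<bar> \<le> norm z" "norm (fst z) \<le> norm z" for z :: "'p datum"
  using norm_fst_le[of "fst z" "snd z"] norm_snd_le[of "snd z" "fst z"] by simp_all

lemma integrable_gauss_z_bound: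
  assumes [measurable]: "g \<in> borel_measurable borel" and "\<And>z :: 'p datum. \<bar>g z\<bar> \<le> C * norm z ^ m"
  shows "integrable (gauss_z \<beta> \<tau>) (g :: 'p datum \<Rightarrow> real)"
proof (rule Bochner_Integration.integrable_bound)
  show "integrable (gauss_z \<beta> \<tau>) (\<lambda>z. C * norm z ^ m)"
    by (intro integrable_mult_right integrable_gauss_z_norm \<tau>)
  show "AE z in gauss_z \<beta> \<tau>. norm (g z) \<le> norm (C * norm z ^ m)"
    using assms(2) by (intro AE_I2) (metis abs_ge_self order_trans real_norm_def)
qed measurable

text \<open>The fourth power of a sum of \<open>n\<close> squared responses costs
  \<open>n ^ 4\<close> by the power inequality, and there are \<open>n\<close> eighth moments: hence
  the exponent 5. Only its being polynomial matters.\<close>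

lemma crude_bound_moment: "\<exists>C. \<forall>n\<ge>1. integrable (P n) (\<lambda>z. (crude_bound n z)\<^sup>2) \<and> (\<integral>z. (crude_bound n z)\<^sup>2 \<partial>P n) \<le> C * real n ^ 5"
proof -
  define m8 where "m8 = (\<integral>z. \<bar>snd z\<bar> ^ 8 \<partial>gauss_z \<beta> \<tau>)"
  have i8: "integrable (gauss_z \<beta> \<tau>) (\<lambda>z. \<bar>snd z\<bar> ^ 8)"
  proof (rule integrable_gauss_z_bound[where C = 1 and m = 8])
    fix z :: "'p datum"
    have "\<bar>snd z\<bar> \<le> norm z" by (rule norm_datum)
    then show "\<bar>\<bar>snd z\<bar> ^ 8\<bar> \<le> 1 * norm z ^ 8" using power_mono[of "\<bar>snd z\<bar>" "norm z" 8] by simp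
  qed measurable
  have m8: "m8 \<ge> 0" unfolding m8_def by (intro Bochner_Integration.integral_nonneg) simp
  have "integrable (P n) (\<lambda>z. (crude_bound n z)\<^sup>2) \<and> (\<integral>z. (crude_bound n z)\<^sup>2 \<partial>P n) \<le> 16 * (1 + m8) * real n ^ 5" if n: "n \<ge> 1" for n
  proof -
    interpret Pn: prob_space "P n" by (rule prob_P)
    define R where "R z = 16 * (1 + real n ^ 4 * (\<Sum>i=1..n. \<bar>snd (z i)\<bar> ^ 8))" for z :: "nat \<Rightarrow> 'p datum"
    have comp: "integrable (P n) (\<lambda>z. \<bar>snd (z i)\<bar> ^ 8)" "(\<integral>z. \<bar>snd (z i)\<bar> ^ 8 \<partial>P n) = m8" if "i \<in> {1..n}" for i
      using integrable_PiM_component[OF prob_space_gauss_z[OF \<tau>] that i8] by (auto simp: m8_def)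
    have Ri: "integrable (P n) R" unfolding R_def
      by (intro integrable_mult_right Bochner_Integration.integrable_add Bochner_Integration.integrable_sum comp(1) Pn.integrable_const)
    define s where "s z = (\<Sum>i=1..n. \<bar>snd (z i)\<bar> ^ 8)" for z :: "nat \<Rightarrow> 'p datum"
    have si: "integrable (P n) s" unfolding s_def by (intro Bochner_Integration.integrable_sum comp(1))
    have "(\<integral>z. s z \<partial>P n) = (\<Sum>i=1..n. \<integral>z. \<bar>snd (z i)\<bar> ^ 8 \<partial>P n)"
      unfolding s_def by (intro Bochner_Integration.integral_sum comp(1))
    also have "\<dots> = (\<Sum>i=1..n. m8)" by (intro sum.cong comp(2)) auto
    finally have sv: "(\<integral>z. s z \<partial>P n) = real n * m8" by simp
    have R: "(\<integral>z. R z \<partial>P n) = 16 * (1 + real n ^ 4 * (real n * m8))"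
      unfolding R_def s_def[symmetric] sv[symmetric] using si by (simp add: Pn.prob_space)
    have le: "(crude_bound n z)\<^sup>2 \<le> R z" for z
    proof -
      have "(crude_bound n z)\<^sup>2 = (1 + response_sq n z) ^ 4" by (simp add: crude_bound_def)
      also have "\<dots> \<le> 2 ^ 4 * (1 ^ 4 + response_sq n z ^ 4)" by (rule power_add_le) (auto simp: response_sq_nonneg)
      also have "response_sq n z ^ 4 \<le> real (card {1..n}) ^ 4 * (\<Sum>i=1..n. ((snd (z i))\<^sup>2) ^ 4)"
        unfolding response_sq_def using n by (intro power_sum_le) auto
      also have "(\<Sum>i=1..n. ((snd (z i))\<^sup>2) ^ 4) = (\<Sum>i=1..n. \<bar>snd (z i)\<bar> ^ 8)" by simp
      finally show ?thesis by (simp add: R_def)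
    qed
    have int: "integrable (P n) (\<lambda>z. (crude_bound n z)\<^sup>2)"
    proof (rule Bochner_Integration.integrable_bound[OF Ri])
      show "AE z in P n. norm ((crude_bound n z)\<^sup>2) \<le> norm (R z)"
        using le by (intro AE_I2) (metis abs_ge_self order_trans real_norm_def abs_of_nonneg zero_le_power2)
    qed measurable
    have "(\<integral>z. (crude_bound n z)\<^sup>2 \<partial>P n) \<le> (\<integral>z. R z \<partial>P n)" by (intro integral_mono int Ri le)
    also have "\<dots> = 16 * (1 + m8 * real n ^ 5)" unfolding R by (simp add: power_numeral_reduce)
    also have "\<dots> \<le> 16 * (1 + m8) * real n ^ 5"
      using n m8 by (simp add: algebra_simps)
    finally show ?thesis using int by simp
  qed
  then show ?thesis by blast
qed

lemma integrable_crude_bound: "n \<ge> 1 \<Longrightarrow> integrable (P n) (crude_bound n)"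
proof -
  assume n: "n \<ge> 1"
  obtain C where "integrable (P n) (\<lambda>z. (crude_bound n z)\<^sup>2)" using crude_bound_moment n by blast
  then show ?thesis
  proof (rule Bochner_Integration.integrable_bound)
    have "norm (crude_bound n z) \<le> norm ((crude_bound n z)\<^sup>2)" for z
      using crude_bound_ge(1)[of n z] self_le_power[of "crude_bound n z" 2] by simp
    then show "AE z in P n. norm (crude_bound n z) \<le> norm ((crude_bound n z)\<^sup>2)" by simp
  qed measurable
qed

text \<open>Each coordinate is a sum of i.i.d. products of noise and covariate, centred by their
  independence, so the second moment grows linearly.\<close>

lemma noise_corr_moment: "\<exists>C. \<forall>n. integrable (P n) (\<lambda>z. (norm (noise_corr n z))\<^sup>2) \<and> (\<integral>z. (norm (noise_corr n z))\<^sup>2 \<partial>P n) \<le> C * real n"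
proof -
  interpret gx: prob_space "gauss_x :: (real ^ 'p) measure" by (rule prob_space_gauss_x)
  interpret ge: prob_space "gauss_e \<tau>" by (rule prob_space_gauss_e[OF \<tau>])
  interpret gp: pair_prob_space "gauss_x :: (real ^ 'p) measure" "gauss_e \<tau>" ..
  define g where "g k z = (snd z - fst z \<bullet> \<beta>) * fst z $ k" for k and z :: "'p datum"
  have [measurable]: "g k \<in> borel_measurable borel" for k unfolding g_def by measurable
  have gb: "\<bar>g k z\<bar> \<le> (1 + norm \<beta>) * norm z ^ 2" for k z
  proof -
    have "\<bar>g k z\<bar> \<le> (norm z + norm z * norm \<beta>) * norm z"
      unfolding g_def abs_mult
    proof (rule mult_mono)
      have "\<bar>snd z - fst z \<bullet> \<beta>\<bar> \<le> \<bar>snd z\<bar> + norm (fst z) * norm \<beta>"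
        using Cauchy_Schwarz_ineq2[of "fst z" \<beta>] by linarith
      also have "\<dots> \<le> norm z + norm z * norm \<beta>"
        by (intro add_mono mult_right_mono norm_datum) auto
      finally show "\<bar>snd z - fst z \<bullet> \<beta>\<bar> \<le> norm z + norm z * norm \<beta>" .
      show "\<bar>fst z $ k\<bar> \<le> norm z" using component_le_norm_cart[of "fst z" k] norm_datum(2)[of z] by linarith
    qed auto
    then show ?thesis by (simp add: power2_eq_square algebra_simps)
  qed
  have gi: "integrable (gauss_z \<beta> \<tau>) (g k)" for k
    by (rule integrable_gauss_z_bound[OF _ gb]) measurable
  have gi2: "integrable (gauss_z \<beta> \<tau>) (\<lambda>z. (g k z)\<^sup>2)" for k
  proof (rule integrable_gauss_z_bound[where C = "(1 + norm \<beta>)\<^sup>2" and m = 4])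
    show "\<bar>(g k z)\<^sup>2\<bar> \<le> (1 + norm \<beta>)\<^sup>2 * norm z ^ 4" for z
      using power_mono[OF gb[of k z], of 2] by (simp add: power_mult_distrib)
  qed measurable
  have mean: "(\<integral>z. g k z \<partial>gauss_z \<beta> \<tau>) = 0" for k
  proof -
    have ix: "integrable gauss_x (\<lambda>x :: real ^ 'p. x $ k)"
      by (rule Bochner_Integration.integrable_bound[OF integrable_gauss_x_moment[of k 1]]) auto
    have ie: "integrable (gauss_e \<tau>) (\<lambda>e. e)"
      by (rule Bochner_Integration.integrable_bound[OF integrable_gauss_e_moment[OF \<tau>, of 1]]) auto
    have "(\<integral>z. g k z \<partial>gauss_z \<beta> \<tau>) = (\<integral>w. fst w $ k * snd w \<partial>(gauss_x \<Otimes>\<^sub>M gauss_e \<tau>))"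
      unfolding gauss_z_def
      by (subst integral_distr[OF measurable_mk_datum[OF \<tau>]]) (auto simp: g_def case_prod_unfold mult.commute)
    also have "\<dots> = 0" using gp.integrable_pair_mult(2)[OF ix ie] integral_gauss_e_id[OF \<tau>] by simp
    finally show ?thesis .
  qed
  define V where "V k = (\<integral>z. (g k z)\<^sup>2 \<partial>gauss_z \<beta> \<tau>)" for k
  have "integrable (P n) (\<lambda>z. (norm (noise_corr n z))\<^sup>2) \<and> (\<integral>z. (norm (noise_corr n z))\<^sup>2 \<partial>P n) \<le> (\<Sum>k\<in>UNIV. V k) * real n" for n
  proof -
    have wk: "noise_corr n z $ k = (\<Sum>i=1..n. 1 * g k (z i))" for z k by (simp add: noise_corr_def g_def)
    have nn: "(\<integral>\<^sup>+z. ennreal ((noise_corr n z $ k)\<^sup>2) \<partial>P n) = ennreal (real n * V k)" for k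
      unfolding wk V_def
      using nn_integral_PiM_sum_sq[OF prob_space_gauss_z[OF \<tau>] _ gi gi2 mean, of "{1..n}" "\<lambda>_. 1" k] by simp
    have wm: "(\<lambda>z. (noise_corr n z $ k)\<^sup>2) \<in> borel_measurable (P n)" for k
      using measurable_compose[OF measurable_noise_corr measurable_vec_nth, of n k] by measurable
    have ik: "integrable (P n) (\<lambda>z. (noise_corr n z $ k)\<^sup>2)" for k
    proof (rule integrableI_nonneg)
      show "(\<integral>\<^sup>+z. ennreal ((noise_corr n z $ k)\<^sup>2) \<partial>P n) < \<infinity>" unfolding nn by simp
      show "(\<lambda>z. (noise_corr n z $ k)\<^sup>2) \<in> borel_measurable (P n)" by (rule wm)
    qed simp
    have vk: "(\<integral>z. (noise_corr n z $ k)\<^sup>2 \<partial>P n) = real n * V k" for k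
    proof -
      have "(\<integral>z. (noise_corr n z $ k)\<^sup>2 \<partial>P n) = enn2real (\<integral>\<^sup>+z. ennreal ((noise_corr n z $ k)\<^sup>2) \<partial>P n)"
        by (rule integral_eq_nn_integral[OF wm]) simp
      then show ?thesis unfolding nn by (simp add: V_def)
    qed
    have sq: "(norm (noise_corr n z))\<^sup>2 = (\<Sum>k\<in>UNIV. (noise_corr n z $ k)\<^sup>2)" for z
      unfolding power2_norm_eq_inner inner_vec_def by (simp add: power2_eq_square)
    have i: "integrable (P n) (\<lambda>z. (norm (noise_corr n z))\<^sup>2)" unfolding sq by (intro Bochner_Integration.integrable_sum ik)
    have "(\<integral>z. (norm (noise_corr n z))\<^sup>2 \<partial>P n) = (\<Sum>k\<in>UNIV. V k) * real n"
      unfolding sq by (simp add: Bochner_Integration.integral_sum[OF ik] vk sum_distrib_left mult.commute)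
    then show ?thesis using i by simp
  qed
  then show ?thesis by blast
qed

lemma corr_eq: "corr {1..n} z = gram {1..n} (\<lambda>i. fst (z i)) \<beta> + noise_corr n z"
proof -
  have "corr {1..n} z = (\<Sum>i=1..n. (fst (z i) \<bullet> \<beta>) *\<^sub>R fst (z i) + (snd (z i) - fst (z i) \<bullet> \<beta>) *\<^sub>R fst (z i))"
    unfolding corr_def by (simp add: scaleR_add_left[symmetric])
  then show ?thesis by (simp add: gram_def noise_corr_def sum.distrib)
qed

lemma estimator_facts:
  assumes n: "n \<ge> N0" and z: "z \<in> space (train_space n)"
  shows "lasso_kkt (gram {1..n} (\<lambda>i. fst (z i))) (corr {1..n} z) UNIV (lam n) (bhat1 n z)"
    and "lasso_kkt (gram {1..n} (\<lambda>i. fst (z i))) (corr {1..n} z) UNIV (lam n + \<delta> n) (bhat2 n z)"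
    and "norm (bhat1 n z) \<le> response_sq n z" and "norm (bhat2 n z) \<le> response_sq n z"
proof -
  have p: "n > 0" "lam n > 0" "lam n + \<delta> n > 0" "lam n \<ge> 1" "lam n + \<delta> n \<ge> 1"
    using n N0 lam(1)[OF n] \<delta>(1)[OF n] d1 by auto
  show "lasso_kkt (gram {1..n} (\<lambda>i. fst (z i))) (corr {1..n} z) UNIV (lam n) (bhat1 n z)"
    "lasso_kkt (gram {1..n} (\<lambda>i. fst (z i))) (corr {1..n} z) UNIV (lam n + \<delta> n) (bhat2 n z)"
    by (intro lasso_estimator_kkt est1 est2 n p z)+
  show "norm (bhat1 n z) \<le> response_sq n z" "norm (bhat2 n z) \<le> response_sq n z"
    unfolding response_sq_def using lasso_estimator_bound[OF est1[OF n] p(1,4) z] lasso_estimator_bound[OF est2[OF n] p(1,5) z] by auto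
qed

text \<open>Lipschitz dependence with curvature \<open>c0 * n\<close>. The two estimators share the
  correlations and differ in the penalty by at most \<open>d2\<close>; \<beta> is the solution for
  zero penalty and noiseless correlations.\<close>

lemma good_bounds:
  assumes n: "n \<ge> N0" and z: "z \<in> space (train_space n)" and c0: "c0 > 0"
    and curv: "\<And>a. c0 * real n * (norm a)\<^sup>2 \<le> a \<bullet> gram {1..n} (\<lambda>i. fst (z i)) a"
  shows "norm (bhat1 n z - bhat2 n z) \<le> d2 * CARD('p) / (c0 * real n)"
    and "norm (bhat1 n z - \<beta>) \<le> (norm (noise_corr n z) + L * CARD('p) * sqrt (real n)) / (c0 * real n)"
    and "norm (bhat2 n z - \<beta>) \<le> (norm (noise_corr n z) + L * CARD('p) * sqrt (real n)) / (c0 * real n)"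
proof -
  let ?G = "gram {1..n} (\<lambda>i. fst (z i))"
  have c: "c0 * real n > 0" using c0 n N0 by simp
  note k1 = estimator_facts(1)[OF n z] and k2 = estimator_facts(2)[OF n z]
  have k0: "lasso_kkt ?G (?G \<beta>) UNIV 0 \<beta>" by (rule lasso_kkt_zero[OF linear_gram]) auto
  note dist = lasso_kkt_dist[OF linear_gram c curv]
  have "norm (bhat1 n z - bhat2 n z) \<le> (norm (corr {1..n} z - corr {1..n} z) + \<bar>lam n - (lam n + \<delta> n)\<bar> * CARD('p)) / (c0 * real n)"
    by (rule dist[OF k1 k2])
  also have "\<dots> \<le> d2 * CARD('p) / (c0 * real n)"
    using \<delta>[OF n] d1 c by (intro divide_right_mono) (auto intro: mult_right_mono)
  finally show "norm (bhat1 n z - bhat2 n z) \<le> d2 * CARD('p) / (c0 * real n)" .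
  have *: "(norm (corr {1..n} z - ?G \<beta>) + \<bar>l - 0\<bar> * CARD('p)) / (c0 * real n) \<le> (norm (noise_corr n z) + L * CARD('p) * sqrt (real n)) / (c0 * real n)"
    if "0 \<le> l" "l \<le> L * sqrt (real n)" for l :: real
  proof (rule divide_right_mono)
    have "corr {1..n} z - ?G \<beta> = noise_corr n z" by (simp only: corr_eq add_diff_cancel_left')
    then show "norm (corr {1..n} z - ?G \<beta>) + \<bar>l - 0\<bar> * CARD('p) \<le> norm (noise_corr n z) + L * CARD('p) * sqrt (real n)"
      using that mult_right_mono[OF that(2), of "real CARD('p)"] by (simp add: mult_ac)
  qed (use c in simp)
  show "norm (bhat1 n z - \<beta>) \<le> (norm (noise_corr n z) + L * CARD('p) * sqrt (real n)) / (c0 * real n)"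
    using order_trans[OF dist[OF k1 k0] *] lam[OF n] \<delta>[OF n] d1 by simp
  show "norm (bhat2 n z - \<beta>) \<le> (norm (noise_corr n z) + L * CARD('p) * sqrt (real n)) / (c0 * real n)"
    using order_trans[OF dist[OF k2 k0] *] lam[OF n] \<delta>[OF n] d1 by simp
qed

end


section \<open>Expected size of the difference of the two losses\<close>

lemma poly_exp_tendsto_0:
  fixes c :: real
  assumes "c > 0"
  shows "(\<lambda>n. real n ^ k * exp (- c * real n)) \<longlonglongrightarrow> 0"
proof -
  have f: "filterlim (\<lambda>n. c * real n) at_top sequentially"
    using assms by (intro filterlim_tendsto_pos_mult_at_top[OF tendsto_const]) (auto intro: filterlim_real_sequentially)
  have "(\<lambda>n. (c * real n) ^ k / exp (c * real n)) \<longlonglongrightarrow> 0"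
    using filterlim_compose[OF tendsto_power_div_exp_0 f] .
  then have "(\<lambda>n. 1 / c ^ k * ((c * real n) ^ k / exp (c * real n))) \<longlonglongrightarrow> 1 / c ^ k * 0"
    by (intro tendsto_mult tendsto_const)
  moreover have "1 / c ^ k * ((c * real n) ^ k / exp (c * real n)) = real n ^ k * exp (- c * real n)" for n
    using assms by (simp add: power_mult_distrib exp_minus field_simps)
  ultimately show ?thesis by simp
qed

context lasso_pair
begin

text \<open>A difference of squared residuals factors into a term linear in the difference of the
  two solutions and one affine in their sum; this product dominates it up to a factor quadratic in
  the test point.\<close>

definition diff_size :: "nat \<Rightarrow> (nat \<Rightarrow> 'p datum) \<Rightarrow> real" where
  "diff_size n z = norm (bhat1 n z - bhat2 n z) * (1 + norm (bhat1 n z) + norm (bhat2 n z))"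

lemma diff_size_nonneg: "0 \<le> diff_size n z" by (simp add: diff_size_def)

lemma measurable_diff_size:
  assumes "n \<ge> N0" shows "diff_size n \<in> borel_measurable (Pi\<^sub>M {1..n} (\<lambda>_. borel))"
proof -
  note [measurable] = measurable_bhat[OF assms]
  show ?thesis unfolding diff_size_def by measurable
qed

lemma diff_size_le_crude_bound:
  assumes n: "n \<ge> N0" and z: "z \<in> space (train_space n)"
  shows "diff_size n z \<le> 4 * crude_bound n z"
proof -
  let ?s = "response_sq n z"
  note b = estimator_facts(3,4)[OF n z]
  have "diff_size n z \<le> (2 * ?s) * (1 + 2 * ?s)"
    unfolding diff_size_def using b norm_triangle_ineq4[of "bhat1 n z" "bhat2 n z"] response_sq_nonneg[of n z] by (intro mult_mono) auto
  also have "\<dots> \<le> 4 * crude_bound n z" using response_sq_nonneg[of n z] by (simp add: crude_bound_def power2_eq_square algebra_simps)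
  finally show ?thesis .
qed

text \<open>An envelope with polynomially growing second moment is negligible on an event of
  exponentially small probability.\<close>

lemma bad_contribution:
  assumes c1: "c1 > 0"
    and B: "\<And>n. n \<ge> 1 \<Longrightarrow> Bad n \<in> sets (Pi\<^sub>M {1..n} (\<lambda>_. borel :: 'p datum measure))"
      "\<And>n. n \<ge> 1 \<Longrightarrow> measure (P n) (Bad n) \<le> C1 * exp (- c1 * real n)"
  shows "\<exists>C. \<forall>\<^sub>F n in sequentially. (\<integral>z. crude_bound n z * indicator (Bad n) z \<partial>P n) \<le> C / real n ^ 2"
proof -
  obtain C where C: "\<And>n. n \<ge> 1 \<Longrightarrow> integrable (P n) (\<lambda>z. (crude_bound n z)\<^sup>2)" "\<And>n. n \<ge> 1 \<Longrightarrow> (\<integral>z. (crude_bound n z)\<^sup>2 \<partial>P n) \<le> C * real n ^ 5"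
    using crude_bound_moment by blast
  have "(\<lambda>n. C1 * (real n ^ 9 * exp (- c1 * real n))) \<longlonglongrightarrow> C1 * 0"
    by (intro tendsto_mult tendsto_const poly_exp_tendsto_0 c1)
  then have "\<forall>\<^sub>F n in sequentially. C1 * (real n ^ 9 * exp (- c1 * real n)) < 1"
    by (rule order_tendstoD) simp
  moreover have "\<forall>\<^sub>F n in sequentially. n \<ge> (1::nat)" by (rule eventually_ge_at_top)
  ultimately have "\<forall>\<^sub>F n in sequentially. (\<integral>z. crude_bound n z * indicator (Bad n) z \<partial>P n) \<le> (C + 1) / real n ^ 2"
  proof eventually_elim
    case (elim n)
    interpret Pn: prob_space "P n" by (rule prob_P)
    have BP: "Bad n \<in> sets (P n)" using B(1)[OF elim(2)] by (simp cong: sets_PiM_cong)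
    have n: "real n > 0" using elim by simp
    \<comment> \<open>A weighted substitute for the Cauchy-Schwarz inequality. The exponent 7 turns
      the second moment of order \<open>n ^ 5\<close> into a term of order \<open>1 / n ^ 2\<close>;
      the exponential has to absorb \<open>n ^ 7\<close> and a further \<open>n ^ 2\<close>, hence
      the power 9 above.\<close>
    have ineq: "crude_bound n z * indicator (Bad n) z \<le> 1 / real n ^ 7 * (crude_bound n z)\<^sup>2 + real n ^ 7 * indicator (Bad n) z" for z
    proof (cases "z \<in> Bad n")
      case True
      have "crude_bound n z \<le> 1 / real n ^ 7 * (crude_bound n z)\<^sup>2 + real n ^ 7"
      proof (cases "crude_bound n z \<le> real n ^ 7")
        case True
        then show ?thesis using n by (smt (verit) zero_le_divide_1_iff mult_nonneg_nonneg zero_le_power2 zero_le_power)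
      next
        case False
        then have "crude_bound n z * real n ^ 7 \<le> crude_bound n z * crude_bound n z" using crude_bound_ge(1)[of n z] by (intro mult_left_mono) auto
        then have "crude_bound n z \<le> 1 / real n ^ 7 * (crude_bound n z)\<^sup>2" using n by (simp add: field_simps power2_eq_square)
        then show ?thesis using n by (simp add: add_increasing2)
      qed
      then show ?thesis using True by simp
    qed simp
    have int: "integrable (P n) (\<lambda>z. crude_bound n z * indicator (Bad n) z)"
      by (rule integrable_real_mult_indicator[OF BP integrable_crude_bound[OF elim(2)]])
    have "(\<integral>z. crude_bound n z * indicator (Bad n) z \<partial>P n) \<le> (\<integral>z. 1 / real n ^ 7 * (crude_bound n z)\<^sup>2 + real n ^ 7 * indicator (Bad n) z \<partial>P n)"
      using C(1)[OF elim(2)] BP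
      by (intro integral_mono int ineq Bochner_Integration.integrable_add integrable_mult_right) (auto simp: Pn.emeasure_eq_measure)
    also have "\<dots> = 1 / real n ^ 7 * (\<integral>z. (crude_bound n z)\<^sup>2 \<partial>P n) + real n ^ 7 * Pn.prob (Bad n)"
      using C(1)[OF elim(2)] BP sets.sets_into_space[OF BP]
      by (subst Bochner_Integration.integral_add) (auto simp: Pn.emeasure_eq_measure Int_absorb2)
    also have "\<dots> \<le> 1 / real n ^ 7 * (C * real n ^ 5) + real n ^ 7 * (C1 * exp (- c1 * real n))"
      using C(2)[OF elim(2)] B(2)[OF elim(2)] n by (intro add_mono mult_left_mono) auto
    also have "1 / real n ^ 7 * (C * real n ^ 5) = C / real n ^ 2" using n by (simp add: field_simps power_numeral_reduce)
    also have "real n ^ 7 * (C1 * exp (- c1 * real n)) = C1 * (real n ^ 9 * exp (- c1 * real n)) / real n ^ 2"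
      using n by (simp add: field_simps power_numeral_reduce)
    also have "C / real n ^ 2 + C1 * (real n ^ 9 * exp (- c1 * real n)) / real n ^ 2 \<le> (C + 1) / real n ^ 2"
      using elim(1) n by (simp add: add_divide_distrib[symmetric] divide_right_mono)
    finally show ?case .
  qed
  then show ?thesis by blast
qed

lemma integrable_diff_size:
  assumes n: "n \<ge> N0" shows "integrable (P n) (diff_size n)" "integrable (P n) (\<lambda>z. (diff_size n z)\<^sup>2)"
proof -
  have n1: "n \<ge> 1" using n N0 by simp
  note [measurable] = measurable_diff_size[OF n]
  obtain C where C: "integrable (P n) (\<lambda>z. (crude_bound n z)\<^sup>2)" using crude_bound_moment n1 by blast
  have sp: "z \<in> space (train_space n)" if "z \<in> space (P n)" for z using that by (simp add: space_PiM)
  show "integrable (P n) (diff_size n)"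
  proof (rule Bochner_Integration.integrable_bound)
    show "integrable (P n) (\<lambda>z. 4 * crude_bound n z)" by (intro integrable_mult_right integrable_crude_bound n1)
    show "AE z in P n. norm (diff_size n z) \<le> norm (4 * crude_bound n z)"
      using diff_size_le_crude_bound[OF n] sp diff_size_nonneg crude_bound_ge(1) by (intro AE_I2) (smt (verit) real_norm_def)
  qed measurable
  show "integrable (P n) (\<lambda>z. (diff_size n z)\<^sup>2)"
  proof (rule Bochner_Integration.integrable_bound)
    show "integrable (P n) (\<lambda>z. 16 * (crude_bound n z)\<^sup>2)" by (intro integrable_mult_right C)
    have "(diff_size n z)\<^sup>2 \<le> 16 * (crude_bound n z)\<^sup>2" if "z \<in> space (P n)" for z
      using power_mono[OF diff_size_le_crude_bound[OF n sp[OF that]] diff_size_nonneg, of 2] by (simp add: power_mult_distrib)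
    then show "AE z in P n. norm ((diff_size n z)\<^sup>2) \<le> norm (16 * (crude_bound n z)\<^sup>2)" by (intro AE_I2) simp
  qed measurable
qed

text \<open>On the curvature event the difference of the solutions is of order \<open>1 / n\<close>
  and their norms have bounded expectation; elsewhere the envelope is used.\<close>

lemma diff_size_expectation: "\<exists>C\<ge>0. \<forall>\<^sub>F n in sequentially. (\<integral>z. diff_size n z \<partial>P n) \<le> C / real n"
proof -
  obtain c0 c1 C1 Bad where c: "c0 > 0" "c1 > 0"
    and B: "\<And>n. n \<ge> 1 \<Longrightarrow> Bad n \<in> sets (Pi\<^sub>M {1..n} (\<lambda>_. borel :: 'p datum measure))"
      "\<And>n. n \<ge> 1 \<Longrightarrow> measure (P n) (Bad n) \<le> C1 * exp (- c1 * real n)"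
      "\<And>n z a. n \<ge> 1 \<Longrightarrow> z \<in> space (train_space n) - Bad n \<Longrightarrow> c0 * real n * (norm a)\<^sup>2 \<le> a \<bullet> gram {1..n} (\<lambda>i. fst (z i)) a"
    using curvature_event by blast
  obtain C2 where C2: "\<forall>\<^sub>F n in sequentially. (\<integral>z. crude_bound n z * indicator (Bad n) z \<partial>P n) \<le> C2 / real n ^ 2"
    using bad_contribution[OF c(2) B(1,2)] by blast
  obtain Cw where Cw: "\<And>n. integrable (P n) (\<lambda>z. (norm (noise_corr n z))\<^sup>2)" "\<And>n. (\<integral>z. (norm (noise_corr n z))\<^sup>2 \<partial>P n) \<le> Cw * real n"
    using noise_corr_moment by blast
  let ?p = "real CARD('p)"
  have d2: "d2 > 0" using \<delta>[of N0] d1 by simp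
  define C where "C = d2 * ?p / c0 * (1 + 2 * norm \<beta> + 2 / c0 * (1 + Cw + L * ?p)) + 4 * \<bar>C2\<bar>"
  have Cw0: "Cw \<ge> 0"
  proof -
    have "0 \<le> (\<integral>z. (norm (noise_corr 1 z))\<^sup>2 \<partial>P 1)" by (intro Bochner_Integration.integral_nonneg) simp
    also have "\<dots> \<le> Cw * real 1" by (rule Cw(2))
    finally show ?thesis by simp
  qed
  have "C \<ge> 0" unfolding C_def using c d2 Cw0 L_pos by simp
  have "\<forall>\<^sub>F n in sequentially. n \<ge> N0" by (rule eventually_ge_at_top)
  then have "\<forall>\<^sub>F n in sequentially. (\<integral>z. diff_size n z \<partial>P n) \<le> C / real n"
    using C2
  proof eventually_elim
    case (elim n)
    then have n1: "n \<ge> 1" "real n \<ge> 1" using N0 by simp_all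
    interpret Pn: prob_space "P n" by (rule prob_P)
    have BP: "Bad n \<in> sets (P n)" using B(1)[OF n1(1)] by (simp cong: sets_PiM_cong)
    define K where "K = d2 * ?p / (c0 * real n)"
    have K: "K \<ge> 0" using d2 c by (simp add: K_def)
    define R where "R z = K * (1 + 2 * norm \<beta> + 2 * ((1 + (norm (noise_corr n z))\<^sup>2) + L * ?p * real n) / (c0 * real n)) 
      + 4 * (crude_bound n z * indicator (Bad n) z)" for z
    have le: "diff_size n z \<le> R z" if "z \<in> space (P n)" for z
    proof -
      have z: "z \<in> space (train_space n)" using that by (simp add: space_PiM)
      \<comment> \<open>Passing to the square of the norm lets the linearly growing second moment of
        \<open>noise_corr\<close> suffice.\<close>
      have w: "norm (noise_corr n z) \<le> 1 + (norm (noise_corr n z))\<^sup>2"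
      proof -
        have "2 * norm (noise_corr n z) \<le> (norm (noise_corr n z))\<^sup>2 + 1"
          using zero_le_power2[of "norm (noise_corr n z) - 1"] by (simp add: power2_diff)
        then show ?thesis using norm_ge_zero[of "noise_corr n z"] by linarith
      qed
      \<comment> \<open>Generous, but after division by \<open>c0 * n\<close> a bounded term
        remains.\<close>
      have sq: "sqrt (real n) \<le> real n"
        using n1 real_le_rsqrt[of 1 "real n"] by (intro real_le_lsqrt) (auto simp: power2_eq_square)
      have A0: "0 \<le> K * (1 + 2 * norm \<beta> + 2 * ((1 + (norm (noise_corr n z))\<^sup>2) + L * ?p * real n) / (c0 * real n))"
        using K c L_pos by (intro mult_nonneg_nonneg) (auto intro!: add_nonneg_nonneg divide_nonneg_nonneg)
      show ?thesis
      proof (cases "z \<in> Bad n")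
        case True
        then show ?thesis using diff_size_le_crude_bound[OF elim(1) z] A0 by (simp add: R_def)
      next
        case False
        then have cv: "c0 * real n * (norm a)\<^sup>2 \<le> a \<bullet> gram {1..n} (\<lambda>i. fst (z i)) a" for a using B(3)[OF n1(1)] z by blast
        note gb = good_bounds[OF elim(1) z c(1) cv]
        have W: "(norm (noise_corr n z) + L * ?p * sqrt (real n)) / (c0 * real n) \<le> ((1 + (norm (noise_corr n z))\<^sup>2) + L * ?p * real n) / (c0 * real n)"
          using w sq c L_pos by (intro divide_right_mono add_mono mult_left_mono) auto
        have nb: "norm b \<le> norm \<beta> + ((1 + (norm (noise_corr n z))\<^sup>2) + L * ?p * real n) / (c0 * real n)"
          if "norm (b - \<beta>) \<le> (norm (noise_corr n z) + L * ?p * sqrt (real n)) / (c0 * real n)" for b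
          using norm_triangle_ineq[of \<beta> "b - \<beta>"] that W by simp
        have "diff_size n z \<le> K * (1 + (norm \<beta> + ((1 + (norm (noise_corr n z))\<^sup>2) + L * ?p * real n) / (c0 * real n)) + 
          (norm \<beta> + ((1 + (norm (noise_corr n z))\<^sup>2) + L * ?p * real n) / (c0 * real n)))"
          unfolding diff_size_def using gb(1) K
          by (intro mult_mono add_mono nb[OF gb(2)] nb[OF gb(3)]) (auto simp: K_def)
        also have "\<dots> = R z" using False by (simp add: R_def add_divide_distrib algebra_simps)
        finally show ?thesis .
      qed
    qed
    have Ri: "integrable (P n) R" unfolding R_def
      by (intro Bochner_Integration.integrable_add integrable_mult_right integrable_divide Cw(1) Pn.integrable_const
          integrable_real_mult_indicator[OF BP integrable_crude_bound[OF n1(1)]])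
    have iB: "integrable (P n) (\<lambda>z. crude_bound n z * indicator (Bad n) z)"
      by (rule integrable_real_mult_indicator[OF BP integrable_crude_bound[OF n1(1)]])
    have "(\<integral>z. diff_size n z \<partial>P n) \<le> (\<integral>z. R z \<partial>P n)" by (intro integral_mono integrable_diff_size elim Ri le)
    also have "\<dots> = K * (1 + 2 * norm \<beta> + 2 * ((1 + (\<integral>z. (norm (noise_corr n z))\<^sup>2 \<partial>P n)) + L * ?p * real n) / (c0 * real n))
      + 4 * (\<integral>z. crude_bound n z * indicator (Bad n) z \<partial>P n)"
      unfolding R_def using Cw(1)[of n] iB by (simp add: Pn.prob_space)
    also have "\<dots> \<le> K * (1 + 2 * norm \<beta> + 2 * ((real n + Cw * real n) + L * ?p * real n) / (c0 * real n)) + 4 * (\<bar>C2\<bar> / real n)"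
    proof (intro add_mono mult_left_mono divide_right_mono order_refl Cw(2) n1(2) K)
      have "C2 / real n ^ 2 \<le> \<bar>C2\<bar> / real n"
        using n1 by (intro frac_le) (auto simp: power2_eq_square)
      then show "(\<integral>z. crude_bound n z * indicator (Bad n) z \<partial>P n) \<le> \<bar>C2\<bar> / real n" using elim(2) by simp
    qed (use c L_pos in auto)
    also have "\<dots> = C / real n"
    proof -
      have "2 * ((real n + Cw * real n) + L * ?p * real n) / (c0 * real n) = 2 / c0 * (1 + Cw + L * ?p)"
        using n1 c by (simp add: field_simps)
      then show ?thesis using n1 c by (simp add: C_def K_def add_divide_distrib algebra_simps)
    qed
    finally show ?case .
  qed
  then show ?thesis using \<open>C \<ge> 0\<close> by blast
qed

end


section \<open>Strict difference of the second moments in the null coordinate\<close>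

context lasso_pair
begin

text \<open>Closeness to the identity depends on the design only, so the estimate carries over from
  the law of the covariates to that of the data.\<close>

lemma not_near_id_prob:
  "\<exists>C. \<forall>n\<ge>1. measure (P n) {z \<in> space (train_space n). \<not> near_id_entries \<eta>0 (real n) {1..n} (\<lambda>i. fst (z i))} \<le> C / real n"
proof -
  obtain C where C: "\<And>I :: nat set. finite I \<Longrightarrow> I \<noteq> {} \<Longrightarrow>
     measure (Pi\<^sub>M I (\<lambda>_. gauss_x)) {x \<in> space (Pi\<^sub>M I (\<lambda>_. borel :: (real ^ 'p) measure)). \<not> near_id_entries \<eta>0 (card I) I x}
       \<le> C / real (card I)"
    using near_id_entries_prob[OF \<eta>0(1)] by blast
  have "measure (P n) {z \<in> space (train_space n). \<not> near_id_entries \<eta>0 (real n) {1..n} (\<lambda>i. fst (z i))} \<le> C / real n"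
    if n: "n \<ge> 1" for n
  proof -
    let ?PX = "Pi\<^sub>M {1..n} (\<lambda>_. gauss_x :: (real ^ 'p) measure)" and ?PE = "Pi\<^sub>M {1..n} (\<lambda>_. gauss_e \<tau>)"
    interpret PX: prob_space ?PX by (intro prob_space_PiM prob_space_gauss_x)
    interpret PE: prob_space ?PE by (intro prob_space_PiM prob_space_gauss_e \<tau>)
    let ?A = "{z \<in> space (train_space n). \<not> near_id_entries \<eta>0 (real n) {1..n} (\<lambda>i. fst (z i))}"
    let ?B = "{x \<in> space (Pi\<^sub>M {1..n} (\<lambda>_. borel)). \<not> near_id_entries \<eta>0 (real n) {1..n} x}"
    have A: "?A \<in> sets (Pi\<^sub>M {1..n} (\<lambda>_. borel))" by measurable
    then have AP: "?A \<in> sets (P n)" by (simp cong: sets_PiM_cong)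
    have B: "?B \<in> sets ?PX" by measurable
    have "emeasure (P n) ?A = (\<integral>\<^sup>+z. indicator ?A z \<partial>P n)" using AP by simp
    also have "\<dots> = (\<integral>\<^sup>+X. \<integral>\<^sup>+E. indicator ?A (mk_data \<beta> {1..n} X E) \<partial>?PE \<partial>?PX)"
      using A by (intro nn_integral_PiM_gauss_z[OF \<tau>] borel_measurable_indicator) auto
    also have "\<dots> = (\<integral>\<^sup>+X. \<integral>\<^sup>+E. indicator ?B X \<partial>?PE \<partial>?PX)"
    proof (intro nn_integral_cong)
      fix X :: "nat \<Rightarrow> real ^ 'p" and E :: "nat \<Rightarrow> real" assume "X \<in> space ?PX"
      then have "X \<in> space (Pi\<^sub>M {1..n} (\<lambda>_. borel))" by (simp add: space_PiM)
      moreover have "near_id_entries \<eta>0 (real n) {1..n} (\<lambda>i. fst (mk_data \<beta> {1..n} X E i)) = near_id_entries \<eta>0 (real n) {1..n} X"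
        unfolding near_id_entries_def by (simp add: mk_data_def)
      ultimately show "indicator ?A (mk_data \<beta> {1..n} X E) = (indicator ?B X :: ennreal)" by (simp add: indicator_def)
    qed
    also have "\<dots> = emeasure ?PX ?B" using B by (simp add: PE.emeasure_space_1)
    finally have "measure (P n) ?A = PX.prob ?B" by (simp add: measure_def)
    also have "\<dots> \<le> C / real n" using C[of "{1..n}"] n by simp
    finally show ?thesis .
  qed
  then show ?thesis by blast
qed

lemma coord_sq_diff_le_diff_size: "\<bar>(bhat1 n z $ j)\<^sup>2 - (bhat2 n z $ j)\<^sup>2\<bar> \<le> diff_size n z"
proof -
  have "(bhat1 n z $ j)\<^sup>2 - (bhat2 n z $ j)\<^sup>2 = (bhat1 n z - bhat2 n z) $ j * (bhat1 n z $ j + bhat2 n z $ j)"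
    by (simp add: power2_eq_square algebra_simps)
  then have "\<bar>(bhat1 n z $ j)\<^sup>2 - (bhat2 n z $ j)\<^sup>2\<bar> = \<bar>(bhat1 n z - bhat2 n z) $ j\<bar> * \<bar>bhat1 n z $ j + bhat2 n z $ j\<bar>"
    by (simp add: abs_mult)
  also have "\<dots> \<le> norm (bhat1 n z - bhat2 n z) * (1 + norm (bhat1 n z) + norm (bhat2 n z))"
  proof (rule mult_mono)
    show "\<bar>bhat1 n z $ j + bhat2 n z $ j\<bar> \<le> 1 + norm (bhat1 n z) + norm (bhat2 n z)"
      using component_le_norm_cart[of "bhat1 n z" j] component_le_norm_cart[of "bhat2 n z" j] by linarith
  qed (auto simp: component_le_norm_cart simp del: vector_minus_component)
  finally show ?thesis by (simp add: diff_size_def)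
qed

text \<open>Near the identity the difference is at least
  \<open>\<delta> n / n * \<bar>bhat2 n z $ j\<bar>\<close>, with expectation at least of order
  \<open>1 / (n * sqrt n)\<close>. Away from it, as long as curvature holds, the modulus is of order
  \<open>1 / n\<close> times the size of the coordinates, on an event of probability
  \<open>O(1 / n)\<close>; this costs only \<open>O(1 / n ^ 2)\<close>, and so does a failure of
  curvature.\<close>

lemma coord_sq_diff_pos:
  "\<forall>\<^sub>F n in sequentially. 0 < (\<integral>z. (bhat1 n z $ j)\<^sup>2 - (bhat2 n z $ j)\<^sup>2 \<partial>P n)"
proof -
  obtain c0 c1 C1 Bad where c: "c0 > 0" "c1 > 0"
    and B: "\<And>n. n \<ge> 1 \<Longrightarrow> Bad n \<in> sets (Pi\<^sub>M {1..n} (\<lambda>_. borel :: 'p datum measure))"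
      "\<And>n. n \<ge> 1 \<Longrightarrow> measure (P n) (Bad n) \<le> C1 * exp (- c1 * real n)"
      "\<And>n z a. n \<ge> 1 \<Longrightarrow> z \<in> space (train_space n) - Bad n \<Longrightarrow> c0 * real n * (norm a)\<^sup>2 \<le> a \<bullet> gram {1..n} (\<lambda>i. fst (z i)) a"
    using curvature_event by blast
  obtain C2 where C2: "\<forall>\<^sub>F n in sequentially. (\<integral>z. crude_bound n z * indicator (Bad n) z \<partial>P n) \<le> C2 / real n ^ 2"
    using bad_contribution[OF c(2) B(1,2)] by blast
  obtain Cw where Cw: "\<And>n. integrable (P n) (\<lambda>z. (norm (noise_corr n z))\<^sup>2)" "\<And>n. (\<integral>z. (norm (noise_corr n z))\<^sup>2 \<partial>P n) \<le> Cw * real n"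
    using noise_corr_moment by blast
  let ?V = "\<lambda>n. {z \<in> space (train_space n). near_id_entries \<eta>0 (real n) {1..n} (\<lambda>i. fst (z i))}"
  let ?V' = "\<lambda>n. {z \<in> space (train_space n). \<not> near_id_entries \<eta>0 (real n) {1..n} (\<lambda>i. fst (z i))}"
  obtain C3 where C3: "\<And>n. n \<ge> 1 \<Longrightarrow> measure (P n) (?V' n) \<le> C3 / real n" using not_near_id_prob by blast
  obtain c4 where c4: "c4 > 0" and large: "\<forall>\<^sub>F n in sequentially. 
    (\<integral>\<^sup>+z. ennreal \<bar>bhat2 n z $ j\<bar> * indicator {z. near_id_entries \<eta>0 (real n) {1..n} (\<lambda>i. fst (z i))} z \<partial>P n)
      \<ge> ennreal (c4 / sqrt (real n))"
    using large_coord_expectation by blast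
  let ?p = "real CARD('p)"
  define K where "K = d2 * ?p / c0"
  have d2: "d2 > 0" using \<delta>[of N0] d1 by simp
  have K: "K > 0" using d2 c by (simp add: K_def)
  define C where "C = K * (2 * (Cw + L\<^sup>2 * ?p\<^sup>2) / c0\<^sup>2 + C3) + C2"
  have "filterlim (\<lambda>n. sqrt (real n)) at_top sequentially"
    by (intro filterlim_compose[OF sqrt_at_top filterlim_real_sequentially])
  then have "\<forall>\<^sub>F n in sequentially. sqrt (real n) > \<bar>C\<bar> / (d1 * c4)"
    by (simp add: filterlim_at_top_dense)
  moreover have "\<forall>\<^sub>F n in sequentially. n \<ge> N0" by (rule eventually_ge_at_top)
  ultimately show ?thesis using C2 large
  proof eventually_elim
    case (elim n)
    then have n1: "n \<ge> 1" "real n \<ge> 1" using N0 by simp_all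
    interpret Pn: prob_space "P n" by (rule prob_P)
    note [measurable] = measurable_bhat[OF elim(2)] measurable_diff_size[OF elim(2)]
    have BP: "Bad n \<in> sets (P n)" using B(1)[OF n1(1)] by (simp cong: sets_PiM_cong)
    have V: "?V n \<in> sets (P n)" "?V' n \<in> sets (P n)" by measurable
    define w where "w = (\<lambda>z. (norm (noise_corr n z))\<^sup>2)"
    have wi: "integrable (P n) w" "(\<integral>z. w z \<partial>P n) \<le> Cw * real n" using Cw[of n] by (auto simp: w_def)
    define D where "D = (c0 * real n)\<^sup>2"
    have D: "D > 0" using c n1 by (simp add: D_def)
    \<comment> \<open>A pointwise lower bound whose expectation can be estimated term by term: the
      gain near the identity, the loss on the complement, and the envelope where curvature
      fails.\<close>
    define R where "R z = d1 / real n * (\<bar>bhat2 n z $ j\<bar> * indicator (?V n) z)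
      - K / real n * (2 * (w z + L\<^sup>2 * ?p\<^sup>2 * real n) / D + indicator (?V' n) z) - crude_bound n z * indicator (Bad n) z" for z
    have le: "R z \<le> (bhat1 n z $ j)\<^sup>2 - (bhat2 n z $ j)\<^sup>2" if "z \<in> space (P n)" for z
    proof -
      have z: "z \<in> space (train_space n)" using that by (simp add: space_PiM)
      have Q0: "0 \<le> 2 * (w z + L\<^sup>2 * ?p\<^sup>2 * real n) / D" using D by (simp add: w_def)
      have KQ0: "0 \<le> K / real n * (2 * (w z + L\<^sup>2 * ?p\<^sup>2 * real n) / D)" by (intro mult_nonneg_nonneg Q0) (use K in simp)
      have Bz0: "0 \<le> crude_bound n z * indicator (Bad n) z" using crude_bound_ge(1)[of n z] by simp
      show ?thesis
      proof (cases "z \<in> ?V n")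
        case True
        then have ni: "near_id \<eta>0 (real n) (gram {1..n} (\<lambda>i. fst (z i)))"
          using near_id_entries_imp[of \<eta>0 "{1..n}" "\<lambda>i. fst (z i)"] by simp
        have "\<delta> n / real n * \<bar>bhat2 n z $ j\<bar> \<le> (bhat1 n z $ j)\<^sup>2 - (bhat2 n z $ j)\<^sup>2"
          using n1 lam[OF elim(2)] \<delta>[OF elim(2)] d1
          by (intro lasso_kkt_diff_coord(4)[OF linear_gram ni _ \<eta>0(5) _ _ estimator_facts(1,2)[OF elim(2) z]]) auto
        moreover have "d1 / real n * \<bar>bhat2 n z $ j\<bar> \<le> \<delta> n / real n * \<bar>bhat2 n z $ j\<bar>"
          using \<delta>[OF elim(2)] n1 by (intro mult_right_mono divide_right_mono) auto
        moreover have "indicator (?V n) z = (1 :: real)" "indicator (?V' n) z = (0 :: real)" using True by auto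
        ultimately show ?thesis unfolding R_def using KQ0 Bz0 by simp
      next
        case False
        then have i: "indicator (?V n) z = (0 :: real)" "indicator (?V' n) z = (1 :: real)" using z by auto
        show ?thesis
        proof (cases "z \<in> Bad n")
          case True
          have "\<bar>bhat2 n z $ j\<bar> \<le> response_sq n z"
            using component_le_norm_cart[of "bhat2 n z" j] estimator_facts(4)[OF elim(2) z] by linarith
          then have "(bhat2 n z $ j)\<^sup>2 \<le> (response_sq n z)\<^sup>2" using abs_le_square_iff[of "bhat2 n z $ j" "response_sq n z"] response_sq_nonneg[of n z] by simp
          then have "(bhat2 n z $ j)\<^sup>2 \<le> crude_bound n z" using crude_bound_ge(3)[of n z] by simp
          moreover have "0 \<le> K / real n * (2 * (w z + L\<^sup>2 * ?p\<^sup>2 * real n) / D + 1)"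
            by (intro mult_nonneg_nonneg add_nonneg_nonneg Q0) (use K in simp_all)
          moreover have "0 \<le> (bhat1 n z $ j)\<^sup>2" by simp
          moreover have "R z = 0 - K / real n * (2 * (w z + L\<^sup>2 * ?p\<^sup>2 * real n) / D + 1) - crude_bound n z"
            unfolding R_def i using True by simp
          ultimately show ?thesis by linarith
        next
          case False
          then have cv: "c0 * real n * (norm a)\<^sup>2 \<le> a \<bullet> gram {1..n} (\<lambda>i. fst (z i)) a" for a using B(3)[OF n1(1)] z by blast
          note gb = good_bounds[OF elim(2) z c(1) cv]
          define r where "r = (norm (noise_corr n z) + L * ?p * sqrt (real n)) / (c0 * real n)"
          have r0: "r \<ge> 0" using c L_pos by (simp add: r_def)
          have bj: "\<bar>bhat1 n z $ j\<bar> \<le> r" "\<bar>bhat2 n z $ j\<bar> \<le> r"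
            using component_le_norm_cart[of "bhat1 n z - \<beta>" j] component_le_norm_cart[of "bhat2 n z - \<beta>" j] gb(2,3) null
            unfolding r_def by auto
          have coord_diff: "\<bar>bhat1 n z $ j - bhat2 n z $ j\<bar> \<le> K / real n"
            using component_le_norm_cart[of "bhat1 n z - bhat2 n z" j] gb(1) by (simp add: K_def)
          have "r\<^sup>2 = (norm (noise_corr n z) + L * ?p * sqrt (real n))\<^sup>2 / D" by (simp add: r_def D_def power_divide)
          also have "\<dots> \<le> (2 * (w z + L\<^sup>2 * ?p\<^sup>2 * real n)) / D"
          proof (rule divide_right_mono)
            have "(a + b)\<^sup>2 \<le> 2 * (a\<^sup>2 + b\<^sup>2)" for a b :: real
              using zero_le_power2[of "a - b"] by (simp add: power2_eq_square algebra_simps)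
            moreover have "(L * ?p * sqrt (real n))\<^sup>2 = L\<^sup>2 * ?p\<^sup>2 * real n" by (simp add: power_mult_distrib)
            ultimately show "(norm (noise_corr n z) + L * ?p * sqrt (real n))\<^sup>2 \<le> 2 * (w z + L\<^sup>2 * ?p\<^sup>2 * real n)"
              unfolding w_def by metis
          qed (use D in simp)
          finally have r2: "r\<^sup>2 \<le> 2 * (w z + L\<^sup>2 * ?p\<^sup>2 * real n) / D" .
          have "\<bar>(bhat1 n z $ j)\<^sup>2 - (bhat2 n z $ j)\<^sup>2\<bar> = \<bar>bhat1 n z $ j - bhat2 n z $ j\<bar> * \<bar>bhat1 n z $ j + bhat2 n z $ j\<bar>"
            unfolding abs_mult[symmetric] by (simp add: power2_eq_square algebra_simps)
          also have "\<dots> \<le> K / real n * (2 * r)" using coord_diff bj K by (intro mult_mono) auto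
          \<comment> \<open>\<open>2 * r \<le> r\<^sup>2 + 1\<close> separates the size of the
            coordinates from the event: the bound for \<open>r\<^sup>2\<close> and the indicator of
            the complement each have expectation of order \<open>1 / n\<close>, and no joint
            estimate is needed.\<close>
          also have "\<dots> \<le> K / real n * (2 * (w z + L\<^sup>2 * ?p\<^sup>2 * real n) / D + 1)"
          proof (rule mult_left_mono)
            show "2 * r \<le> 2 * (w z + L\<^sup>2 * ?p\<^sup>2 * real n) / D + 1"
              using r2 zero_le_power2[of "r - 1"] unfolding power2_diff by simp
          qed (use K in simp)
          finally have "\<bar>(bhat1 n z $ j)\<^sup>2 - (bhat2 n z $ j)\<^sup>2\<bar> \<le> K / real n * (2 * (w z + L\<^sup>2 * ?p\<^sup>2 * real n) / D + 1)" .
          moreover have "R z = 0 - K / real n * (2 * (w z + L\<^sup>2 * ?p\<^sup>2 * real n) / D + 1)"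
            unfolding R_def i using False by simp
          ultimately show ?thesis by linarith
        qed
      qed
    qed
    have iB: "integrable (P n) (\<lambda>z. crude_bound n z * indicator (Bad n) z)"
      by (rule integrable_real_mult_indicator[OF BP integrable_crude_bound[OF n1(1)]])
    have ib2: "integrable (P n) (\<lambda>z. \<bar>bhat2 n z $ j\<bar>)"
    proof (rule Bochner_Integration.integrable_bound[OF integrable_crude_bound[OF n1(1)] _ AE_I2])
      fix z assume "z \<in> space (P n)"
      then have z: "z \<in> space (train_space n)" by (simp add: space_PiM)
      have "\<bar>bhat2 n z $ j\<bar> \<le> response_sq n z"
        using component_le_norm_cart[of "bhat2 n z" j] estimator_facts(4)[OF elim(2) z] by linarith
      then show "norm \<bar>bhat2 n z $ j\<bar> \<le> norm (crude_bound n z)" using crude_bound_ge(2)[of n z] response_sq_nonneg[of n z] by simp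
    qed measurable
    have ibV: "integrable (P n) (\<lambda>z. \<bar>bhat2 n z $ j\<bar> * indicator (?V n) z)"
      by (rule integrable_real_mult_indicator[OF V(1) ib2])
    have bV: "(\<integral>z. \<bar>bhat2 n z $ j\<bar> * indicator (?V n) z \<partial>P n) \<ge> c4 / sqrt (real n)"
    proof -
      have "ennreal (c4 / sqrt (real n)) \<le> (\<integral>\<^sup>+z. ennreal (\<bar>bhat2 n z $ j\<bar> * indicator (?V n) z) \<partial>P n)"
      proof (rule order_trans[OF elim(4)], rule nn_integral_mono)
        fix z assume "z \<in> space (P n)"
        then have "z \<in> space (train_space n)" by (simp add: space_PiM)
        then show "ennreal \<bar>bhat2 n z $ j\<bar> * indicator {z. near_id_entries \<eta>0 (real n) {1..n} (\<lambda>i. fst (z i))} z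
            \<le> ennreal (\<bar>bhat2 n z $ j\<bar> * indicator (?V n) z)" by (simp add: indicator_def)
      qed
      also have "\<dots> = ennreal (\<integral>z. \<bar>bhat2 n z $ j\<bar> * indicator (?V n) z \<partial>P n)"
        by (rule nn_integral_eq_integral[OF ibV]) simp
      finally show ?thesis by (simp add: Bochner_Integration.integral_nonneg)
    qed
    have iV': "integrable (P n) (indicator (?V' n) :: _ \<Rightarrow> real)" using V(2) by (simp add: Pn.emeasure_eq_measure)
    have vV': "(\<integral>z. indicator (?V' n) z \<partial>P n) = Pn.prob (?V' n)"
      using sets.sets_into_space[OF V(2)] by (simp add: Int_absorb2)
    have iQ: "integrable (P n) (\<lambda>z. 2 * (w z + L\<^sup>2 * ?p\<^sup>2 * real n) / D)" using wi by simp
    have Ri: "integrable (P n) R" unfolding R_def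
      by (intro Bochner_Integration.integrable_diff Bochner_Integration.integrable_add integrable_mult_right ibV iB iQ iV')
    have "(\<integral>z. R z \<partial>P n) = d1 / real n * (\<integral>z. \<bar>bhat2 n z $ j\<bar> * indicator (?V n) z \<partial>P n)
      - K / real n * (2 * ((\<integral>z. w z \<partial>P n) + L\<^sup>2 * ?p\<^sup>2 * real n) / D + Pn.prob (?V' n)) - (\<integral>z. crude_bound n z * indicator (Bad n) z \<partial>P n)"
      unfolding R_def
      by (simp only: Bochner_Integration.integral_diff Bochner_Integration.integrable_diff Bochner_Integration.integral_add
          Bochner_Integration.integrable_add integrable_mult_right integral_mult_right_zero ibV iB iQ iV' vV')
         (use wi(1) in \<open>simp add: Pn.prob_space\<close>)
    also have "\<dots> \<ge> d1 / real n * (c4 / sqrt (real n)) 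
       - K / real n * (2 * (Cw * real n + L\<^sup>2 * ?p\<^sup>2 * real n) / D + C3 / real n) - C2 / real n ^ 2"
      using bV wi(2) C3[OF n1(1)] elim(3) d1 K D
      by (intro diff_mono mult_left_mono add_mono divide_right_mono) auto
    finally have e2: "d1 / real n * (c4 / sqrt (real n)) 
       - K / real n * (2 * (Cw * real n + L\<^sup>2 * ?p\<^sup>2 * real n) / D + C3 / real n) - C2 / real n ^ 2 \<le> (\<integral>z. R z \<partial>P n)" .
    have e3: "d1 / real n * (c4 / sqrt (real n)) 
       - K / real n * (2 * (Cw * real n + L\<^sup>2 * ?p\<^sup>2 * real n) / D + C3 / real n) - C2 / real n ^ 2
      = (d1 * c4 * sqrt (real n) - C) / real n ^ 2"
    proof -
      have 1: "d1 / real n * (c4 / sqrt (real n)) = d1 * c4 * sqrt (real n) / real n ^ 2"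
        using n1 real_sqrt_mult_self[of "real n"] by (simp add: field_simps power2_eq_square)
      have 2: "2 * (Cw * real n + L\<^sup>2 * ?p\<^sup>2 * real n) / D = 2 * (Cw + L\<^sup>2 * ?p\<^sup>2) / c0\<^sup>2 / real n"
        using n1 c by (simp add: D_def power_mult_distrib field_simps power2_eq_square)
      have 3: "K / N * (X / N + Y / N) = K * (X + Y) / N ^ 2" for X Y N :: real
        by (simp add: power2_eq_square add_divide_distrib[symmetric])
      show ?thesis unfolding 1 2 3 C_def by (simp only: diff_divide_distrib add_divide_distrib)
    qed
    have e4: "(d1 * c4 * sqrt (real n) - C) / real n ^ 2 > 0"
    proof -
      have "\<bar>C\<bar> < d1 * c4 * sqrt (real n)" using elim(1) d1 c4 by (simp add: field_simps)
      then show ?thesis using n1 by simp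
    qed
    have "0 < (\<integral>z. R z \<partial>P n)" using e2 e4 unfolding e3 by (rule order_less_le_trans[rotated])
    also have "\<dots> \<le> (\<integral>z. (bhat1 n z $ j)\<^sup>2 - (bhat2 n z $ j)\<^sup>2 \<partial>P n)"
    proof (intro integral_mono Ri le)
      show "integrable (P n) (\<lambda>z. (bhat1 n z $ j)\<^sup>2 - (bhat2 n z $ j)\<^sup>2)"
      proof (rule Bochner_Integration.integrable_bound[OF integrable_diff_size(1)[OF elim(2)] _ AE_I2])
        show "norm ((bhat1 n z $ j)\<^sup>2 - (bhat2 n z $ j)\<^sup>2) \<le> norm (diff_size n z)" for z
          using coord_sq_diff_le_diff_size[of n z] diff_size_nonneg[of n z] by simp
      qed measurable
    qed
    finally show ?case .
  qed
qed

end


section \<open>Lower bounds by symmetrization\<close>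

text \<open>Averaging over \<open>e\<close> and \<open>- e\<close> cancels the term mixing
  \<open>a * e\<close> with \<open>r\<close>, and \<open>r\<^sup>2\<close> is discarded.\<close>

lemma nn_integral_gauss_e_affine_sq:
  assumes \<tau>: "\<tau> > 0"
  shows "ennreal (a\<^sup>2 * \<tau>\<^sup>2) \<le> (\<integral>\<^sup>+e. ennreal ((a * e + r)\<^sup>2) \<partial>gauss_e \<tau>)"
proof -
  let ?I = "\<integral>\<^sup>+e. ennreal ((a * e + r)\<^sup>2) \<partial>gauss_e \<tau>"
  have "ennreal (2 * a\<^sup>2) * ennreal (\<tau>\<^sup>2) = (\<integral>\<^sup>+e. ennreal (2 * a\<^sup>2) * ennreal (e\<^sup>2) \<partial>gauss_e \<tau>)"
    by (simp add: nn_integral_cmult nn_integral_gauss_e_sq[OF \<tau>])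
  also have "\<dots> \<le> (\<integral>\<^sup>+e. ennreal ((a * e + r)\<^sup>2) + ennreal ((a * (- e) + r)\<^sup>2) \<partial>gauss_e \<tau>)"
  proof (rule nn_integral_mono)
    fix e
    have "(a * e + r)\<^sup>2 + (a * (- e) + r)\<^sup>2 = 2 * a\<^sup>2 * e\<^sup>2 + 2 * r\<^sup>2" by (simp add: power2_eq_square algebra_simps)
    then have "2 * a\<^sup>2 * e\<^sup>2 \<le> (a * e + r)\<^sup>2 + (a * (- e) + r)\<^sup>2" by simp
    then show "ennreal (2 * a\<^sup>2) * ennreal (e\<^sup>2) \<le> ennreal ((a * e + r)\<^sup>2) + ennreal ((a * (- e) + r)\<^sup>2)"
      by (simp only: ennreal_mult'[symmetric] ennreal_plus[symmetric] zero_le_power2 mult_nonneg_nonneg ennreal_leI zero_le_numeral)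
  qed
  also have "\<dots> = ?I + (\<integral>\<^sup>+e. ennreal ((a * (- e) + r)\<^sup>2) \<partial>gauss_e \<tau>)" by (rule nn_integral_add) measurable
  also have "(\<integral>\<^sup>+e. ennreal ((a * (- e) + r)\<^sup>2) \<partial>gauss_e \<tau>) = ?I"
    by (rule nn_integral_gauss_e_uminus) measurable
  finally have 2: "ennreal (2 * a\<^sup>2) * ennreal (\<tau>\<^sup>2) \<le> 2 * ?I" by (simp only: mult_2)
  have "ennreal (a\<^sup>2 * \<tau>\<^sup>2) = ennreal (1 / 2 * (2 * a\<^sup>2 * \<tau>\<^sup>2))" by simp
  also have "\<dots> = ennreal (1 / 2) * (ennreal (2 * a\<^sup>2) * ennreal (\<tau>\<^sup>2))"
    by (subst ennreal_mult', simp, subst ennreal_mult', simp, rule refl)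
  also have "\<dots> \<le> ennreal (1 / 2) * (ennreal 2 * ?I)" using 2 by (intro mult_left_mono) auto
  also have "\<dots> = (ennreal (1 / 2) * ennreal 2) * ?I" by (simp only: mult.assoc)
  also have "ennreal (1 / 2) * ennreal 2 = 1" by (subst ennreal_mult'[symmetric]) auto
  finally show ?thesis by simp
qed

text \<open>The same symmetrization by reflecting coordinate \<open>k\<close>. The full second
  moment is the squared norm of \<open>a\<close>, but one coordinate suffices.\<close>

lemma nn_integral_gauss_x_inner_sq:
  fixes a :: "real ^ 'p::finite"
  shows "ennreal ((a $ k)\<^sup>2) \<le> (\<integral>\<^sup>+x. ennreal ((x \<bullet> a)\<^sup>2) \<partial>gauss_x)"
proof -
  let ?I = "\<integral>\<^sup>+x. ennreal ((x \<bullet> a)\<^sup>2) \<partial>gauss_x"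
  have "ennreal (2 * (a $ k)\<^sup>2) = (\<integral>\<^sup>+x. ennreal (2 * (a $ k)\<^sup>2) * ennreal ((x $ k)\<^sup>2) \<partial>gauss_x)"
    by (simp add: nn_integral_cmult nn_integral_gauss_x_sq)
  also have "\<dots> \<le> (\<integral>\<^sup>+x. ennreal ((x \<bullet> a)\<^sup>2) + ennreal ((flip_coord k x \<bullet> a)\<^sup>2) \<partial>gauss_x)"
  proof (rule nn_integral_mono)
    fix x :: "real ^ 'p"
    define s where "s = (\<Sum>i\<in>UNIV - {k}. x $ i * a $ i)"
    have x1: "x \<bullet> a = x $ k * a $ k + s"
      unfolding inner_vec_def s_def by (subst sum.remove[of _ k]) auto
    have "(\<Sum>i\<in>UNIV - {k}. flip_coord k x $ i * a $ i) = s" unfolding s_def by (intro sum.cong) (auto simp: flip_coord_def)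
    then have x2: "flip_coord k x \<bullet> a = - (x $ k * a $ k) + s"
      unfolding inner_vec_def by (subst sum.remove[of _ k]) (auto simp: flip_coord_def)
    have "(x \<bullet> a)\<^sup>2 + (flip_coord k x \<bullet> a)\<^sup>2 = 2 * (a $ k)\<^sup>2 * (x $ k)\<^sup>2 + 2 * s\<^sup>2"
      unfolding x1 x2 by (simp add: power2_eq_square algebra_simps)
    then have "2 * (a $ k)\<^sup>2 * (x $ k)\<^sup>2 \<le> (x \<bullet> a)\<^sup>2 + (flip_coord k x \<bullet> a)\<^sup>2" by simp
    then show "ennreal (2 * (a $ k)\<^sup>2) * ennreal ((x $ k)\<^sup>2) \<le> ennreal ((x \<bullet> a)\<^sup>2) + ennreal ((flip_coord k x \<bullet> a)\<^sup>2)"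
      by (simp only: ennreal_mult'[symmetric] ennreal_plus[symmetric] zero_le_power2 mult_nonneg_nonneg ennreal_leI zero_le_numeral)
  qed
  also have "\<dots> = ?I + (\<integral>\<^sup>+x. ennreal ((flip_coord k x \<bullet> a)\<^sup>2) \<partial>gauss_x)" by (rule nn_integral_add) measurable
  also have "(\<integral>\<^sup>+x. ennreal ((flip_coord k x \<bullet> a)\<^sup>2) \<partial>gauss_x) = ?I"
    by (rule nn_integral_gauss_x_flip) measurable
  finally have 2: "ennreal (2 * (a $ k)\<^sup>2) \<le> 2 * ?I" by (simp only: mult_2)
  have "ennreal ((a $ k)\<^sup>2) = ennreal (1 / 2 * (2 * (a $ k)\<^sup>2))" by simp
  also have "\<dots> = ennreal (1 / 2) * ennreal (2 * (a $ k)\<^sup>2)" by (rule ennreal_mult') simp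
  also have "\<dots> \<le> ennreal (1 / 2) * (ennreal 2 * ?I)" using 2 by (intro mult_left_mono) auto
  also have "\<dots> = (ennreal (1 / 2) * ennreal 2) * ?I" by (simp only: mult.assoc)
  also have "ennreal (1 / 2) * ennreal 2 = 1" by (subst ennreal_mult'[symmetric]) auto
  finally show ?thesis by simp
qed

text \<open>The preimage of an open set under the continuous data map is open, hence contains a
  product of open sets, to which covariate and noise each give positive probability.\<close>

lemma emeasure_gauss_z_pos:
  fixes \<beta> :: "real ^ 'p::finite"
  assumes \<tau>: "\<tau> > 0" and U: "open U" "U \<noteq> {}"
  shows "emeasure (gauss_z \<beta> \<tau>) U > 0"
proof -
  interpret ge: prob_space "gauss_e \<tau>" by (rule prob_space_gauss_e[OF \<tau>])
  let ?f = "\<lambda>w :: (real ^ 'p) \<times> real. (fst w, fst w \<bullet> \<beta> + snd w)"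
  have Um [measurable]: "U \<in> sets borel" using U by simp
  have "open (?f -` U)" by (intro open_vimage U continuous_intros)
  obtain x y where xy: "(x, y) \<in> U" using U by auto
  then have "(x, y - x \<bullet> \<beta>) \<in> ?f -` U" by simp
  then obtain A B where
    AB: "open A" "open B" "(x, y - x \<bullet> \<beta>) \<in> A \<times> B" "A \<times> B \<subseteq> ?f -` U"
    by (rule open_prod_elim[OF \<open>open (?f -` U)\<close>])
  have [measurable]: "A \<in> sets borel" "B \<in> sets borel" using AB by auto
  have "0 < emeasure gauss_x A * emeasure (gauss_e \<tau>) B"
    using emeasure_gauss_x_pos[OF AB(1)] emeasure_gauss_e_pos[OF AB(2) _ \<tau>] AB(3)
    by (auto simp: ennreal_zero_less_mult_iff)
  also have "\<dots> = (\<integral>\<^sup>+x. \<integral>\<^sup>+e. indicator A x * indicator B e \<partial>gauss_e \<tau> \<partial>gauss_x)"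
    by (simp add: nn_integral_cmult nn_integral_multc)
  also have "\<dots> \<le> (\<integral>\<^sup>+x. \<integral>\<^sup>+e. indicator U (x, x \<bullet> \<beta> + e) \<partial>gauss_e \<tau> \<partial>gauss_x)"
    using AB(4) by (intro nn_integral_mono) (auto simp: indicator_def)
  also have "\<dots> = (\<integral>\<^sup>+z. indicator U z \<partial>gauss_z \<beta> \<tau>)"
    by (rule nn_integral_gauss_z[OF \<tau>, symmetric]) measurable
  finally show ?thesis by simp
qed

section \<open>The loss as a function of test point and training set\<close>

context lasso_pair
begin

definition pair_loss :: "nat \<Rightarrow> 'p datum \<Rightarrow> (nat \<Rightarrow> 'p datum) \<Rightarrow> real" where
  "pair_loss n = diff_loss (bhat1 n) (bhat2 n)"

lemma pair_loss_eq: "pair_loss n z0 z = - (fst z0 \<bullet> (bhat1 n z - bhat2 n z)) * (2 * snd z0 - fst z0 \<bullet> (bhat1 n z + bhat2 n z))"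
  by (simp add: pair_loss_def diff_loss_def inner_diff_right inner_add_right power2_eq_square algebra_simps)

lemma pair_loss_bound: "\<bar>pair_loss n z0 z\<bar> \<le> 2 * (norm z0)\<^sup>2 * diff_size n z"
proof -
  have "\<bar>pair_loss n z0 z\<bar> \<le> (norm z0 * norm (bhat1 n z - bhat2 n z)) * (2 * norm z0 * (1 + norm (bhat1 n z) + norm (bhat2 n z)))"
    unfolding pair_loss_eq abs_mult abs_minus_cancel
  proof (rule mult_mono)
    have "\<bar>fst z0 \<bullet> (bhat1 n z - bhat2 n z)\<bar> \<le> norm (fst z0) * norm (bhat1 n z - bhat2 n z)" by (rule Cauchy_Schwarz_ineq2)
    also have "\<dots> \<le> norm z0 * norm (bhat1 n z - bhat2 n z)" by (intro mult_right_mono norm_datum) auto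
    finally show "\<bar>fst z0 \<bullet> (bhat1 n z - bhat2 n z)\<bar> \<le> norm z0 * norm (bhat1 n z - bhat2 n z)" .
    have "\<bar>fst z0 \<bullet> (bhat1 n z + bhat2 n z)\<bar> \<le> norm (fst z0) * norm (bhat1 n z + bhat2 n z)" by (rule Cauchy_Schwarz_ineq2)
    also have "\<dots> \<le> norm z0 * (norm (bhat1 n z) + norm (bhat2 n z))" by (intro mult_mono norm_datum norm_triangle_ineq) auto
    finally have 1: "\<bar>fst z0 \<bullet> (bhat1 n z + bhat2 n z)\<bar> \<le> norm z0 * (norm (bhat1 n z) + norm (bhat2 n z))" .
    have "\<bar>2 * snd z0 - fst z0 \<bullet> (bhat1 n z + bhat2 n z)\<bar> \<le> 2 * norm z0 + norm z0 * (norm (bhat1 n z) + norm (bhat2 n z))"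
      using 1 norm_datum(1)[of z0] by linarith
    also have "\<dots> \<le> 2 * norm z0 + 2 * (norm z0 * (norm (bhat1 n z) + norm (bhat2 n z)))" by simp
    finally show "\<bar>2 * snd z0 - fst z0 \<bullet> (bhat1 n z + bhat2 n z)\<bar> \<le> 2 * norm z0 * (1 + norm (bhat1 n z) + norm (bhat2 n z))"
      by (simp add: algebra_simps)
  qed auto
  then show ?thesis by (simp add: diff_size_def power2_eq_square mult_ac)
qed

lemma measurable_pair_loss:
  assumes "n \<ge> N0"
  shows "(\<lambda>(z0, z). pair_loss n z0 z) \<in> borel_measurable (borel \<Otimes>\<^sub>M Pi\<^sub>M {1..n} (\<lambda>_. borel))"
proof -
  note [measurable] = measurable_bhat[OF assms]
  show ?thesis unfolding pair_loss_eq case_prod_unfold by measurable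
qed

definition datum_second_moment :: real where "datum_second_moment = (\<integral>z. (norm z)\<^sup>2 \<partial>gauss_z \<beta> \<tau>)"

lemma integrable_norm_datum: "integrable (gauss_z \<beta> \<tau>) (\<lambda>z. norm z ^ k)"
  by (rule integrable_gauss_z_norm[OF \<tau>])

sublocale PP: prob_space "P n" for n by (rule prob_P)
sublocale zP: pair_prob_space "gauss_z \<beta> \<tau>" "P n" for n ..

lemma integrable_pair_loss:
  assumes n: "n \<ge> N0"
  shows "integrable (gauss_z \<beta> \<tau> \<Otimes>\<^sub>M P n) (\<lambda>w. pair_loss n (fst w) (snd w))"
proof (rule Bochner_Integration.integrable_bound)
  show "integrable (gauss_z \<beta> \<tau> \<Otimes>\<^sub>M P n) (\<lambda>w. (2 * (norm (fst w))\<^sup>2) * diff_size n (snd w))"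
    using zP.integrable_pair_mult(1)[OF integrable_mult_right[OF integrable_norm_datum[of 2]] integrable_diff_size(1)[OF n], of 2] .
  show "AE w in gauss_z \<beta> \<tau> \<Otimes>\<^sub>M P n. norm (pair_loss n (fst w) (snd w)) \<le> norm ((2 * (norm (fst w))\<^sup>2) * diff_size n (snd w))"
    using pair_loss_bound diff_size_nonneg by (intro AE_I2) simp
  show "(\<lambda>w. pair_loss n (fst w) (snd w)) \<in> borel_measurable (gauss_z \<beta> \<tau> \<Otimes>\<^sub>M P n)"
    using measurable_pair_loss[OF n] by (simp add: case_prod_unfold cong: measurable_cong_sets sets_PiM_cong sets_pair_measure_cong)
qed

text \<open>The explicit form of \<open>centered_loss\<close>: the conditional expectation becomes
  an integral over an independent test point.\<close>

definition centered_pair_loss :: "nat \<Rightarrow> 'p datum \<Rightarrow> (nat \<Rightarrow> 'p datum) \<Rightarrow> real" where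
  "centered_pair_loss n z0 z = pair_loss n z0 z - (\<integral>y. pair_loss n y z \<partial>gauss_z \<beta> \<tau>)"

lemma measurable_centered_pair_loss:
  assumes "n \<ge> N0"
  shows "(\<lambda>(z0, z). centered_pair_loss n z0 z) \<in> borel_measurable (borel \<Otimes>\<^sub>M Pi\<^sub>M {1..n} (\<lambda>_. borel))"
proof -
  note hm [measurable] = measurable_pair_loss[OF assms]
  have [measurable]: "(\<lambda>(z, z0). pair_loss n z0 z) \<in> borel_measurable (Pi\<^sub>M {1..n} (\<lambda>_. borel) \<Otimes>\<^sub>M gauss_z \<beta> \<tau>)"
    by measurable
  show ?thesis unfolding centered_pair_loss_def by measurable
qed

lemma centered_pair_loss_bound: "\<bar>centered_pair_loss n z0 z\<bar> \<le> 2 * ((norm z0)\<^sup>2 + datum_second_moment) * diff_size n z"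
proof -
  have "\<bar>\<integral>y. pair_loss n y z \<partial>gauss_z \<beta> \<tau>\<bar> \<le> (\<integral>y. 2 * (norm y)\<^sup>2 * diff_size n z \<partial>gauss_z \<beta> \<tau>)"
  proof (cases "integrable (gauss_z \<beta> \<tau>) (\<lambda>y. pair_loss n y z)")
    case True
    have "\<bar>\<integral>y. pair_loss n y z \<partial>gauss_z \<beta> \<tau>\<bar> \<le> (\<integral>y. \<bar>pair_loss n y z\<bar> \<partial>gauss_z \<beta> \<tau>)" by (rule integral_abs_bound)
    also have "\<dots> \<le> (\<integral>y. 2 * (norm y)\<^sup>2 * diff_size n z \<partial>gauss_z \<beta> \<tau>)"
      using True pair_loss_bound integrable_norm_datum[of 2] by (intro integral_mono) auto
    finally show ?thesis .
  next
    \<comment> \<open>Without integrability the integral takes its default value 0, so the bound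
      persists.\<close>
    case False
    then show ?thesis using diff_size_nonneg by (auto simp: not_integrable_integral_eq intro!: Bochner_Integration.integral_nonneg)
  qed
  also have "\<dots> = 2 * datum_second_moment * diff_size n z" by (simp add: datum_second_moment_def)
  finally show ?thesis using pair_loss_bound[of n z0 z] unfolding centered_pair_loss_def by (simp add: algebra_simps)
qed

text \<open>Only the part of the loss that is linear in the test noise is used.\<close>
lemma centered_pair_loss_diff_lower:
  "ennreal (4 * \<tau>\<^sup>2 * (coord_diff n z - coord_diff n z')\<^sup>2) \<le> (\<integral>\<^sup>+z0. ennreal ((centered_pair_loss n z0 z - centered_pair_loss n z0 z')\<^sup>2) \<partial>gauss_z \<beta> \<tau>)"
proof -
  define \<Delta> where "\<Delta> = (bhat1 n z - bhat2 n z) - (bhat1 n z' - bhat2 n z')"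
  \<comment> \<open>Collects everything that does not involve the test noise, both centring
    integrals included.\<close>
  define r where "r x = centered_pair_loss n (x, x \<bullet> \<beta>) z - centered_pair_loss n (x, x \<bullet> \<beta>) z'" for x
  have lin: "centered_pair_loss n (x, x \<bullet> \<beta> + e) z - centered_pair_loss n (x, x \<bullet> \<beta> + e) z' = (- 2 * (x \<bullet> \<Delta>)) * e + r x" for x e
    unfolding r_def centered_pair_loss_def pair_loss_eq \<Delta>_def by (simp add: inner_diff_right algebra_simps)
  have hm [measurable]: "(\<lambda>y. pair_loss n y z) \<in> borel_measurable borel" for z
    unfolding pair_loss_eq by measurable
  have [measurable]: "(\<lambda>y. centered_pair_loss n y z) \<in> borel_measurable borel" for z unfolding centered_pair_loss_def by measurable
  have "ennreal (4 * \<tau>\<^sup>2 * (coord_diff n z - coord_diff n z')\<^sup>2) = ennreal (4 * \<tau>\<^sup>2) * ennreal ((\<Delta> $ j)\<^sup>2)"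
    by (simp add: \<Delta>_def coord_diff_def ennreal_mult')
  also have "\<dots> \<le> ennreal (4 * \<tau>\<^sup>2) * (\<integral>\<^sup>+x. ennreal ((x \<bullet> \<Delta>)\<^sup>2) \<partial>gauss_x)"
    by (intro mult_left_mono nn_integral_gauss_x_inner_sq) auto
  also have "\<dots> = (\<integral>\<^sup>+x. ennreal (4 * \<tau>\<^sup>2) * ennreal ((x \<bullet> \<Delta>)\<^sup>2) \<partial>gauss_x)"
    by (rule nn_integral_cmult[symmetric]) measurable
  also have "\<dots> \<le> (\<integral>\<^sup>+x. \<integral>\<^sup>+e. ennreal (((- 2 * (x \<bullet> \<Delta>)) * e + r x)\<^sup>2) \<partial>gauss_e \<tau> \<partial>gauss_x)"
  proof (rule nn_integral_mono)
    fix x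
    have "ennreal (4 * \<tau>\<^sup>2) * ennreal ((x \<bullet> \<Delta>)\<^sup>2) = ennreal ((- 2 * (x \<bullet> \<Delta>))\<^sup>2 * \<tau>\<^sup>2)"
      by (simp add: ennreal_mult'[symmetric] power_mult_distrib mult_ac)
    also have "\<dots> \<le> (\<integral>\<^sup>+e. ennreal (((- 2 * (x \<bullet> \<Delta>)) * e + r x)\<^sup>2) \<partial>gauss_e \<tau>)"
      by (rule nn_integral_gauss_e_affine_sq[OF \<tau>])
    finally show "ennreal (4 * \<tau>\<^sup>2) * ennreal ((x \<bullet> \<Delta>)\<^sup>2) \<le> (\<integral>\<^sup>+e. ennreal (((- 2 * (x \<bullet> \<Delta>)) * e + r x)\<^sup>2) \<partial>gauss_e \<tau>)" .
  qed
  also have "\<dots> = (\<integral>\<^sup>+x. \<integral>\<^sup>+e. ennreal ((centered_pair_loss n (x, x \<bullet> \<beta> + e) z - centered_pair_loss n (x, x \<bullet> \<beta> + e) z')\<^sup>2) \<partial>gauss_e \<tau> \<partial>gauss_x)"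
    unfolding lin ..
  also have "\<dots> = (\<integral>\<^sup>+z0. ennreal ((centered_pair_loss n z0 z - centered_pair_loss n z0 z')\<^sup>2) \<partial>gauss_z \<beta> \<tau>)"
    by (rule nn_integral_gauss_z[OF \<tau>, symmetric]) measurable
  finally show ?thesis .
qed

definition mean_pair_loss :: "nat \<Rightarrow> 'p datum \<Rightarrow> real" where "mean_pair_loss n z0 = (\<integral>z. pair_loss n z0 z \<partial>P n)"

lemma mean_pair_loss_bound:
  assumes "n \<ge> N0" shows "\<bar>mean_pair_loss n z0\<bar> \<le> 2 * (norm z0)\<^sup>2 * (\<integral>z. diff_size n z \<partial>P n)"
proof -
  note [measurable] = measurable_pair_loss[OF assms]
  have i: "integrable (P n) (\<lambda>z. 2 * (norm z0)\<^sup>2 * diff_size n z)" by (intro integrable_mult_right integrable_diff_size assms)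
  have hi: "integrable (P n) (\<lambda>z. pair_loss n z0 z)"
    by (rule Bochner_Integration.integrable_bound[OF i]) (measurable, use pair_loss_bound diff_size_nonneg in \<open>auto intro!: AE_I2 simp: abs_mult\<close>)
  have "\<bar>mean_pair_loss n z0\<bar> \<le> (\<integral>z. \<bar>pair_loss n z0 z\<bar> \<partial>P n)" unfolding mean_pair_loss_def by (rule integral_abs_bound)
  also have "\<dots> \<le> (\<integral>z. 2 * (norm z0)\<^sup>2 * diff_size n z \<partial>P n)" using hi i pair_loss_bound by (intro integral_mono) auto
  finally show ?thesis by simp
qed

text \<open>\<open>mean_pair_loss n\<close> is a quadratic polynomial without constant term.\<close>
lemma mean_pair_loss_continuous:
  assumes n: "n \<ge> N0" shows "continuous_on UNIV (mean_pair_loss n)"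
proof -
  note [measurable] = measurable_bhat[OF n]
  note Mi = integrable_diff_size(1)[OF n]
  define D where "D k z = bhat1 n z $ k - bhat2 n z $ k" for k z
  define S where "S k z = bhat1 n z $ k + bhat2 n z $ k" for k z
  have Db: "\<bar>D k z\<bar> \<le> norm (bhat1 n z - bhat2 n z)" for k z
    using component_le_norm_cart[of "bhat1 n z - bhat2 n z" k] by (simp add: D_def)
  have Sb: "\<bar>S k z\<bar> \<le> norm (bhat1 n z) + norm (bhat2 n z)" for k z
    using component_le_norm_cart[of "bhat1 n z" k] component_le_norm_cart[of "bhat2 n z" k] unfolding S_def by linarith
  have [measurable]: "D k \<in> borel_measurable (P n)" "S k \<in> borel_measurable (P n)" for k
    unfolding D_def S_def by measurable
  have Di: "integrable (P n) (D k)" for k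
  proof (rule Bochner_Integration.integrable_bound[OF Mi _ AE_I2])
    fix z
    have "\<bar>D k z\<bar> * 1 \<le> norm (bhat1 n z - bhat2 n z) * (1 + norm (bhat1 n z) + norm (bhat2 n z))"
      by (intro mult_mono Db) auto
    then show "norm (D k z) \<le> norm (diff_size n z)" using diff_size_nonneg[of n z] by (simp add: diff_size_def)
  qed measurable
  have DSi: "integrable (P n) (\<lambda>z. D k z * S l z)" for k l
  proof (rule Bochner_Integration.integrable_bound[OF Mi _ AE_I2])
    fix z
    have "\<bar>D k z\<bar> * \<bar>S l z\<bar> \<le> norm (bhat1 n z - bhat2 n z) * (1 + norm (bhat1 n z) + norm (bhat2 n z))"
      using Sb[of l z] by (intro mult_mono Db) auto
    then show "norm (D k z * S l z) \<le> norm (diff_size n z)" using diff_size_nonneg[of n z] by (simp add: diff_size_def abs_mult)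
  qed measurable
  have hx: "pair_loss n z0 z = (\<Sum>k\<in>UNIV. (- 2 * snd z0 * fst z0 $ k) * D k z) + (\<Sum>k\<in>UNIV. \<Sum>l\<in>UNIV. (fst z0 $ k * fst z0 $ l) * (D k z * S l z))" for z0 z
  proof -
    have "pair_loss n z0 z = - 2 * snd z0 * (fst z0 \<bullet> (bhat1 n z - bhat2 n z)) + (fst z0 \<bullet> (bhat1 n z - bhat2 n z)) * (fst z0 \<bullet> (bhat1 n z + bhat2 n z))"
      unfolding pair_loss_eq by (simp add: algebra_simps)
    also have "fst z0 \<bullet> (bhat1 n z - bhat2 n z) = (\<Sum>k\<in>UNIV. fst z0 $ k * D k z)" by (simp add: inner_vec_def D_def)
    also have "fst z0 \<bullet> (bhat1 n z + bhat2 n z) = (\<Sum>k\<in>UNIV. fst z0 $ k * S k z)" by (simp add: inner_vec_def S_def)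
    also have "(\<Sum>k\<in>UNIV. fst z0 $ k * D k z) * (\<Sum>k\<in>UNIV. fst z0 $ k * S k z) =
        (\<Sum>k\<in>UNIV. \<Sum>l\<in>UNIV. (fst z0 $ k * fst z0 $ l) * (D k z * S l z))"
      unfolding sum_product by (intro sum.cong refl) (simp add: mult_ac)
    also have "- 2 * snd z0 * (\<Sum>k\<in>UNIV. fst z0 $ k * D k z) = (\<Sum>k\<in>UNIV. (- 2 * snd z0 * fst z0 $ k) * D k z)"
      by (simp only: sum_distrib_left mult.assoc)
    finally show ?thesis .
  qed
  have "mean_pair_loss n z0 = (\<Sum>k\<in>UNIV. (- 2 * snd z0 * fst z0 $ k) * (\<integral>z. D k z \<partial>P n))
      + (\<Sum>k\<in>UNIV. \<Sum>l\<in>UNIV. (fst z0 $ k * fst z0 $ l) * (\<integral>z. D k z * S l z \<partial>P n))" for z0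
    unfolding mean_pair_loss_def hx using Di DSi
    by (simp add: Bochner_Integration.integral_add Bochner_Integration.integral_sum)
  then have "mean_pair_loss n = (\<lambda>z0. (\<Sum>k\<in>UNIV. (- 2 * snd z0 * fst z0 $ k) * (\<integral>z. D k z \<partial>P n))
      + (\<Sum>k\<in>UNIV. \<Sum>l\<in>UNIV. (fst z0 $ k * fst z0 $ l) * (\<integral>z. D k z * S l z \<partial>P n)))" by (simp add: fun_eq_iff)
  then show ?thesis by (simp only:) (intro continuous_intros)
qed

text \<open>By continuity and full support, an almost surely constant mean loss would be constant.
  At the origin the loss vanishes, whereas at \<open>(axis j 1, 0)\<close> its mean is the expected
  difference of the squared \<open>j\<close>-th coordinates.\<close>

lemma mean_pair_loss_not_AE_const:
  assumes n: "n \<ge> N0" and pos: "0 < (\<integral>z. (bhat1 n z $ j)\<^sup>2 - (bhat2 n z $ j)\<^sup>2 \<partial>P n)"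
  shows "\<not> (AE z0 in gauss_z \<beta> \<tau>. mean_pair_loss n z0 = c)"
proof
  assume ae: "AE z0 in gauss_z \<beta> \<tau>. mean_pair_loss n z0 = c"
  let ?U = "{z0. mean_pair_loss n z0 \<noteq> c}"
  have "open ?U" using mean_pair_loss_continuous[OF n] by (intro open_Collect_neq) auto
  then have "?U \<in> sets (gauss_z \<beta> \<tau>)" by simp
  then have "emeasure (gauss_z \<beta> \<tau>) ?U = 0" using ae by (subst (asm) AE_iff_measurable[of ?U]) auto
  then have "?U = {}" using emeasure_gauss_z_pos[OF \<tau> \<open>open ?U\<close>, of \<beta>] by fastforce
  then have all: "mean_pair_loss n z0 = c" for z0 by blast
  have "pair_loss n 0 = (\<lambda>z. 0)" unfolding fun_eq_iff pair_loss_eq by simp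
  then have g0: "mean_pair_loss n 0 = 0" unfolding mean_pair_loss_def by simp
  have "pair_loss n (axis j 1, 0) = (\<lambda>z. (bhat1 n z $ j)\<^sup>2 - (bhat2 n z $ j)\<^sup>2)"
    unfolding fun_eq_iff pair_loss_def diff_loss_def by (simp add: inner_axis')
  then have "mean_pair_loss n (axis j 1, 0) = (\<integral>z. (bhat1 n z $ j)\<^sup>2 - (bhat2 n z $ j)\<^sup>2 \<partial>P n)"
    unfolding mean_pair_loss_def by (simp only:)
  with pos have "0 < mean_pair_loss n (axis j 1, 0)" by (simp only:)
  then show False using all[of 0] all[of "(axis j 1, 0)"] g0 by linarith
qed

end


section \<open>From the abstract model to integrals against product laws\<close>

context gaussian_linear_model
begin

text \<open>One statement serves the original and the perturbed training set, according to the
  choice of \<open>f\<close>. The law of the family indexed by \<open>{0..n}\<close> is split at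
  index 0.\<close>

lemma joint_law:
  fixes f :: "nat \<Rightarrow> nat option"
  assumes f: "inj_on f {0..n}"
  shows "distr M (borel \<Otimes>\<^sub>M train_space n) (\<lambda>\<omega>. (case_option Z1' Z (f 0) \<omega>, \<lambda>i\<in>{1..n}. case_option Z1' Z (f i) \<omega>)) =
    gauss_z \<beta> \<tau> \<Otimes>\<^sub>M Pi\<^sub>M {1..n} (\<lambda>_. gauss_z \<beta> \<tau>)" (is "distr M ?B ?X = ?R")
proof (rule measure_eqI)
  interpret gz: prob_space "gauss_z \<beta> \<tau>" by (rule prob_space_gauss_z[OF \<tau>_pos])
  interpret pgz: product_sigma_finite "\<lambda>_. gauss_z \<beta> \<tau>" ..
  interpret P: prob_space "Pi\<^sub>M {1..n} (\<lambda>_. gauss_z \<beta> \<tau>)" by (intro prob_space_PiM prob_space_gauss_z \<tau>_pos)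
  have R: "sets ?R = sets ?B" by (intro sets_pair_measure_cong sets_PiM_cong) auto
  then show "sets (distr M ?B ?X) = sets ?R" by simp
  fix A assume "A \<in> sets (distr M ?B ?X)"
  then have A [measurable]: "A \<in> sets ?B" by simp
  have V [measurable]: "case_option Z1' Z k \<in> M \<rightarrow>\<^sub>M borel" for k by (cases k) auto
  have Xm [measurable]: "?X \<in> M \<rightarrow>\<^sub>M ?B" by (intro measurable_Pair V measurable_restrict)
  have I: "insert 0 {1..n} = {0..n}" by auto
  define F where "F z = (indicator A (z 0, restrict z {1..n}) :: ennreal)" for z
  have "(\<lambda>z. (z 0, restrict z {1..n})) \<in> Pi\<^sub>M {0..n} (\<lambda>_. borel) \<rightarrow>\<^sub>M ?B"
    by (intro measurable_Pair measurable_component_singleton measurable_restrict) auto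
  from measurable_compose[OF this borel_measurable_indicator[OF A]]
  have Fm: "F \<in> borel_measurable (Pi\<^sub>M {0..n} (\<lambda>_. borel))" unfolding F_def .
  have FX: "F (\<lambda>i\<in>{0..n}. case_option Z1' Z (f i) \<omega>) = indicator A (?X \<omega>)" for \<omega>
  proof -
    have "restrict (\<lambda>i\<in>{0..n}. case_option Z1' Z (f i) \<omega>) {1..n} = (\<lambda>i\<in>{1..n}. case_option Z1' Z (f i) \<omega>)"
      by (auto simp: fun_eq_iff)
    then show ?thesis unfolding F_def by simp
  qed
  have "emeasure (distr M ?B ?X) A = (\<integral>\<^sup>+\<omega>. indicator A (?X \<omega>) \<partial>M)"
    using A by (simp flip: nn_integral_indicator add: nn_integral_distr[OF Xm])
  also have "\<dots> = (\<integral>\<^sup>+\<omega>. F (\<lambda>i\<in>{0..n}. case_option Z1' Z (f i) \<omega>) \<partial>M)" unfolding FX ..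
  also have "\<dots> = (\<integral>\<^sup>+z. F z \<partial>Pi\<^sub>M {0..n} (\<lambda>_. gauss_z \<beta> \<tau>))" by (rule nn_integral_family[OF f _ _ Fm]) auto
  also have "\<dots> = (\<integral>\<^sup>+q. \<integral>\<^sup>+z. F (z(0 := q)) \<partial>Pi\<^sub>M {1..n} (\<lambda>_. gauss_z \<beta> \<tau>) \<partial>gauss_z \<beta> \<tau>)"
  proof -
    have "F \<in> borel_measurable (Pi\<^sub>M (insert 0 {1..n}) (\<lambda>_. gauss_z \<beta> \<tau>))"
      using Fm unfolding I by (simp cong: measurable_cong_sets sets_PiM_cong)
    from pgz.product_nn_integral_insert_rev[OF _ _ this] show ?thesis unfolding I by simp
  qed
  also have "\<dots> = (\<integral>\<^sup>+q. \<integral>\<^sup>+z. indicator A (q, z) \<partial>Pi\<^sub>M {1..n} (\<lambda>_. gauss_z \<beta> \<tau>) \<partial>gauss_z \<beta> \<tau>)"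
  proof (intro nn_integral_cong)
    fix q z assume "z \<in> space (Pi\<^sub>M {1..n} (\<lambda>_. gauss_z \<beta> \<tau>))"
    then have "restrict (z(0 := q)) {1..n} = z" by (auto simp: fun_eq_iff space_PiM PiE_def extensional_def)
    then show "F (z(0 := q)) = indicator A (q, z)" unfolding F_def by simp
  qed
  also have "\<dots> = (\<integral>\<^sup>+w. indicator A w \<partial>?R)"
    using A R by (intro P.nn_integral_fst) auto
  also have "\<dots> = emeasure ?R A" using A R by simp
  finally show "emeasure (distr M ?B ?X) A = emeasure ?R A" .
qed

end

lemma (in lasso_pair) sets_P: "sets (P n) = sets (train_space n)"
  by (rule sets_PiM_cong) auto

lemma (in lasso_pair) integrable_centered_pair_loss_sq:
  assumes n: "n \<ge> N0"
  shows "integrable (gauss_z \<beta> \<tau> \<Otimes>\<^sub>M P n) (\<lambda>w. (centered_pair_loss n (fst w) (snd w))\<^sup>2)"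
proof (rule Bochner_Integration.integrable_bound)
  have datum_second_moment: "datum_second_moment \<ge> 0" unfolding datum_second_moment_def by (intro Bochner_Integration.integral_nonneg) simp
  have "integrable (gauss_z \<beta> \<tau>) (\<lambda>z. 4 * (norm z ^ 4 + 2 * datum_second_moment * norm z ^ 2 + datum_second_moment\<^sup>2))"
    by (intro integrable_mult_right Bochner_Integration.integrable_add integrable_norm_datum) simp
  then show "integrable (gauss_z \<beta> \<tau> \<Otimes>\<^sub>M P n) (\<lambda>w. (4 * (norm (fst w) ^ 4 + 2 * datum_second_moment * norm (fst w) ^ 2 + datum_second_moment\<^sup>2)) * (diff_size n (snd w))\<^sup>2)"
    by (rule zP.integrable_pair_mult(1)[OF _ integrable_diff_size(2)[OF n]])
  show "AE w in gauss_z \<beta> \<tau> \<Otimes>\<^sub>M P n. norm ((centered_pair_loss n (fst w) (snd w))\<^sup>2)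
      \<le> norm ((4 * (norm (fst w) ^ 4 + 2 * datum_second_moment * norm (fst w) ^ 2 + datum_second_moment\<^sup>2)) * (diff_size n (snd w))\<^sup>2)"
  proof (rule AE_I2)
    fix w
    have "(centered_pair_loss n (fst w) (snd w))\<^sup>2 \<le> (2 * ((norm (fst w))\<^sup>2 + datum_second_moment) * diff_size n (snd w))\<^sup>2"
      using centered_pair_loss_bound[of n "fst w" "snd w"] by (metis abs_ge_zero power2_abs power_mono)
    also have "\<dots> = (4 * (norm (fst w) ^ 4 + 2 * datum_second_moment * norm (fst w) ^ 2 + datum_second_moment\<^sup>2)) * (diff_size n (snd w))\<^sup>2"
      by (simp add: power_mult_distrib power2_sum power2_eq_square power4_eq_xxxx algebra_simps)
    finally show "norm ((centered_pair_loss n (fst w) (snd w))\<^sup>2)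
      \<le> norm ((4 * (norm (fst w) ^ 4 + 2 * datum_second_moment * norm (fst w) ^ 2 + datum_second_moment\<^sup>2)) * (diff_size n (snd w))\<^sup>2)" by simp
  qed
  show "(\<lambda>w. (centered_pair_loss n (fst w) (snd w))\<^sup>2) \<in> borel_measurable (gauss_z \<beta> \<tau> \<Otimes>\<^sub>M P n)"
    using measurable_centered_pair_loss[OF n]
    by (intro borel_measurable_power) (simp add: case_prod_unfold cong: measurable_cong_sets sets_PiM_cong sets_pair_measure_cong)
qed

locale lasso_model = lasso_pair \<beta> \<tau> L d1 d2 j lam \<delta> bhat1 bhat2 N0 + model: gaussian_linear_model M Z Z1' \<beta> \<tau>
  for \<beta> :: "real ^ 'p::finite" and \<tau> L d1 d2 j lam \<delta> bhat1 bhat2 N0 and M :: "'a measure" and Z Z1'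
begin

lemma train_perturbed: "n \<ge> 1 \<Longrightarrow> train (Z(1 := Z1')) n \<omega> = (train Z n \<omega>)(1 := Z1' \<omega>)"
  by (auto simp: train_def fun_eq_iff)

text \<open>In the perturbed case \<open>f\<close> sends index 1 to \<open>None\<close>, the index
  of the copy, so that the pair of test point and training set has the same law in both
  cases.\<close>

lemma train_laws:
  assumes n: "n \<ge> 1" and W: "W = Z \<or> W = Z(1 := Z1')"
  shows "W 0 \<in> M \<rightarrow>\<^sub>M borel" "train W n \<in> M \<rightarrow>\<^sub>M train_space n"
    "distr M (borel \<Otimes>\<^sub>M train_space n) (\<lambda>\<omega>. (W 0 \<omega>, train W n \<omega>)) = gauss_z \<beta> \<tau> \<Otimes>\<^sub>M P n"
proof -
  have Wi: "W i \<in> M \<rightarrow>\<^sub>M borel" for i using W by (auto simp: model.measurable_Z)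
  then show "W 0 \<in> M \<rightarrow>\<^sub>M borel" "train W n \<in> M \<rightarrow>\<^sub>M train_space n"
    by (auto simp: train_def[abs_def] intro!: measurable_restrict)
  define f where "f i = (if W = Z then Some i else if i = 1 then None else Some i)" for i :: nat
  have f: "inj_on f {0..n}" by (auto simp: f_def inj_on_def)
  have "case_option Z1' Z (f i) = W i" for i using W by (auto simp: f_def)
  then show "distr M (borel \<Otimes>\<^sub>M train_space n) (\<lambda>\<omega>. (W 0 \<omega>, train W n \<omega>)) = gauss_z \<beta> \<tau> \<Otimes>\<^sub>M P n"
    using model.joint_law[OF f] by (simp add: train_def)
qed

lemma centered_loss_AE:
  assumes n: "n \<ge> N0" and W: "W = Z \<or> W = Z(1 := Z1')"
  shows "AE \<omega> in M. centered_loss M W n (pair_loss n) \<omega> = centered_pair_loss n (W 0 \<omega>) (train W n \<omega>)"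
proof -
  have n1: "n \<ge> 1" using n N0 by simp
  note m [measurable] = train_laws(1,2)[OF n1 W]
  \<comment> \<open>\<open>cond_exp_given_indep\<close> conditions on the first component, so the
    training set has to come first.\<close>
  have swap: "distr M (train_space n \<Otimes>\<^sub>M borel) (\<lambda>\<omega>. (train W n \<omega>, W 0 \<omega>)) = P n \<Otimes>\<^sub>M gauss_z \<beta> \<tau>"
  proof -
    interpret pair_sigma_finite "P n" "gauss_z \<beta> \<tau>" ..
    have "P n \<Otimes>\<^sub>M gauss_z \<beta> \<tau> = distr (gauss_z \<beta> \<tau> \<Otimes>\<^sub>M P n) (P n \<Otimes>\<^sub>M gauss_z \<beta> \<tau>) (\<lambda>(x, y). (y, x))"
      by (rule distr_pair_swap)
    also have "\<dots> = distr (gauss_z \<beta> \<tau> \<Otimes>\<^sub>M P n) (train_space n \<Otimes>\<^sub>M borel) (\<lambda>(x, y). (y, x))"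
      by (intro distr_cong sets_pair_measure_cong sets_PiM_cong) auto
    also have "\<dots> = distr M (train_space n \<Otimes>\<^sub>M borel) ((\<lambda>(x, y). (y, x)) \<circ> (\<lambda>\<omega>. (W 0 \<omega>, train W n \<omega>)))"
      unfolding train_laws(3)[OF n1 W, symmetric] by (rule distr_distr) measurable
    finally show ?thesis by (simp add: comp_def)
  qed
  have "integrable (P n \<Otimes>\<^sub>M gauss_z \<beta> \<tau>) (\<lambda>w. pair_loss n (snd w) (fst w))"
    using zP.integrable_product_swap[OF integrable_pair_loss[OF n]] by (simp add: case_prod_unfold)
  then have "AE \<omega> in M. cond_exp_given M (train_space n) (train W n) (\<lambda>\<omega>. pair_loss n (W 0 \<omega>) (train W n \<omega>)) \<omega>
      = (\<integral>y. pair_loss n y (train W n \<omega>) \<partial>gauss_z \<beta> \<tau>)"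
    using model.cond_exp_given_indep[OF m(2,1) swap prob_P prob_space_gauss_z[OF \<tau>] sets_P sets_gauss(3),
        of "\<lambda>w. pair_loss n (snd w) (fst w)"]
    by simp
  then show ?thesis by eventually_elim (simp add: centered_loss_def centered_pair_loss_def)
qed

lemma integrable_centered_pair_loss_train:
  assumes n: "n \<ge> N0" and W: "W = Z \<or> W = Z(1 := Z1')"
  shows "(\<lambda>\<omega>. centered_pair_loss n (W 0 \<omega>) (train W n \<omega>)) \<in> borel_measurable M"
    "integrable M (\<lambda>\<omega>. (centered_pair_loss n (W 0 \<omega>) (train W n \<omega>))\<^sup>2)"
proof -
  have n1: "n \<ge> 1" using n N0 by simp
  note m [measurable] = train_laws(1,2)[OF n1 W] and km [measurable] = measurable_centered_pair_loss[OF n]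
  show "(\<lambda>\<omega>. centered_pair_loss n (W 0 \<omega>) (train W n \<omega>)) \<in> borel_measurable M" by measurable
  show "integrable M (\<lambda>\<omega>. (centered_pair_loss n (W 0 \<omega>) (train W n \<omega>))\<^sup>2)"
    using integrable_centered_pair_loss_sq[OF n] unfolding train_laws(3)[OF n1 W, symmetric]
    by (subst (asm) integrable_distr_eq) measurable
qed

text \<open>Test point, training set and copy are \<open>n + 2\<close> independent data points.
  Integrating the test point innermost leaves two fixed training sets, to which the bound by the
  test noise applies; the outer integrals are then those of
  \<open>resample_lower_bound\<close>.\<close>

lemma loss_stability_lower_bound:
  "\<exists>c>0. \<forall>\<^sub>F n in sequentially. loss_stability M Z Z1' n (pair_loss n) \<ge> c / (real n ^ 2 * sqrt (real n))"
proof -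
  interpret pgz: product_sigma_finite "\<lambda>_. gauss_z \<beta> \<tau>" ..
  obtain c where c: "c > 0" and low: "\<forall>\<^sub>F n in sequentially.
    (\<integral>\<^sup>+z. \<integral>\<^sup>+q. ennreal ((coord_diff n z - coord_diff n (z(1 := q)))\<^sup>2) \<partial>gauss_z \<beta> \<tau> \<partial>P n) \<ge> ennreal (c / (real n ^ 2 * sqrt (real n)))"
    using resample_lower_bound by blast
  have "\<forall>\<^sub>F n in sequentially. n \<ge> N0" by (rule eventually_ge_at_top)
  then have "\<forall>\<^sub>F n in sequentially. loss_stability M Z Z1' n (pair_loss n) \<ge> (4 * \<tau>\<^sup>2 * c) / (real n ^ 2 * sqrt (real n))"
    using low
  proof eventually_elim
    case (elim n)
    have n1: "n \<ge> 1" using elim N0 by simp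
    let ?W = "Z(1 := Z1')"
    note km [measurable] = measurable_centered_pair_loss[OF elim(1)] and djm [measurable] = measurable_coord_diff[OF elim(1)]
    note k1 = integrable_centered_pair_loss_train[OF elim(1), of Z, simplified] and k2 = integrable_centered_pair_loss_train[OF elim(1), of ?W, OF disjI2[OF refl]]
    define K where "K \<omega> = (centered_pair_loss n (Z 0 \<omega>) (train Z n \<omega>) - centered_pair_loss n (?W 0 \<omega>) (train ?W n \<omega>))\<^sup>2" for \<omega>
    have Km [measurable]: "K \<in> borel_measurable M" unfolding K_def using k1(1) k2(1) by measurable
    \<comment> \<open>Integrability matters for a lower bound: otherwise the Bochner integral in
      \<open>loss_stability\<close> would be 0.\<close>
    have Ki: "integrable M K"
    proof (rule Bochner_Integration.integrable_bound[OF integrable_mult_right[OF Bochner_Integration.integrable_add[OF k1(2) k2(2)], of 2] Km AE_I2])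
      have "(a - b)\<^sup>2 \<le> 2 * (a\<^sup>2 + b\<^sup>2)" for a b :: real
        using zero_le_power2[of "a + b"] by (simp add: power2_eq_square algebra_simps)
      then show "norm (K \<omega>) \<le> norm (2 * ((centered_pair_loss n (Z 0 \<omega>) (train Z n \<omega>))\<^sup>2 + (centered_pair_loss n (?W 0 \<omega>) (train ?W n \<omega>))\<^sup>2))" for \<omega>
        unfolding K_def by simp
    qed
    have "loss_stability M Z Z1' n (pair_loss n) = (\<integral>\<omega>. K \<omega> \<partial>M)"
      unfolding loss_stability_def
    proof (rule integral_cong_AE)
      show ae: "AE \<omega> in M. (centered_loss M Z n (pair_loss n) \<omega> - centered_loss M (Z(1 := Z1')) n (pair_loss n) \<omega>)\<^sup>2 = K \<omega>"
        using centered_loss_AE[OF elim(1), of Z, OF disjI1[OF refl]] centered_loss_AE[OF elim(1), of ?W, OF disjI2[OF refl]]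
        by eventually_elim (simp add: K_def)
      have "centered_loss M W n (pair_loss n) \<in> borel_measurable M" if W: "W = Z \<or> W = ?W" for W
      proof -
        note [measurable] = train_laws(1,2)[OF n1 W] measurable_pair_loss[OF elim(1)]
        show ?thesis unfolding centered_loss_def[abs_def] cond_exp_given_def by measurable
      qed
      then have [measurable]: "centered_loss M Z n (pair_loss n) \<in> borel_measurable M" "centered_loss M ?W n (pair_loss n) \<in> borel_measurable M"
        by auto
      show "(\<lambda>\<omega>. (centered_loss M Z n (pair_loss n) \<omega> - centered_loss M ?W n (pair_loss n) \<omega>)\<^sup>2) \<in> borel_measurable M" by measurable
    qed measurable
    then have loss: "ennreal (loss_stability M Z Z1' n (pair_loss n)) = (\<integral>\<^sup>+\<omega>. ennreal (K \<omega>) \<partial>M)"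
    proof -
      have "0 \<le> K \<omega>" for \<omega> by (simp add: K_def)
      then show ?thesis using nn_integral_eq_integral[OF Ki] \<open>loss_stability M Z Z1' n (pair_loss n) = (\<integral>\<omega>. K \<omega> \<partial>M)\<close> by simp
    qed
    \<comment> \<open>Index 0 is the test point and \<open>n + 1\<close> the copy, which thus stays
      clear of the training indices.\<close>
    define I where "I = {0..n+1}"
    have I: "I = insert 0 (insert (n + 1) {1..n})" using n1 by (auto simp: I_def)
    define f where "f i = (if i = n + 1 then None else Some i)" for i
    have f: "inj_on f I" by (auto simp: f_def inj_on_def)
    define F where "F y = ennreal ((centered_pair_loss n (y 0) (restrict y {1..n}) - centered_pair_loss n (y 0) ((restrict y {1..n})(1 := y (n + 1))))\<^sup>2)" for y
    have c0 [measurable]: "(\<lambda>y. y 0) \<in> Pi\<^sub>M I (\<lambda>_. borel) \<rightarrow>\<^sub>M borel" "(\<lambda>y. y (n + 1)) \<in> Pi\<^sub>M I (\<lambda>_. borel) \<rightarrow>\<^sub>M borel"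
      by (intro measurable_component_singleton; simp add: I)+
    have r0 [measurable]: "(\<lambda>y. restrict y {1..n}) \<in> Pi\<^sub>M I (\<lambda>_. borel) \<rightarrow>\<^sub>M Pi\<^sub>M {1..n} (\<lambda>_. borel)"
      by (intro measurable_restrict measurable_component_singleton) (auto simp: I)
    have u0 [measurable]: "(\<lambda>y. (restrict y {1..n})(1 := y (n + 1))) \<in> Pi\<^sub>M I (\<lambda>_. borel) \<rightarrow>\<^sub>M Pi\<^sub>M {1..n} (\<lambda>_. borel)"
      using n1 by (intro measurable_fun_upd[where J = "{1..n}"] r0 c0) auto
    have Fm [measurable]: "F \<in> borel_measurable (Pi\<^sub>M I (\<lambda>_. borel))" unfolding F_def by measurable
    have FK: "F (\<lambda>i\<in>I. case_option Z1' Z (f i) \<omega>) = ennreal (K \<omega>)" for \<omega>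
    proof -
      let ?y = "\<lambda>i\<in>I. case_option Z1' Z (f i) \<omega>"
      have r: "restrict ?y {1..n} = train Z n \<omega>" by (auto simp: train_def fun_eq_iff I f_def)
      have "?y 0 = Z 0 \<omega>" "?y (n + 1) = Z1' \<omega>" using n1 by (auto simp: I f_def)
      then show ?thesis unfolding F_def r K_def train_perturbed[OF n1] by simp
    qed
    have "(\<integral>\<^sup>+\<omega>. ennreal (K \<omega>) \<partial>M) = (\<integral>\<^sup>+y. F y \<partial>Pi\<^sub>M I (\<lambda>_. gauss_z \<beta> \<tau>))"
      unfolding FK[symmetric] by (rule model.nn_integral_family[OF f _ _ Fm]) (auto simp: I)
    also have "\<dots> = (\<integral>\<^sup>+y. \<integral>\<^sup>+z0. F (y(0 := z0)) \<partial>gauss_z \<beta> \<tau> \<partial>Pi\<^sub>M (insert (n + 1) {1..n}) (\<lambda>_. gauss_z \<beta> \<tau>))"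
      using Fm unfolding I by (intro pgz.product_nn_integral_insert) (auto cong: measurable_cong_sets sets_PiM_cong)
    also have "\<dots> = (\<integral>\<^sup>+z. \<integral>\<^sup>+q. \<integral>\<^sup>+z0. F (z(n + 1 := q, 0 := z0)) \<partial>gauss_z \<beta> \<tau> \<partial>gauss_z \<beta> \<tau> \<partial>P n)"
    proof (rule pgz.product_nn_integral_insert)
      have "(\<lambda>w. (fst w)(0 := snd w)) \<in> Pi\<^sub>M (insert (n + 1) {1..n}) (\<lambda>_. borel) \<Otimes>\<^sub>M borel \<rightarrow>\<^sub>M Pi\<^sub>M I (\<lambda>_. borel :: 'p datum measure)"
        unfolding I by (intro measurable_fun_upd[where J = "insert (n + 1) {1..n}"]) auto
      from measurable_compose[OF this Fm]
      have [measurable]: "(\<lambda>(y, z0). F (y(0 := z0))) \<in> borel_measurable (Pi\<^sub>M (insert (n + 1) {1..n}) (\<lambda>_. borel) \<Otimes>\<^sub>M borel)"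
        by (simp add: case_prod_unfold)
      show "(\<lambda>y. \<integral>\<^sup>+z0. F (y(0 := z0)) \<partial>gauss_z \<beta> \<tau>) \<in> borel_measurable (Pi\<^sub>M (insert (n + 1) {1..n}) (\<lambda>_. gauss_z \<beta> \<tau>))"
        by measurable
    qed auto
    also have "\<dots> = (\<integral>\<^sup>+z. \<integral>\<^sup>+q. \<integral>\<^sup>+z0. ennreal ((centered_pair_loss n z0 z - centered_pair_loss n z0 (z(1 := q)))\<^sup>2) \<partial>gauss_z \<beta> \<tau> \<partial>gauss_z \<beta> \<tau> \<partial>P n)"
    proof (intro nn_integral_cong)
      fix z q z0 assume "z \<in> space (P n)"
      then have "restrict (z(n + 1 := q, 0 := z0)) {1..n} = z" by (auto simp: fun_eq_iff space_PiM PiE_def extensional_def)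
      then show "F (z(n + 1 := q, 0 := z0)) = ennreal ((centered_pair_loss n z0 z - centered_pair_loss n z0 (z(1 := q)))\<^sup>2)"
        unfolding F_def by simp
    qed
    also have "\<dots> \<ge> (\<integral>\<^sup>+z. \<integral>\<^sup>+q. ennreal (4 * \<tau>\<^sup>2 * (coord_diff n z - coord_diff n (z(1 := q)))\<^sup>2) \<partial>gauss_z \<beta> \<tau> \<partial>P n)"
      by (intro nn_integral_mono centered_pair_loss_diff_lower)
    also have "(\<integral>\<^sup>+z. \<integral>\<^sup>+q. ennreal (4 * \<tau>\<^sup>2 * (coord_diff n z - coord_diff n (z(1 := q)))\<^sup>2) \<partial>gauss_z \<beta> \<tau> \<partial>P n)
      = ennreal (4 * \<tau>\<^sup>2) * (\<integral>\<^sup>+z. \<integral>\<^sup>+q. ennreal ((coord_diff n z - coord_diff n (z(1 := q)))\<^sup>2) \<partial>gauss_z \<beta> \<tau> \<partial>P n)"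
    proof -
      have "(\<lambda>w. (fst w)(1 := snd w)) \<in> Pi\<^sub>M {1..n} (\<lambda>_. borel) \<Otimes>\<^sub>M borel \<rightarrow>\<^sub>M Pi\<^sub>M {1..n} (\<lambda>_. borel :: 'p datum measure)"
        using n1 by (intro measurable_fun_upd[where J = "{1..n}"]) auto
      from measurable_compose[OF this djm]
      have dm [measurable]: "(\<lambda>(z, q). coord_diff n (z(1 := q))) \<in> borel_measurable (Pi\<^sub>M {1..n} (\<lambda>_. borel) \<Otimes>\<^sub>M borel)"
        by (simp add: case_prod_unfold)
      have "(\<integral>\<^sup>+q. ennreal (4 * \<tau>\<^sup>2 * (coord_diff n z - coord_diff n (z(1 := q)))\<^sup>2) \<partial>gauss_z \<beta> \<tau>)
        = ennreal (4 * \<tau>\<^sup>2) * (\<integral>\<^sup>+q. ennreal ((coord_diff n z - coord_diff n (z(1 := q)))\<^sup>2) \<partial>gauss_z \<beta> \<tau>)" if "z \<in> space (P n)" for z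
      proof -
        define \<phi> where "\<phi> = (\<lambda>q. coord_diff n (z(1 := q)))"
        have "\<phi> \<in> borel_measurable borel"
          unfolding \<phi>_def using measurable_compose[OF measurable_Pair1' dm] that by (simp add: space_PiM)
        then have \<phi>m: "\<phi> \<in> borel_measurable (gauss_z \<beta> \<tau>)"
          by (simp only: measurable_cong_sets[OF sets_gauss(3) refl])
        have "(\<integral>\<^sup>+q. ennreal (4 * \<tau>\<^sup>2) * ennreal ((coord_diff n z - \<phi> q)\<^sup>2) \<partial>gauss_z \<beta> \<tau>)
            = ennreal (4 * \<tau>\<^sup>2) * (\<integral>\<^sup>+q. ennreal ((coord_diff n z - \<phi> q)\<^sup>2) \<partial>gauss_z \<beta> \<tau>)"
          by (intro nn_integral_cmult measurable_compose[OF _ measurable_ennreal] borel_measurable_power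
              borel_measurable_diff borel_measurable_const \<phi>m)
        moreover have s: "ennreal (4 * \<tau>\<^sup>2 * a\<^sup>2) = ennreal (4 * \<tau>\<^sup>2) * ennreal (a\<^sup>2)" for a by (rule ennreal_mult') simp
        ultimately show ?thesis unfolding s \<phi>_def by blast
      qed
      then have "(\<integral>\<^sup>+z. \<integral>\<^sup>+q. ennreal (4 * \<tau>\<^sup>2 * (coord_diff n z - coord_diff n (z(1 := q)))\<^sup>2) \<partial>gauss_z \<beta> \<tau> \<partial>P n)
        = (\<integral>\<^sup>+z. ennreal (4 * \<tau>\<^sup>2) * (\<integral>\<^sup>+q. ennreal ((coord_diff n z - coord_diff n (z(1 := q)))\<^sup>2) \<partial>gauss_z \<beta> \<tau>) \<partial>P n)"
        by (intro nn_integral_cong)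
      also have "\<dots> = ennreal (4 * \<tau>\<^sup>2) * (\<integral>\<^sup>+z. \<integral>\<^sup>+q. ennreal ((coord_diff n z - coord_diff n (z(1 := q)))\<^sup>2) \<partial>gauss_z \<beta> \<tau> \<partial>P n)"
        by (rule nn_integral_cmult) measurable
      finally show ?thesis .
    qed
    finally have ge: "ennreal (4 * \<tau>\<^sup>2) * (\<integral>\<^sup>+z. \<integral>\<^sup>+q. ennreal ((coord_diff n z - coord_diff n (z(1 := q)))\<^sup>2) \<partial>gauss_z \<beta> \<tau> \<partial>P n)
      \<le> ennreal (loss_stability M Z Z1' n (pair_loss n))" unfolding loss .
    have "ennreal ((4 * \<tau>\<^sup>2 * c) / (real n ^ 2 * sqrt (real n))) = ennreal (4 * \<tau>\<^sup>2) * ennreal (c / (real n ^ 2 * sqrt (real n)))"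
      by (subst ennreal_mult'[symmetric]) auto
    also have "\<dots> \<le> ennreal (4 * \<tau>\<^sup>2) * (\<integral>\<^sup>+z. \<integral>\<^sup>+q. ennreal ((coord_diff n z - coord_diff n (z(1 := q)))\<^sup>2) \<partial>gauss_z \<beta> \<tau> \<partial>P n)"
      by (intro mult_left_mono elim) auto
    also note ge
    finally show ?case
      by (subst (asm) ennreal_le_iff) (simp_all add: loss_stability_def Bochner_Integration.integral_nonneg)
  qed
  moreover have "4 * \<tau>\<^sup>2 * c > 0" using c \<tau> by simp
  ultimately show ?thesis by blast
qed

lemma sigma_sq_eq:
  assumes n: "n \<ge> N0"
  shows "sigma_sq M Z n (pair_loss n) = (\<integral>z0. (mean_pair_loss n z0 - (\<integral>y. mean_pair_loss n y \<partial>gauss_z \<beta> \<tau>))\<^sup>2 \<partial>gauss_z \<beta> \<tau>)"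
proof -
  have n1: "n \<ge> 1" using n N0 by simp
  note m [measurable] = train_laws(1,2)[OF n1, of Z, OF disjI1[OF refl]] and law = train_laws(3)[OF n1, of Z, OF disjI1[OF refl]]
  have gm [measurable]: "mean_pair_loss n \<in> borel_measurable borel" by (rule borel_measurable_continuous_onI[OF mean_pair_loss_continuous[OF n]])
  let ?C = "cond_exp_given M borel (Z 0) (\<lambda>\<omega>. pair_loss n (Z 0 \<omega>) (train Z n \<omega>))"
  have ae: "AE \<omega> in M. ?C \<omega> = mean_pair_loss n (Z 0 \<omega>)"
    using model.cond_exp_given_indep[OF m law prob_space_gauss_z[OF \<tau>] prob_P sets_gauss(3) sets_P integrable_pair_loss[OF n]]
    by (simp add: mean_pair_loss_def)
  have [measurable]: "?C \<in> borel_measurable M" unfolding cond_exp_given_def by measurable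
  have E: "(\<integral>\<omega>. ?C \<omega> \<partial>M) = (\<integral>y. mean_pair_loss n y \<partial>gauss_z \<beta> \<tau>)"
  proof -
    have "(\<integral>\<omega>. ?C \<omega> \<partial>M) = (\<integral>\<omega>. mean_pair_loss n (Z 0 \<omega>) \<partial>M)" by (intro integral_cong_AE ae) measurable
    then show ?thesis unfolding model.law_Z[of 0, symmetric] by (simp add: integral_distr)
  qed
  have "sigma_sq M Z n (pair_loss n) = (\<integral>\<omega>. (?C \<omega> - (\<integral>\<omega>. ?C \<omega> \<partial>M))\<^sup>2 \<partial>M)" by (simp add: sigma_sq_def)
  also have "\<dots> = (\<integral>\<omega>. (mean_pair_loss n (Z 0 \<omega>) - (\<integral>y. mean_pair_loss n y \<partial>gauss_z \<beta> \<tau>))\<^sup>2 \<partial>M)"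
    unfolding E by (rule integral_cong_AE) (measurable, use ae in eventually_elim, simp)
  also have "\<dots> = (\<integral>z0. (mean_pair_loss n z0 - (\<integral>y. mean_pair_loss n y \<partial>gauss_z \<beta> \<tau>))\<^sup>2 \<partial>distr M borel (Z 0))"
    by (rule integral_distr[symmetric]) measurable
  finally show ?thesis unfolding model.law_Z .
qed

text \<open>The upper bound comes from the second moment of \<open>mean_pair_loss\<close>, which is
  at most of order \<open>1 / n\<close> times the squared norm of the test point. A vanishing
  variance would make this function almost surely constant.\<close>

lemma sigma_sq_bounds:
  "\<exists>C>0. \<forall>\<^sub>F n in sequentially. 0 < sigma_sq M Z n (pair_loss n) \<and> sigma_sq M Z n (pair_loss n) \<le> C / real n ^ 2"
proof -
  obtain C where C: "C \<ge> 0" "\<forall>\<^sub>F n in sequentially. (\<integral>z. diff_size n z \<partial>P n) \<le> C / real n" using diff_size_expectation by blast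
  define m4 where "m4 = (\<integral>z. norm z ^ 4 \<partial>gauss_z \<beta> \<tau>)"
  have m4: "m4 \<ge> 0" unfolding m4_def by (intro Bochner_Integration.integral_nonneg) simp
  have "\<forall>\<^sub>F n in sequentially. n \<ge> N0" by (rule eventually_ge_at_top)
  \<comment> \<open>The summand 1 only makes the constant positive.\<close>
  then have "\<forall>\<^sub>F n in sequentially. 0 < sigma_sq M Z n (pair_loss n) \<and> sigma_sq M Z n (pair_loss n) \<le> (4 * C\<^sup>2 * m4 + 1) / real n ^ 2"
    using C(2) coord_sq_diff_pos
  proof eventually_elim
    case (elim n)
    have n1: "real n \<ge> 1" using elim N0 by simp
    have gm [measurable]: "mean_pair_loss n \<in> borel_measurable borel" by (rule borel_measurable_continuous_onI[OF mean_pair_loss_continuous[OF elim(1)]])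
    have M0: "0 \<le> (\<integral>z. diff_size n z \<partial>P n)" by (intro Bochner_Integration.integral_nonneg diff_size_nonneg)
    have b: "\<bar>mean_pair_loss n z0\<bar> \<le> 2 * C / real n * norm z0 ^ 2" for z0
    proof -
      have "\<bar>mean_pair_loss n z0\<bar> \<le> 2 * (norm z0)\<^sup>2 * (\<integral>z. diff_size n z \<partial>P n)" by (rule mean_pair_loss_bound[OF elim(1)])
      also have "\<dots> \<le> 2 * (norm z0)\<^sup>2 * (C / real n)" by (intro mult_left_mono elim) auto
      finally show ?thesis by (simp add: mult_ac)
    qed
    have b2: "(mean_pair_loss n z0)\<^sup>2 \<le> 4 * C\<^sup>2 / real n ^ 2 * norm z0 ^ 4" for z0
      using power_mono[OF b[of z0] abs_ge_zero, of 2] by (simp add: power_mult_distrib power_divide)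
    have gi: "integrable (gauss_z \<beta> \<tau>) (mean_pair_loss n)" by (rule integrable_gauss_z_bound[OF gm b])
    have gi2: "integrable (gauss_z \<beta> \<tau>) (\<lambda>z. (mean_pair_loss n z)\<^sup>2)"
      by (rule integrable_gauss_z_bound[where C = "4 * C\<^sup>2 / real n ^ 2" and m = 4]) (use b2 in \<open>measurable, auto\<close>)
    let ?E = "\<integral>y. mean_pair_loss n y \<partial>gauss_z \<beta> \<tau>"
    have vi: "integrable (gauss_z \<beta> \<tau>) (\<lambda>z. (mean_pair_loss n z - ?E)\<^sup>2)"
      unfolding power2_diff using gi gi2 by simp
    have "(\<integral>z0. (mean_pair_loss n z0 - ?E)\<^sup>2 \<partial>gauss_z \<beta> \<tau>) = (\<integral>z. (mean_pair_loss n z)\<^sup>2 \<partial>gauss_z \<beta> \<tau>) - ?E\<^sup>2"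
      by (rule gz.variance_eq[OF gi gi2])
    also have "\<dots> \<le> (\<integral>z. 4 * C\<^sup>2 / real n ^ 2 * norm z ^ 4 \<partial>gauss_z \<beta> \<tau>)"
    proof -
      have "(\<integral>z. (mean_pair_loss n z)\<^sup>2 \<partial>gauss_z \<beta> \<tau>) \<le> (\<integral>z. 4 * C\<^sup>2 / real n ^ 2 * norm z ^ 4 \<partial>gauss_z \<beta> \<tau>)"
        by (intro integral_mono gi2 integrable_mult_right integrable_norm_datum b2)
      then show ?thesis using zero_le_power2[of ?E] by linarith
    qed
    also have "\<dots> = 4 * C\<^sup>2 * m4 / real n ^ 2" by (simp add: m4_def)
    also have "\<dots> \<le> (4 * C\<^sup>2 * m4 + 1) / real n ^ 2" by (intro divide_right_mono) auto
    finally have up: "sigma_sq M Z n (pair_loss n) \<le> (4 * C\<^sup>2 * m4 + 1) / real n ^ 2" unfolding sigma_sq_eq[OF elim(1)] .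
    have "sigma_sq M Z n (pair_loss n) \<noteq> 0"
    proof
      assume "sigma_sq M Z n (pair_loss n) = 0"
      then have "AE z in gauss_z \<beta> \<tau>. (mean_pair_loss n z - ?E)\<^sup>2 = 0"
        unfolding sigma_sq_eq[OF elim(1)] using integral_nonneg_eq_0_iff_AE[OF vi] by simp
      then have "AE z in gauss_z \<beta> \<tau>. mean_pair_loss n z = ?E" by eventually_elim simp
      then show False using mean_pair_loss_not_AE_const[OF elim(1,3)] by blast
    qed
    moreover have "0 \<le> sigma_sq M Z n (pair_loss n)"
      unfolding sigma_sq_eq[OF elim(1)] by (intro Bochner_Integration.integral_nonneg) simp
    ultimately show ?case using up by simp
  qed
  moreover have "4 * C\<^sup>2 * m4 + 1 > 0" using m4 by (simp add: add_nonneg_pos)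
  ultimately show ?thesis by blast
qed

end

section \<open>From eventual bounds with explicit constants to Landau symbols\<close>

theorem theorem3p3:
  fixes M :: "'a measure"
    and Z :: "nat \<Rightarrow> 'a \<Rightarrow> (real ^ 'p::finite) \<times> real"
    and Z1' :: "'a \<Rightarrow> (real ^ 'p) \<times> real"
    and \<beta> :: "real ^ 'p"
    and \<tau> :: real
    and lam \<delta> :: "nat \<Rightarrow> real"
    and bhat1 bhat2 :: "nat \<Rightarrow> (nat \<Rightarrow> (real ^ 'p) \<times> real) \<Rightarrow> real ^ 'p"
    and h :: "nat \<Rightarrow> (real ^ 'p) \<times> real \<Rightarrow> (nat \<Rightarrow> (real ^ 'p) \<times> real) \<Rightarrow> real"
  assumes model: "gaussian_linear_model M Z Z1' \<beta> \<tau>"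
    and sparse: "card {j. \<beta> $ j \<noteq> 0} < CARD('p)"
    and lam_pos: "\<And>n. lam n > 0"
    and \<delta>_pos: "\<And>n. \<delta> n > 0"
    and lam_upper: "lam \<in> O(\<lambda>n. sqrt (real n))"
    and lam_lower: "lam \<in> \<omega>(\<lambda>_. 1)"
    and \<delta>_order: "\<delta> \<in> \<Theta>(\<lambda>_. 1)"
    and bhat1: "\<And>n. n \<ge> CARD('p) \<Longrightarrow> is_lasso_estimator n (lam n) (bhat1 n)"
    and bhat2: "\<And>n. n \<ge> CARD('p) \<Longrightarrow> is_lasso_estimator n (lam n + \<delta> n) (bhat2 n)"
    and h_def: "\<And>n. h n = diff_loss (bhat1 n) (bhat2 n)"
  shows "(\<lambda>n. sigma_sq M Z n (h n)) \<in> O(\<lambda>n. 1 / real n ^ 2)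
    \<and> (\<lambda>n. loss_stability M Z Z1' n (h n)) \<in> \<Omega>(\<lambda>n. 1 / (real n ^ 2 * sqrt (real n)))
    \<and> (\<lambda>n. rel_loss_stability M Z Z1' n (h n)) \<in> \<Omega>(\<lambda>n. sqrt (real n))
    \<and> (\<lambda>n. rel_loss_stability M Z Z1' n (h n)) \<notin> o(\<lambda>_. 1)"
proof -
  obtain j where j: "\<beta> $ j = 0"
  proof -
    have "{j. \<beta> $ j \<noteq> 0} \<noteq> UNIV" using sparse by auto
    then show ?thesis using that by blast
  qed
  obtain cl where cl: "cl > 0" "\<forall>\<^sub>F n in sequentially. norm (lam n) \<le> cl * norm (sqrt (real n))"
    using lam_upper by (elim landau_o.bigE)
  have lam1: "\<forall>\<^sub>F n in sequentially. norm (lam n) \<ge> 1 * norm (1 :: real)"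
    using lam_lower by (rule landau_omega.smallD) simp
  have "\<delta> \<in> O(\<lambda>_. 1)" "\<delta> \<in> \<Omega>(\<lambda>_. 1)" using \<delta>_order by auto
  then obtain d1 d2 where d1: "d1 > 0" "\<forall>\<^sub>F n in sequentially. norm (\<delta> n) \<ge> d1 * norm (1 :: real)"
    and d2: "d2 > 0" "\<forall>\<^sub>F n in sequentially. norm (\<delta> n) \<le> d2 * norm (1 :: real)"
    by (elim landau_o.bigE landau_omega.bigE) blast
  \<comment> \<open>Positivity of both sequences turns the norms in the Landau conditions into the
    values themselves.\<close>
  have "\<forall>\<^sub>F n in sequentially. lam n \<ge> 1 \<and> lam n \<le> cl * sqrt (real n) \<and> d1 \<le> \<delta> n \<and> \<delta> n \<le> d2"
    using cl(2) lam1 d1(2) d2(2)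
  proof eventually_elim
    case (elim n)
    then show ?case using lam_pos[of n] \<delta>_pos[of n] by simp
  qed
  then obtain N where N: "\<And>n. n \<ge> N \<Longrightarrow> lam n \<ge> 1 \<and> lam n \<le> cl * sqrt (real n) \<and> d1 \<le> \<delta> n \<and> \<delta> n \<le> d2"
    unfolding eventually_sequentially by blast
  \<comment> \<open>The estimators are given for \<open>n \<ge> CARD('p)\<close> only, and
    \<open>n \<ge> 2\<close> leaves an observation besides the resampled one.\<close>
  define N0 where "N0 = max N (max 2 CARD('p))"
  interpret model: gaussian_linear_model M Z Z1' \<beta> \<tau> by (rule model)
  \<comment> \<open>\<open>cl + d2\<close> serves as \<open>L\<close> because
    \<open>d2 \<le> d2 * sqrt n\<close> absorbs the gap \<delta> into the larger penalty.\<close>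
  interpret lasso_model \<beta> \<tau> "cl + d2" d1 d2 j lam \<delta> bhat1 bhat2 N0 M Z Z1'
  proof unfold_locales
    show "\<tau> > 0" by (rule model.\<tau>_pos)
    show "\<beta> $ j = 0" by (rule j)
    show "d1 > 0" by (rule d1)
    show "N0 \<ge> 2" by (simp add: N0_def)
    fix n assume n: "n \<ge> N0"
    then have nN: "n \<ge> N" "n \<ge> CARD('p)" "n \<ge> 2" by (simp_all add: N0_def)
    show "lam n \<ge> 1" "d1 \<le> \<delta> n" "\<delta> n \<le> d2" using N[OF nN(1)] by auto
    have "d2 * 1 \<le> d2 * sqrt (real n)" using nN d2 by (intro mult_left_mono) auto
    then show "lam n + \<delta> n \<le> (cl + d2) * sqrt (real n)" using N[OF nN(1)] by (simp add: distrib_right)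
    show "is_lasso_estimator n (lam n) (bhat1 n)" "is_lasso_estimator n (lam n + \<delta> n) (bhat2 n)"
      using bhat1 bhat2 nN by auto
  qed
  have h: "h n = pair_loss n" for n by (simp add: h_def pair_loss_def)
  obtain C where C: "C > 0" "\<forall>\<^sub>F n in sequentially. 0 < sigma_sq M Z n (h n) \<and> sigma_sq M Z n (h n) \<le> C / real n ^ 2"
    using sigma_sq_bounds unfolding h by blast
  obtain c where c: "c > 0" "\<forall>\<^sub>F n in sequentially. loss_stability M Z Z1' n (h n) \<ge> c / (real n ^ 2 * sqrt (real n))"
    using loss_stability_lower_bound unfolding h by blast
  have sigma: "(\<lambda>n. sigma_sq M Z n (h n)) \<in> O(\<lambda>n. 1 / real n ^ 2)"
  proof (rule landau_o.bigI[OF C(1)])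
    show "\<forall>\<^sub>F n in sequentially. norm (sigma_sq M Z n (h n)) \<le> C * norm (1 / real n ^ 2)"
      using C(2) by eventually_elim simp
  qed
  have loss: "(\<lambda>n. loss_stability M Z Z1' n (h n)) \<in> \<Omega>(\<lambda>n. 1 / (real n ^ 2 * sqrt (real n)))"
  proof (rule landau_omega.bigI[OF c(1)])
    show "\<forall>\<^sub>F n in sequentially. norm (loss_stability M Z Z1' n (h n)) \<ge> c * norm (1 / (real n ^ 2 * sqrt (real n)))"
      using c(2) by eventually_elim simp
  qed
  have "\<forall>\<^sub>F n in sequentially. n \<ge> (1::nat)" by (rule eventually_ge_at_top)
  then have rel: "\<forall>\<^sub>F n in sequentially. rel_loss_stability M Z Z1' n (h n) \<ge> c / C * sqrt (real n)"
    using C(2) c(2)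
  proof eventually_elim
    case (elim n)
    define s where "s = sqrt (real n)"
    have s: "s > 0" "s * s = real n" using elim(1) by (auto simp: s_def)
    have "c / C * s = (s * s) * (c / ((s * s) ^ 2 * s)) / (C / (s * s) ^ 2)"
      using s(1) C(1) by (simp add: field_simps power2_eq_square)
    also have "\<dots> = real n * (c / (real n ^ 2 * s)) / (C / real n ^ 2)" unfolding s(2) ..
    \<comment> \<open>Enlarging the denominator to \<open>C / n ^ 2\<close> is legitimate only
      because the variance is positive; division by 0 would give 0.\<close>
    also have "\<dots> \<le> real n * loss_stability M Z Z1' n (h n) / sigma_sq M Z n (h n)"
    proof (rule frac_le)
      have "0 \<le> c / (real n ^ 2 * sqrt (real n))" using c(1) by simp
      then show "0 \<le> real n * loss_stability M Z Z1' n (h n)" using elim by (intro mult_nonneg_nonneg) auto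
      show "real n * (c / (real n ^ 2 * s)) \<le> real n * loss_stability M Z Z1' n (h n)"
        unfolding s_def using elim by (intro mult_left_mono) auto
    qed (use elim in auto)
    finally show ?case by (simp add: rel_loss_stability_def s_def)
  qed
  have cC: "c / C > 0" using c C by simp
  have rel_omega: "(\<lambda>n. rel_loss_stability M Z Z1' n (h n)) \<in> \<Omega>(\<lambda>n. sqrt (real n))"
  proof (rule landau_omega.bigI[OF cC])
    show "\<forall>\<^sub>F n in sequentially. norm (rel_loss_stability M Z Z1' n (h n)) \<ge> c / C * norm (sqrt (real n))"
      using rel by eventually_elim simp
  qed
  have "(\<lambda>n. rel_loss_stability M Z Z1' n (h n)) \<notin> o(\<lambda>_. 1)"
  proof
    assume "(\<lambda>n. rel_loss_stability M Z Z1' n (h n)) \<in> o(\<lambda>_. 1)"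
    then have "\<forall>\<^sub>F n in sequentially. norm (rel_loss_stability M Z Z1' n (h n)) \<le> c / (2 * C) * norm (1 :: real)"
      by (rule landau_o.smallD) (use c C in simp)
    moreover have "\<forall>\<^sub>F n in sequentially. n \<ge> (1::nat)" by (rule eventually_ge_at_top)
    ultimately have "\<forall>\<^sub>F n :: nat in sequentially. False"
      using rel
    proof eventually_elim
      case (elim n)
      have "c / C * 1 \<le> c / C * sqrt (real n)" using elim(2) cC by (intro mult_left_mono) auto
      also have "\<dots> \<le> c / (2 * C)" using elim by simp
      finally show ?case using c C by (simp add: field_simps)
    qed
    then show False by simp
  qed
  then show ?thesis using sigma loss rel_omega by blast
qed

end
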